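(* Let $K$ be a field of characteristic zero and let $\lambda$ be an $(m|n)$-hook partition of $r$. Let $S=S(m|n,r)$ and let $A_\lambda\subseteq A(m|n,r)$ be the $K$-span of all symmetrizers $T^\lambda[i:j]$, $i,j\in I(m|n,r)$. Then $A_\lambda$ is an $S$-superbimodule, the symmetrizers $T^{\lambda}[i:j]$ with $T_i$ and $T_j$ both semistandard form a $K$-basis of $A_\lambda$, and $A_\lambda$ is isomorphic, as an $S$-superbimodule, to $D_{\lambda}\otimes_K D^o_{\lambda}$.
   Context: Symbols and multiindices. Fix $m,n,r$. The symbols $1,\dots,m$ are even and $m+1,\dots,m+n$ are odd; $|a|\in\{0,1\}$ denotes the parity of $a$. $I(m|n,r)$ is the set of multiindices $i=(i_1,\dots,i_r)$ with entries in $\{1,\dots,m+n\}$. The symmetric group $\Sigma_r$ acts on the right on multiindices by $(j\pi)_a=j_{\pi(a)}$ (permutations are composed as functions). The signed action is $j*\pi=(-1)^{s(j,\pi)}\,j\pi$, where $s(j,\pi)$ is the number of pairs $a<b$ with $\pi(a)>\pi(b)$ and $j_{\pi(a)},j_{\pi(b)}>m$; expressions in signed multiindices are extended linearly, e.g. $\chi_{i,-j}=-\chi_{i,j}$ and $\chi_{-i,j}=-\chi_{i,j}$. The space $A(m|n,r)$. $A(m|n)$ is the free supercommutative $K$-superalgebra on generators $c_{ab}$, $1\le a,b\le m+n$, of parity $|a|+|b|$ (so $c_{ab}c_{de}=(-1)^{|c_{ab}||c_{de}|}c_{de}c_{ab}$), and $A(m|n,r)$ is its degree $r$ part. It is spanned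 by the elements $$\chi_{i,j}=(-1)^{\sum_{t=1}^r |i_t|(|i_{t+1}|+|j_{t+1}|+\dots+|i_r|+|j_r|)}c_{i_1j_1}c_{i_2j_2}\cdots c_{i_rj_r},\quad i,j\in I(m|n,r),$$ which satisfy $\chi_{i*\pi,j*\pi}=\chi_{i,j}$ for $\pi\in\Sigma_r$. The Schur superalgebra. $S=S(m|n,r)$ is the dual space of $A(m|n,r)$, with product determined by $(\xi\eta)(\chi_{p,q})=\sum_{s\in I(m|n,r)}\xi(\chi_{p,s})\,\eta(\chi_{s,q})$. It acts on $A(m|n,r)$ on the left and on the right by $\xi\chi_{i,j}=\sum_{a\in I(m|n,r)}\xi(\chi_{a,j})\chi_{i,a}$ and $\chi_{i,j}\xi=\sum_{b\in I(m|n,r)}\xi(\chi_{i,b})\chi_{b,j}$. A superbimodule is a $\mathbb Z_2$-graded bimodule. Tableaux. $\lambda=(\lambda_1,\lambda_2,\dots)$ is an $(m|n)$-hook partition of $r$ if it is a partition of $r$ with $\lambda_{m+1}\le n$. Fix a basic tableau $T=T^\lambda$, i.e. a bijection from the diagram $[\lambda]$ to $\{1,\dots,r\}$; $C(T)$ and $R(T)$ are the subgroups of $\Sigma_r$ preserving each column, respectively each row, of $T$. For $i\in I(m|n,r)$, $T_i$ is the tableau of shape $\lambda$ with entry $i_{T(b)}$ in box $b$. $T_i$ is semistandard if its entries weakly increase down columns and from left to right along rows, no even symbol is repeated in a column, and no odd symbol is repeated in a row. Symmetrizers. $$T^{\lambda}[i:j]=\sum_{\rho\in R(T)}\sum_{\kappa\in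 C(T)}\mathrm{sgn}(\kappa)\,\chi_{i*\rho,\,j*\kappa}.$$ Irreducible supermodules. For a composition $\mu=(\mu_1,\dots,\mu_{m+n})$ of $r$ let $i$ be any multiindex containing each symbol $a$ exactly $\mu_a$ times, and let $\xi_\mu\in S$ be the idempotent with $\xi_\mu(\chi_{k,l})=1$ if $k=l=i\pi$ for some $\pi\in\Sigma_r$, and $\xi_\mu(\chi_{k,l})=0$ if $(k,l)$ is not of this form up to simultaneous permutation. The $\mu$-weight space of a left (right) $S$-supermodule $M$ is $\xi_\mu M$ (resp. $M\xi_\mu$). Weights are ordered by dominance: $\mu\unlhd\nu$ iff $\mu_1+\dots+\mu_a\le\nu_1+\dots+\nu_a$ for all $a$. An $(m|n)$-hook partition $\lambda$ is identified with the weight that is the content of the tableau $T_\ell$ of shape $\lambda$ in which row $a$ is filled with $a$ for $1\le a\le m$, and all boxes below row $m$ in column $b$ are filled with $m+b$. $D_\lambda$ (resp. $D^o_\lambda$) is the irreducible left (resp. right) $S$-supermodule of highest weight $\lambda$; it is unique up to isomorphism and parity shift, and isomorphisms are understood up to parity shift. $D_\lambda\otimes_K D_\lambda^o$ is an $S$-superbimodule via the left action on the first factor and the right action on the second. *)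

theory Defs
  imports
    Complex_Main
    "HOL-Library.Multiset"
    "HOL-Library.FuncSet"
    "HOL-Library.Function_Algebras"
    "HOL-Library.Z2"
    "HOL-Combinatorics.Permutations"
begin

section \<open>Symbols and multiindices\<close>

definition par :: "nat \<Rightarrow> nat \<Rightarrow> nat" where
  "par m a = (if a \<le> m then 0 else 1)"

definition multiindices :: "nat \<Rightarrow> nat \<Rightarrow> nat \<Rightarrow> (nat \<Rightarrow> nat) set" where
  "multiindices m n r = {1..r} \<rightarrow>\<^sub>E {1..m + n}"

text \<open>
  The symmetric group on \<open>{1..r}\<close> acts on the right by \<open>j \<circ> \<pi>\<close>. The signed action is
  \<open>j * \<pi> = act_sgn m r j \<pi> \<cdot> (j \<circ> \<pi>)\<close>; the scalar is kept apart from the multiindex.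
\<close>

definition act_sgn :: "nat \<Rightarrow> nat \<Rightarrow> (nat \<Rightarrow> nat) \<Rightarrow> (nat \<Rightarrow> nat) \<Rightarrow> 'k::field" where
  "act_sgn m r j \<pi> =
     (-1) ^ card {(a, b). a \<in> {1..r} \<and> b \<in> {1..r} \<and> a < b \<and> \<pi> a > \<pi> b \<and> m < j (\<pi> a) \<and> m < j (\<pi> b)}"


section \<open>The free supercommutative superalgebra\<close>

text \<open>
  \<open>A(m|n)\<close> is modelled on its standard basis, the tensor product of the polynomial algebra in
  the even generators and the exterior algebra in the odd ones. A generator \<open>c\<^bsub>ab\<^esub>\<close> is named
  by the pair \<open>(a, b)\<close>; a multiset of pairs in which no odd generator is repeated stands for the
  product of its elements taken in lexicographic order. An element of the algebra is its
  coefficient function.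
\<close>

type_synonym monom = "(nat \<times> nat) multiset"
type_synonym 'k superpoly = "monom \<Rightarrow> 'k"

definition gen_par :: "nat \<Rightarrow> nat \<times> nat \<Rightarrow> nat" where
  "gen_par m x = par m (fst x) + par m (snd x)"

definition gen_less :: "nat \<times> nat \<Rightarrow> nat \<times> nat \<Rightarrow> bool" where
  "gen_less x y \<longleftrightarrow> fst x < fst y \<or> (fst x = fst y \<and> snd x < snd y)"

definition super_monom :: "nat \<Rightarrow> monom \<Rightarrow> bool" where
  "super_monom m M \<longleftrightarrow> (\<forall>x \<in># M. odd (gen_par m x) \<longrightarrow> count M x = 1)"

definition monom_par :: "nat \<Rightarrow> monom \<Rightarrow> nat" where
  "monom_par m M = (\<Sum>x \<in># M. gen_par m x)"

text \<open>
  Sorting the concatenation of the ordered monomials \<open>N\<close> and \<open>P\<close> moves each odd generator of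
  \<open>P\<close> past the larger odd generators of \<open>N\<close>.
\<close>

definition monom_sgn :: "nat \<Rightarrow> monom \<Rightarrow> monom \<Rightarrow> 'k::field" where
  "monom_sgn m N P =
     (-1) ^ card {(x, y). x \<in># N \<and> y \<in># P \<and> odd (gen_par m x) \<and> odd (gen_par m y) \<and> gen_less y x}"

definition sp_mult :: "nat \<Rightarrow> 'k::field superpoly \<Rightarrow> 'k superpoly \<Rightarrow> 'k superpoly" where
  "sp_mult m f g = (\<lambda>M. if super_monom m M
     then (\<Sum>N \<in> {N. N \<subseteq># M}. monom_sgn m N (M - N) * f N * g (M - N)) else 0)"

definition sp_one :: "'k::field superpoly" where
  "sp_one = (\<lambda>M. if M = {#} then 1 else 0)"

definition sp_gen :: "nat \<Rightarrow> nat \<Rightarrow> 'k::field superpoly" where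
  "sp_gen a b = (\<lambda>M. if M = {#(a, b)#} then 1 else 0)"

text \<open>Addition of functions is pointwise, by the instances of \<open>Function_Algebras\<close>.\<close>

definition fscale :: "'k::field \<Rightarrow> ('x \<Rightarrow> 'k) \<Rightarrow> ('x \<Rightarrow> 'k)" where
  "fscale c f = (\<lambda>x. c * f x)"

definition A_alg :: "nat \<Rightarrow> nat \<Rightarrow> 'k::field superpoly set" where
  "A_alg m n = {f. finite {M. f M \<noteq> 0} \<and>
     (\<forall>M. f M \<noteq> 0 \<longrightarrow> set_mset M \<subseteq> {1..m + n} \<times> {1..m + n} \<and> super_monom m M)}"

definition A_deg :: "nat \<Rightarrow> nat \<Rightarrow> nat \<Rightarrow> 'k::field superpoly set" where
  "A_deg m n r = {f \<in> A_alg m n. \<forall>M. f M \<noteq> 0 \<longrightarrow> size M = r}"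

definition A_comp :: "nat \<Rightarrow> nat \<Rightarrow> nat \<Rightarrow> bit \<Rightarrow> 'k::field superpoly set" where
  "A_comp m n r p = {f \<in> A_deg m n r. \<forall>M. f M \<noteq> 0 \<longrightarrow> of_nat (monom_par m M) = p}"

definition chi :: "nat \<Rightarrow> nat \<Rightarrow> (nat \<Rightarrow> nat) \<Rightarrow> (nat \<Rightarrow> nat) \<Rightarrow> 'k::field superpoly" where
  "chi m r i j = fscale
     ((-1) ^ (\<Sum>t = 1..r. par m (i t) * (\<Sum>u = t + 1..r. par m (i u) + par m (j u))))
     (foldr (sp_mult m) (map (\<lambda>t. sp_gen (i t) (j t)) [1..<r + 1]) sp_one)"


section \<open>Linear maps on subspaces and graded spaces\<close>

definition lin_on :: "('k \<Rightarrow> 'a::ab_group_add \<Rightarrow> 'a) \<Rightarrow> ('k \<Rightarrow> 'b::ab_group_add \<Rightarrow> 'b)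
    \<Rightarrow> 'a set \<Rightarrow> ('a \<Rightarrow> 'b) \<Rightarrow> bool" where
  "lin_on s s' V f \<longleftrightarrow>
     (\<forall>v \<in> V. \<forall>w \<in> V. f (v + w) = f v + f w) \<and> (\<forall>c. \<forall>v \<in> V. f (s c v) = s' c (f v))"

text \<open>
  The carrier of a \<open>\<int>/2\<close>-graded space is a subset of an ambient additive group. The
  components are indexed by the field \<open>bit\<close> with two elements, so that parities add.
\<close>

record ('k, 'v) gspace =
  scal :: "'k \<Rightarrow> 'v \<Rightarrow> 'v"
  carr :: "'v set"
  hcomp :: "bit \<Rightarrow> 'v set"

definition graded_space :: "('k::field, 'v::ab_group_add) gspace \<Rightarrow> bool" where
  "graded_space V \<longleftrightarrow> vector_space (scal V) \<and>
     (\<forall>p. module.subspace (scal V) (hcomp V p)) \<and>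
     carr V = {v + w | v w. v \<in> hcomp V 0 \<and> w \<in> hcomp V 1} \<and>
     hcomp V 0 \<inter> hcomp V 1 = {0}"

definition graded_subspace :: "('k::field, 'v::ab_group_add) gspace \<Rightarrow> 'v set \<Rightarrow> bool" where
  "graded_subspace V W \<longleftrightarrow> W \<subseteq> carr V \<and> module.subspace (scal V) W \<and>
     W = {v + w | v w. v \<in> W \<inter> hcomp V 0 \<and> w \<in> W \<inter> hcomp V 1}"


section \<open>The Schur superalgebra\<close>

text \<open>A functional on the degree \<open>r\<close> part is extended by zero to the ambient type.\<close>

type_synonym 'k functional = "'k superpoly \<Rightarrow> 'k"

definition schur :: "nat \<Rightarrow> nat \<Rightarrow> nat \<Rightarrow> 'k::field functional set" where
  "schur m n r = {\<xi>. lin_on fscale (*) (A_deg m n r) \<xi> \<and> (\<forall>f. f \<notin> A_deg m n r \<longrightarrow> \<xi> f = 0)}"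

definition schur_comp :: "nat \<Rightarrow> nat \<Rightarrow> nat \<Rightarrow> bit \<Rightarrow> 'k::field functional set" where
  "schur_comp m n r p = {\<xi> \<in> schur m n r. \<forall>f \<in> A_comp m n r (p + 1). \<xi> f = 0}"

definition schur_mult ::
    "nat \<Rightarrow> nat \<Rightarrow> nat \<Rightarrow> 'k::field functional \<Rightarrow> 'k functional \<Rightarrow> 'k functional" where
  "schur_mult m n r \<xi> \<eta> = (THE \<zeta>. \<zeta> \<in> schur m n r \<and>
     (\<forall>p \<in> multiindices m n r. \<forall>q \<in> multiindices m n r.
        \<zeta> (chi m r p q) = (\<Sum>s \<in> multiindices m n r. \<xi> (chi m r p s) * \<eta> (chi m r s q))))"

definition schur_one :: "nat \<Rightarrow> nat \<Rightarrow> nat \<Rightarrow> 'k::field functional" where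
  "schur_one m n r = (THE \<epsilon>. \<epsilon> \<in> schur m n r \<and>
     (\<forall>\<xi> \<in> schur m n r. schur_mult m n r \<epsilon> \<xi> = \<xi> \<and> schur_mult m n r \<xi> \<epsilon> = \<xi>))"

text \<open>
  The actions on \<open>A(m|n,r)\<close>: linear maps determined by their values on the spanning elements
  \<open>\<chi>\<^bsub>i,j\<^esub>\<close>, extended by zero to the ambient type.
\<close>

definition A_lact ::
    "nat \<Rightarrow> nat \<Rightarrow> nat \<Rightarrow> 'k::field functional \<Rightarrow> 'k superpoly \<Rightarrow> 'k superpoly" where
  "A_lact m n r \<xi> = (THE F. lin_on fscale fscale (A_deg m n r) F \<and>
     (\<forall>f. f \<notin> A_deg m n r \<longrightarrow> F f = 0) \<and>
     (\<forall>i \<in> multiindices m n r. \<forall>j \<in> multiindices m n r.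
        F (chi m r i j) = (\<Sum>a \<in> multiindices m n r. fscale (\<xi> (chi m r a j)) (chi m r i a))))"

definition A_ract ::
    "nat \<Rightarrow> nat \<Rightarrow> nat \<Rightarrow> 'k::field functional \<Rightarrow> 'k superpoly \<Rightarrow> 'k superpoly" where
  "A_ract m n r \<xi> = (THE F. lin_on fscale fscale (A_deg m n r) F \<and>
     (\<forall>f. f \<notin> A_deg m n r \<longrightarrow> F f = 0) \<and>
     (\<forall>i \<in> multiindices m n r. \<forall>j \<in> multiindices m n r.
        F (chi m r i j) = (\<Sum>b \<in> multiindices m n r. fscale (\<xi> (chi m r i b)) (chi m r b j))))"


section \<open>Supermodules and superbimodules\<close>

text \<open>An action is a function of the algebra element and the vector, on either side: a right
  action \<open>R\<close> sends \<open>\<xi>\<close> and \<open>v\<close> to \<open>v\<xi> = R \<xi> v\<close>.\<close>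

type_synonym ('k, 'v) action = "'k functional \<Rightarrow> 'v \<Rightarrow> 'v"

definition graded_action ::
    "nat \<Rightarrow> nat \<Rightarrow> nat \<Rightarrow> ('k::field, 'v::ab_group_add) gspace \<Rightarrow> ('k, 'v) action \<Rightarrow> bool" where
  "graded_action m n r V act \<longleftrightarrow>
     (\<forall>\<xi> \<in> schur m n r. lin_on (scal V) (scal V) (carr V) (act \<xi>) \<and> act \<xi> ` carr V \<subseteq> carr V) \<and>
     (\<forall>v \<in> carr V. lin_on fscale (scal V) (schur m n r) (\<lambda>\<xi>. act \<xi> v)) \<and>
     (\<forall>v \<in> carr V. act (schur_one m n r) v = v) \<and>
     (\<forall>p q. \<forall>\<xi> \<in> schur_comp m n r p. \<forall>v \<in> hcomp V q. act \<xi> v \<in> hcomp V (p + q))"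

definition left_supermodule ::
    "nat \<Rightarrow> nat \<Rightarrow> nat \<Rightarrow> ('k::field, 'v::ab_group_add) gspace \<Rightarrow> ('k, 'v) action \<Rightarrow> bool" where
  "left_supermodule m n r V L \<longleftrightarrow> graded_space V \<and> graded_action m n r V L \<and>
     (\<forall>\<xi> \<in> schur m n r. \<forall>\<eta> \<in> schur m n r. \<forall>v \<in> carr V. L (schur_mult m n r \<xi> \<eta>) v = L \<xi> (L \<eta> v))"

definition right_supermodule ::
    "nat \<Rightarrow> nat \<Rightarrow> nat \<Rightarrow> ('k::field, 'v::ab_group_add) gspace \<Rightarrow> ('k, 'v) action \<Rightarrow> bool" where
  "right_supermodule m n r V R \<longleftrightarrow> graded_space V \<and> graded_action m n r V R \<and>
     (\<forall>\<xi> \<in> schur m n r. \<forall>\<eta> \<in> schur m n r. \<forall>v \<in> carr V. R (schur_mult m n r \<xi> \<eta>) v = R \<eta> (R \<xi> v))"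

definition superbimodule :: "nat \<Rightarrow> nat \<Rightarrow> nat \<Rightarrow> ('k::field, 'v::ab_group_add) gspace
    \<Rightarrow> ('k, 'v) action \<Rightarrow> ('k, 'v) action \<Rightarrow> bool" where
  "superbimodule m n r V L R \<longleftrightarrow> left_supermodule m n r V L \<and> right_supermodule m n r V R \<and>
     (\<forall>\<xi> \<in> schur m n r. \<forall>\<eta> \<in> schur m n r. \<forall>v \<in> carr V. R \<eta> (L \<xi> v) = L \<xi> (R \<eta> v))"

text \<open>
  Isomorphism up to parity shift: \<open>q = 0\<close> for an even isomorphism, \<open>q = 1\<close> for an even
  isomorphism onto the parity shift.
\<close>

definition superbimodule_iso :: "nat \<Rightarrow> nat \<Rightarrow> nat
    \<Rightarrow> ('k::field, 'v::ab_group_add) gspace \<Rightarrow> ('k, 'v) action \<Rightarrow> ('k, 'v) action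
    \<Rightarrow> ('k, 'w::ab_group_add) gspace \<Rightarrow> ('k, 'w) action \<Rightarrow> ('k, 'w) action \<Rightarrow> bool" where
  "superbimodule_iso m n r V L R W L' R' \<longleftrightarrow>
     (\<exists>f. lin_on (scal V) (scal W) (carr V) f \<and> bij_betw f (carr V) (carr W) \<and>
       (\<forall>\<xi> \<in> schur m n r. \<forall>v \<in> carr V. f (L \<xi> v) = L' \<xi> (f v) \<and> f (R \<xi> v) = R' \<xi> (f v)) \<and>
       (\<exists>q. \<forall>p. f ` hcomp V p = hcomp W (p + q)))"

text \<open>Meant for \<open>act\<close> the action of a left or right supermodule.\<close>

definition irreducible_action ::
    "nat \<Rightarrow> nat \<Rightarrow> nat \<Rightarrow> ('k::field, 'v::ab_group_add) gspace \<Rightarrow> ('k, 'v) action \<Rightarrow> bool" where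
  "irreducible_action m n r V act \<longleftrightarrow> carr V \<noteq> {0} \<and>
     (\<forall>W. graded_subspace V W \<and> (\<forall>\<xi> \<in> schur m n r. act \<xi> ` W \<subseteq> W) \<longrightarrow> W = {0} \<or> W = carr V)"


section \<open>Weights\<close>

definition weights :: "nat \<Rightarrow> nat \<Rightarrow> nat \<Rightarrow> (nat \<Rightarrow> nat) set" where
  "weights m n r = {\<mu>. (\<forall>a. a \<notin> {1..m + n} \<longrightarrow> \<mu> a = 0) \<and> (\<Sum>a = 1..m + n. \<mu> a) = r}"

definition dominated :: "nat \<Rightarrow> nat \<Rightarrow> (nat \<Rightarrow> nat) \<Rightarrow> (nat \<Rightarrow> nat) \<Rightarrow> bool" where
  "dominated m n \<mu> \<nu> \<longleftrightarrow> (\<forall>a \<in> {1..m + n}. (\<Sum>b = 1..a. \<mu> b) \<le> (\<Sum>b = 1..a. \<nu> b))"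

definition has_content :: "nat \<Rightarrow> nat \<Rightarrow> nat \<Rightarrow> (nat \<Rightarrow> nat) \<Rightarrow> (nat \<Rightarrow> nat) \<Rightarrow> bool" where
  "has_content m n r i \<mu> \<longleftrightarrow> (\<forall>a \<in> {1..m + n}. card {t \<in> {1..r}. i t = a} = \<mu> a)"

definition weight_idem :: "nat \<Rightarrow> nat \<Rightarrow> nat \<Rightarrow> (nat \<Rightarrow> nat) \<Rightarrow> 'k::field functional" where
  "weight_idem m n r \<mu> = (THE \<xi>. \<xi> \<in> schur m n r \<and>
     (\<forall>i \<in> multiindices m n r. has_content m n r i \<mu> \<longrightarrow>
       (\<forall>k \<in> multiindices m n r. \<forall>l \<in> multiindices m n r.
          \<xi> (chi m r k l) = (if k = l \<and> (\<exists>\<pi>. \<pi> permutes {1..r} \<and> k = i \<circ> \<pi>) then 1 else 0))))"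

definition weight_space :: "nat \<Rightarrow> nat \<Rightarrow> nat \<Rightarrow> ('k::field, 'v::ab_group_add) gspace
    \<Rightarrow> ('k, 'v) action \<Rightarrow> (nat \<Rightarrow> nat) \<Rightarrow> 'v set" where
  "weight_space m n r V act \<mu> = act (weight_idem m n r \<mu>) ` carr V"

definition highest_weight :: "nat \<Rightarrow> nat \<Rightarrow> nat \<Rightarrow> ('k::field, 'v::ab_group_add) gspace
    \<Rightarrow> ('k, 'v) action \<Rightarrow> (nat \<Rightarrow> nat) \<Rightarrow> bool" where
  "highest_weight m n r V act \<nu> \<longleftrightarrow> \<nu> \<in> weights m n r \<and> weight_space m n r V act \<nu> \<noteq> {0} \<and>
     (\<forall>\<mu> \<in> weights m n r. weight_space m n r V act \<mu> \<noteq> {0} \<longrightarrow> dominated m n \<mu> \<nu>)"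


section \<open>Hook partitions and tableaux\<close>

text \<open>
  A partition is a sequence \<open>lam 1, lam 2, \<dots>\<close>; the value \<open>lam 0\<close> is irrelevant.
  Boxes are pairs (row, column), counted from 1.
\<close>

definition diagram :: "(nat \<Rightarrow> nat) \<Rightarrow> (nat \<times> nat) set" where
  "diagram lam = {(a, b). 1 \<le> a \<and> 1 \<le> b \<and> b \<le> lam a}"

definition partition_of :: "nat \<Rightarrow> (nat \<Rightarrow> nat) \<Rightarrow> bool" where
  "partition_of r lam \<longleftrightarrow> (\<forall>a b. 1 \<le> a \<and> a \<le> b \<longrightarrow> lam b \<le> lam a) \<and>
     finite {a. 1 \<le> a \<and> lam a \<noteq> 0} \<and> (\<Sum>a \<in> {a. 1 \<le> a \<and> lam a \<noteq> 0}. lam a) = r"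

definition hook_partition :: "nat \<Rightarrow> nat \<Rightarrow> nat \<Rightarrow> (nat \<Rightarrow> nat) \<Rightarrow> bool" where
  "hook_partition m n r lam \<longleftrightarrow> partition_of r lam \<and> lam (m + 1) \<le> n"

definition T_ell :: "nat \<Rightarrow> nat \<times> nat \<Rightarrow> nat" where
  "T_ell m bx = (if fst bx \<le> m then fst bx else m + snd bx)"

text \<open>The weight with which a hook partition is identified.\<close>

definition hook_weight :: "nat \<Rightarrow> (nat \<Rightarrow> nat) \<Rightarrow> nat \<Rightarrow> nat" where
  "hook_weight m lam a = card {bx \<in> diagram lam. T_ell m bx = a}"

definition row_group ::
    "nat \<Rightarrow> (nat \<Rightarrow> nat) \<Rightarrow> (nat \<times> nat \<Rightarrow> nat) \<Rightarrow> (nat \<Rightarrow> nat) set" where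
  "row_group r lam T = {\<rho>. \<rho> permutes {1..r} \<and>
     (\<forall>a. \<rho> ` (T ` {bx \<in> diagram lam. fst bx = a}) = T ` {bx \<in> diagram lam. fst bx = a})}"

definition col_group ::
    "nat \<Rightarrow> (nat \<Rightarrow> nat) \<Rightarrow> (nat \<times> nat \<Rightarrow> nat) \<Rightarrow> (nat \<Rightarrow> nat) set" where
  "col_group r lam T = {\<kappa>. \<kappa> permutes {1..r} \<and>
     (\<forall>b. \<kappa> ` (T ` {bx \<in> diagram lam. snd bx = b}) = T ` {bx \<in> diagram lam. snd bx = b})}"

text \<open>An equality of entries is a repetition; even symbols may repeat along rows only, odd ones
  along columns only.\<close>

definition semistandard ::
    "nat \<Rightarrow> (nat \<Rightarrow> nat) \<Rightarrow> (nat \<times> nat \<Rightarrow> nat) \<Rightarrow> (nat \<Rightarrow> nat) \<Rightarrow> bool" where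
  "semistandard m lam T i \<longleftrightarrow>
     (\<forall>a b b'. (a, b) \<in> diagram lam \<and> (a, b') \<in> diagram lam \<and> b < b' \<longrightarrow>
        i (T (a, b)) \<le> i (T (a, b')) \<and> (i (T (a, b)) = i (T (a, b')) \<longrightarrow> i (T (a, b)) \<le> m)) \<and>
     (\<forall>a a' b. (a, b) \<in> diagram lam \<and> (a', b) \<in> diagram lam \<and> a < a' \<longrightarrow>
        i (T (a, b)) \<le> i (T (a', b)) \<and> (i (T (a, b)) = i (T (a', b)) \<longrightarrow> m < i (T (a, b))))"

definition ss_indices ::
    "nat \<Rightarrow> nat \<Rightarrow> nat \<Rightarrow> (nat \<Rightarrow> nat) \<Rightarrow> (nat \<times> nat \<Rightarrow> nat) \<Rightarrow> (nat \<Rightarrow> nat) set" where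
  "ss_indices m n r lam T = {i \<in> multiindices m n r. semistandard m lam T i}"

definition symmetrizer :: "nat \<Rightarrow> nat \<Rightarrow> (nat \<Rightarrow> nat) \<Rightarrow> (nat \<times> nat \<Rightarrow> nat)
    \<Rightarrow> (nat \<Rightarrow> nat) \<Rightarrow> (nat \<Rightarrow> nat) \<Rightarrow> 'k::field superpoly" where
  "symmetrizer m r lam T i j = (\<Sum>\<rho> \<in> row_group r lam T. \<Sum>\<kappa> \<in> col_group r lam T.
     fscale (of_int (sign \<kappa>) * act_sgn m r i \<rho> * act_sgn m r j \<kappa>) (chi m r (i \<circ> \<rho>) (j \<circ> \<kappa>)))"

definition A_lam :: "nat \<Rightarrow> nat \<Rightarrow> nat \<Rightarrow> (nat \<Rightarrow> nat) \<Rightarrow> (nat \<times> nat \<Rightarrow> nat)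
    \<Rightarrow> 'k::field superpoly set" where
  "A_lam m n r lam T = module.span fscale
     {symmetrizer m r lam T i j | i j. i \<in> multiindices m n r \<and> j \<in> multiindices m n r}"

definition A_lam_space :: "nat \<Rightarrow> nat \<Rightarrow> nat \<Rightarrow> (nat \<Rightarrow> nat) \<Rightarrow> (nat \<times> nat \<Rightarrow> nat)
    \<Rightarrow> ('k::field, 'k superpoly) gspace" where
  "A_lam_space m n r lam T = \<lparr>scal = fscale, carr = A_lam m n r lam T,
     hcomp = (\<lambda>p. A_lam m n r lam T \<inter> A_comp m n r p)\<rparr>"


section \<open>The irreducible supermodules of highest weight \<open>\<lambda>\<close>\<close>

definition is_D :: "nat \<Rightarrow> nat \<Rightarrow> nat \<Rightarrow> (nat \<Rightarrow> nat)
    \<Rightarrow> ('k::field, 'v::ab_group_add) gspace \<Rightarrow> ('k, 'v) action \<Rightarrow> bool" where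
  "is_D m n r lam V L \<longleftrightarrow> left_supermodule m n r V L \<and> irreducible_action m n r V L \<and>
     highest_weight m n r V L (hook_weight m lam)"

definition is_D_op :: "nat \<Rightarrow> nat \<Rightarrow> nat \<Rightarrow> (nat \<Rightarrow> nat)
    \<Rightarrow> ('k::field, 'v::ab_group_add) gspace \<Rightarrow> ('k, 'v) action \<Rightarrow> bool" where
  "is_D_op m n r lam V R \<longleftrightarrow> right_supermodule m n r V R \<and> irreducible_action m n r V R \<and>
     highest_weight m n r V R (hook_weight m lam)"


section \<open>Tensor products\<close>

text \<open>
  Over a field, \<open>V \<otimes> W\<close> embeds into the dual of the space of bilinear forms on \<open>V \<times> W\<close>,
  with \<open>v \<otimes> w\<close> acting as evaluation at \<open>(v, w)\<close>; this image is the model used here.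
\<close>

definition bilinear_forms :: "('k::field, 'v::ab_group_add) gspace
    \<Rightarrow> ('k, 'w::ab_group_add) gspace \<Rightarrow> ('v \<Rightarrow> 'w \<Rightarrow> 'k) set" where
  "bilinear_forms V W = {B. (\<forall>v \<in> carr V. lin_on (scal W) (*) (carr W) (B v)) \<and>
     (\<forall>w \<in> carr W. lin_on (scal V) (*) (carr V) (\<lambda>v. B v w))}"

definition tensor :: "('k::field, 'v::ab_group_add) gspace \<Rightarrow> ('k, 'w::ab_group_add) gspace
    \<Rightarrow> 'v \<Rightarrow> 'w \<Rightarrow> ('v \<Rightarrow> 'w \<Rightarrow> 'k) \<Rightarrow> 'k" where
  "tensor V W v w = (\<lambda>B. if B \<in> bilinear_forms V W then B v w else 0)"

definition tensor_space :: "('k::field, 'v::ab_group_add) gspace \<Rightarrow> ('k, 'w::ab_group_add) gspace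
    \<Rightarrow> ('k, ('v \<Rightarrow> 'w \<Rightarrow> 'k) \<Rightarrow> 'k) gspace" where
  "tensor_space V W = \<lparr>scal = fscale,
     carr = module.span fscale {tensor V W v w | v w. v \<in> carr V \<and> w \<in> carr W},
     hcomp = (\<lambda>p. module.span fscale
       {tensor V W v w | v w. \<exists>q. v \<in> hcomp V q \<and> w \<in> hcomp W (p + q)})\<rparr>"

text \<open>The actions \<open>\<xi>(v \<otimes> w) = \<xi>v \<otimes> w\<close> and \<open>(v \<otimes> w)\<xi> = v \<otimes> w\<xi>\<close>.\<close>

definition tensor_lact :: "('k::field, 'v::ab_group_add) gspace \<Rightarrow> ('k, 'w::ab_group_add) gspace
    \<Rightarrow> ('k, 'v) action \<Rightarrow> ('k, ('v \<Rightarrow> 'w \<Rightarrow> 'k) \<Rightarrow> 'k) action" where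
  "tensor_lact V W L \<xi> t = (\<lambda>B. if B \<in> bilinear_forms V W then t (\<lambda>v w. B (L \<xi> v) w) else 0)"

definition tensor_ract :: "('k::field, 'v::ab_group_add) gspace \<Rightarrow> ('k, 'w::ab_group_add) gspace
    \<Rightarrow> ('k, 'w) action \<Rightarrow> ('k, ('v \<Rightarrow> 'w \<Rightarrow> 'k) \<Rightarrow> 'k) action" where
  "tensor_ract V W R \<xi> t = (\<lambda>B. if B \<in> bilinear_forms V W then t (\<lambda>v w. B v (R \<xi> w)) else 0)"

end

theory Submission imports Defs begin

text \<open>
  As a function of \<open>j\<close> (and, after transposition, of \<open>i\<close>) the symmetrizer \<open>T[i:j]\<close> is the image of
  \<open>\<chi>\<^bsub>i,j\<^esub>\<close> under a Young symmetrizer \<open>Y\<close> of the signed action of \<open>\<Sigma>\<^sub>r\<close>, and \<open>Y\<^sup>2 = h Y\<close> with \<open>h \<noteq> 0\<close>. Both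
  actions of \<open>S\<close> commute with the signed action. Garnir relations show that the symmetrizers with
  semistandard \<open>T\<^sub>i\<close> and \<open>T\<^sub>j\<close> span; a triangularity argument, ordering multiindices by their pairing
  with the row function, shows that they are independent.

  The multiindex \<open>\<ell>\<close> of highest weight is entrywise minimal among the semistandard ones. Modulo the
  elements of \<open>S\<close> that factor through a weight not dominated by \<open>\<lambda>\<close>, the symmetrized matrix unit at
  \<open>(\<ell>, \<ell>)\<close> is a nonzero multiple of the idempotent \<open>\<xi>\<^sub>\<lambda>\<close>. Hence in any irreducible supermodule of
  highest weight \<open>\<lambda>\<close> the vectors \<open>f\<^sub>j\<close>, obtained by applying the symmetrized matrix units at
  \<open>(j, \<ell>)\<close> to a highest weight vector, span, and their linear relations are exactly those imposed by
  \<open>Y\<close>. Sending \<open>T[i:j]\<close> to the tensor of \<open>f\<^sub>j\<close> with the row symmetrization of the vectors \<open>g\<^sub>i\<close>,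
  constructed in the same way in the right supermodule, is therefore a well-defined isomorphism.
\<close>

text \<open>Signs are the obstacle, and two devices tame them. The signed action enters through the
  abstract locale \<open>signed_action\<close>; twisting its cocycle by the sign character negates
  the parity predicate, and transposing the shape at the same time exchanges rows with columns.
  Straightening of the first index and the row version of triangularity are thus column results read
  in the twisted locale. Secondly, the normalization of \<open>\<chi>\<close> makes a simultaneous
  permutation of \<open>i\<close> and \<open>j\<close> cost one sign for \<open>i\<close> times one
  for \<open>j\<close>. Hence \<open>S\<close> is the algebra of matrices with this symmetry under
  ordinary multiplication, and plain transposition is an anti-automorphism that turns right modules
  into left ones. The isomorphism is well defined because it is given on all of
  \<open>A(m|n,r)\<close>: a bilinear form evaluated at the vectors of both modules is a matrix, and
  \<open>theta\<close> turns matrices into functionals on \<open>A(m|n,r)\<close>. The same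
  functionals, fed with \<open>bc k\<close> and \<open>bc l\<close>, prove independence. The
  multiple of the idempotent, which must hold in every module at once, is computed in the model
  spanned by the symmetrizers with first index \<open>\<ell>\<close>.\<close>

declare One_nat_def [simp del]

section \<open>Permutations of the positions and reindexing of sums over them\<close>

definition perms :: "nat \<Rightarrow> (nat \<Rightarrow> nat) set" where
  "perms r = {\<pi>. \<pi> permutes {1..r}}"

lemma sum_fun_apply: "(\<Sum>x\<in>A. f x) y = (\<Sum>x\<in>A. f x y)"
  by (induction A rule: infinite_finite_induct) auto

lemma finite_perms [simp]: "finite (perms r)"
  by (simp add: perms_def finite_permutations)

lemma id_perms [simp]: "id \<in> perms r"
  by (simp add: perms_def)

lemma perms_compose [simp]: "\<pi> \<in> perms r \<Longrightarrow> \<sigma> \<in> perms r \<Longrightarrow> \<pi> \<circ> \<sigma> \<in> perms r"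
  by (simp add: perms_def permutes_compose)

lemma perms_inv [simp]: "\<pi> \<in> perms r \<Longrightarrow> inv \<pi> \<in> perms r"
  by (simp add: perms_def permutes_inv)

lemma perms_inv_comp [simp]:
  assumes "\<pi> \<in> perms r"
  shows "inv \<pi> \<circ> \<pi> = id" "\<pi> \<circ> inv \<pi> = id" "inv (inv \<pi>) = \<pi>"
  using assms permutes_inv_o permutes_inv_inv by (auto simp: perms_def)

lemma perms_inv_comp_assoc [simp]:
  assumes "\<pi> \<in> perms r"
  shows "inv \<pi> \<circ> (\<pi> \<circ> f) = f" "\<pi> \<circ> (inv \<pi> \<circ> f) = f" "g \<circ> \<pi> \<circ> inv \<pi> = g" "g \<circ> inv \<pi> \<circ> \<pi> = g"
  by (simp_all only: o_assoc perms_inv_comp[OF assms] id_comp)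
    (simp_all only: o_assoc[symmetric] perms_inv_comp[OF assms] comp_id)

lemma perms_inj: "\<pi> \<in> perms r \<Longrightarrow> \<pi> x = \<pi> y \<longleftrightarrow> x = y"
  unfolding perms_def using permutes_inj[of \<pi> "{1..r}"] by (auto dest: injD)

lemma perms_in: "\<pi> \<in> perms r \<Longrightarrow> \<pi> t \<in> {1..r} \<longleftrightarrow> t \<in> {1..r}"
  using permutes_in_image[of \<pi> "{1..r}" t] by (simp add: perms_def)

lemma perms_inv_apply [simp]: "\<pi> \<in> perms r \<Longrightarrow> \<pi> (inv \<pi> x) = x" "\<pi> \<in> perms r \<Longrightarrow> inv \<pi> (\<pi> x) = x"
  unfolding perms_def using permutes_inverses[of \<pi> "{1..r}"] by auto

lemma transpose_perms [simp]: "s \<in> {1..r} \<Longrightarrow> t \<in> {1..r} \<Longrightarrow> transpose s t \<in> perms r"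
  unfolding perms_def mem_Collect_eq by (rule permutes_swap_id)

lemma perms_inv_of_comp:
  "\<pi> \<in> perms r \<Longrightarrow> \<sigma> \<in> perms r \<Longrightarrow> inv (\<pi> \<circ> \<sigma>) = inv \<sigma> \<circ> inv \<pi>"
  by (simp add: o_inv_distrib permutes_bij perms_def)

lemma sum_perms_left:
  "\<pi> \<in> perms r \<Longrightarrow> (\<Sum>\<sigma>\<in>perms r. f (\<pi> \<circ> \<sigma>)) = (\<Sum>\<sigma>\<in>perms r. f \<sigma>)"
  by (rule sum.reindex_bij_witness[where i = "\<lambda>\<sigma>. inv \<pi> \<circ> \<sigma>" and j = "\<lambda>\<sigma>. \<pi> \<circ> \<sigma>"]) auto

lemma sum_perms_right:
  "\<pi> \<in> perms r \<Longrightarrow> (\<Sum>\<sigma>\<in>perms r. f (\<sigma> \<circ> \<pi>)) = (\<Sum>\<sigma>\<in>perms r. f \<sigma>)"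
  by (rule sum.reindex_bij_witness[where i = "\<lambda>\<sigma>. \<sigma> \<circ> inv \<pi>" and j = "\<lambda>\<sigma>. \<sigma> \<circ> \<pi>"]) auto

lemma sum_perms_inv: "(\<Sum>\<sigma>\<in>perms r. f (inv \<sigma>)) = (\<Sum>\<sigma>\<in>perms r. f \<sigma>)"
  by (rule sum.reindex_bij_witness[where i = inv and j = inv]) auto

lemma sign_perms_comp:
  "\<pi> \<in> perms r \<Longrightarrow> \<sigma> \<in> perms r \<Longrightarrow> sign (\<pi> \<circ> \<sigma>) = sign \<pi> * sign \<sigma>"
  unfolding perms_def mem_Collect_eq using permutes_imp_permutation[of "{1..r}"]
  by (auto intro!: sign_compose)

lemma sign_perms_inv: "\<pi> \<in> perms r \<Longrightarrow> sign (inv \<pi>) = sign \<pi>"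
  unfolding perms_def mem_Collect_eq using permutes_imp_permutation[of "{1..r}"]
  by (auto intro!: sign_inverse)

section \<open>The group algebra of the symmetric group\<close>

definition conv :: "nat \<Rightarrow> ((nat \<Rightarrow> nat) \<Rightarrow> 'a::comm_ring_1) \<Rightarrow> ((nat \<Rightarrow> nat) \<Rightarrow> 'a) \<Rightarrow> (nat \<Rightarrow> nat) \<Rightarrow> 'a" where
  "conv r g h \<pi> = (\<Sum>\<sigma>\<in>perms r. g \<sigma> * h (inv \<sigma> \<circ> \<pi>))"

text \<open>Point mass, polymorphic because it serves for group elements and for
  multiindices.\<close>

definition delta :: "'b \<Rightarrow> 'b \<Rightarrow> 'a::comm_ring_1" where
  "delta x y = (if y = x then 1 else 0)"

lemma conv_assoc: "conv r (conv r f g) h = conv r f (conv r g h)"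
proof
  fix \<pi>
  have "conv r (conv r f g) h \<pi> =
      (\<Sum>\<tau>\<in>perms r. \<Sum>\<sigma>\<in>perms r. f \<tau> * (g (inv \<tau> \<circ> \<sigma>) * h (inv \<sigma> \<circ> \<pi>)))"
    unfolding conv_def sum_distrib_right by (subst sum.swap) (simp add: mult.assoc)
  also have "\<dots> = (\<Sum>\<tau>\<in>perms r. \<Sum>\<sigma>\<in>perms r. f \<tau> * (g \<sigma> * h (inv \<sigma> \<circ> (inv \<tau> \<circ> \<pi>))))"
  proof (rule sum.cong[OF refl])
    fix \<tau> assume t: "\<tau> \<in> perms r"
    show "(\<Sum>\<sigma>\<in>perms r. f \<tau> * (g (inv \<tau> \<circ> \<sigma>) * h (inv \<sigma> \<circ> \<pi>))) =
       (\<Sum>\<sigma>\<in>perms r. f \<tau> * (g \<sigma> * h (inv \<sigma> \<circ> (inv \<tau> \<circ> \<pi>))))"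
      by (subst sum_perms_left[OF t, symmetric], rule sum.cong[OF refl])
        (simp add: perms_inv_comp_assoc[OF t] perms_inv_of_comp[OF t] o_assoc[symmetric])
  qed
  also have "\<dots> = conv r f (conv r g h) \<pi>"
    by (simp add: conv_def sum_distrib_left)
  finally show "conv r (conv r f g) h \<pi> = conv r f (conv r g h) \<pi>" .
qed

lemma conv_of_int: "conv r (\<lambda>\<sigma>. of_int (g \<sigma>)) (\<lambda>\<sigma>. of_int (h \<sigma>)) = (\<lambda>\<pi>. of_int (conv r g h \<pi>))"
  by (simp add: conv_def fun_eq_iff)

text \<open>This is the anti-involution of the group algebra. Row and column sums are fixed by it,
  so it exchanges products of the form column times row with those of the form row times
  column.\<close>

lemma conv_inv:
  assumes "\<pi> \<in> perms r"
  shows "conv r g h (inv \<pi>) = conv r (\<lambda>\<sigma>. h (inv \<sigma>)) (\<lambda>\<sigma>. g (inv \<sigma>)) \<pi>"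
proof -
  have "conv r g h (inv \<pi>) = (\<Sum>\<sigma>\<in>perms r. g (inv \<pi> \<circ> \<sigma>) * h (inv (inv \<pi> \<circ> \<sigma>) \<circ> inv \<pi>))"
    unfolding conv_def by (rule sum_perms_left[OF perms_inv[OF assms], symmetric])
  also have "\<dots> = (\<Sum>\<sigma>\<in>perms r. g (inv \<pi> \<circ> \<sigma>) * h (inv \<sigma>))"
    by (intro sum.cong refl) (simp add: perms_inv_comp[OF assms] perms_inv_of_comp[OF perms_inv[OF assms]] o_assoc[symmetric])
  also have "\<dots> = conv r (\<lambda>\<sigma>. h (inv \<sigma>)) (\<lambda>\<sigma>. g (inv \<sigma>)) \<pi>"
    unfolding conv_def
    by (intro sum.cong refl)
      (simp add: perms_inv_of_comp[OF perms_inv assms] mult.commute)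
  finally show ?thesis .
qed

lemma conv_cong:
  assumes "\<And>\<sigma>. \<sigma> \<in> perms r \<Longrightarrow> g \<sigma> = g' \<sigma>" "\<And>\<sigma>. \<sigma> \<in> perms r \<Longrightarrow> h \<sigma> = h' \<sigma>" "\<pi> \<in> perms r"
  shows "conv r g h \<pi> = conv r g' h' \<pi>"
  unfolding conv_def
  by (intro sum.cong refl arg_cong2[where f = "(*)"]) (simp_all add: assms)

lemma conv_delta_left: "\<tau> \<in> perms r \<Longrightarrow> conv r (delta \<tau>) h \<pi> = h (inv \<tau> \<circ> \<pi>)"
  unfolding conv_def delta_def by (simp add: if_distrib[of "\<lambda>x. x * _"] sum.delta cong: if_cong)

lemma conv_delta_right:
  assumes "\<tau> \<in> perms r" "\<pi> \<in> perms r"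
  shows "conv r g (delta \<tau>) \<pi> = g (\<pi> \<circ> inv \<tau>)"
proof -
  have "inv \<sigma> \<circ> \<pi> = \<tau> \<longleftrightarrow> \<sigma> = \<pi> \<circ> inv \<tau>" if "\<sigma> \<in> perms r" for \<sigma>
    using perms_inv_comp_assoc[OF that] perms_inv_comp_assoc[OF assms(1)] by metis
  then have "conv r g (delta \<tau>) \<pi> = (\<Sum>\<sigma>\<in>perms r. if \<sigma> = \<pi> \<circ> inv \<tau> then g \<sigma> else 0)"
    unfolding conv_def delta_def by (intro sum.cong) auto
  also have "\<dots> = g (\<pi> \<circ> inv \<tau>)"
    using assms by (simp add: sum.delta)
  finally show ?thesis .
qed

lemma conv_scale_right: "conv r g (\<lambda>\<sigma>. c * h \<sigma>) = (\<lambda>\<pi>. c * conv r g h \<pi>)"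
  by (simp add: conv_def fun_eq_iff sum_distrib_left mult_ac)

lemma conv_scale_left: "conv r (\<lambda>\<sigma>. c * g \<sigma>) h = (\<lambda>\<pi>. c * conv r g h \<pi>)"
  by (simp add: conv_def fun_eq_iff sum_distrib_left mult_ac)

lemma conv_support:
  assumes "\<And>\<sigma>. \<sigma> \<notin> perms r \<Longrightarrow> h \<sigma> = 0" "\<pi> \<notin> perms r"
  shows "conv r g h \<pi> = 0"
proof -
  have "inv \<sigma> \<circ> \<pi> \<notin> perms r" if "\<sigma> \<in> perms r" for \<sigma>
    using perms_compose[OF that] perms_inv_comp_assoc(2)[OF that] assms(2) by metis
  then show ?thesis unfolding conv_def using assms(1) by (intro sum.neutral) auto
qed

section \<open>Row and column groups\<close>

text \<open>Row group and column group are one construction for the two coordinate functions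
  \<open>row\<close> and \<open>col\<close>, so a single set of lemmas serves both.\<close>

definition level_perms :: "nat \<Rightarrow> (nat \<Rightarrow> nat) \<Rightarrow> (nat \<Rightarrow> nat) set" where
  "level_perms r f = {\<rho>\<in>perms r. \<forall>t\<in>{1..r}. f (\<rho> t) = f t}"

lemma level_permsD: "\<rho> \<in> level_perms r f \<Longrightarrow> \<rho> \<in> perms r"
  "\<rho> \<in> level_perms r f \<Longrightarrow> t \<in> {1..r} \<Longrightarrow> f (\<rho> t) = f t"
  by (auto simp: level_perms_def)

lemma finite_level_perms [simp]: "finite (level_perms r f)"
  by (rule finite_subset[OF _ finite_perms]) (auto simp: level_perms_def)

lemma id_level_perms [simp]: "id \<in> level_perms r f"
  by (simp add: level_perms_def)

lemma level_perms_comp: "\<rho> \<in> level_perms r f \<Longrightarrow> \<sigma> \<in> level_perms r f \<Longrightarrow> \<rho> \<circ> \<sigma> \<in> level_perms r f"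
  using perms_in[of \<sigma> r] by (auto simp: level_perms_def)

lemma level_perms_inv:
  assumes "\<rho> \<in> level_perms r f"
  shows "inv \<rho> \<in> level_perms r f"
proof -
  have "f (inv \<rho> t) = f t" if "t \<in> {1..r}" for t
  proof -
    have "inv \<rho> t \<in> {1..r}" using perms_in[OF perms_inv[OF level_permsD(1)[OF assms]]] that by blast
    then show ?thesis using level_permsD(2)[OF assms, of "inv \<rho> t"] level_permsD(1)[OF assms] by simp
  qed
  then show ?thesis using level_permsD(1)[OF assms] by (simp add: level_perms_def)
qed

lemma level_perms_comp_iff:
  assumes "\<rho> \<in> level_perms r f" "\<pi> \<in> perms r"
  shows "\<rho> \<circ> \<pi> \<in> level_perms r f \<longleftrightarrow> \<pi> \<in> level_perms r f"
    "\<pi> \<circ> \<rho> \<in> level_perms r f \<longleftrightarrow> \<pi> \<in> level_perms r f"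
  using level_perms_comp[OF assms(1)] level_perms_comp[OF level_perms_inv[OF assms(1)]]
    level_perms_comp[OF _ assms(1)] level_perms_comp[OF _ level_perms_inv[OF assms(1)]]
    perms_inv_comp_assoc[OF level_permsD(1)[OF assms(1)]] by metis+

lemma transpose_level_perms:
  "s \<in> {1..r} \<Longrightarrow> t \<in> {1..r} \<Longrightarrow> f s = f t \<Longrightarrow> transpose s t \<in> level_perms r f"
  by (auto simp: level_perms_def transpose_def)

definition rowsum :: "nat \<Rightarrow> (nat \<Rightarrow> nat) \<Rightarrow> (nat \<Rightarrow> nat) \<Rightarrow> 'a::comm_ring_1" where
  "rowsum r row \<pi> = (if \<pi> \<in> level_perms r row then 1 else 0)"

definition colsum :: "nat \<Rightarrow> (nat \<Rightarrow> nat) \<Rightarrow> (nat \<Rightarrow> nat) \<Rightarrow> 'a::comm_ring_1" where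
  "colsum r col \<pi> = (if \<pi> \<in> level_perms r col then of_int (sign \<pi>) else 0)"

definition young :: "nat \<Rightarrow> (nat \<Rightarrow> nat) \<Rightarrow> (nat \<Rightarrow> nat) \<Rightarrow> (nat \<Rightarrow> nat) \<Rightarrow> 'a::comm_ring_1" where
  "young r row col = conv r (colsum r col) (rowsum r row)"

lemma rowsum_inv: "\<pi> \<in> perms r \<Longrightarrow> rowsum r row (inv \<pi>) = rowsum r row \<pi>"
  using level_perms_inv[of \<pi> r row] level_perms_inv[of "inv \<pi>" r row]
  by (auto simp: rowsum_def)

lemma colsum_inv: "\<pi> \<in> perms r \<Longrightarrow> colsum r col (inv \<pi>) = colsum r col \<pi>"
  using level_perms_inv[of \<pi> r col] level_perms_inv[of "inv \<pi>" r col]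
  by (auto simp: colsum_def sign_perms_inv)

lemma rowsum_of_int: "rowsum r row = (\<lambda>\<pi>. of_int (rowsum r row \<pi>))"
  by (simp add: rowsum_def fun_eq_iff)

lemma colsum_of_int: "colsum r col = (\<lambda>\<pi>. of_int (colsum r col \<pi>))"
  by (simp add: colsum_def fun_eq_iff)

lemma young_of_int: "young r row col = (\<lambda>\<pi>. of_int (young r row col \<pi>))"
  unfolding young_def by (subst rowsum_of_int, subst colsum_of_int, rule conv_of_int)

lemma rowsum_right: "\<rho> \<in> level_perms r row \<Longrightarrow> \<pi> \<in> perms r \<Longrightarrow> rowsum r row (\<pi> \<circ> \<rho>) = rowsum r row \<pi>"
  by (simp add: rowsum_def level_perms_comp_iff)

lemma colsum_left:
  "\<kappa> \<in> level_perms r col \<Longrightarrow> \<pi> \<in> perms r \<Longrightarrow> colsum r col (\<kappa> \<circ> \<pi>) = of_int (sign \<kappa>) * colsum r col \<pi>"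
  by (auto simp: colsum_def level_perms_comp_iff sign_perms_comp dest: level_permsD)

lemma rowsum_support: "\<pi> \<notin> perms r \<Longrightarrow> rowsum r row \<pi> = 0"
  by (auto simp: rowsum_def level_perms_def)

lemma colsum_support: "\<pi> \<notin> perms r \<Longrightarrow> colsum r col \<pi> = 0"
  by (auto simp: colsum_def level_perms_def)

lemma young_support: "\<pi> \<notin> perms r \<Longrightarrow> young r row col \<pi> = 0"
  unfolding young_def by (rule conv_support) (auto simp: rowsum_support)

lemma rowsum_rowsum:
  "conv r (rowsum r row) (rowsum r row) = (\<lambda>\<pi>. of_nat (card (level_perms r row)) * rowsum r row \<pi>)"
proof
  fix \<pi>
  have "conv r (rowsum r row) (rowsum r row) \<pi> = (\<Sum>\<sigma>\<in>level_perms r row. rowsum r row (inv \<sigma> \<circ> \<pi>) :: 'a)"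
    unfolding conv_def
    by (rule sum.mono_neutral_cong_right) (auto simp: rowsum_def dest: level_permsD)
  also have "\<dots> = (\<Sum>\<sigma>\<in>level_perms r row. rowsum r row \<pi>)"
  proof (rule sum.cong[OF refl])
    fix \<sigma> assume s: "\<sigma> \<in> level_perms r row"
    show "rowsum r row (inv \<sigma> \<circ> \<pi>) = (rowsum r row \<pi> :: 'a)"
      using level_perms_comp[OF s, of "inv \<sigma> \<circ> \<pi>"] level_perms_comp[OF level_perms_inv[OF s], of \<pi>]
        perms_inv_comp_assoc(2)[OF level_permsD(1)[OF s], of \<pi>] by (auto simp: rowsum_def)
  qed
  finally show "conv r (rowsum r row) (rowsum r row) \<pi> = of_nat (card (level_perms r row)) * (rowsum r row \<pi> :: 'a)"
    by simp
qed

lemma colsum_colsum: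
  "conv r (colsum r col) (colsum r col) = (\<lambda>\<pi>. of_nat (card (level_perms r col)) * colsum r col \<pi>)"
proof
  fix \<pi>
  have "conv r (colsum r col) (colsum r col) \<pi> =
      (\<Sum>\<sigma>\<in>level_perms r col. of_int (sign \<sigma>) * colsum r col (inv \<sigma> \<circ> \<pi>) :: 'a)"
    unfolding conv_def
    by (rule sum.mono_neutral_cong_right) (auto simp: colsum_def dest: level_permsD)
  also have "\<dots> = (\<Sum>\<sigma>\<in>level_perms r col. colsum r col \<pi>)"
  proof (rule sum.cong[OF refl])
    fix \<sigma> assume s: "\<sigma> \<in> level_perms r col"
    show "of_int (sign \<sigma>) * colsum r col (inv \<sigma> \<circ> \<pi>) = (colsum r col \<pi> :: 'a)"
    proof (cases "\<pi> \<in> perms r")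
      case True
      then show ?thesis
        using colsum_left[OF s perms_compose[OF perms_inv[OF level_permsD(1)[OF s]] True], where 'a = 'a]
        by (simp add: perms_inv_comp_assoc[OF level_permsD(1)[OF s]])
    next
      case False
      then have "inv \<sigma> \<circ> \<pi> \<notin> perms r"
        using perms_compose[OF level_permsD(1)[OF s], of "inv \<sigma> \<circ> \<pi>"]
          perms_inv_comp_assoc(2)[OF level_permsD(1)[OF s], of \<pi>] by metis
      then show ?thesis by (simp only: colsum_support False mult_zero_right not_False_eq_True)
    qed
  qed
  finally show "conv r (colsum r col) (colsum r col) \<pi> = of_nat (card (level_perms r col)) * (colsum r col \<pi> :: 'a)"
    by simp
qed

lemma young_left:
  assumes "\<kappa> \<in> level_perms r col"
  shows "conv r (young r row col) h (\<kappa> \<circ> \<pi>) = of_int (sign \<kappa>) * conv r (young r row col) h \<pi>"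
proof -
  have k: "\<kappa> \<in> perms r" using assms by (rule level_permsD)
  have *: "conv r (colsum r col) g (\<kappa> \<circ> \<pi>) = of_int (sign \<kappa>) * conv r (colsum r col) g \<pi>" for g :: "(nat \<Rightarrow> nat) \<Rightarrow> 'a"
    unfolding conv_def
    by (subst sum_perms_left[OF k, symmetric], unfold sum_distrib_left, rule sum.cong[OF refl])
      (simp add: perms_inv_comp_assoc[OF k] colsum_left[OF assms] perms_inv_of_comp[OF k] o_assoc[symmetric] mult.assoc)
  show ?thesis unfolding young_def conv_assoc by (rule *)
qed

lemma young_right:
  assumes "\<rho> \<in> level_perms r row" "\<pi> \<in> perms r"
  shows "conv r h (young r row col) (\<pi> \<circ> \<rho>) = conv r h (young r row col) \<pi>"
proof -
  have *: "conv r g (rowsum r row) (\<pi> \<circ> \<rho>) = conv r g (rowsum r row) \<pi>" for g :: "(nat \<Rightarrow> nat) \<Rightarrow> 'a"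
    unfolding conv_def o_assoc
    by (intro sum.cong refl arg_cong2[where f = "(*)"]) (simp add: rowsum_right assms)
  show ?thesis unfolding young_def conv_assoc[symmetric] by (rule *)
qed

text \<open>A tableau seen from its positions: \<open>row t\<close> and \<open>col t\<close> locate
  the box of position \<open>t\<close>, and \<open>down\<close> closes the set of boxes towards the
  corner. The axioms are symmetric in \<open>row\<close> and \<open>col\<close>, which makes
  transposition available.\<close>

locale young_shape =
  fixes r :: nat and row col :: "nat \<Rightarrow> nat"
  assumes pos: "t \<in> {1..r} \<Longrightarrow> 1 \<le> row t \<and> 1 \<le> col t"
    and box_inj: "s \<in> {1..r} \<Longrightarrow> t \<in> {1..r} \<Longrightarrow> row s = row t \<Longrightarrow> col s = col t \<Longrightarrow> s = t"
    and down: "t \<in> {1..r} \<Longrightarrow> 1 \<le> a \<Longrightarrow> a \<le> row t \<Longrightarrow> 1 \<le> b \<Longrightarrow> b \<le> col t \<Longrightarrow>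
      \<exists>s\<in>{1..r}. row s = a \<and> col s = b"
begin

lemma transposed: "young_shape r col row"
proof
  show "1 \<le> col t \<and> 1 \<le> row t" if "t \<in> {1..r}" for t using pos[OF that] by simp
  show "s = t" if "s \<in> {1..r}" "t \<in> {1..r}" "col s = col t" "row s = row t" for s t
    using box_inj that by simp
  show "\<exists>s\<in>{1..r}. col s = a \<and> row s = b"
    if "t \<in> {1..r}" "1 \<le> a" "a \<le> col t" "1 \<le> b" "b \<le> row t" for t a b
    using down[of t b a] that by auto
qed

lemma row_col_inter:
  assumes "\<pi> \<in> level_perms r row" "\<pi> \<in> level_perms r col"
  shows "\<pi> = id"
proof
  fix t
  show "\<pi> t = id t"
  proof (cases "t \<in> {1..r}")
    case True
    then show ?thesis using box_inj[of "\<pi> t" t] level_permsD[OF assms(1)] level_permsD[OF assms(2)]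
        perms_in[OF level_permsD(1)[OF assms(1)]] by auto
  next
    case False
    then show ?thesis using level_permsD(1)[OF assms(1)] by (auto simp: perms_def dest: permutes_not_in)
  qed
qed

text \<open>Row and column group meet trivially, so a single term of the convolution
  survives.\<close>

lemma young_id: "young r row col id = 1"
proof -
  have "young r row col id = (\<Sum>\<sigma>\<in>perms r. colsum r col \<sigma> * rowsum r row \<sigma> :: 'a)"
    unfolding young_def conv_def by (intro sum.cong refl) (simp add: rowsum_inv)
  also have "\<dots> = (\<Sum>\<sigma>\<in>{id}. colsum r col \<sigma> * rowsum r row \<sigma> :: 'a)"
    by (rule sum.mono_neutral_right) (auto simp: colsum_def rowsum_def dest: row_col_inter)
  also have "\<dots> = 1" by (simp add: colsum_def rowsum_def)
  finally show ?thesis .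
qed

text \<open>Extremal choice: take the column permutation \<open>\<kappa>\<close> that maximizes the
  scalar product \<open>\<Psi>\<close> of the row numbers before and after. If
  \<open>\<kappa> \<circ> \<pi>\<close> still changed a row, one more swap inside a column would
  raise \<open>\<Psi>\<close>, as in the rearrangement inequality.\<close>

lemma row_col_factor:
  assumes p: "\<pi> \<in> perms r"
    and sep: "\<And>s t. s \<in> {1..r} \<Longrightarrow> t \<in> {1..r} \<Longrightarrow> s \<noteq> t \<Longrightarrow> row s = row t \<Longrightarrow> col (\<pi> s) \<noteq> col (\<pi> t)"
  shows "\<exists>\<kappa>\<in>level_perms r col. \<kappa> \<circ> \<pi> \<in> level_perms r row"
proof -
  define \<Psi> where "\<Psi> \<kappa> = (\<Sum>x\<in>{1..r}. row x * row (\<kappa> (\<pi> x)))" for \<kappa>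
  have "finite (\<Psi> ` level_perms r col)" "\<Psi> ` level_perms r col \<noteq> {}" using id_level_perms[of r col] by (simp, blast)
  then obtain \<kappa> where k: "\<kappa> \<in> level_perms r col" and max: "\<And>\<kappa>'. \<kappa>' \<in> level_perms r col \<Longrightarrow> \<Psi> \<kappa>' \<le> \<Psi> \<kappa>"
    using Max_in[of "\<Psi> ` level_perms r col"] Max_ge[of "\<Psi> ` level_perms r col"] by (metis image_iff)
  define q where "q = \<kappa> \<circ> \<pi>"
  have q: "q \<in> perms r" unfolding q_def using perms_compose[OF level_permsD(1)[OF k] p] .
  have qsep: "col (q s) \<noteq> col (q t)" if "s \<in> {1..r}" "t \<in> {1..r}" "s \<noteq> t" "row s = row t" for s t
    using sep[OF that] level_permsD(2)[OF k] perms_in[OF p] that unfolding q_def o_def by metis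
  have "row (q x) = row x" if x: "x \<in> {1..r}" for x
  proof (rule ccontr)
    assume viol: "row (q x) \<noteq> row x"
    define B where "B = {x\<in>{1..r}. row (q x) \<noteq> row x}"
    \<comment> \<open>The topmost row that is not preserved.\<close>
    define a where "a = Min (row ` B)"
    have B: "finite B" "x \<in> B" using x viol by (auto simp: B_def)
    then have "a \<in> row ` B" unfolding a_def by (intro Min_in) auto
    then obtain s where s: "s \<in> {1..r}" "row s = a" "row (q s) \<noteq> a" by (auto simp: B_def)
    have amin: "a \<le> row y" if "y \<in> {1..r}" "row (q y) \<noteq> row y" for y
      unfolding a_def using that B by (intro Min_le) (auto simp: B_def)
    have qs: "q s \<in> {1..r}" using perms_in[OF q] s by blast
    \<comment> \<open>Each row above \<open>a\<close> is mapped into itself, hence onto itself by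
      finiteness, so no position of row \<open>a\<close> can land there.\<close>
    have "a < row (q s)"
    proof (rule ccontr)
      assume "\<not> a < row (q s)"
      then have lt: "row (q s) < a" using s by simp
      define X where "X = {y\<in>{1..r}. row y = row (q s)}"
      have "row (q y) = row y" if "y \<in> X" for y
        using amin[of y] that lt by (auto simp: X_def)
      then have "q ` X \<subseteq> X" using perms_in[OF q] unfolding X_def by auto
      moreover have "finite X" "inj_on q X" using perms_inj[OF q] by (auto simp: X_def inj_on_def)
      ultimately have "q ` X = X" using endo_inj_surj[of X q] by blast
      moreover have "q s \<in> X" using qs by (simp add: X_def)
      ultimately obtain y where "y \<in> X" "q y = q s" by (metis imageE)
      then have "y = s" using perms_inj[OF q] by blast
      then show False using \<open>y \<in> X\<close> lt s by (simp add: X_def)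
    qed
    then obtain u where u: "u \<in> {1..r}" "row u = a" "col u = col (q s)"
      using down[OF qs, of a "col (q s)"] pos[OF qs] pos[OF s(1)] s by auto
    \<comment> \<open>The preimage \<open>s'\<close> of \<open>u\<close> is not in row
      \<open>a\<close>, because \<open>q\<close> separates the columns of positions in one row. So
      \<open>s'\<close> and \<open>q s\<close> both lie below row \<open>a\<close>, and exchanging
      the values \<open>u\<close> and \<open>q s\<close> raises \<open>\<Psi>\<close> by
      \<open>(row s' - a) * (row (q s) - a)\<close>.\<close>
    define s' where "s' = inv q u"
    have qs': "q s' = u" unfolding s'_def using q by simp
    have s': "s' \<in> {1..r}" using perms_in[OF q, of s'] qs' u by simp
    have "s' \<noteq> s" using qs' u s by auto
    then have ne: "row s' \<noteq> a" using qsep[OF s' s(1)] qs' u s by auto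
    then have "a < row s'" using amin[OF s'] qs' u by auto
    define \<kappa>' where "\<kappa>' = transpose u (q s) \<circ> \<kappa>"
    have k': "\<kappa>' \<in> level_perms r col" unfolding \<kappa>'_def
      by (intro level_perms_comp k transpose_level_perms u qs)
    have val: "\<kappa>' (\<pi> y) = (if y = s then u else if y = s' then q s else q y)" for y
    proof -
      have "q y = u \<longleftrightarrow> y = s'" "q y = q s \<longleftrightarrow> y = s" using qs' perms_inj[OF q] by auto
      then show ?thesis unfolding \<kappa>'_def using qs' \<open>s' \<noteq> s\<close>
        by (auto simp: transpose_def q_def[unfolded o_def fun_eq_iff, rule_format, symmetric])
    qed
    have split: "(\<Sum>x\<in>{1..r}. f x) = f s + f s' + (\<Sum>x\<in>{1..r}-{s,s'}. f x)" for f :: "nat \<Rightarrow> nat"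
      using s(1) s' \<open>s' \<noteq> s\<close> sum.remove[of "{1..r}" s f] sum.remove[of "{1..r} - {s}" s' f]
      by (simp add: Diff_insert[symmetric] insert_commute)
    have "\<Psi> \<kappa>' = a * a + row s' * row (q s) + (\<Sum>x\<in>{1..r}-{s,s'}. row x * row (q x))"
      unfolding \<Psi>_def split val using s s' u \<open>s' \<noteq> s\<close> by (auto intro!: sum.cong)
    moreover have "\<Psi> \<kappa> = a * row (q s) + row s' * a + (\<Sum>x\<in>{1..r}-{s,s'}. row x * row (q x))"
      unfolding \<Psi>_def split using s s' u qs' by (simp add: q_def)
    moreover have "a * row (q s) + row s' * a < a * a + row s' * row (q s)"
    proof -
      obtain d e where "row (q s) = a + Suc d" "row s' = a + Suc e"
        using \<open>a < row (q s)\<close> \<open>a < row s'\<close> by (metis less_imp_Suc_add add_Suc_right)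
      then show ?thesis by (simp add: algebra_simps)
    qed
    ultimately have "\<Psi> \<kappa> < \<Psi> \<kappa>'" by linarith
    then show False using max[OF k'] by simp
  qed
  then have "q \<in> level_perms r row" using q by (simp add: level_perms_def)
  then show ?thesis using k unfolding q_def by (rule bexI)
qed

text \<open>For \<open>\<pi>\<close> outside the products of column and row permutations, some pair in a common row is
  moved to a common column, and the two transpositions force the value at \<open>\<pi>\<close> to be its own
  negative.\<close>

lemma young_unique:
  fixes g :: "(nat \<Rightarrow> nat) \<Rightarrow> 'a::{idom, ring_char_0}"
  assumes left: "\<And>\<kappa> \<pi>. \<kappa> \<in> level_perms r col \<Longrightarrow> \<pi> \<in> perms r \<Longrightarrow> g (\<kappa> \<circ> \<pi>) = of_int (sign \<kappa>) * g \<pi>"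
    and right: "\<And>\<rho> \<pi>. \<rho> \<in> level_perms r row \<Longrightarrow> \<pi> \<in> perms r \<Longrightarrow> g (\<pi> \<circ> \<rho>) = g \<pi>"
    and p: "\<pi> \<in> perms r"
  shows "g \<pi> = g id * young r row col \<pi>"
proof -
  have aux: "h \<pi> = 0"
    if left: "\<And>\<kappa> \<pi>. \<kappa> \<in> level_perms r col \<Longrightarrow> \<pi> \<in> perms r \<Longrightarrow> h (\<kappa> \<circ> \<pi>) = of_int (sign \<kappa>) * h \<pi>"
    and right: "\<And>\<rho> \<pi>. \<rho> \<in> level_perms r row \<Longrightarrow> \<pi> \<in> perms r \<Longrightarrow> h (\<pi> \<circ> \<rho>) = h \<pi>"
    and zero: "h id = 0" for h :: "(nat \<Rightarrow> nat) \<Rightarrow> 'a"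
  proof (cases "\<exists>s\<in>{1..r}. \<exists>t\<in>{1..r}. s \<noteq> t \<and> row s = row t \<and> col (\<pi> s) = col (\<pi> t)")
    case True
    then obtain s t where st: "s \<in> {1..r}" "t \<in> {1..r}" "s \<noteq> t" "row s = row t" "col (\<pi> s) = col (\<pi> t)"
      by blast
    have pst: "\<pi> s \<in> {1..r}" "\<pi> t \<in> {1..r}" "\<pi> s \<noteq> \<pi> t"
      using perms_in[OF p] perms_inj[OF p] st by auto
    have eq: "transpose (\<pi> s) (\<pi> t) \<circ> (\<pi> \<circ> transpose s t) = \<pi>"
      using st perms_inj[OF p] by (auto simp: fun_eq_iff transpose_def)
    have "h \<pi> = h (transpose (\<pi> s) (\<pi> t) \<circ> (\<pi> \<circ> transpose s t))" by (simp only: eq)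
    also have "\<dots> = of_int (sign (transpose (\<pi> s) (\<pi> t))) * h (\<pi> \<circ> transpose s t)"
      using st pst p by (intro left transpose_level_perms perms_compose transpose_perms)
    also have "\<dots> = - h \<pi>"
      unfolding right[OF transpose_level_perms[OF st(1,2,4)] p] using pst(3) by (simp add: sign_swap_id)
    finally have "h \<pi> = - h \<pi>" .
    then have "2 * h \<pi> = 0" by (metis add.right_inverse mult_2)
    then show ?thesis by simp
  next
    case False
    then obtain \<kappa> where k: "\<kappa> \<in> level_perms r col" "\<kappa> \<circ> \<pi> \<in> level_perms r row"
      using row_col_factor[OF p] by blast
    have "of_int (sign \<kappa>) * h \<pi> = h (id \<circ> (\<kappa> \<circ> \<pi>))" using left[OF k(1) p] by simp
    also have "\<dots> = 0" using right[OF k(2), of id] zero by simp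
    finally show ?thesis by (simp add: sign_def split: if_splits)
  qed
  have y1: "young r row col (\<kappa> \<circ> \<pi>) = of_int (sign \<kappa>) * (young r row col \<pi> :: 'a)"
    if "\<kappa> \<in> level_perms r col" "\<pi> \<in> perms r" for \<kappa> \<pi>
    using young_left[OF that(1), of row "delta id :: _ \<Rightarrow> 'a" \<pi>] conv_delta_right[of id r _ "young r row col :: _ \<Rightarrow> 'a"] that
      perms_compose[OF level_permsD(1)[OF that(1)] that(2)] by simp
  have y2: "young r row col (\<pi> \<circ> \<rho>) = (young r row col \<pi> :: 'a)"
    if "\<rho> \<in> level_perms r row" "\<pi> \<in> perms r" for \<rho> \<pi>
    using young_right[OF that, of "delta id :: _ \<Rightarrow> 'a" col] conv_delta_left[of id r "young r row col :: _ \<Rightarrow> 'a"] that by simp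
  \<comment> \<open>The difference inherits both symmetries and vanishes at the identity.\<close>
  have "g \<pi> - g id * young r row col \<pi> = 0"
    by (rule aux[of "\<lambda>\<pi>. g \<pi> - g id * young r row col \<pi>"]) (simp_all add: left right y1 y2 young_id right_diff_distrib mult.left_commute)
  then show ?thesis by simp
qed

text \<open>Whatever \<open>g\<close> is, the product is column antisymmetric on the left and row
  invariant on the right, so uniqueness makes it a multiple of the Young symmetrizer; the factor is
  read off at the identity.\<close>

lemma young_sandwich_aux:
  fixes g :: "(nat \<Rightarrow> nat) \<Rightarrow> 'a::{idom, ring_char_0}"
  shows "conv r (young r row col) (conv r g (young r row col)) \<pi> =
    conv r (young r row col) (conv r g (young r row col)) id * young r row col \<pi>"
proof (cases "\<pi> \<in> perms r")
  case True
  then show ?thesis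
    using young_right[of _ r row _ "conv r (young r row col) g" col]
    by (intro young_unique) (simp_all only: young_left conv_assoc)
next
  case False
  then show ?thesis
    by (simp only: young_support mult_zero_right conv_support not_False_eq_True)
qed

text \<open>Classically the product of the hook lengths. It is taken over the integers so that sums
  of squares can be used; \<open>of_int\<close> carries it to any field of characteristic
  zero.\<close>

definition hook_const :: int where
  "hook_const = conv r (young r row col) (young r row col) id"

lemma young_idem:
  "conv r (young r row col) (young r row col) \<pi> = of_int hook_const * (young r row col \<pi> :: 'a::{idom, ring_char_0})"
proof -
  have "conv r (young r row col) (young r row col) \<pi> = hook_const * young r row col \<pi>"
  proof (cases "\<pi> \<in> perms r")
    case True
    then show ?thesis unfolding hook_const_def
      by (intro young_unique) (simp_all only: young_left young_right)
  next
    case False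
    then show ?thesis by (simp only: young_support mult_zero_right conv_support not_False_eq_True)
  qed
  then have "of_int (conv r (young r row col) (young r row col) \<pi>) = of_int hook_const * (of_int (young r row col \<pi>) :: 'a)"
    by simp
  then show ?thesis by (simp add: young_of_int[where 'a = 'a] conv_of_int)
qed

text \<open>With the involution \<open>\<pi> \<mapsto> \<pi>\<^sup>-\<^sup>1\<close>, both \<open>c\<^sup>- r c\<^sup>-\<close> and \<open>c\<^sup>- r (c\<^sup>- r)\<^sup>*\<close> are nonzero because the coefficient of
  the identity in \<open>x x\<^sup>*\<close> is a sum of squares.\<close>

lemma hook_const_nonzero: "hook_const \<noteq> 0"
proof
  assume c0: "hook_const = 0"
  let ?C = "colsum r col :: _ \<Rightarrow> int" and ?R = "rowsum r row :: _ \<Rightarrow> int" and ?Y = "young r row col :: _ \<Rightarrow> int"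
  have sq: "conv r g (\<lambda>\<sigma>. g (inv \<sigma>)) id = (\<Sum>\<sigma>\<in>perms r. g \<sigma> * g \<sigma>)" for g :: "_ \<Rightarrow> int"
    unfolding conv_def by (intro sum.cong refl) simp
  have invC: "(\<lambda>\<sigma>. ?C (inv \<sigma>)) \<sigma> = ?C \<sigma>" "(\<lambda>\<sigma>. ?R (inv \<sigma>)) \<sigma> = ?R \<sigma>" if "\<sigma> \<in> perms r" for \<sigma>
    using that colsum_inv rowsum_inv by auto
  define Z where "Z = conv r ?Y ?C"
  have invY: "?Y (inv \<pi>) = conv r ?R ?C \<pi>" if "\<pi> \<in> perms r" for \<pi>
    unfolding young_def conv_inv[OF that] by (intro conv_cong invC that)
  have Zinv: "Z (inv \<pi>) = Z \<pi>" if "\<pi> \<in> perms r" for \<pi>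
    unfolding Z_def conv_inv[OF that]
    by (subst conv_cong[OF invC(1) invY that]) (auto simp: young_def conv_assoc)
  \<comment> \<open>The square of the column sum \<open>C\<close> is a multiple of \<open>C\<close>,
    so the square of \<open>Z = C R C\<close> is a multiple of \<open>Y Y C\<close>, which vanishes
    by assumption.\<close>
  have "conv r Z Z = conv r ?Y (conv r (conv r ?C ?C) (conv r ?R ?C))"
    by (simp add: Z_def young_def conv_assoc)
  also have "\<dots> = (\<lambda>\<pi>. of_nat (card (level_perms r col)) * conv r (conv r ?Y ?Y) ?C \<pi>)"
    by (simp add: colsum_colsum conv_scale_left conv_scale_right young_def conv_assoc)
  also have "\<dots> = (\<lambda>\<pi>. 0)"
    using young_idem[where 'a = int] c0 by (simp add: conv_def)
  finally have "(\<Sum>\<sigma>\<in>perms r. Z \<sigma> * Z \<sigma>) = 0"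
    using sq[of Z] conv_cong[of r Z Z "\<lambda>\<sigma>. Z (inv \<sigma>)" Z id] Zinv by simp
  then have Z0: "Z \<sigma> = 0" if "\<sigma> \<in> perms r" for \<sigma>
    using that by (simp add: sum_nonneg_eq_0_iff)
  \<comment> \<open>Inversion turns \<open>Y = C R\<close> into \<open>R C\<close>, and
    \<open>C R R C\<close> is a multiple of \<open>Z\<close>.\<close>
  have "(\<Sum>\<sigma>\<in>perms r. ?Y \<sigma> * ?Y \<sigma>) = conv r ?Y (conv r ?R ?C) id"
    unfolding sq[symmetric] by (rule conv_cong) (auto simp: invY)
  also have "conv r ?Y (conv r ?R ?C) = conv r ?C (conv r (conv r ?R ?R) ?C)"
    by (simp add: young_def conv_assoc)
  also have "\<dots> id = of_nat (card (level_perms r row)) * Z id"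
    by (simp add: rowsum_rowsum conv_scale_left conv_scale_right Z_def young_def conv_assoc)
  also have "\<dots> = 0" by (simp add: Z0)
  finally have "?Y \<sigma> = 0" if "\<sigma> \<in> perms r" for \<sigma>
    using that by (simp add: sum_nonneg_eq_0_iff)
  from this[of id] show False by (simp add: young_id)
qed

text \<open>The value at the identity behaves like a trace: rotating the last factor to the front
  turns \<open>Y \<pi> Y\<close> into \<open>Y Y \<pi>\<close>, whose value at the identity is that
  of \<open>Y Y\<close> at \<open>inv \<pi>\<close>.\<close>

lemma young_sandwich:
  fixes \<sigma> \<pi> :: "nat \<Rightarrow> nat"
  assumes "\<pi> \<in> perms r"
  shows "conv r (young r row col) (conv r (delta \<pi>) (young r row col)) =
    (\<lambda>\<sigma>. of_int hook_const * young r row col (inv \<pi>) * (young r row col \<sigma> :: 'a::{idom, ring_char_0}))"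
proof
  fix \<sigma>
  let ?Y = "young r row col :: _ \<Rightarrow> 'a"
  have "conv r ?Y (conv r (delta \<pi>) ?Y) id = (\<Sum>\<sigma>\<in>perms r. ?Y \<sigma> * ?Y (inv \<pi> \<circ> inv \<sigma>))"
    unfolding conv_def[of r ?Y] by (simp add: conv_delta_left[OF assms])
  also have "\<dots> = (\<Sum>\<sigma>\<in>perms r. ?Y (inv \<pi> \<circ> inv \<sigma>) * ?Y \<sigma>)" by (simp add: mult.commute)
  also have "\<dots> = (\<Sum>\<sigma>\<in>perms r. ?Y (inv \<pi> \<circ> inv (\<sigma> \<circ> inv \<pi>)) * ?Y (\<sigma> \<circ> inv \<pi>))"
    by (rule sum_perms_right[OF perms_inv[OF assms], symmetric])
  also have "\<dots> = (\<Sum>\<sigma>\<in>perms r. ?Y (inv \<sigma>) * ?Y (inv (inv \<sigma>) \<circ> inv \<pi>))"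
    by (intro sum.cong refl)
      (simp add: perms_inv_of_comp[OF _ perms_inv[OF assms]] perms_inv_comp[OF assms] perms_inv_comp_assoc[OF assms])
  also have "\<dots> = conv r ?Y ?Y (inv \<pi>)"
    unfolding conv_def by (rule sum_perms_inv)
  finally show "conv r ?Y (conv r (delta \<pi>) ?Y) \<sigma> = of_int hook_const * ?Y (inv \<pi>) * ?Y \<sigma>"
    by (subst young_sandwich_aux) (simp add: young_idem)
qed

end

section \<open>Rearrangements along columns\<close>

definition csorted :: "nat \<Rightarrow> (nat \<Rightarrow> nat) \<Rightarrow> (nat \<Rightarrow> nat) \<Rightarrow> (nat \<Rightarrow> nat) \<Rightarrow> bool" where
  "csorted r row col j \<longleftrightarrow> (\<forall>s\<in>{1..r}. \<forall>t\<in>{1..r}. col s = col t \<and> row s < row t \<longrightarrow> j s \<le> j t)"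

text \<open>A potential: constant under permutations that preserve the levels of \<open>f\<close>,
  and raised by every swap that moves a larger entry to where \<open>f\<close> is larger. With
  \<open>row\<close> it orders multiindices for triangularity, with \<open>col\<close> it drives
  straightening.\<close>

definition pairing :: "nat \<Rightarrow> (nat \<Rightarrow> nat) \<Rightarrow> (nat \<Rightarrow> nat) \<Rightarrow> nat" where
  "pairing r f j = (\<Sum>t\<in>{1..r}. f t * j t)"

lemma pairing_swap_less:
  assumes st: "s \<in> {1..r}" "t \<in> {1..r}" and lt: "f s < f t" "j t < j s"
  shows "pairing r f j < pairing r f (j \<circ> transpose s t)"
proof -
  have ne: "s \<noteq> t" using lt by auto
  have split: "(\<Sum>x\<in>{1..r}. g x) = g s + g t + (\<Sum>x\<in>{1..r}-{s,t}. g x)" for g :: "nat \<Rightarrow> nat"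
    using st ne sum.remove[of "{1..r}" s g] sum.remove[of "{1..r} - {s}" t g]
    by (simp add: Diff_insert[symmetric] insert_commute)
  have rest: "(\<Sum>x\<in>{1..r}-{s,t}. f x * (j \<circ> transpose s t) x) = (\<Sum>x\<in>{1..r}-{s,t}. f x * j x)"
    by (intro sum.cong) auto
  obtain d e where "f t = f s + Suc d" "j s = j t + Suc e"
    using lt by (metis less_imp_Suc_add add_Suc_right)
  then show ?thesis unfolding pairing_def split rest by (simp add: algebra_simps)
qed

lemma pairing_level_perm:
  assumes "\<rho> \<in> level_perms r f"
  shows "pairing r f (j \<circ> \<rho>) = pairing r f j"
proof -
  have "bij_betw \<rho> {1..r} {1..r}"
    using level_permsD(1)[OF assms] by (auto simp: perms_def permutes_imp_bij)
  from sum.reindex_bij_betw[OF this, of "\<lambda>t. f t * j t"] show ?thesis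
    unfolding pairing_def using level_permsD(2)[OF assms] by simp
qed

context young_shape
begin

text \<open>Counting in the column of \<open>t\<close>: if \<open>j (\<kappa> t) < j t\<close>, then
  only boxes strictly above \<open>t\<close> can carry an entry of \<open>j\<close> bounded by
  \<open>j (\<kappa> t)\<close>, whereas \<open>j \<circ> \<kappa>\<close> has such entries at
  \<open>t\<close> and at all boxes above it. But \<open>\<kappa>\<close> maps the second set
  injectively into the first.\<close>

lemma csorted_unique_aux:
  assumes k: "\<kappa> \<in> level_perms r col" and sj: "csorted r row col j" and si: "csorted r row col (j \<circ> \<kappa>)"
    and t: "t \<in> {1..r}"
  shows "j t \<le> (j \<circ> \<kappa>) t"
proof (rule ccontr)
  assume "\<not> j t \<le> (j \<circ> \<kappa>) t"
  then have lt: "j (\<kappa> t) < j t" by simp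
  let ?X = "{x\<in>{1..r}. col x = col t}"
  let ?A = "{x\<in>?X. j (\<kappa> x) \<le> j (\<kappa> t)}" and ?B = "{x\<in>?X. j x \<le> j (\<kappa> t)}"
  have kp: "\<kappa> \<in> perms r" using k by (rule level_permsD)
  have "\<kappa> x \<in> ?B" if "x \<in> ?A" for x
    using that level_permsD(2)[OF k, of x] perms_in[OF kp, of x] by simp
  then have "\<kappa> ` ?A \<subseteq> ?B" by blast
  moreover have "inj_on \<kappa> ?A" using perms_inj[OF kp] by (auto simp: inj_on_def)
  ultimately have 1: "card ?A \<le> card ?B" by (intro card_inj_on_le) auto
  have "x \<in> {x\<in>?X. row x < row t}" if x: "x \<in> ?B" for x
  proof -
    have "j x < j t" using lt x by simp
    then have "x \<noteq> t" "\<not> row t < row x" using sj t x unfolding csorted_def by (auto simp: not_less[symmetric])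
    then show ?thesis using x box_inj[of x t] t by (auto simp: linorder_not_less le_less)
  qed
  then have 2: "card ?B \<le> card {x\<in>?X. row x < row t}" by (intro card_mono) auto
  have "insert t {x\<in>?X. row x < row t} \<subseteq> ?A" using si t unfolding csorted_def by auto
  then have "card (insert t {x\<in>?X. row x < row t}) \<le> card ?A" by (intro card_mono) auto
  with 1 2 show False by simp
qed

lemma csorted_unique:
  assumes k: "\<kappa> \<in> level_perms r col" and sj: "csorted r row col j" and si: "csorted r row col (j \<circ> \<kappa>)"
  shows "j \<circ> \<kappa> = j"
proof
  fix t
  have kp: "\<kappa> \<in> perms r" using k by (rule level_permsD)
  have "(j \<circ> \<kappa>) \<circ> inv \<kappa> = j" using kp by simp
  then have "(j \<circ> \<kappa>) t \<le> j t" if "t \<in> {1..r}"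
    using csorted_unique_aux[OF level_perms_inv[OF k] si _ that] sj by simp
  then show "(j \<circ> \<kappa>) t = j t"
    using csorted_unique_aux[OF k sj si, of t] kp
    by (cases "t \<in> {1..r}") (auto simp: perms_def dest: permutes_not_in)
qed

lemma csorted_exists:
  obtains \<kappa> where "\<kappa> \<in> level_perms r col" "csorted r row col (j \<circ> \<kappa>)"
    "\<And>\<kappa>'. \<kappa>' \<in> level_perms r col \<Longrightarrow> pairing r row (j \<circ> \<kappa>') \<le> pairing r row (j \<circ> \<kappa>)"
proof -
  let ?P = "(\<lambda>\<kappa>. pairing r row (j \<circ> \<kappa>)) ` level_perms r col"
  have "finite ?P" "?P \<noteq> {}" using id_level_perms[of r col] by (simp, blast)
  then have "Max ?P \<in> ?P" by (rule Max_in)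
  then obtain \<kappa> where k: "\<kappa> \<in> level_perms r col" and M: "Max ?P = pairing r row (j \<circ> \<kappa>)" by blast
  have max: "pairing r row (j \<circ> \<kappa>') \<le> pairing r row (j \<circ> \<kappa>)" if "\<kappa>' \<in> level_perms r col" for \<kappa>'
    unfolding M[symmetric] using that by (intro Max_ge) auto
  have "csorted r row col (j \<circ> \<kappa>)"
    unfolding csorted_def
  proof (intro ballI impI, rule ccontr)
    fix s t assume st: "s \<in> {1..r}" "t \<in> {1..r}" "col s = col t \<and> row s < row t"
      and "\<not> (j \<circ> \<kappa>) s \<le> (j \<circ> \<kappa>) t"
    then have "pairing r row (j \<circ> \<kappa>) < pairing r row (j \<circ> \<kappa> \<circ> transpose s t)"
      by (intro pairing_swap_less) auto
    moreover have "\<kappa> \<circ> transpose s t \<in> level_perms r col"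
      using st by (intro level_perms_comp k transpose_level_perms) auto
    ultimately show False using max by (fastforce simp: o_assoc)
  qed
  with k max show ?thesis using that by blast
qed

text \<open>An arrangement of maximal pairing is sorted, hence equals \<open>j\<close> by
  uniqueness; an unsorted one is improved by a single swap.\<close>

lemma pairing_csorted:
  assumes k: "\<kappa> \<in> level_perms r col" and sj: "csorted r row col j"
  shows "j \<circ> \<kappa> = j \<or> pairing r row (j \<circ> \<kappa>) < pairing r row j"
proof -
  have less: "j \<circ> \<tau> = j" if "\<tau> \<in> level_perms r col" "csorted r row col (j \<circ> \<tau>)" for \<tau>
    using csorted_unique[OF that(1) sj that(2)] .
  obtain \<tau> where "\<tau> \<in> level_perms r col" "csorted r row col (j \<circ> \<tau>)" and
    max: "\<And>\<kappa>'. \<kappa>' \<in> level_perms r col \<Longrightarrow> pairing r row (j \<circ> \<kappa>') \<le> pairing r row (j \<circ> \<tau>)"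
    using csorted_exists[of j] by blast
  then have jt: "j \<circ> \<tau> = j" using less by blast
  show ?thesis
  proof (cases "csorted r row col (j \<circ> \<kappa>)")
    case True
    then show ?thesis using less k by blast
  next
    case False
    then obtain s t where st: "s \<in> {1..r}" "t \<in> {1..r}" "col s = col t" "row s < row t"
      "(j \<circ> \<kappa>) t < (j \<circ> \<kappa>) s" unfolding csorted_def by (auto simp: not_le)
    then have "pairing r row (j \<circ> \<kappa>) < pairing r row (j \<circ> \<kappa> \<circ> transpose s t)"
      by (intro pairing_swap_less) auto
    also have "\<dots> \<le> pairing r row j"
      using max[of "\<kappa> \<circ> transpose s t"] st jt
      by (simp add: o_assoc level_perms_comp[OF k] transpose_level_perms)
    finally show ?thesis ..
  qed
qed

end

section \<open>Signed actions on multiindices\<close>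

lemma multiindices_comp [simp]:
  assumes "i \<in> multiindices m n r" "\<pi> \<in> perms r"
  shows "i \<circ> \<pi> \<in> multiindices m n r"
proof -
  have "\<pi> x \<notin> {1..r}" if "x \<notin> {1..r}" for x using perms_in[OF assms(2), of x] that by blast
  moreover have "\<pi> x \<in> {1..r}" if "x \<in> {1..r}" for x using perms_in[OF assms(2), of x] that by blast
  ultimately show ?thesis using assms(1) unfolding multiindices_def
    by (intro PiE_I) (auto simp: PiE_def extensional_def Pi_def simp del: atLeastAtMost_iff)
qed

lemma finite_multiindices [simp]: "finite (multiindices m n r)"
  unfolding multiindices_def by (intro finite_PiE) auto

lemma sum_multiindices_perm:
  assumes "\<pi> \<in> perms r"
  shows "(\<Sum>a\<in>multiindices m n r. f (a \<circ> \<pi>)) = (\<Sum>a\<in>multiindices m n r. f a)"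
  by (rule sum.reindex_bij_witness[where i = "\<lambda>a. a \<circ> inv \<pi>" and j = "\<lambda>a. a \<circ> \<pi>"])
    (simp_all add: assms perms_inv_comp_assoc[OF assms])

text \<open>Multiindices carry a right action, so functions of a multiindex form a left module over
  the group algebra, with \<open>conv\<close> as its product; \<open>sg\<close> supplies the sign
  cocycle.\<close>

definition grp_act :: "nat \<Rightarrow> ((nat \<Rightarrow> nat) \<Rightarrow> (nat \<Rightarrow> nat) \<Rightarrow> 'k::comm_ring_1) \<Rightarrow> ((nat \<Rightarrow> nat) \<Rightarrow> 'k)
    \<Rightarrow> ((nat \<Rightarrow> nat) \<Rightarrow> 'k) \<Rightarrow> (nat \<Rightarrow> nat) \<Rightarrow> 'k" where
  "grp_act r sg g H j = (\<Sum>\<pi>\<in>perms r. g \<pi> * sg j \<pi> * H (j \<circ> \<pi>))"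

lemma grp_act_scale: "grp_act r sg (\<lambda>\<pi>. c * g \<pi>) H j = c * grp_act r sg g H j"
  by (simp add: grp_act_def sum_distrib_left mult.assoc)

lemma grp_act_sum: "grp_act r sg g (\<lambda>j. \<Sum>x\<in>X. F x j) j = (\<Sum>x\<in>X. grp_act r sg g (F x) j)"
  unfolding grp_act_def by (subst sum.swap) (simp add: sum_distrib_left)

lemma grp_act_const: "grp_act r sg g (\<lambda>j. c * H j) j = c * grp_act r sg g H j"
  by (simp add: grp_act_def sum_distrib_left mult_ac)

lemma grp_act_colsum:
  "grp_act r sg (colsum r col) H j = (\<Sum>\<kappa>\<in>level_perms r col. of_int (sign \<kappa>) * sg j \<kappa> * H (j \<circ> \<kappa>))"
  unfolding grp_act_def
  by (rule sum.mono_neutral_cong_right) (auto simp: colsum_def dest: level_permsD)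

lemma grp_act_rowsum:
  "grp_act r sg (rowsum r row) H j = (\<Sum>\<rho>\<in>level_perms r row. sg j \<rho> * H (j \<circ> \<rho>))"
  unfolding grp_act_def
  by (rule sum.mono_neutral_cong_right) (auto simp: rowsum_def dest: level_permsD)

text \<open>\<open>p\<close> marks the symbols for which exchanging two equal entries costs a sign.
  The cocycle is kept abstract because its product with the sign character is again an instance,
  with \<open>p\<close> negated.\<close>

locale signed_action =
  fixes m n r :: nat and p :: "nat \<Rightarrow> bool"
    and sg :: "(nat \<Rightarrow> nat) \<Rightarrow> (nat \<Rightarrow> nat) \<Rightarrow> 'k::field_char_0"
  assumes sg_unit: "i \<in> multiindices m n r \<Longrightarrow> \<pi> \<in> perms r \<Longrightarrow> sg i \<pi> = 1 \<or> sg i \<pi> = -1"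
    and sg_comp: "i \<in> multiindices m n r \<Longrightarrow> \<pi> \<in> perms r \<Longrightarrow> \<sigma> \<in> perms r \<Longrightarrow>
      sg i (\<pi> \<circ> \<sigma>) = sg i \<pi> * sg (i \<circ> \<pi>) \<sigma>"
    and sg_transpose: "i \<in> multiindices m n r \<Longrightarrow> s \<in> {1..r} \<Longrightarrow> t \<in> {1..r} \<Longrightarrow> s \<noteq> t \<Longrightarrow> i s = i t \<Longrightarrow>
      sg i (transpose s t) = (if p (i s) then -1 else 1)"
begin

abbreviation Ix :: "(nat \<Rightarrow> nat) set" where "Ix \<equiv> multiindices m n r"

abbreviation act :: "((nat \<Rightarrow> nat) \<Rightarrow> 'k) \<Rightarrow> ((nat \<Rightarrow> nat) \<Rightarrow> 'k) \<Rightarrow> (nat \<Rightarrow> nat) \<Rightarrow> 'k" where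
  "act \<equiv> grp_act r sg"

lemma sg_square [simp]: "i \<in> Ix \<Longrightarrow> \<pi> \<in> perms r \<Longrightarrow> sg i \<pi> * sg i \<pi> = 1"
  using sg_unit[of i \<pi>] by auto

lemma sg_square_left [simp]: "i \<in> Ix \<Longrightarrow> \<pi> \<in> perms r \<Longrightarrow> sg i \<pi> * (sg i \<pi> * x) = x"
  using sg_unit[of i \<pi>] by auto

lemma sg_id [simp]: "i \<in> Ix \<Longrightarrow> sg i id = 1"
  using sg_comp[of i id id] sg_unit[of i id] by auto

lemma sg_inv: "i \<in> Ix \<Longrightarrow> \<pi> \<in> perms r \<Longrightarrow> sg (i \<circ> \<pi>) (inv \<pi>) = sg i \<pi>"
  using sg_comp[of i \<pi> "inv \<pi>"] sg_unit[of i \<pi>] sg_unit[of "i \<circ> \<pi>" "inv \<pi>"] by auto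

lemma twisted: "signed_action m n r (\<lambda>a. \<not> p a) (\<lambda>i \<pi>. of_int (sign \<pi>) * sg i \<pi>)"
proof
  fix i \<pi> \<sigma> assume i: "i \<in> Ix" and p: "\<pi> \<in> perms r"
  show "of_int (sign \<pi>) * sg i \<pi> = 1 \<or> of_int (sign \<pi>) * sg i \<pi> = -1"
    using sg_unit[OF i p] by (auto simp: sign_def)
  assume s: "\<sigma> \<in> perms r"
  show "of_int (sign (\<pi> \<circ> \<sigma>)) * sg i (\<pi> \<circ> \<sigma>) = of_int (sign \<pi>) * sg i \<pi> * (of_int (sign \<sigma>) * sg (i \<circ> \<pi>) \<sigma>)"
    by (simp add: sign_perms_comp[OF p s] sg_comp[OF i p s])
next
  fix i s t assume "i \<in> Ix" "s \<in> {1..r}" "t \<in> {1..r}" "s \<noteq> t" "i s = i t"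
  then show "of_int (sign (transpose s t)) * sg i (transpose s t) = (if \<not> p (i s) then -1 else 1)"
    using sg_transpose[of i s t] by (simp add: sign_swap_id)
qed

lemma grp_act_conv:
  assumes "j \<in> Ix"
  shows "act g (act h H) j = act (conv r g h) H j"
proof -
  have "act g (act h H) j = (\<Sum>\<pi>\<in>perms r. \<Sum>\<sigma>\<in>perms r. g \<pi> * h \<sigma> * sg j (\<pi> \<circ> \<sigma>) * H (j \<circ> (\<pi> \<circ> \<sigma>)))"
    unfolding grp_act_def sum_distrib_left
    by (intro sum.cong refl) (simp add: sg_comp[OF assms] o_assoc mult_ac)
  also have "\<dots> = (\<Sum>\<pi>\<in>perms r. \<Sum>\<tau>\<in>perms r. g \<pi> * h (inv \<pi> \<circ> \<tau>) * sg j \<tau> * H (j \<circ> \<tau>))"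
  proof (rule sum.cong[OF refl])
    fix \<pi> assume p: "\<pi> \<in> perms r"
    show "(\<Sum>\<sigma>\<in>perms r. g \<pi> * h \<sigma> * sg j (\<pi> \<circ> \<sigma>) * H (j \<circ> (\<pi> \<circ> \<sigma>))) =
        (\<Sum>\<tau>\<in>perms r. g \<pi> * h (inv \<pi> \<circ> \<tau>) * sg j \<tau> * H (j \<circ> \<tau>))"
      by (subst sum_perms_left[OF p, symmetric]) (simp add: perms_inv_comp_assoc[OF p])
  qed
  also have "\<dots> = act (conv r g h) H j"
    unfolding grp_act_def conv_def by (subst sum.swap) (simp add: sum_distrib_right)
  finally show ?thesis .
qed

lemma grp_act_cong: "j \<in> Ix \<Longrightarrow> (\<And>i. i \<in> Ix \<Longrightarrow> H i = H' i) \<Longrightarrow> act g H j = act g H' j"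
  unfolding grp_act_def by (intro sum.cong refl) simp

lemma grp_act_delta:
  assumes "\<pi> \<in> perms r"
  shows "act (delta \<pi>) H j = sg j \<pi> * H (j \<circ> \<pi>)"
proof -
  have "act (delta \<pi>) H j = (\<Sum>\<sigma>\<in>perms r. if \<sigma> = \<pi> then sg j \<sigma> * H (j \<circ> \<sigma>) else 0)"
    unfolding grp_act_def delta_def by (intro sum.cong) auto
  then show ?thesis using assms by (simp add: sum.delta)
qed

lemma grp_act_shift:
  assumes "j \<in> Ix" "\<pi> \<in> perms r"
  shows "sg j \<pi> * act g H (j \<circ> \<pi>) = act (\<lambda>\<sigma>. g (inv \<pi> \<circ> \<sigma>)) H j"
proof -
  have "sg j \<pi> * act g H (j \<circ> \<pi>) = act (delta \<pi>) (act g H) j" by (simp add: grp_act_delta assms)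
  also have "\<dots> = act (conv r (delta \<pi>) g) H j" by (rule grp_act_conv[OF assms(1)])
  also have "conv r (delta \<pi>) g = (\<lambda>\<sigma>. g (inv \<pi> \<circ> \<sigma>))" by (rule ext) (rule conv_delta_left[OF assms(2)])
  finally show ?thesis .
qed

lemma colsum_perm:
  assumes "j \<in> Ix" "\<kappa> \<in> level_perms r col"
  shows "act (colsum r col) H j = of_int (sign \<kappa>) * sg j \<kappa> * act (colsum r col) H (j \<circ> \<kappa>)"
proof -
  have k: "\<kappa> \<in> perms r" "inv \<kappa> \<in> level_perms r col" using assms level_permsD level_perms_inv by auto
  have "sg j \<kappa> * act (colsum r col) H (j \<circ> \<kappa>) = act (\<lambda>\<sigma>. of_int (sign \<kappa>) * colsum r col \<sigma>) H j"
    unfolding grp_act_shift[OF assms(1) k(1)] unfolding grp_act_def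
    by (intro sum.cong refl) (simp add: colsum_left[OF k(2)] sign_perms_inv[OF k(1)])
  then show ?thesis by (simp add: grp_act_scale mult.assoc flip: of_int_mult mult.assoc[of "of_int _" "of_int _"])
qed

lemma rowsum_perm:
  assumes "j \<in> Ix" "\<rho> \<in> level_perms r row"
  shows "act (rowsum r row) H (j \<circ> \<rho>) = sg j \<rho> * act (rowsum r row) H j"
proof -
  have k: "\<rho> \<in> perms r" "inv \<rho> \<in> level_perms r row" using assms level_permsD level_perms_inv by auto
  have "sg j \<rho> * act (rowsum r row) H (j \<circ> \<rho>) = act (rowsum r row) H j"
    unfolding grp_act_shift[OF assms(1) k(1)] unfolding grp_act_def
    by (intro sum.cong refl) (simp add: rowsum_def level_perms_comp_iff[OF k(2)])
  then show ?thesis using assms k sg_square_left[of j \<rho>] by metis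
qed

text \<open>A permutation fixing a multiindex is a product of transpositions of equal entries.\<close>

lemma stabilizer_induct [consumes 2, case_names id swap]:
  assumes "\<pi> \<in> perms r" "j \<circ> \<pi> = j" and "P id"
    and step: "\<And>\<pi> s t. \<pi> \<in> perms r \<Longrightarrow> j \<circ> \<pi> = j \<Longrightarrow> s \<in> {1..r} \<Longrightarrow> t \<in> {1..r} \<Longrightarrow> s \<noteq> t \<Longrightarrow> j s = j t \<Longrightarrow>
      \<pi> s = s \<Longrightarrow> {x. \<pi> x \<noteq> x} \<subseteq> {x. (transpose s t \<circ> \<pi>) x \<noteq> x} \<Longrightarrow> (transpose s t \<circ> \<pi>) t \<noteq> t \<Longrightarrow>
      (transpose s t \<circ> \<pi>) s \<noteq> s \<Longrightarrow> P \<pi> \<Longrightarrow> P (transpose s t \<circ> \<pi>)"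
  shows "P \<pi>"
  using assms(1,2)
proof (induction "card {x\<in>{1..r}. \<pi> x \<noteq> x}" arbitrary: \<pi> rule: less_induct)
  case less
  show ?case
  proof (cases "\<exists>x. \<pi> x \<noteq> x")
    case False
    then have "\<pi> = id" by auto
    then show ?thesis using \<open>P id\<close> by simp
  next
    case True
    then obtain s where s: "\<pi> s \<noteq> s" by blast
    have s_in: "s \<in> {1..r}" using s less.prems(1) by (auto simp: perms_def dest: permutes_not_in)
    define t where "t = \<pi> s"
    have t: "t \<in> {1..r}" using perms_in[OF less.prems(1)] s_in by (simp add: t_def)
    have jst: "j s = j t" using less.prems(2) by (metis t_def comp_apply)
    \<comment> \<open>Undoing the move of \<open>s\<close> makes \<open>s\<close> a fixed point and
      moves no new point. The extra premises of \<open>step\<close> record this, so that conditions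
      on moved points pass to the smaller permutation.\<close>
    define \<pi>' where "\<pi>' = transpose s t \<circ> \<pi>"
    have eq: "transpose s t \<circ> \<pi>' = \<pi>" by (simp add: \<pi>'_def o_assoc)
    have p': "\<pi>' \<in> perms r" using s_in t less.prems(1) by (simp add: \<pi>'_def)
    have "j \<circ> transpose s t = j" using jst by (auto simp: fun_eq_iff transpose_def)
    then have j': "j \<circ> \<pi>' = j" using less.prems(2) unfolding \<pi>'_def o_assoc by simp
    have fix_s: "\<pi>' s = s" by (simp add: \<pi>'_def t_def)
    have tt: "\<pi> t \<noteq> t" using perms_inj[OF less.prems(1)] s by (auto simp: t_def)
    have sub: "{x. \<pi>' x \<noteq> x} \<subseteq> {x. \<pi> x \<noteq> x}"
    proof
      fix x assume "x \<in> {x. \<pi>' x \<noteq> x}"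
      then show "x \<in> {x. \<pi> x \<noteq> x}" using s tt by (auto simp: \<pi>'_def transpose_def t_def split: if_splits)
    qed
    have "{x\<in>{1..r}. \<pi>' x \<noteq> x} \<subset> {x\<in>{1..r}. \<pi> x \<noteq> x}" using sub fix_s s s_in by blast
    then have "P \<pi>'" by (intro less.hyps p' j' psubset_card_mono) auto
    from step[OF p' j' s_in t _ jst fix_s _ _ _ this] show ?thesis
      unfolding eq using sub s tt t_def by auto
  qed
qed

text \<open>Each swap of equal entries contributes -1 if the entry satisfies \<open>p\<close> and 1
  otherwise; the assumption makes this uniform over all swaps.\<close>

lemma sg_stabilizer:
  assumes "\<pi> \<in> perms r" "j \<circ> \<pi> = j" "j \<in> Ix" "\<And>t. \<pi> t \<noteq> t \<Longrightarrow> p (j t) = b"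
  shows "sg j \<pi> = (if b then of_int (sign \<pi>) else 1)"
  using assms(1,2,4)
proof (induction rule: stabilizer_induct)
  case id
  then show ?case using sg_id[OF assms(3)] by (simp add: id_def)
next
  case (swap \<pi> s t)
  have "sg j (transpose s t \<circ> \<pi>) = sg j (transpose s t) * sg (j \<circ> transpose s t) \<pi>"
    using swap assms(3) by (intro sg_comp) auto
  also have "j \<circ> transpose s t = j" using swap by (auto simp: fun_eq_iff transpose_def)
  also have "sg j (transpose s t) = (if b then -1 else 1)"
    using sg_transpose[OF assms(3), of s t] swap by auto
  also have "sg j \<pi> = (if b then of_int (sign \<pi>) else 1)"
    using swap.IH swap.hyps swap.prems by blast
  finally show ?case using swap by (simp add: sign_perms_comp[of _ r] sign_swap_id)
qed

text \<open>Both signs come from the same swaps, each exchanging two entries that are equal and the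
  same in \<open>j\<close> and \<open>k\<close>. It is meant for multiindices that differ only at a
  fixed position of \<open>\<pi>\<close>.\<close>

lemma sg_common_stabilizer:
  assumes "\<pi> \<in> perms r" "j \<circ> \<pi> = j" "j \<in> Ix" "k \<in> Ix" "\<And>t. \<pi> t \<noteq> t \<Longrightarrow> k t = j t"
  shows "sg j \<pi> = sg k \<pi>"
  using assms(1,2,5)
proof (induction rule: stabilizer_induct)
  case id
  then show ?case using sg_id[OF assms(3)] sg_id[OF assms(4)] by (simp add: id_def)
next
  case (swap \<pi> s t)
  have k: "k s = j s" "k t = j t" using swap by auto
  have stab: "j \<circ> transpose s t = j" "k \<circ> transpose s t = k"
    using swap k by (auto simp: fun_eq_iff transpose_def)
  have "sg i (transpose s t \<circ> \<pi>) = sg i (transpose s t) * sg (i \<circ> transpose s t) \<pi>" if "i \<in> Ix" for i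
    using swap that by (intro sg_comp) auto
  moreover have "sg j (transpose s t) = sg k (transpose s t)"
    using sg_transpose[OF assms(3), of s t] sg_transpose[OF assms(4), of s t] swap k by simp
  moreover have "sg j \<pi> = sg k \<pi>" using swap.IH swap.hyps swap.prems by blast
  ultimately show ?case using assms(3,4) stab by (simp add: o_def)
qed

end

section \<open>Semistandard multiindices: triangularity and straightening\<close>

lemmas ident_level_perms [simp] = id_level_perms[unfolded id_def]

locale signed_young = signed_action m n r p sg + young_shape r row col
  for m n r p and sg :: "(nat \<Rightarrow> nat) \<Rightarrow> (nat \<Rightarrow> nat) \<Rightarrow> 'k::field_char_0" and row col
begin

abbreviation C where "C \<equiv> level_perms r col"
abbreviation R where "R \<equiv> level_perms r row"
abbreviation Y :: "(nat \<Rightarrow> nat) \<Rightarrow> 'k" where "Y \<equiv> young r row col"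

definition semistd :: "(nat \<Rightarrow> nat) \<Rightarrow> bool" where
  "semistd j \<longleftrightarrow> (\<forall>s\<in>{1..r}. \<forall>t\<in>{1..r}.
     (row s = row t \<and> col s < col t \<longrightarrow> j s \<le> j t \<and> (j s = j t \<longrightarrow> \<not> p (j s))) \<and>
     (col s = col t \<and> row s < row t \<longrightarrow> j s \<le> j t \<and> (j s = j t \<longrightarrow> p (j s))))"

definition SS :: "(nat \<Rightarrow> nat) set" where "SS = {j\<in>Ix. semistd j}"

lemma finite_SS [simp]: "finite SS"
  by (simp add: SS_def)

lemma SS_Ix: "j \<in> SS \<Longrightarrow> j \<in> Ix"
  by (simp add: SS_def)

text \<open>Exchanging rows with columns and even with odd symbols preserves semistandardness and
  turns row sums into column sums, so results proved on the column side transfer to the row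
  side.\<close>

lemma twisted_young:
  "signed_young m n r (\<lambda>a. \<not> p a) (\<lambda>i \<pi>. of_int (sign \<pi>) * sg i \<pi>) col row"
  by (intro signed_young.intro twisted transposed)

lemma twisted_semistd:
  "signed_young.semistd r (\<lambda>a. \<not> p a) col row = semistd"
  unfolding signed_young.semistd_def[OF twisted_young] semistd_def by (auto simp: fun_eq_iff)

lemma twisted_SS: "signed_young.SS m n r (\<lambda>a. \<not> p a) col row = SS"
  unfolding signed_young.SS_def[OF twisted_young] SS_def twisted_semistd ..

lemma twisted_colsum:
  "grp_act r (\<lambda>i \<pi>. of_int (sign \<pi>) * sg i \<pi>) (colsum r row) = act (rowsum r row)"
  unfolding grp_act_def colsum_def rowsum_def
  by (intro ext sum.cong refl) (simp add: flip: of_int_mult mult.assoc)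

lemma twisted_rowsum:
  "grp_act r (\<lambda>i \<pi>. of_int (sign \<pi>) * sg i \<pi>) (rowsum r col) = act (colsum r col)"
  unfolding grp_act_def colsum_def rowsum_def
  by (intro ext sum.cong refl) simp

lemma act_young: "j \<in> Ix \<Longrightarrow> act Y H j = act (colsum r col) (act (rowsum r row) H) j"
  by (simp add: young_def grp_act_conv)

lemma act_young_delta:
  assumes "j \<in> Ix"
  shows "act Y (delta l) j =
    (\<Sum>\<kappa>\<in>C. \<Sum>\<rho>\<in>R. of_int (sign \<kappa>) * sg j \<kappa> * (sg (j \<circ> \<kappa>) \<rho> * delta l (j \<circ> \<kappa> \<circ> \<rho>)))"
  unfolding act_young[OF assms] grp_act_colsum grp_act_rowsum by (simp add: sum_distrib_left)

lemma semistd_csorted: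
  assumes "semistd j"
  shows "csorted r row col j" "csorted r col row j"
  using assms unfolding semistd_def csorted_def by blast+

lemma semistd_equal:
  assumes j: "semistd j" and st: "s \<in> {1..r}" "t \<in> {1..r}" "s \<noteq> t" "j s = j t"
  shows "col s = col t \<Longrightarrow> p (j t)" "row s = row t \<Longrightarrow> \<not> p (j t)"
proof -
  have a: "row a < row b \<Longrightarrow> col a = col b \<Longrightarrow> j a = j b \<Longrightarrow> p (j a)"
    "col a < col b \<Longrightarrow> row a = row b \<Longrightarrow> j a = j b \<Longrightarrow> \<not> p (j a)"
    if "a \<in> {1..r}" "b \<in> {1..r}" for a b
    using j that unfolding semistd_def by blast+
  show "p (j t)" if c: "col s = col t"
  proof -
    have "row s \<noteq> row t" using box_inj[OF st(1,2)] st(3) c by blast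
    then show ?thesis using a(1)[OF st(1,2)] a(1)[OF st(2,1)] c st(4) by (cases "row s < row t") auto
  qed
  show "\<not> p (j t)" if c: "row s = row t"
  proof -
    have "col s \<noteq> col t" using box_inj[OF st(1,2)] st(3) c by blast
    then show ?thesis using a(2)[OF st(1,2)] a(2)[OF st(2,1)] c st(4) by (cases "col s < col t") auto
  qed
qed

text \<open>Row permutations keep the pairing with \<open>row\<close>, and a column permutation of
  the column-sorted \<open>j\<close> lowers it unless it fixes \<open>j\<close>. So
  \<open>\<kappa>\<close> fixes \<open>j\<close>, and \<open>\<rho>\<close> then leads from one
  row-sorted multiindex to another, which must coincide.\<close>

lemma triangular_term:
  assumes j: "j \<in> SS" and l: "l \<in> SS" and k: "\<kappa> \<in> C" and rho: "\<rho> \<in> R" and eq: "j \<circ> \<kappa> \<circ> \<rho> = l"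
    and le: "pairing r row j \<le> pairing r row l"
  shows "j \<circ> \<kappa> = j \<and> j = l"
proof -
  have "pairing r row (j \<circ> \<kappa>) = pairing r row l"
    using pairing_level_perm[OF rho, of "j \<circ> \<kappa>"] eq by simp
  then have 1: "j \<circ> \<kappa> = j"
    using pairing_csorted[OF k] semistd_csorted(1) j le by (fastforce simp: SS_def)
  interpret tr: young_shape r col row by (rule transposed)
  have "j \<circ> \<rho> = j"
    using tr.csorted_unique[OF rho] j l eq 1 semistd_csorted(2) by (auto simp: SS_def)
  with 1 eq show ?thesis by simp
qed

lemma act_young_delta_upper:
  assumes "j \<in> SS" "l \<in> SS" "pairing r row j \<le> pairing r row l" "j \<noteq> l"
  shows "act Y (delta l) j = 0"
  unfolding act_young_delta[OF SS_Ix[OF assms(1)]]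
  using triangular_term[OF assms(1,2) _ _ _ assms(3)] assms(4)
  by (intro sum.neutral ballI) (auto simp: delta_def)

text \<open>Nothing cancels: a column permutation fixing \<open>l\<close> exchanges only entries
  with \<open>p\<close>, so \<open>sg\<close> cancels the sign of \<open>\<kappa>\<close>; a row
  permutation fixing \<open>l\<close> exchanges only entries without \<open>p\<close> and has sign
  1. The value counts pairs of permutations, the identity pair among them, and characteristic zero
  keeps it nonzero.\<close>

lemma act_young_delta_diag:
  assumes l: "l \<in> SS"
  shows "act Y (delta l) l \<noteq> 0"
proof -
  have lI: "l \<in> Ix" using l by (rule SS_Ix)
  let ?Q = "\<lambda>\<kappa> \<rho>. l \<circ> \<kappa> \<circ> \<rho> = l"
  have "of_int (sign \<kappa>) * sg l \<kappa> * (sg (l \<circ> \<kappa>) \<rho> * delta l (l \<circ> \<kappa> \<circ> \<rho>)) = of_nat (if ?Q \<kappa> \<rho> then 1 else 0)"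
    if k: "\<kappa> \<in> C" and rho: "\<rho> \<in> R" for \<kappa> \<rho>
  proof (cases "?Q \<kappa> \<rho>")
    case True
    then have fix1: "l \<circ> \<kappa> = l" using triangular_term[OF l l k rho] by simp
    with True have fix2: "l \<circ> \<rho> = l" by simp
    have kp: "\<kappa> \<in> perms r" and rp: "\<rho> \<in> perms r" using k rho level_permsD by auto
    have "p (l t)" if "\<kappa> t \<noteq> t" for t
    proof -
      have t: "t \<in> {1..r}" using that kp by (auto simp: perms_def dest: permutes_not_in)
      then have kt: "\<kappa> t \<in> {1..r}" "col (\<kappa> t) = col t" using perms_in[OF kp, of t] level_permsD[OF k] by auto
      have "l (\<kappa> t) = l t" using fix1 by (metis comp_apply)
      then show ?thesis using semistd_equal(1)[of l "\<kappa> t" t] l kt t that by (simp add: SS_def)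
    qed
    then have 1: "sg l \<kappa> = of_int (sign \<kappa>)" using sg_stabilizer[OF kp fix1 lI, of True] by simp
    have "\<not> p (l t)" if "\<rho> t \<noteq> t" for t
    proof -
      have t: "t \<in> {1..r}" using that rp by (auto simp: perms_def dest: permutes_not_in)
      then have kt: "\<rho> t \<in> {1..r}" "row (\<rho> t) = row t" using perms_in[OF rp, of t] level_permsD[OF rho] by auto
      have "l (\<rho> t) = l t" using fix2 by (metis comp_apply)
      then show ?thesis using semistd_equal(2)[of l "\<rho> t" t] l kt t that by (simp add: SS_def)
    qed
    then have 2: "sg l \<rho> = 1" using sg_stabilizer[OF rp fix2 lI, of False] by simp
    show ?thesis using True fix1 1 2 by (simp add: delta_def flip: of_int_mult)
  qed (simp add: delta_def)
  then have eq: "act Y (delta l) l = of_nat (\<Sum>\<kappa>\<in>C. \<Sum>\<rho>\<in>R. if ?Q \<kappa> \<rho> then 1 else 0)"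
    unfolding act_young_delta[OF lI] of_nat_sum by (intro sum.cong refl) simp
  have "1 \<le> (\<Sum>\<kappa>\<in>C. \<Sum>\<rho>\<in>R. if ?Q \<kappa> \<rho> then 1 else (0::nat))"
  proof -
    have "1 = (if ?Q id id then 1 else (0::nat))" by simp
    also have "\<dots> \<le> (\<Sum>\<rho>\<in>R. if ?Q id \<rho> then 1 else 0)" by (rule member_le_sum) auto
    also have "\<dots> \<le> (\<Sum>\<kappa>\<in>C. \<Sum>\<rho>\<in>R. if ?Q \<kappa> \<rho> then 1 else (0::nat))"
      by (rule member_le_sum[of id C "\<lambda>\<kappa>. \<Sum>\<rho>\<in>R. if ?Q \<kappa> \<rho> then 1 else 0"]) auto
    finally show ?thesis .
  qed
  then show ?thesis unfolding eq of_nat_eq_0_iff by linarith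
qed

text \<open>Test with the \<open>l\<close> of largest pairing among the nonzero coefficients: only
  the diagonal term survives.\<close>

lemma triangular:
  assumes zero: "\<And>l. l \<in> SS \<Longrightarrow> (\<Sum>j\<in>SS. y j * act Y (delta l) j) = 0" and j: "j \<in> SS"
  shows "y j = 0"
proof (rule ccontr)
  assume nz: "y j \<noteq> 0"
  let ?D = "{j\<in>SS. y j \<noteq> 0}"
  have "Max (pairing r row ` ?D) \<in> pairing r row ` ?D" using nz j by (intro Max_in) auto
  then obtain l where l: "l \<in> SS" "y l \<noteq> 0" and M: "Max (pairing r row ` ?D) = pairing r row l" by auto
  have max: "pairing r row i \<le> pairing r row l" if "i \<in> SS" "y i \<noteq> 0" for i
    unfolding M[symmetric] using that by (intro Max_ge) auto
  have "0 = (\<Sum>j\<in>SS. y j * act Y (delta l) j)" using zero[OF l(1)] by simp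
  also have "\<dots> = (\<Sum>j\<in>{l}. y j * act Y (delta l) j)"
    using l act_young_delta_upper max by (intro sum.mono_neutral_right) auto
  finally show False using l act_young_delta_diag[OF l(1)] by simp
qed

section \<open>Garnir relations and straightening\<close>

definition row_equiv :: "((nat \<Rightarrow> nat) \<Rightarrow> 'k) \<Rightarrow> bool" where
  "row_equiv F \<longleftrightarrow> (\<forall>j\<in>Ix. \<forall>\<rho>\<in>R. F (j \<circ> \<rho>) = sg j \<rho> * F j)"

lemma permutes_subset_perms: "\<pi> permutes X \<Longrightarrow> X \<subseteq> {1..r} \<Longrightarrow> \<pi> \<in> perms r"
  unfolding perms_def by (auto intro: permutes_subset)

text \<open>For fixed \<open>\<kappa>\<close> the sum over \<open>\<pi>\<close> vanishes: the
  transposition \<open>w\<close> of the colliding positions satisfies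
  \<open>w \<circ> \<kappa> = \<kappa> \<circ> w'\<close> with \<open>w'\<close> in the row group,
  under which \<open>F\<close> is equivariant, so the terms of \<open>\<pi>\<close> and
  \<open>\<pi> \<circ> w\<close> cancel.\<close>

lemma garnir:
  assumes F: "row_equiv F" and j: "j \<in> Ix" and X: "X \<subseteq> {1..r}"
    and coll: "\<And>\<kappa>. \<kappa> \<in> C \<Longrightarrow> \<exists>x\<in>X. \<exists>y\<in>X. x \<noteq> y \<and> row (inv \<kappa> x) = row (inv \<kappa> y)"
  shows "(\<Sum>\<pi> | \<pi> permutes X. of_int (sign \<pi>) * sg j \<pi> * act (colsum r col) F (j \<circ> \<pi>)) = 0"
proof -
  define g where "g \<kappa> \<pi> = of_int (sign (\<pi> \<circ> \<kappa>)) * sg j (\<pi> \<circ> \<kappa>) * F (j \<circ> (\<pi> \<circ> \<kappa>))"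
    for \<kappa> \<pi> :: "nat \<Rightarrow> nat"
  have pp: "\<pi> \<in> perms r" if "\<pi> permutes X" for \<pi> using that X by (rule permutes_subset_perms)
  have "(\<Sum>\<pi> | \<pi> permutes X. of_int (sign \<pi>) * sg j \<pi> * act (colsum r col) F (j \<circ> \<pi>)) =
      (\<Sum>\<pi> | \<pi> permutes X. \<Sum>\<kappa>\<in>C. g \<kappa> \<pi>)"
    unfolding grp_act_colsum sum_distrib_left
  proof (intro sum.cong refl)
    fix \<pi> \<kappa> assume "\<pi> \<in> {\<pi>. \<pi> permutes X}" and k: "\<kappa> \<in> C"
    then have p: "\<pi> \<in> perms r" using pp by simp
    have k': "\<kappa> \<in> perms r" using k by (rule level_permsD)
    show "of_int (sign \<pi>) * sg j \<pi> * (of_int (sign \<kappa>) * sg (j \<circ> \<pi>) \<kappa> * F (j \<circ> \<pi> \<circ> \<kappa>)) = g \<kappa> \<pi>"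
      unfolding g_def sg_comp[OF j p k'] sign_perms_comp[OF p k'] by (simp add: o_assoc)
  qed
  also have "\<dots> = (\<Sum>\<kappa>\<in>C. \<Sum>\<pi> | \<pi> permutes X. g \<kappa> \<pi>)" by (rule sum.swap)
  also have "\<dots> = 0"
  proof (rule sum.neutral, rule ballI)
    fix \<kappa> assume k: "\<kappa> \<in> C"
    then have k': "\<kappa> \<in> perms r" by (rule level_permsD)
    obtain x y where xy: "x \<in> X" "y \<in> X" "x \<noteq> y" "row (inv \<kappa> x) = row (inv \<kappa> y)" using coll[OF k] by blast
    define w where "w = transpose x y"
    define w' where "w' = transpose (inv \<kappa> x) (inv \<kappa> y)"
    have wX: "w permutes X" unfolding w_def using xy by (intro permutes_swap_id) auto
    have in_r: "inv \<kappa> x \<in> {1..r}" "inv \<kappa> y \<in> {1..r}"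
      using perms_in[OF perms_inv[OF k'], of x] perms_in[OF perms_inv[OF k'], of y] xy X by blast+
    have w': "w' \<in> R" unfolding w'_def by (rule transpose_level_perms[OF in_r xy(4)])
    have ne: "inv \<kappa> x \<noteq> inv \<kappa> y" using xy(3) perms_inj[OF perms_inv[OF k']] by simp
    have comm: "w \<circ> \<kappa> = \<kappa> \<circ> w'"
    proof
      fix z
      have "\<kappa> z = x \<longleftrightarrow> z = inv \<kappa> x" "\<kappa> z = y \<longleftrightarrow> z = inv \<kappa> y" using k' by auto
      then show "(w \<circ> \<kappa>) z = (\<kappa> \<circ> w') z" using k' unfolding w_def w'_def by (auto simp: transpose_def)
    qed
    have neg: "g \<kappa> (\<pi> \<circ> w) = - g \<kappa> \<pi>" if "\<pi> permutes X" for \<pi>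
    proof -
      have p: "\<pi> \<circ> \<kappa> \<in> perms r" using pp[OF that] k' by simp
      have w'p: "w' \<in> perms r" using w' by (rule level_permsD)
      have "\<pi> \<circ> w \<circ> \<kappa> = \<pi> \<circ> \<kappa> \<circ> w'" using comm by (metis o_assoc)
      moreover have "sign w' = -1" using ne by (simp add: w'_def sign_swap_id)
      moreover have "F (j \<circ> (\<pi> \<circ> \<kappa> \<circ> w')) = sg (j \<circ> (\<pi> \<circ> \<kappa>)) w' * F (j \<circ> (\<pi> \<circ> \<kappa>))"
        using F multiindices_comp[OF j p] w' unfolding row_equiv_def by (simp add: o_assoc)
      moreover have "sg (j \<circ> (\<pi> \<circ> \<kappa>)) w' * sg (j \<circ> (\<pi> \<circ> \<kappa>)) w' = 1"
        using multiindices_comp[OF j p] w'p by simp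
      ultimately show ?thesis unfolding g_def
        by (simp add: sg_comp[OF j p w'p] sign_perms_comp[OF p w'p] mult.assoc mult.left_commute)
    qed
    have "(\<Sum>\<pi> | \<pi> permutes X. g \<kappa> \<pi>) = (\<Sum>\<pi> | \<pi> permutes X. g \<kappa> (\<pi> \<circ> w))"
      by (rule sum.reindex_bij_witness[where i = "\<lambda>\<pi>. \<pi> \<circ> w" and j = "\<lambda>\<pi>. \<pi> \<circ> w"])
        (use wX in \<open>auto simp: o_assoc[symmetric] w_def intro: permutes_compose\<close>)
    also have "\<dots> = - (\<Sum>\<pi> | \<pi> permutes X. g \<kappa> \<pi>)"
      unfolding sum_negf[symmetric] by (intro sum.cong refl) (simp add: neg)
    finally have "2 * (\<Sum>\<pi> | \<pi> permutes X. g \<kappa> \<pi>) = 0" by (metis add.right_inverse mult_2)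
    then show "(\<Sum>\<pi> | \<pi> permutes X. g \<kappa> \<pi>) = 0" by simp
  qed
  finally show ?thesis .
qed

text \<open>Pigeonhole: \<open>X\<close> has more elements than the column of \<open>s\<close>,
  while its positions, moved back by \<open>\<kappa>\<close>, lie in columns not left of that column
  and so occupy only rows that it meets.\<close>

lemma garnir_collision:
  assumes st: "s \<in> {1..r}" "t \<in> {1..r}" "row s = row t" "col s < col t" and k: "\<kappa> \<in> C"
  defines "X \<equiv> {x\<in>{1..r}. col x = col s \<and> row s \<le> row x} \<union> {x\<in>{1..r}. col x = col t \<and> row x \<le> row t}"
  shows "\<exists>x\<in>X. \<exists>y\<in>X. x \<noteq> y \<and> row (inv \<kappa> x) = row (inv \<kappa> y)"
proof -
  let ?L = "{x\<in>{1..r}. col x = col s}"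
  let ?A = "{x\<in>{1..r}. col x = col s \<and> row s \<le> row x}" and ?B = "{x\<in>{1..r}. col x = col t \<and> row x \<le> row t}"
  let ?A' = "{x\<in>{1..r}. col x = col s \<and> row x \<le> row s}"
  have kp: "\<kappa> \<in> perms r" using k by (rule level_permsD)
  \<comment> \<open>The column of \<open>t\<close> has a box in every row down to that of
    \<open>t\<close>, which is the row of \<open>s\<close>. So \<open>?B\<close> is at least as
    large as the upper part of the column of \<open>s\<close>; counting \<open>s\<close> in both
    parts makes \<open>X\<close> exceed the column by one.\<close>
  have "row ` ?A' \<subseteq> row ` ?B"
  proof
    fix a assume "a \<in> row ` ?A'"
    then obtain x where x: "x \<in> {1..r}" "a = row x" "row x \<le> row t" using st by auto
    then obtain y where "y \<in> {1..r}" "row y = a" "col y = col t"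
      using down[OF st(2), of a "col t"] pos[OF x(1)] pos[OF st(2)] by auto
    then show "a \<in> row ` ?B" using x by (intro image_eqI[of _ _ y]) auto
  qed
  then have "card (row ` ?A') \<le> card (row ` ?B)" by (intro card_mono) auto
  moreover have "card (row ` ?A') = card ?A'" using box_inj by (intro card_image) (auto simp: inj_on_def)
  moreover have "card (row ` ?B) \<le> card ?B" by (rule card_image_le) auto
  ultimately have 1: "card ?A' \<le> card ?B" by linarith
  have "card ?L + 1 = card ?A + card ?A'"
  proof -
    have "?A \<union> ?A' = ?L" "?A \<inter> ?A' = {s}" using st box_inj[OF _ st(1)] by auto
    then show ?thesis using card_Un_Int[of ?A ?A'] by simp
  qed
  also have "\<dots> \<le> card ?A + card ?B" using 1 by simp
  also have "\<dots> = card X" unfolding X_def using st by (intro card_Un_disjoint[symmetric]) auto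
  finally have cX: "card ?L < card X" by simp
  have "(\<lambda>x. row (inv \<kappa> x)) ` X \<subseteq> row ` ?L"
  proof
    fix a assume "a \<in> (\<lambda>x. row (inv \<kappa> x)) ` X"
    then obtain x where x: "x \<in> X" "a = row (inv \<kappa> x)" by blast
    have xr: "x \<in> {1..r}" using x by (auto simp: X_def)
    have ix: "inv \<kappa> x \<in> {1..r}" "col (inv \<kappa> x) = col x"
      using perms_in[OF perms_inv[OF kp], of x] level_permsD(2)[OF level_perms_inv[OF k] xr] xr by auto
    have "col s \<le> col x" using x st by (auto simp: X_def)
    then obtain y where "y \<in> {1..r}" "row y = a" "col y = col s"
      using down[OF ix(1), of a "col s"] pos[OF ix(1)] pos[OF st(1)] ix x by auto
    then show "a \<in> row ` ?L" by blast
  qed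
  then have "card ((\<lambda>x. row (inv \<kappa> x)) ` X) \<le> card (row ` ?L)" by (intro card_mono) auto
  also have "\<dots> \<le> card ?L" by (rule card_image_le) auto
  finally have "card ((\<lambda>x. row (inv \<kappa> x)) ` X) < card X" using cX by simp
  then have "\<not> inj_on (\<lambda>x. row (inv \<kappa> x)) X" by (rule pigeonhole)
  then show ?thesis by (auto simp: inj_on_def)
qed

text \<open>A permutation of the Garnir set either moves larger entries to the right, or it exchanges only
  equal odd entries between the two columns and then acts trivially up to a column permutation.\<close>

lemma garnir_term:
  assumes j: "j \<in> Ix" and sj: "csorted r row col j"
    and st: "s \<in> {1..r}" "t \<in> {1..r}" "row s = row t" "col s < col t"
    and viol: "j t \<le> j s" "j s = j t \<Longrightarrow> p (j s)"
  defines "A \<equiv> {x\<in>{1..r}. col x = col s \<and> row s \<le> row x}"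
    and "B \<equiv> {x\<in>{1..r}. col x = col t \<and> row x \<le> row t}"
  assumes "\<pi> permutes A \<union> B"
  shows "pairing r col j < pairing r col (j \<circ> \<pi>) \<or>
    (pairing r col (j \<circ> \<pi>) = pairing r col j \<and>
     (\<forall>F. of_int (sign \<pi>) * sg j \<pi> * act (colsum r col) F (j \<circ> \<pi>) = act (colsum r col) F j))"
  using assms(11)
proof (induction "card {y\<in>B. \<pi> y \<in> A}" arbitrary: \<pi> rule: less_induct)
  case less
  have fin: "finite A" "finite B" by (auto simp: A_def B_def)
  have sub: "A \<subseteq> {1..r}" "B \<subseteq> {1..r}" by (auto simp: A_def B_def)
  have disj: "A \<inter> B = {}" using st by (auto simp: A_def B_def)
  have pp: "\<pi> \<in> perms r" using permutes_subset_perms[OF less.prems] sub by blast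
  note inj = perms_inj[OF pp]
  have inAB: "\<pi> x \<in> A \<union> B \<longleftrightarrow> x \<in> A \<union> B" for x using permutes_in_image[OF less.prems] .
  show ?case
  proof (cases "\<exists>y\<in>B. \<pi> y \<in> A")
    case False
    have "\<pi> ` B \<subseteq> B" using False inAB by blast
    then have PB: "\<pi> ` B = B" using fin inj by (intro endo_inj_surj) (auto simp: inj_on_def)
    have PA: "\<pi> x \<in> A" if "x \<in> A" for x
    proof (rule ccontr)
      assume "\<pi> x \<notin> A"
      then have "\<pi> x \<in> \<pi> ` B" using inAB[of x] that PB by blast
      then have "x \<in> B" using inj by auto
      then show False using that disj by blast
    qed
    have "col (\<pi> x) = col x" if "x \<in> {1..r}" for x
    proof -
      consider "x \<in> A" | "x \<in> B" | "x \<notin> A \<union> B" by blast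
      then show ?thesis
      proof cases
        case 1 then show ?thesis using PA[OF 1] by (simp add: A_def)
      next
        case 2
        then have "\<pi> x \<in> B" using PB by blast
        then show ?thesis using 2 by (simp add: B_def)
      next
        case 3 then show ?thesis using permutes_not_in[OF less.prems] by simp
      qed
    qed
    then have "\<pi> \<in> C" using pp by (simp add: level_perms_def)
    then show ?thesis using pairing_level_perm colsum_perm[OF j] by metis
  next
    case True
    then obtain y where y: "y \<in> B" "\<pi> y \<in> A" by blast
    have "\<exists>x\<in>A. \<pi> x \<in> B"
    proof (rule ccontr)
      assume "\<not> (\<exists>x\<in>A. \<pi> x \<in> B)"
      then have "\<pi> ` A \<subseteq> A" using inAB by blast
      then have "\<pi> ` A = A" using fin inj by (intro endo_inj_surj) (auto simp: inj_on_def)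
      then have "\<pi> y \<in> \<pi> ` A" using y by simp
      then have "y \<in> A" using inj by auto
      then show False using y disj by blast
    qed
    then obtain x where x: "x \<in> A" "\<pi> x \<in> B" by blast
    \<comment> \<open>Swapping the values at \<open>x\<close> and \<open>y\<close> undoes one
      exchange between the two columns, so the induction hypothesis applies to
      \<open>\<pi>'\<close>.\<close>
    define w where "w = transpose (\<pi> x) (\<pi> y)"
    define \<pi>' where "\<pi>' = w \<circ> \<pi>"
    have wp: "w permutes A \<union> B" unfolding w_def using x y by (intro permutes_swap_id) auto
    have p': "\<pi>' permutes A \<union> B" unfolding \<pi>'_def using wp less.prems by (intro permutes_compose)
    have pp': "\<pi>' \<in> perms r" "w \<in> perms r" using permutes_subset_perms[OF p'] permutes_subset_perms[OF wp] sub by blast+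
    have eq: "\<pi> = w \<circ> \<pi>'" by (simp add: \<pi>'_def w_def o_assoc)
    have val: "\<pi>' x = \<pi> y" "\<pi>' y = \<pi> x" by (simp_all add: \<pi>'_def w_def)
    have val': "\<pi>' z = \<pi> z" if "z \<noteq> x" "z \<noteq> y" for z
      using that inj by (simp add: \<pi>'_def w_def)
    have eq2: "\<pi> = \<pi>' \<circ> transpose x y" using val val' by (auto simp: fun_eq_iff transpose_def)
    have xB: "x \<notin> B" using x(1) disj by blast
    have yA: "\<pi>' y \<notin> A" unfolding val using x(2) disj by blast
    have "z \<in> {z\<in>B. \<pi>' z \<in> A} \<longleftrightarrow> z \<in> {z\<in>B. \<pi> z \<in> A} - {y}" for z
      using xB yA val'[of z] by (cases "z = x"; cases "z = y") simp_all
    then have "{z\<in>B. \<pi>' z \<in> A} = {z\<in>B. \<pi> z \<in> A} - {y}" by blast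
    then have "card {z\<in>B. \<pi>' z \<in> A} < card {z\<in>B. \<pi> z \<in> A}"
      using y fin by (simp only:, intro card_Diff1_less) auto
    from less.hyps[OF this p'] have IH: "pairing r col j < pairing r col (j \<circ> \<pi>') \<or>
      (pairing r col (j \<circ> \<pi>') = pairing r col j \<and>
       (\<forall>F. of_int (sign \<pi>') * sg j \<pi>' * act (colsum r col) F (j \<circ> \<pi>') = act (colsum r col) F j))" .
    \<comment> \<open>Entries on \<open>B\<close> are at most \<open>j t\<close>, which is at most
      \<open>j s\<close>, which is at most every entry on \<open>A\<close>. So relative to
      \<open>\<pi>'\<close> the permutation \<open>\<pi>\<close> moves the larger of two entries to
      the right, or exchanges equal ones.\<close>
    have le1: "j (\<pi> x) \<le> j t"
    proof (cases "\<pi> x = t")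
      case False
      then have "row (\<pi> x) < row t" using x st(2) box_inj[of "\<pi> x" t] by (force simp: B_def)
      then show ?thesis using x sj st(2) unfolding csorted_def B_def by auto
    qed simp
    have le2: "j s \<le> j (\<pi> y)"
    proof (cases "\<pi> y = s")
      case False
      then have "row s < row (\<pi> y)" using y st(1) box_inj[of "\<pi> y" s] by (force simp: A_def)
      then show ?thesis using y sj st(1) unfolding csorted_def A_def by auto
    qed simp
    show ?thesis
    proof (cases "j (\<pi> x) = j (\<pi> y)")
      case False
      then have "pairing r col (j \<circ> \<pi>') < pairing r col (j \<circ> \<pi>' \<circ> transpose x y)"
        using le1 le2 viol(1) val x y st by (intro pairing_swap_less) (auto simp: A_def B_def)
      then show ?thesis using IH by (auto simp: eq2 o_assoc)
    next
      case True
      then have jw: "j \<circ> w = j" by (auto simp: w_def fun_eq_iff transpose_def)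
      have v: "j (\<pi> x) = j s" "j s = j t" using True le1 le2 viol(1) by auto
      have ne: "\<pi> x \<noteq> \<pi> y" using x y disj by auto
      have "\<pi> x \<in> {1..r}" "\<pi> y \<in> {1..r}" using x y sub by blast+
      then have "sg j w = -1" unfolding w_def using sg_transpose[OF j _ _ ne True] v viol(2) by simp
      moreover have "sg j \<pi> = sg j w * sg j \<pi>'"
        unfolding eq using sg_comp[OF j pp'(2,1)] jw by simp
      moreover have "sign \<pi> = - sign \<pi>'"
        unfolding eq using sign_perms_comp[OF pp'(2,1)] ne by (simp add: w_def sign_swap_id)
      moreover have "j \<circ> \<pi> = j \<circ> \<pi>'" unfolding eq o_assoc jw ..
      ultimately show ?thesis using IH by simp
    qed
  qed
qed

text \<open>The coefficients are chosen before \<open>F\<close>, so one relation serves all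
  row-equivariant functions. The induction measure is the gap between the pairing with
  \<open>col\<close> and an upper bound, its value at the constant function \<open>m + n\<close>;
  Garnir relations only lead to larger pairings.\<close>

theorem straightening:
  assumes "j \<in> Ix"
  shows "\<exists>c. \<forall>F. row_equiv F \<longrightarrow> act (colsum r col) F j = (\<Sum>i\<in>SS. c i * act (colsum r col) F i)"
  using assms
proof (induction "pairing r col (\<lambda>_. m + n) - pairing r col j" arbitrary: j rule: less_induct)
  case less
  let ?goal = "\<lambda>j. \<exists>c. \<forall>F. row_equiv F \<longrightarrow> act (colsum r col) F j = (\<Sum>i\<in>SS. c i * act (colsum r col) F i)"
  have bound: "pairing r col i \<le> pairing r col (\<lambda>_. m + n)" if "i \<in> Ix" for i
    unfolding pairing_def using that by (intro sum_mono mult_left_mono) (auto simp: multiindices_def PiE_def Pi_def)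
  obtain \<kappa> where k: "\<kappa> \<in> C" and sj: "csorted r row col (j \<circ> \<kappa>)" using csorted_exists[of j] by blast
  define j' where "j' = j \<circ> \<kappa>"
  have kp: "\<kappa> \<in> perms r" using k by (rule level_permsD)
  have j': "j' \<in> Ix" "csorted r row col j'" using less.prems kp sj by (auto simp: j'_def)
  have pj': "pairing r col j' = pairing r col j" unfolding j'_def by (rule pairing_level_perm[OF k])
  have "?goal j'"
  proof (cases "\<exists>s\<in>{1..r}. \<exists>t\<in>{1..r}. s \<noteq> t \<and> col s = col t \<and> j' s = j' t \<and> \<not> p (j' s)")
    case True
    then obtain s t where st: "s \<in> {1..r}" "t \<in> {1..r}" "s \<noteq> t" "col s = col t" "j' s = j' t" "\<not> p (j' s)"
      by blast
    \<comment> \<open>A repeated entry without \<open>p\<close> in a column makes the column sum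
      equal to its own negative.\<close>
    have "j' \<circ> transpose s t = j'" using st by (auto simp: fun_eq_iff transpose_def)
    then have "act (colsum r col) F j' = - act (colsum r col) F j'" for F
      using colsum_perm[OF j'(1) transpose_level_perms[OF st(1,2,4)], of F] sg_transpose[OF j'(1) st(1,2,3,5)] st
      by (simp add: sign_swap_id)
    then have "act (colsum r col) F j' = 0" for F by (metis eq_neg_iff_add_eq_0 mult_2 mult_eq_0_iff zero_neq_numeral)
    then show ?thesis by (intro exI[of _ "\<lambda>_. 0"]) simp
  next
    case even: False
    show ?thesis
    proof (cases "semistd j'")
      case True
      then have "j' \<in> SS" using j' by (simp add: SS_def)
      then show ?thesis
        by (intro exI[of _ "\<lambda>i. if i = j' then 1 else 0"]) (simp add: if_distrib[of "\<lambda>x. x * _"] sum.delta cong: if_cong)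
    next
      case False
      then obtain s t where st: "s \<in> {1..r}" "t \<in> {1..r}" "row s = row t" "col s < col t"
        and viol: "\<not> (j' s \<le> j' t \<and> (j' s = j' t \<longrightarrow> \<not> p (j' s)))"
        using even j'(2) unfolding semistd_def csorted_def by (metis nat_less_le)
      define X where "X = {x\<in>{1..r}. col x = col s \<and> row s \<le> row x} \<union> {x\<in>{1..r}. col x = col t \<and> row x \<le> row t}"
      have X: "X \<subseteq> {1..r}" "finite X" by (auto simp: X_def)
      let ?G = "{\<pi>. \<pi> permutes X}"
      let ?G2 = "{\<pi>\<in>?G. pairing r col j' < pairing r col (j' \<circ> \<pi>)}"
      have fG: "finite ?G" using X(2) by (rule finite_permutations)
      have dich: "pairing r col j' < pairing r col (j' \<circ> \<pi>) \<or>
         (pairing r col (j' \<circ> \<pi>) = pairing r col j' \<and>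
         (\<forall>F. of_int (sign \<pi>) * sg j' \<pi> * act (colsum r col) F (j' \<circ> \<pi>) = act (colsum r col) F j'))"
        if "\<pi> permutes X" for \<pi>
        using garnir_term[OF j' st, of \<pi>] that viol unfolding X_def by auto
      have "\<exists>c. \<forall>F. row_equiv F \<longrightarrow> act (colsum r col) F (j' \<circ> \<pi>) = (\<Sum>i\<in>SS. c i * act (colsum r col) F i)"
        if "\<pi> \<in> ?G2" for \<pi>
      proof (rule less.hyps)
        show "j' \<circ> \<pi> \<in> Ix" using that permutes_subset_perms[OF _ X(1)] j' by auto
        then show "pairing r col (\<lambda>_. m + n) - pairing r col (j' \<circ> \<pi>) < pairing r col (\<lambda>_. m + n) - pairing r col j"
          using that bound[of "j' \<circ> \<pi>"] pj' by auto
      qed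
      then have "\<forall>\<pi>\<in>?G2. \<exists>c. \<forall>F. row_equiv F \<longrightarrow>
          act (colsum r col) F (j' \<circ> \<pi>) = (\<Sum>i\<in>SS. c i * act (colsum r col) F i)" by blast
      from bchoice[OF this] obtain c where c: "\<And>\<pi> F. \<pi> \<in> ?G2 \<Longrightarrow> row_equiv F \<Longrightarrow>
          act (colsum r col) F (j' \<circ> \<pi>) = (\<Sum>i\<in>SS. c \<pi> i * act (colsum r col) F i)" by blast
      \<comment> \<open>Counts the Garnir terms that reproduce the term of \<open>j'\<close>; the
        identity is one of them, so characteristic zero permits division by
        \<open>N\<close>.\<close>
      define N where "N = (of_nat (card (?G - ?G2)) :: 'k)"
      have "id \<in> ?G - ?G2" by (simp add: permutes_id)
      then have "?G - ?G2 \<noteq> {}" by blast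
      then have N: "N \<noteq> 0" unfolding N_def of_nat_eq_0_iff using fG by (simp only: card_eq_0_iff finite_Diff) simp
      have "act (colsum r col) F j' = (\<Sum>i\<in>SS. (- (\<Sum>\<pi>\<in>?G2. of_int (sign \<pi>) * sg j' \<pi> * c \<pi> i) / N) * act (colsum r col) F i)"
        if F: "row_equiv F" for F
      proof -
        let ?f = "\<lambda>\<pi>. of_int (sign \<pi>) * sg j' \<pi> * act (colsum r col) F (j' \<circ> \<pi>)"
        have "0 = sum ?f ?G"
          using garnir[OF F j'(1) X(1) garnir_collision[OF st, folded X_def]] by simp
        also have "\<dots> = sum ?f ?G2 + sum ?f (?G - ?G2)"
          using fG by (subst sum.subset_diff[of ?G2 ?G]) auto
        also have "sum ?f (?G - ?G2) = (\<Sum>\<pi>\<in>?G - ?G2. act (colsum r col) F j')"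
          using dich by (intro sum.cong refl) auto
        also have "\<dots> = N * act (colsum r col) F j'" by (simp add: N_def)
        also have "sum ?f ?G2 = (\<Sum>i\<in>SS. (\<Sum>\<pi>\<in>?G2. of_int (sign \<pi>) * sg j' \<pi> * c \<pi> i) * act (colsum r col) F i)"
          using c[OF _ F] unfolding sum_distrib_right
          by (subst sum.swap) (auto intro!: sum.cong simp: sum_distrib_left mult.assoc)
        finally have "act (colsum r col) F j' = - (\<Sum>i\<in>SS. (\<Sum>\<pi>\<in>?G2. of_int (sign \<pi>) * sg j' \<pi> * c \<pi> i) * act (colsum r col) F i) / N"
          using N by (simp add: field_simps eq_neg_iff_add_eq_0 add.commute)
        also have "\<dots> = (\<Sum>i\<in>SS. - ((\<Sum>\<pi>\<in>?G2. of_int (sign \<pi>) * sg j' \<pi> * c \<pi> i) * act (colsum r col) F i) / N)"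
          by (simp only: sum_divide_distrib sum_negf[symmetric])
        finally show ?thesis by simp
      qed
      then show ?thesis by (intro exI allI impI)
    qed
  qed
  then obtain c where c: "\<And>F. row_equiv F \<Longrightarrow> act (colsum r col) F j' = (\<Sum>i\<in>SS. c i * act (colsum r col) F i)" by blast
  show ?case
  proof (intro exI allI impI)
    fix F assume "row_equiv F"
    then show "act (colsum r col) F j = (\<Sum>i\<in>SS. (of_int (sign \<kappa>) * sg j \<kappa> * c i) * act (colsum r col) F i)"
      using colsum_perm[OF less.prems k, of F] c[of F] by (simp add: j'_def sum_distrib_left mult.assoc)
  qed
qed

end

section \<open>Products of signs over pairs of positions\<close>

definition pairs :: "nat \<Rightarrow> (nat \<times> nat) set" where
  "pairs r = {(s, t). s \<in> {1..r} \<and> t \<in> {1..r} \<and> s < t}"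

lemma finite_pairs [simp]: "finite (pairs r)"
  by (rule finite_subset[of _ "{1..r} \<times> {1..r}"]) (auto simp: pairs_def)

text \<open>A permutation permutes the unordered pairs, so the product changes only at the inverted
  ones, where \<open>h u v\<close> replaces \<open>h v u\<close>; as values of \<open>h\<close>
  square to 1, this is the factor \<open>h u v * h v u\<close>. Both the cocycle rule of the signed
  action and the behaviour of \<open>\<chi>\<close> under permutations are instances.\<close>

lemma prod_pairs_perm:
  fixes h :: "nat \<Rightarrow> nat \<Rightarrow> 'k::comm_ring_1"
  assumes p: "\<pi> \<in> perms r" and h: "\<And>u v. h u v * h u v = 1"
  shows "(\<Prod>(s, t)\<in>pairs r. h (\<pi> s) (\<pi> t)) =
    (\<Prod>(s, t)\<in>pairs r. h s t) * (\<Prod>(s, t)\<in>pairs r. if \<pi> t < \<pi> s then h (\<pi> s) (\<pi> t) * h (\<pi> t) (\<pi> s) else 1)"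
proof -
  define \<phi> where "\<phi> = (\<lambda>(\<sigma> :: nat \<Rightarrow> nat) (s, t). (min (\<sigma> s) (\<sigma> t), max (\<sigma> s) (\<sigma> t)))"
  have \<phi>: "\<phi> \<sigma> x \<in> pairs r" if \<sigma>: "\<sigma> \<in> perms r" and x: "x \<in> pairs r" for \<sigma> x
  proof -
    obtain s t where "x = (s, t)" "s \<in> {1..r}" "t \<in> {1..r}" "s < t" using x by (auto simp: pairs_def)
    moreover from this have "\<sigma> s \<in> {1..r}" "\<sigma> t \<in> {1..r}" "\<sigma> s \<noteq> \<sigma> t"
      using perms_in[OF \<sigma>, of s] perms_in[OF \<sigma>, of t] perms_inj[OF \<sigma>, of s t] by auto
    ultimately show ?thesis by (auto simp: pairs_def \<phi>_def min_def max_def)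
  qed
  have inv: "\<phi> \<sigma> (\<phi> \<tau> x) = x" if "x \<in> pairs r" "\<And>z. \<sigma> (\<tau> z) = z" for \<sigma> \<tau> x
    using that by (auto simp: pairs_def \<phi>_def min_def max_def)
  have "(\<Prod>(s, t)\<in>pairs r. h s t) = (\<Prod>x\<in>pairs r. case \<phi> \<pi> x of (s, t) \<Rightarrow> h s t)"
    by (rule prod.reindex_bij_witness[where i = "\<phi> \<pi>" and j = "\<phi> (inv \<pi>)"])
      (use p in \<open>auto intro!: \<phi> simp: inv\<close>)
  also have "\<dots> * (\<Prod>(s, t)\<in>pairs r. if \<pi> t < \<pi> s then h (\<pi> s) (\<pi> t) * h (\<pi> t) (\<pi> s) else 1) =
      (\<Prod>(s, t)\<in>pairs r. h (\<pi> s) (\<pi> t))"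
    unfolding prod.distrib[symmetric]
  proof (intro prod.cong refl)
    fix x assume "x \<in> pairs r"
    then obtain s t where x: "x = (s, t)" "s < t" by (auto simp: pairs_def)
    have "h (\<pi> t) (\<pi> s) * (h (\<pi> s) (\<pi> t) * h (\<pi> t) (\<pi> s)) = h (\<pi> s) (\<pi> t)"
      using h[of "\<pi> t" "\<pi> s"] by (metis mult.left_commute mult.right_neutral)
    then show "(case \<phi> \<pi> x of (s, t) \<Rightarrow> h s t) *
        (case x of (s, t) \<Rightarrow> if \<pi> t < \<pi> s then h (\<pi> s) (\<pi> t) * h (\<pi> t) (\<pi> s) else 1) =
        (case x of (s, t) \<Rightarrow> h (\<pi> s) (\<pi> t))"
      by (simp add: x \<phi>_def min_def max_def)
  qed
  finally show ?thesis by simp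
qed

lemma prod_neg_one:
  "finite A \<Longrightarrow> (\<Prod>x\<in>A. if P x then -1 else 1) = (-1 :: 'k::comm_ring_1) ^ card {x\<in>A. P x}"
  by (simp add: prod.If_cases Int_def)

definition odd_pair :: "nat \<Rightarrow> (nat \<Rightarrow> nat) \<Rightarrow> nat \<Rightarrow> nat \<Rightarrow> 'k::comm_ring_1" where
  "odd_pair m i u v = (if m < i u \<and> m < i v then -1 else 1)"

lemma act_sgn_prod:
  "act_sgn m r i \<pi> = (\<Prod>(s, t)\<in>pairs r. if \<pi> t < \<pi> s then odd_pair m i (\<pi> s) (\<pi> t) else 1)"
proof -
  have "(\<Prod>(s, t)\<in>pairs r. if \<pi> t < \<pi> s then odd_pair m i (\<pi> s) (\<pi> t) else 1 :: 'a) =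
      (\<Prod>x\<in>pairs r. if \<pi> (snd x) < \<pi> (fst x) \<and> m < i (\<pi> (fst x)) \<and> m < i (\<pi> (snd x)) then -1 else 1)"
    by (intro prod.cong refl) (auto simp: odd_pair_def)
  also have "\<dots> = (-1) ^ card {x\<in>pairs r. \<pi> (snd x) < \<pi> (fst x) \<and> m < i (\<pi> (fst x)) \<and> m < i (\<pi> (snd x))}"
    by (rule prod_neg_one) simp
  also have "{x\<in>pairs r. \<pi> (snd x) < \<pi> (fst x) \<and> m < i (\<pi> (fst x)) \<and> m < i (\<pi> (snd x))} =
      {(a, b). a \<in> {1..r} \<and> b \<in> {1..r} \<and> a < b \<and> \<pi> a > \<pi> b \<and> m < i (\<pi> a) \<and> m < i (\<pi> b)}"
    by (auto simp: pairs_def)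
  finally show ?thesis by (simp add: act_sgn_def)
qed

lemma act_sgn_comp:
  assumes p: "\<pi> \<in> perms r" and s: "\<sigma> \<in> perms r"
  shows "act_sgn m r i (\<pi> \<circ> \<sigma>) = (act_sgn m r i \<pi> * act_sgn m r (i \<circ> \<pi>) \<sigma> :: 'k::field)"
proof -
  define h :: "nat \<Rightarrow> nat \<Rightarrow> 'k" where
    "h u v = (if \<pi> v < \<pi> u then odd_pair m i (\<pi> u) (\<pi> v) else 1)" for u v
  have "act_sgn m r i (\<pi> \<circ> \<sigma>) = (\<Prod>(s, t)\<in>pairs r. h (\<sigma> s) (\<sigma> t))"
    unfolding act_sgn_prod h_def comp_apply ..
  also have "\<dots> = (\<Prod>(s, t)\<in>pairs r. h s t) *
      (\<Prod>(s, t)\<in>pairs r. if \<sigma> t < \<sigma> s then h (\<sigma> s) (\<sigma> t) * h (\<sigma> t) (\<sigma> s) else 1)"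
    by (rule prod_pairs_perm[OF s]) (simp add: h_def odd_pair_def)
  also have "(\<Prod>(s, t)\<in>pairs r. h s t) = act_sgn m r i \<pi>" unfolding act_sgn_prod h_def ..
  also have "(\<Prod>(s, t)\<in>pairs r. if \<sigma> t < \<sigma> s then h (\<sigma> s) (\<sigma> t) * h (\<sigma> t) (\<sigma> s) else 1) = act_sgn m r (i \<circ> \<pi>) \<sigma>"
    unfolding act_sgn_prod
  proof (intro prod.cong refl)
    fix x assume "x \<in> pairs r"
    then obtain s t where x: "x = (s, t)" "s < t" by (auto simp: pairs_def)
    then have "\<pi> (\<sigma> s) \<noteq> \<pi> (\<sigma> t)" using perms_inj[OF p] perms_inj[OF s] by simp
    then show "(case x of (s, t) \<Rightarrow> if \<sigma> t < \<sigma> s then h (\<sigma> s) (\<sigma> t) * h (\<sigma> t) (\<sigma> s) else 1) =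
       (case x of (s, t) \<Rightarrow> if \<sigma> t < \<sigma> s then odd_pair m (i \<circ> \<pi>) (\<sigma> s) (\<sigma> t) else 1)"
      by (auto simp: x h_def odd_pair_def)
  qed
  finally show ?thesis .
qed

text \<open>The inversions of odd entries are the pair itself and, for each odd entry strictly in
  between, one pair with either end. The latter come in twos and cancel.\<close>

lemma act_sgn_transpose:
  assumes st: "s \<in> {1..r}" "t \<in> {1..r}" "s \<noteq> t" "i s = i t"
  shows "act_sgn m r i (transpose s t) = (if m < i s then -1 else 1 :: 'k::field)"
proof -
  have main: "act_sgn m r i (transpose s t) = (if m < i s then -1 else 1 :: 'k)"
    if st: "s \<in> {1..r}" "t \<in> {1..r}" "s < t" "i s = i t" for s t
  proof -
    let ?w = "transpose s t"
    let ?D = "{(a, b). a \<in> {1..r} \<and> b \<in> {1..r} \<and> a < b \<and> ?w a > ?w b \<and> m < i (?w a) \<and> m < i (?w b)}"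
    show ?thesis
    proof (cases "m < i s")
      case False
      then have "?D = {}" using st by (auto simp: transpose_def split: if_splits)
      then show ?thesis using False by (simp only: act_sgn_def card.empty if_False power_0)
    next
      case True
      define U where "U = {u. s < u \<and> u < t \<and> m < i u}"
      have U: "finite U" by (rule finite_subset[of _ "{..t}"]) (auto simp: U_def)
      have "?D = insert (s, t) ((\<lambda>u. (s, u)) ` U \<union> (\<lambda>u. (u, t)) ` U)"
        using st True by (auto simp: U_def transpose_def split: if_splits)
      also have "card \<dots> = Suc (card ((\<lambda>u. (s, u)) ` U \<union> (\<lambda>u. (u, t)) ` U))"
        using U by (intro card_insert_disjoint) (auto simp: U_def)
      also have "card ((\<lambda>u. (s, u)) ` U \<union> (\<lambda>u. (u, t)) ` U) = card ((\<lambda>u. (s, u)) ` U) + card ((\<lambda>u. (u, t)) ` U)"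
        using U by (intro card_Un_disjoint) (auto simp: U_def)
      also have "card ((\<lambda>u. (s, u)) ` U) = card U" by (intro card_image) (auto simp: inj_on_def)
      also have "card ((\<lambda>u. (u, t)) ` U) = card U" by (intro card_image) (auto simp: inj_on_def)
      finally have "card ?D = Suc (card U + card U)" .
      then show ?thesis using True by (simp only: act_sgn_def) (simp add: power_add flip: power_mult_distrib)
    qed
  qed
  show ?thesis
  proof (cases "s < t")
    case True
    then show ?thesis using main st by blast
  next
    case False
    then show ?thesis using main[of t s] st by (simp add: transpose_commute)
  qed
qed

lemma power_minus1_cases: "(-1) ^ k = (1 :: 'k::comm_ring_1) \<or> (-1) ^ k = (-1 :: 'k)"
  by (cases "even k") simp_all

lemma signed_action_act_sgn: "signed_action m n r (\<lambda>a. m < a) (act_sgn m r :: _ \<Rightarrow> _ \<Rightarrow> 'k::field_char_0)"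
proof
  fix i \<pi> \<sigma>
  show "act_sgn m r i \<pi> = (1 :: 'k) \<or> act_sgn m r i \<pi> = (-1 :: 'k)"
    unfolding act_sgn_def by (rule power_minus1_cases)
  assume "\<pi> \<in> perms r" "\<sigma> \<in> perms r"
  then show "act_sgn m r i (\<pi> \<circ> \<sigma>) = (act_sgn m r i \<pi> * act_sgn m r (i \<circ> \<pi>) \<sigma> :: 'k)"
    by (rule act_sgn_comp)
next
  fix i :: "nat \<Rightarrow> nat" and s t assume "s \<in> {1..r}" "t \<in> {1..r}" "s \<noteq> t" "i s = i t"
  then show "act_sgn m r i (transpose s t) = (if m < i s then -1 else 1 :: 'k)"
    by (rule act_sgn_transpose)
qed

section \<open>The elements \<open>\<chi>\<^bsub>i,j\<^esub>\<close>\<close>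

definition ord_sgn :: "nat \<Rightarrow> nat \<times> nat \<Rightarrow> nat \<times> nat \<Rightarrow> 'k::comm_ring_1" where
  "ord_sgn m x y = (if odd (gen_par m x) \<and> odd (gen_par m y) \<and> gen_less y x then -1 else 1)"

lemma super_monom_diff:
  assumes "super_monom m (add_mset x M)"
  shows "super_monom m M"
  unfolding super_monom_def
proof (intro ballI impI)
  fix y assume y: "y \<in># M" "odd (gen_par m y)"
  then have "count (add_mset x M) y = 1" using assms by (simp add: super_monom_def)
  moreover have "0 < count M y" using y(1) by (simp only: count_greater_zero_iff)
  moreover have "count M y \<le> count (add_mset x M) y" by simp
  ultimately show "count M y = 1" by linarith
qed

lemma finite_submultisets: "finite {N. N \<subseteq># M}"
proof (rule finite_subset)
  show "{N. N \<subseteq># M} \<subseteq> mset ` {xs. set xs \<subseteq> set_mset M \<and> length xs \<le> size M}"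
  proof
    fix N assume "N \<in> {N. N \<subseteq># M}"
    moreover obtain xs where "mset xs = N" using ex_mset by blast
    ultimately show "N \<in> mset ` {xs. set xs \<subseteq> set_mset M \<and> length xs \<le> size M}"
      using set_mset_mono[of N M] size_mset_mono[of N M] by (intro image_eqI[of _ _ xs]) auto
  qed
qed (simp add: finite_lists_length_le)

lemma sp_mult_gen:
  "sp_mult m (sp_gen a b) f = (\<lambda>M. if super_monom m M \<and> (a, b) \<in># M
     then monom_sgn m {#(a, b)#} (M - {#(a, b)#}) * f (M - {#(a, b)#}) else 0)"
proof
  fix M :: monom
  have fin: "finite {N. N \<subseteq># M}" by (rule finite_submultisets)
  have "(\<Sum>N\<in>{N. N \<subseteq># M}. monom_sgn m N (M - N) * sp_gen a b N * f (M - N)) =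
     (\<Sum>N\<in>{N. N \<subseteq># M}. if N = {#(a, b)#} then monom_sgn m N (M - N) * f (M - N) else 0)"
    by (intro sum.cong) (auto simp: sp_gen_def)
  also have "\<dots> = (if (a, b) \<in># M then monom_sgn m {#(a, b)#} (M - {#(a, b)#}) * f (M - {#(a, b)#}) else 0)"
    using fin by (simp add: sum.delta)
  finally show "sp_mult m (sp_gen a b) f M = (if super_monom m M \<and> (a, b) \<in># M
     then monom_sgn m {#(a, b)#} (M - {#(a, b)#}) * f (M - {#(a, b)#}) else 0)"
    by (simp add: sp_mult_def)
qed

text \<open>\<open>monom_sgn\<close> counts distinct generators while the product runs over
  positions; they agree because a monomial satisfying \<open>super_monom\<close> repeats no odd
  generator.\<close>

lemma monom_sgn_single:
  assumes M: "super_monom m (add_mset (x k) (image_mset x (mset_set K)))" and K: "finite K"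
  shows "monom_sgn m {#x k#} (image_mset x (mset_set K)) = (\<Prod>t\<in>K. ord_sgn m (x k) (x t) :: 'k::field)"
proof -
  let ?Q = "\<lambda>y. odd (gen_par m (x k)) \<and> odd (gen_par m y) \<and> gen_less y (x k)"
  let ?P = "image_mset x (mset_set K)"
  have "inj_on x {t\<in>K. ?Q (x t)}"
  proof (rule inj_onI)
    fix s t assume st: "s \<in> {t\<in>K. ?Q (x t)}" "t \<in> {t\<in>K. ?Q (x t)}" "x s = x t"
    show "s = t"
    proof (rule ccontr)
      assume "s \<noteq> t"
      then have "{s, t} \<subseteq> {u\<in>K. x u = x s}" using st by auto
      then have "card {s, t} \<le> card {u\<in>K. x u = x s}" using K by (intro card_mono) auto
      moreover have "count ?P (x s) = card {u\<in>K. x u = x s}"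
        using K by (simp add: count_image_mset_eq_card_vimage)
      moreover have "count (add_mset (x k) ?P) (x s) = 1"
        using M st K unfolding super_monom_def by (auto simp: K)
      ultimately show False using \<open>s \<noteq> t\<close> by (auto split: if_splits)
    qed
  qed
  then have "card {t\<in>K. ?Q (x t)} = card (x ` {t\<in>K. ?Q (x t)})" by (simp add: card_image)
  also have "\<dots> = card (Pair (x k) ` (x ` {t\<in>K. ?Q (x t)}))" by (intro card_image[symmetric]) (auto simp: inj_on_def)
  also have "Pair (x k) ` (x ` {t\<in>K. ?Q (x t)}) =
      {(z, y). z \<in># {#x k#} \<and> y \<in># ?P \<and> odd (gen_par m z) \<and> odd (gen_par m y) \<and> gen_less y z}"
    using K by auto
  finally have "monom_sgn m {#x k#} ?P = (-1 :: 'k) ^ card {t\<in>K. ?Q (x t)}" by (simp add: monom_sgn_def)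
  also have "\<dots> = (\<Prod>t\<in>K. if ?Q (x t) then -1 else 1)" using K by (rule prod_neg_one[symmetric])
  finally show ?thesis by (simp add: ord_sgn_def)
qed

text \<open>Induction from the right end of the word: a further generator on the left contributes
  one sign per later position, or annihilates the word by repeating an odd generator.\<close>

lemma word_eq:
  assumes "k \<le> Suc r"
  shows "foldr (sp_mult m) (map (\<lambda>t. sp_gen (i t) (j t)) [k..<r + 1]) sp_one =
    (\<lambda>M. if M = image_mset (\<lambda>t. (i t, j t)) (mset_set {k..r}) \<and> super_monom m M
      then (\<Prod>s\<in>{k..r}. \<Prod>t\<in>{s+1..r}. ord_sgn m (i s, j s) (i t, j t)) else (0 :: 'k::field))"
  using assms
proof (induction rule: inc_induct)
  case base
  then show ?case by (auto simp: sp_one_def fun_eq_iff super_monom_def)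
next
  case (step k)
  let ?x = "\<lambda>t. (i t, j t)"
  let ?P = "image_mset ?x (mset_set {Suc k..r})"
  have up: "[k..<r + 1] = k # [Suc k..<r + 1]" using step by (simp add: upt_conv_Cons)
  have set: "{k..r} = insert k {Suc k..r}" using step by auto
  have P: "image_mset ?x (mset_set {k..r}) = add_mset (?x k) ?P" unfolding set by simp
  have pr: "(\<Prod>s\<in>{k..r}. \<Prod>t\<in>{s+1..r}. ord_sgn m (?x s) (?x t)) =
     (\<Prod>t\<in>{Suc k..r}. ord_sgn m (?x k) (?x t)) * (\<Prod>s\<in>{Suc k..r}. \<Prod>t\<in>{s+1..r}. ord_sgn m (?x s) (?x t) :: 'k)"
    unfolding set by (simp flip: Suc_eq_plus1)
  show ?case
  proof
    fix M :: monom
    let ?cond = "M = image_mset ?x (mset_set {k..r}) \<and> super_monom m M"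
    have L: "foldr (sp_mult m) (map (\<lambda>t. sp_gen (i t) (j t)) [k..<r + 1]) sp_one M =
      (if super_monom m M \<and> ?x k \<in># M then monom_sgn m {#?x k#} (M - {#?x k#}) *
        (if M - {#?x k#} = ?P \<and> super_monom m (M - {#?x k#})
         then (\<Prod>s\<in>{Suc k..r}. \<Prod>t\<in>{s+1..r}. ord_sgn m (?x s) (?x t)) else (0 :: 'k)) else 0)"
      unfolding up list.map foldr.simps comp_apply sp_mult_gen step.IH ..
    show "foldr (sp_mult m) (map (\<lambda>t. sp_gen (i t) (j t)) [k..<r + 1]) sp_one M =
      (if ?cond then (\<Prod>s\<in>{k..r}. \<Prod>t\<in>{s+1..r}. ord_sgn m (?x s) (?x t)) else (0 :: 'k))"
    proof (cases ?cond)
      case True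
      then have M: "M = add_mset (?x k) ?P" "super_monom m M" unfolding P by blast+
      have "super_monom m ?P" using super_monom_diff M by blast
      moreover have "monom_sgn m {#?x k#} ?P = (\<Prod>t\<in>{Suc k..r}. ord_sgn m (?x k) (?x t) :: 'k)"
        using M by (intro monom_sgn_single) auto
      moreover have "M - {#?x k#} = ?P" "?x k \<in># M" using M by auto
      ultimately show ?thesis using L M(2) True by (simp only: pr if_True simp_thms)
    next
      case False
      then have "\<not> (super_monom m M \<and> ?x k \<in># M \<and> M - {#?x k#} = ?P)"
        unfolding P by (metis insert_DiffM)
      then show ?thesis unfolding L using False by (auto simp only: mult_zero_right split: if_splits)
    qed
  qed
qed

definition pos_monom :: "nat \<Rightarrow> (nat \<Rightarrow> nat) \<Rightarrow> (nat \<Rightarrow> nat) \<Rightarrow> monom" where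
  "pos_monom r i j = image_mset (\<lambda>t. (i t, j t)) (mset_set {1..r})"

text \<open>Joint contribution of two positions: the normalizing sign of \<open>\<chi>\<close> times
  the sign of sorting the two generators.\<close>

definition pair_sgn :: "nat \<Rightarrow> nat \<times> nat \<Rightarrow> nat \<times> nat \<Rightarrow> 'k::comm_ring_1" where
  "pair_sgn m x y = (-1) ^ (par m (fst x) * (par m (fst y) + par m (snd y))) * ord_sgn m x y"

definition chi_sgn :: "nat \<Rightarrow> nat \<Rightarrow> (nat \<Rightarrow> nat) \<Rightarrow> (nat \<Rightarrow> nat) \<Rightarrow> 'k::comm_ring_1" where
  "chi_sgn m r i j = (\<Prod>(s, t)\<in>pairs r. pair_sgn m (i s, j s) (i t, j t))"

lemma chi_eq:
  "chi m r i j M = (if M = pos_monom r i j \<and> super_monom m M then chi_sgn m r i j else (0 :: 'k::field))"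
proof -
  have mult_if: "a * (if c then b else 0) = (if c then a * b else 0)" for a b :: 'k and c by simp
  have pairs: "pairs r = Sigma {1..r} (\<lambda>s. {s+1..r})" by (auto simp: pairs_def)
  have "chi_sgn m r i j = (\<Prod>s\<in>{1..r}. \<Prod>t\<in>{s+1..r}. pair_sgn m (i s, j s) (i t, j t) :: 'k)"
    unfolding chi_sgn_def pairs by (rule prod.Sigma[symmetric]) auto
  also have "\<dots> = (-1) ^ (\<Sum>t = 1..r. par m (i t) * (\<Sum>u = t + 1..r. par m (i u) + par m (j u))) *
      (\<Prod>s\<in>{1..r}. \<Prod>t\<in>{s+1..r}. ord_sgn m (i s, j s) (i t, j t))"
    by (simp add: pair_sgn_def prod.distrib power_sum sum_distrib_left)
  finally have sgn: "chi_sgn m r i j = \<dots>" .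
  have word: "foldr (sp_mult m) (map (\<lambda>t. sp_gen (i t) (j t)) [1..<r + 1]) sp_one =
    (\<lambda>M. if M = image_mset (\<lambda>t. (i t, j t)) (mset_set {1..r}) \<and> super_monom m M
      then (\<Prod>s\<in>{1..r}. \<Prod>t\<in>{s+1..r}. ord_sgn m (i s, j s) (i t, j t)) else (0 :: 'k))"
    by (rule word_eq) simp
  show ?thesis
    unfolding chi_def fscale_def word pos_monom_def sgn by (rule mult_if)
qed

lemma pos_monom_comp: "\<pi> \<in> perms r \<Longrightarrow> pos_monom r (i \<circ> \<pi>) (j \<circ> \<pi>) = pos_monom r i j"
  unfolding pos_monom_def
  by (subst permutes_image_mset[of \<pi> "{1..r}", symmetric])
    (auto simp: perms_def multiset.map_comp comp_def)

lemma pos_monom_eqD: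
  assumes eq: "pos_monom r i j = pos_monom r k l"
    and ij: "i \<in> multiindices m n r" "j \<in> multiindices m n r" and kl: "k \<in> multiindices m n r" "l \<in> multiindices m n r"
  shows "\<exists>\<pi>\<in>perms r. i = k \<circ> \<pi> \<and> j = l \<circ> \<pi>"
proof -
  obtain \<pi> where p: "\<pi> permutes {1..r}" and e: "\<forall>t\<in>{1..r}. (i t, j t) = (k (\<pi> t), l (\<pi> t))"
    using image_mset_eq_implies_permutes[OF _ eq[unfolded pos_monom_def]] by auto
  have pp: "\<pi> \<in> perms r" using p by (simp add: perms_def)
  have "i = k \<circ> \<pi>" using ij kl multiindices_comp[OF kl(1) pp] e unfolding multiindices_def
    by (intro extensionalityI[of _ "{1..r}"]) (auto simp: PiE_def)
  moreover have "j = l \<circ> \<pi>" using ij kl multiindices_comp[OF kl(2) pp] e unfolding multiindices_def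
    by (intro extensionalityI[of _ "{1..r}"]) (auto simp: PiE_def)
  ultimately show ?thesis using pp by blast
qed

lemma count_pos_monom: "count (pos_monom r i j) x = card {t\<in>{1..r}. (i t, j t) = x}"
  unfolding pos_monom_def by (simp add: count_image_mset_eq_card_vimage)

lemma super_pos_monomD:
  assumes "super_monom m (pos_monom r i j)" "s \<in> {1..r}" "t \<in> {1..r}" "s \<noteq> t" "i s = i t" "j s = j t"
  shows "even (gen_par m (i s, j s))"
proof (rule ccontr)
  assume odd: "odd (gen_par m (i s, j s))"
  have "{s, t} \<subseteq> {u\<in>{1..r}. (i u, j u) = (i s, j s)}" using assms by auto
  then have "card {s, t} \<le> card {u\<in>{1..r}. (i u, j u) = (i s, j s)}" by (intro card_mono) auto
  then have "2 \<le> count (pos_monom r i j) (i s, j s)" using assms(4) by (simp add: count_pos_monom)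
  moreover from this have "(i s, j s) \<in># pos_monom r i j" by (metis count_eq_zero_iff not_numeral_le_zero)
  ultimately show False using assms(1) odd unfolding super_monom_def by fastforce
qed

lemma not_super_pos_monomD:
  assumes "\<not> super_monom m (pos_monom r i j)"
  obtains s t where "s \<in> {1..r}" "t \<in> {1..r}" "s \<noteq> t" "i s = i t" "j s = j t" "odd (gen_par m (i s, j s))"
proof -
  obtain x where x: "x \<in># pos_monom r i j" "odd (gen_par m x)" "count (pos_monom r i j) x \<noteq> 1"
    using assms by (auto simp: super_monom_def)
  let ?U = "{t\<in>{1..r}. (i t, j t) = x}"
  have "0 < count (pos_monom r i j) x" using x(1) by (simp only: count_greater_zero_iff)
  then have "2 \<le> card ?U" using x(3) unfolding count_pos_monom by linarith
  then obtain s t where "s \<in> ?U" "t \<in> ?U" "s \<noteq> t" by (auto simp: card_le_Suc_iff numeral_2_eq_2)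
  then show ?thesis using that[of s t] x(2) by auto
qed

lemma odd_gen_par: "odd (gen_par m (a, b)) \<longleftrightarrow> (m < a) \<noteq> (m < b)"
  by (simp add: gen_par_def par_def)

lemma even_gen_par: "even (gen_par m (a, b)) \<longleftrightarrow> (m < a) = (m < b)"
  by (simp add: gen_par_def par_def)

text \<open>This is the purpose of the normalization of \<open>\<chi>\<close>: commuting two
  generators costs a sign in which the parities of first and second indices are mixed, and the
  prefactor splits it into one sign for the first indices and one for the second.\<close>

lemma pair_sgn_swap:
  assumes "x = y \<Longrightarrow> even (gen_par m x)"
  shows "pair_sgn m x y * pair_sgn m y x =
    ((if m < fst x \<and> m < fst y then -1 else 1) * (if m < snd x \<and> m < snd y then -1 else 1) :: 'k::comm_ring_1)"
proof -
  obtain a b c d where [simp]: "x = (a, b)" "y = (c, d)" by fastforce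
  have "gen_less x y \<noteq> gen_less y x \<or> x = y" by (auto simp: gen_less_def)
  then have "ord_sgn m x y * ord_sgn m y x =
      (if (m < a) \<noteq> (m < b) \<and> (m < c) \<noteq> (m < d) then -1 else 1 :: 'k)"
    using assms by (auto simp: ord_sgn_def odd_gen_par even_gen_par gen_less_def)
  moreover have "pair_sgn m x y * pair_sgn m y x =
    (-1) ^ (par m a * (par m c + par m d)) * (-1) ^ (par m c * (par m a + par m b)) *
    (ord_sgn m x y * ord_sgn m y x :: 'k)"
    by (simp add: pair_sgn_def mult_ac)
  ultimately show ?thesis by (auto simp: par_def)
qed

lemma pair_sgn_square: "pair_sgn m x y * pair_sgn m x y = (1 :: 'k::comm_ring_1)"
  by (simp add: pair_sgn_def ord_sgn_def flip: power_add power_mult_distrib)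

lemma chi_sgn_comp:
  assumes p: "\<pi> \<in> perms r" and super: "super_monom m (pos_monom r i j)"
  shows "chi_sgn m r (i \<circ> \<pi>) (j \<circ> \<pi>) = (act_sgn m r i \<pi> * act_sgn m r j \<pi> * chi_sgn m r i j :: 'k::field)"
proof -
  define h :: "nat \<Rightarrow> nat \<Rightarrow> 'k" where "h s t = pair_sgn m (i s, j s) (i t, j t)" for s t
  have "chi_sgn m r (i \<circ> \<pi>) (j \<circ> \<pi>) = (\<Prod>(s, t)\<in>pairs r. h (\<pi> s) (\<pi> t))"
    unfolding chi_sgn_def h_def comp_apply ..
  also have "\<dots> = (\<Prod>(s, t)\<in>pairs r. h s t) *
      (\<Prod>(s, t)\<in>pairs r. if \<pi> t < \<pi> s then h (\<pi> s) (\<pi> t) * h (\<pi> t) (\<pi> s) else 1)"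
    by (rule prod_pairs_perm[OF p]) (simp add: h_def pair_sgn_square)
  also have "(\<Prod>(s, t)\<in>pairs r. if \<pi> t < \<pi> s then h (\<pi> s) (\<pi> t) * h (\<pi> t) (\<pi> s) else 1) =
      (\<Prod>(s, t)\<in>pairs r. (if \<pi> t < \<pi> s then odd_pair m i (\<pi> s) (\<pi> t) else 1) *
        (if \<pi> t < \<pi> s then odd_pair m j (\<pi> s) (\<pi> t) else 1))"
  proof (intro prod.cong refl)
    fix x assume "x \<in> pairs r"
    then obtain s t where x: "x = (s, t)" "s < t" "s \<in> {1..r}" "t \<in> {1..r}" by (auto simp: pairs_def)
    then have st: "\<pi> s \<in> {1..r}" "\<pi> t \<in> {1..r}" "\<pi> s \<noteq> \<pi> t"
      using perms_in[OF p, of s] perms_in[OF p, of t] perms_inj[OF p, of s t] by auto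
    have "h (\<pi> s) (\<pi> t) * h (\<pi> t) (\<pi> s) = odd_pair m i (\<pi> s) (\<pi> t) * odd_pair m j (\<pi> s) (\<pi> t)"
      unfolding h_def odd_pair_def
      using super_pos_monomD[OF super st] by (subst pair_sgn_swap) auto
    then show "(case x of (s, t) \<Rightarrow> if \<pi> t < \<pi> s then h (\<pi> s) (\<pi> t) * h (\<pi> t) (\<pi> s) else 1) =
       (case x of (s, t) \<Rightarrow> (if \<pi> t < \<pi> s then odd_pair m i (\<pi> s) (\<pi> t) else 1) *
        (if \<pi> t < \<pi> s then odd_pair m j (\<pi> s) (\<pi> t) else 1))"
      by (simp add: x)
  qed
  also have "\<dots> = act_sgn m r i \<pi> * act_sgn m r j \<pi>"
    unfolding act_sgn_prod prod.distrib[symmetric] by (simp add: case_prod_beta)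
  also have "(\<Prod>(s, t)\<in>pairs r. h s t) = chi_sgn m r i j" unfolding chi_sgn_def h_def ..
  finally show ?thesis by (simp only: mult_ac)
qed

text \<open>The invariance of \<open>\<chi>\<close> under the signed action with all signs moved to
  the right. When an odd generator is repeated, both sides are zero.\<close>

lemma chi_comp:
  assumes "\<pi> \<in> perms r"
  shows "chi m r (i \<circ> \<pi>) (j \<circ> \<pi>) M = (act_sgn m r i \<pi> * act_sgn m r j \<pi> * chi m r i j M :: 'k::field)"
  unfolding chi_eq pos_monom_comp[OF assms] using chi_sgn_comp[OF assms, of m i j] by auto

lemma chi_sgn_square: "chi_sgn m r i j * chi_sgn m r i j = (1 :: 'k::comm_ring_1)"
  unfolding chi_sgn_def prod.distrib[symmetric]
  by (intro prod.neutral) (auto simp: pair_sgn_square)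

section \<open>The Schur superalgebra as an algebra of matrices\<close>

lemma vector_space_fscale: "vector_space (fscale :: 'k::field \<Rightarrow> ('x \<Rightarrow> 'k) \<Rightarrow> 'x \<Rightarrow> 'k)"
  by unfold_locales (auto simp: fscale_def fun_eq_iff algebra_simps)

interpretation fs: vector_space "fscale :: 'k::field \<Rightarrow> ('x \<Rightarrow> 'k) \<Rightarrow> 'x \<Rightarrow> 'k"
  by (rule vector_space_fscale)

lemma fscale_apply [simp]: "fscale c f x = c * f x"
  by (simp add: fscale_def)

lemma lin_on_sum:
  assumes lin: "lin_on s s' V f" and V: "0 \<in> V" "\<And>v w. v \<in> V \<Longrightarrow> w \<in> V \<Longrightarrow> v + w \<in> V"
    "\<And>c v. v \<in> V \<Longrightarrow> s c v \<in> V" and v: "\<And>x. x \<in> X \<Longrightarrow> v x \<in> V"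
  shows "f (\<Sum>x\<in>X. s (c x) (v x)) = (\<Sum>x\<in>X. s' (c x) (f (v x)))"
proof -
  have f0: "f 0 = 0" using lin V(1) unfolding lin_on_def by (metis add.right_neutral add_cancel_right_right)
  have sum_in: "(\<Sum>x\<in>X. s (c x) (v x)) \<in> V" if "\<And>x. x \<in> X \<Longrightarrow> v x \<in> V" for X
    using that V by (induction X rule: infinite_finite_induct) auto
  show ?thesis using v
  proof (induction X rule: infinite_finite_induct)
    case (insert x X)
    then have "v x \<in> V" "(\<Sum>x\<in>X. s (c x) (v x)) \<in> V" using sum_in by auto
    then have "f (s (c x) (v x) + (\<Sum>x\<in>X. s (c x) (v x))) = s' (c x) (f (v x)) + f (\<Sum>x\<in>X. s (c x) (v x))"
      using lin V(3) unfolding lin_on_def by simp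
    then show ?case using insert by simp
  qed (simp_all add: f0)
qed

lemma lin_on_0: "lin_on s s' V f \<Longrightarrow> 0 \<in> V \<Longrightarrow> f 0 = 0"
  unfolding lin_on_def by (metis add.right_neutral add_cancel_right_right)

lemma image_mset_nth: "image_mset (\<lambda>t. xs ! (t - 1)) (mset_set {1..length xs}) = mset xs"
proof -
  have "{1..length xs} = Suc ` {..<length xs}" by (auto simp: image_Suc_lessThan)
  then have "image_mset (\<lambda>t. xs ! (t - 1)) (mset_set {1..length xs}) = image_mset (\<lambda>t. xs ! t) (mset_set {..<length xs})"
    by (simp add: image_mset_mset_set[symmetric] multiset.map_comp comp_def)
  also have "\<dots> = mset (map (\<lambda>t. xs ! t) [0..<length xs])" by (simp add: lessThan_atLeast0)
  finally show ?thesis by (simp add: map_nth)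
qed

lemma card_nonzeroI: "finite Z \<Longrightarrow> x \<in> Z \<Longrightarrow> card Z \<noteq> 0"
  by auto

locale schur_setting =
  fixes m n r :: nat and K :: "'k::field_char_0 itself"
begin

sublocale signed_action m n r "\<lambda>a. m < a" "act_sgn m r :: _ \<Rightarrow> _ \<Rightarrow> 'k"
  by (rule signed_action_act_sgn)

abbreviation eps :: "(nat \<Rightarrow> nat) \<Rightarrow> (nat \<Rightarrow> nat) \<Rightarrow> 'k" where "eps \<equiv> act_sgn m r"
abbreviation \<chi> :: "(nat \<Rightarrow> nat) \<Rightarrow> (nat \<Rightarrow> nat) \<Rightarrow> 'k superpoly" where "\<chi> \<equiv> chi m r"
abbreviation A :: "'k superpoly set" where "A \<equiv> A_deg m n r"
abbreviation S :: "'k functional set" where "S \<equiv> schur m n r"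
abbreviation mult :: "'k functional \<Rightarrow> 'k functional \<Rightarrow> 'k functional" where "mult \<equiv> schur_mult m n r"
abbreviation lact :: "'k functional \<Rightarrow> 'k superpoly \<Rightarrow> 'k superpoly" where "lact \<equiv> A_lact m n r"
abbreviation ract :: "'k functional \<Rightarrow> 'k superpoly \<Rightarrow> 'k superpoly" where "ract \<equiv> A_ract m n r"

lemma eps_mult_self [simp]: "i \<in> Ix \<Longrightarrow> \<pi> \<in> perms r \<Longrightarrow> eps i \<pi> * eps i \<pi> = 1"
  by (rule sg_square)

lemma A_zero: "0 \<in> A" by (simp add: A_deg_def A_alg_def)

lemma A_add: "f \<in> A \<Longrightarrow> g \<in> A \<Longrightarrow> f + g \<in> A"
proof -
  assume f: "f \<in> A" and g: "g \<in> A"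
  have "{M. (f + g) M \<noteq> 0} \<subseteq> {M. f M \<noteq> 0} \<union> {M. g M \<noteq> 0}" by auto
  then have "finite {M. (f + g) M \<noteq> 0}" using f g finite_subset unfolding A_deg_def A_alg_def by blast
  moreover have "(f + g) M \<noteq> 0 \<Longrightarrow> f M \<noteq> 0 \<or> g M \<noteq> 0" for M by auto
  ultimately show "f + g \<in> A" using f g unfolding A_deg_def A_alg_def by blast
qed

lemma A_scale: "f \<in> A \<Longrightarrow> fscale c f \<in> A"
proof -
  assume f: "f \<in> A"
  have "{M. fscale c f M \<noteq> 0} \<subseteq> {M. f M \<noteq> 0}" by auto
  then have "finite {M. fscale c f M \<noteq> 0}" using f finite_subset unfolding A_deg_def A_alg_def by blast
  then show "fscale c f \<in> A" using f unfolding A_deg_def A_alg_def by auto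
qed

lemma A_subspace: "fs.subspace A"
  by (rule fs.subspaceI) (auto simp: A_zero A_add A_scale)

lemma A_sum: "(\<And>x. x \<in> X \<Longrightarrow> F x \<in> A) \<Longrightarrow> (\<Sum>x\<in>X. F x) \<in> A"
  by (rule fs.subspace_sum[OF A_subspace])

lemma pos_monom_props:
  assumes "i \<in> Ix" "j \<in> Ix"
  shows "set_mset (pos_monom r i j) \<subseteq> {1..m + n} \<times> {1..m + n}" "size (pos_monom r i j) = r"
  using assms by (auto simp: pos_monom_def multiindices_def PiE_def Pi_def)

lemma chi_in_A [simp]:
  assumes "i \<in> Ix" "j \<in> Ix"
  shows "\<chi> i j \<in> A"
proof -
  have "{M. \<chi> i j M \<noteq> 0} \<subseteq> {pos_monom r i j}" by (auto simp: chi_eq)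
  then have "finite {M. \<chi> i j M \<noteq> 0}" using finite_subset by blast
  moreover have "M = pos_monom r i j \<and> super_monom m M" if "\<chi> i j M \<noteq> 0" for M
    using that by (auto simp: chi_eq split: if_splits)
  ultimately show ?thesis using pos_monom_props[OF assms] unfolding A_deg_def A_alg_def by blast
qed

lemma A_support:
  assumes f: "f \<in> A" and M: "f M \<noteq> 0"
  obtains i j where "i \<in> Ix" "j \<in> Ix" "M = pos_monom r i j" "super_monom m M"
proof -
  have MA: "set_mset M \<subseteq> {1..m + n} \<times> {1..m + n}" "super_monom m M" "size M = r"
    using assms by (auto simp: A_deg_def A_alg_def)
  obtain xs where xs: "mset xs = M" using ex_mset by blast
  have len: "length xs = r" using xs MA by (metis size_mset)
  define i where "i = (\<lambda>t\<in>{1..r}. fst (xs ! (t - 1)))"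
  define j where "j = (\<lambda>t\<in>{1..r}. snd (xs ! (t - 1)))"
  have "xs ! (t - 1) \<in> {1..m + n} \<times> {1..m + n}" if "t \<in> {1..r}" for t
  proof -
    have "t - 1 < length xs" using that len by auto
    then show ?thesis using MA(1) xs nth_mem by fastforce
  qed
  then have "i \<in> Ix" "j \<in> Ix" unfolding i_def j_def multiindices_def by (force simp: mem_Times_iff)+
  moreover have "M = pos_monom r i j"
  proof -
    have "pos_monom r i j = image_mset (\<lambda>t. xs ! (t - 1)) (mset_set {1..r})"
      unfolding pos_monom_def by (intro image_mset_cong) (auto simp: i_def j_def)
    also have "\<dots> = M" using image_mset_nth[of xs] xs len by simp
    finally show ?thesis ..
  qed
  ultimately show ?thesis using that MA(2) by blast
qed

text \<open>The symmetry that the \<open>\<chi> i j\<close> themselves have. By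
  \<open>lift_chi\<close> and \<open>S_equivariant\<close> these are exactly the matrices that
  extend linearly to \<open>A\<close>, so \<open>S\<close> is the algebra of equivariant
  matrices.\<close>

definition equivariant :: "((nat \<Rightarrow> nat) \<Rightarrow> (nat \<Rightarrow> nat) \<Rightarrow> 'k) \<Rightarrow> bool" where
  "equivariant G \<longleftrightarrow> (\<forall>i\<in>Ix. \<forall>j\<in>Ix. \<forall>\<pi>\<in>perms r. G (i \<circ> \<pi>) (j \<circ> \<pi>) = eps i \<pi> * eps j \<pi> * G i j)"

text \<open>Coefficients expressing an element of \<open>A(m|n,r)\<close> by the spanning set of all \<open>\<chi>\<^bsub>i,j\<^esub>\<close>, spread evenly
  over the pairs \<open>(i,j)\<close> with the same monomial.\<close>

definition coord :: "'k superpoly \<Rightarrow> (nat \<Rightarrow> nat) \<times> (nat \<Rightarrow> nat) \<Rightarrow> 'k" where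
  "coord f x = chi_sgn m r (fst x) (snd x) * f (pos_monom r (fst x) (snd x)) /
     of_nat (card {y\<in>Ix \<times> Ix. pos_monom r (fst y) (snd y) = pos_monom r (fst x) (snd x)})"

text \<open>Swapping the two positions of a repeated odd generator fixes \<open>k\<close> and
  \<open>l\<close>, but the total sign is -1 since exactly one of the two symbols is odd.\<close>

lemma equivariant_zero:
  assumes G: "equivariant G" and kl: "k \<in> Ix" "l \<in> Ix" and ns: "\<not> super_monom m (pos_monom r k l)"
  shows "G k l = 0"
proof -
  obtain s t where st: "s \<in> {1..r}" "t \<in> {1..r}" "s \<noteq> t" "k s = k t" "l s = l t" "odd (gen_par m (k s, l s))"
    using not_super_pos_monomD[OF ns] by blast
  have "k \<circ> transpose s t = k" "l \<circ> transpose s t = l" using st by (auto simp: fun_eq_iff transpose_def)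
  then have "G k l = eps k (transpose s t) * eps l (transpose s t) * G k l"
    using G kl transpose_perms[OF st(1,2)] unfolding equivariant_def by metis
  also have "eps k (transpose s t) * eps l (transpose s t) = -1"
    using st by (auto simp: act_sgn_transpose odd_gen_par)
  finally have "2 * G k l = 0" by (metis add.right_inverse mult_2 mult_minus1)
  then show ?thesis by simp
qed

text \<open>Pairs with the same monomial differ by one permutation of both indices, whose sign
  occurs once in \<open>coord\<close> and once in \<open>G\<close>. So all of them contribute the
  same amount.\<close>

lemma lift_chi:
  assumes G: "equivariant G" and kl: "k \<in> Ix" "l \<in> Ix"
  shows "(\<Sum>x\<in>Ix \<times> Ix. coord (\<chi> k l) x * G (fst x) (snd x)) = G k l"
proof (cases "super_monom m (pos_monom r k l)")
  case False
  then have "\<chi> k l = (\<lambda>_. 0)" by (auto simp: chi_eq fun_eq_iff)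
  then show ?thesis using equivariant_zero[OF G kl False] by (simp add: coord_def)
next
  case True
  let ?Z = "{y\<in>Ix \<times> Ix. pos_monom r (fst y) (snd y) = pos_monom r k l}"
  have fin: "finite ?Z" by simp
  have "(\<Sum>x\<in>Ix \<times> Ix. coord (\<chi> k l) x * G (fst x) (snd x)) = (\<Sum>x\<in>?Z. coord (\<chi> k l) x * G (fst x) (snd x))"
    by (intro sum.mono_neutral_right) (auto simp: coord_def chi_eq)
  also have "\<dots> = (\<Sum>x\<in>?Z. G k l / of_nat (card ?Z))"
  proof (intro sum.cong refl)
    fix x assume x: "x \<in> ?Z"
    then obtain i j where xij: "x = (i, j)" "i \<in> Ix" "j \<in> Ix" "pos_monom r i j = pos_monom r k l" by auto
    obtain \<pi> where p: "\<pi> \<in> perms r" "i = k \<circ> \<pi>" "j = l \<circ> \<pi>"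
      using pos_monom_eqD[OF xij(4,2,3) kl] by blast
    have "chi_sgn m r i j * chi_sgn m r k l = (eps k \<pi> * eps l \<pi> :: 'k)"
      unfolding p(2,3) chi_sgn_comp[OF p(1) True] by (simp add: mult.assoc chi_sgn_square)
    moreover have "G i j = eps k \<pi> * eps l \<pi> * G k l" using G kl p unfolding equivariant_def by auto
    moreover have "eps k \<pi> * eps l \<pi> * (eps k \<pi> * eps l \<pi>) = 1"
      using eps_mult_self[OF kl(1) p(1)] eps_mult_self[OF kl(2) p(1)] by (metis mult.assoc mult.commute mult_1)
    ultimately have "chi_sgn m r i j * chi_sgn m r k l * G i j = G k l" by (metis mult.assoc mult_1)
    then show "coord (\<chi> k l) x * G (fst x) (snd x) = G k l / of_nat (card ?Z)"
      using True by (simp add: coord_def xij chi_eq)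
  qed
  also have "\<dots> = G k l"
  proof -
    have "(k, l) \<in> ?Z" using kl by simp
    with fin have "card ?Z \<noteq> 0" by (rule card_nonzeroI)
    then show ?thesis by simp
  qed
  finally show ?thesis .
qed

lemma chi_equivariant: "equivariant (\<lambda>i j. \<chi> i j M)"
  by (simp add: equivariant_def chi_comp)

lemma coord_add: "coord (f + g) x = coord f x + coord g x"
  by (simp add: coord_def ring_distribs add_divide_distrib)

lemma coord_scale: "coord (fscale c f) x = c * coord f x"
  by (simp add: coord_def)

lemma chi_expand:
  assumes f: "f \<in> A"
  shows "f = (\<Sum>x\<in>Ix \<times> Ix. fscale (coord f x) (\<chi> (fst x) (snd x)))"
proof
  fix M
  let ?Z = "{y\<in>Ix \<times> Ix. pos_monom r (fst y) (snd y) = M}"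
  have "(\<Sum>x\<in>Ix \<times> Ix. fscale (coord f x) (\<chi> (fst x) (snd x))) M =
      (\<Sum>x\<in>Ix \<times> Ix. coord f x * \<chi> (fst x) (snd x) M)" by (simp add: sum_fun_apply)
  also have "\<dots> = (\<Sum>x\<in>?Z. coord f x * \<chi> (fst x) (snd x) M)"
    by (intro sum.mono_neutral_right) (auto simp: chi_eq)
  also have "\<dots> = (\<Sum>x\<in>?Z. f M / of_nat (card ?Z))"
  proof (intro sum.cong refl)
    fix x assume x: "x \<in> ?Z"
    show "coord f x * \<chi> (fst x) (snd x) M = f M / of_nat (card ?Z)"
    proof (cases "super_monom m M")
      case True
      have "chi_sgn m r (fst x) (snd x) * (chi_sgn m r (fst x) (snd x) * f M) = f M"
        by (simp add: chi_sgn_square flip: mult.assoc)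
      then show ?thesis using x True by (simp add: coord_def chi_eq mult_ac)
    next
      case False
      then have "f M = 0" using f unfolding A_deg_def A_alg_def by blast
      then show ?thesis using False by (simp add: chi_eq)
    qed
  qed
  also have "\<dots> = f M"
  proof (cases "f M = 0")
    case False
    then obtain i j where "i \<in> Ix" "j \<in> Ix" "M = pos_monom r i j" using A_support[OF f] by metis
    then have "(i, j) \<in> ?Z" by simp
    moreover have "finite ?Z" by simp
    ultimately have "card ?Z \<noteq> 0" by (intro card_nonzeroI)
    then show ?thesis by simp
  qed simp
  finally show "f M = (\<Sum>x\<in>Ix \<times> Ix. fscale (coord f x) (\<chi> (fst x) (snd x))) M" by simp
qed

lemma lin_on_A_expand:
  assumes "lin_on fscale s A F" "f \<in> A"
  shows "F f = (\<Sum>x\<in>Ix \<times> Ix. s (coord f x) (F (\<chi> (fst x) (snd x))))"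
proof -
  have "F (\<Sum>x\<in>Ix \<times> Ix. fscale (coord f x) (\<chi> (fst x) (snd x))) =
      (\<Sum>x\<in>Ix \<times> Ix. s (coord f x) (F (\<chi> (fst x) (snd x))))"
    by (rule lin_on_sum[OF assms(1) A_zero A_add A_scale]) auto
  then show ?thesis using chi_expand[OF assms(2)] by simp
qed

lemma lin_on_A_ext:
  assumes "lin_on fscale s A F" "lin_on fscale s A F'"
    and "\<And>i j. i \<in> Ix \<Longrightarrow> j \<in> Ix \<Longrightarrow> F (\<chi> i j) = F' (\<chi> i j)" and "f \<in> A"
  shows "F f = F' f"
  unfolding lin_on_A_expand[OF assms(1,4)] lin_on_A_expand[OF assms(2,4)]
  by (intro sum.cong refl arg_cong2[where f = s] assms(3)) auto

definition to_S :: "((nat \<Rightarrow> nat) \<Rightarrow> (nat \<Rightarrow> nat) \<Rightarrow> 'k) \<Rightarrow> 'k functional" where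
  "to_S F f = (if f \<in> A then \<Sum>x\<in>Ix \<times> Ix. coord f x * F (fst x) (snd x) else 0)"

lemma to_S_in [simp]: "to_S F \<in> S"
  unfolding schur_def lin_on_def to_S_def
  by (auto simp: A_add A_scale coord_add coord_scale sum.distrib ring_distribs sum_distrib_left mult.assoc)

lemma to_S_chi [simp]: "equivariant F \<Longrightarrow> i \<in> Ix \<Longrightarrow> j \<in> Ix \<Longrightarrow> to_S F (\<chi> i j) = F i j"
  unfolding to_S_def using lift_chi by simp

lemma S_lin: "\<xi> \<in> S \<Longrightarrow> lin_on fscale (*) A \<xi>"
  by (simp add: schur_def)

lemma S_ext:
  assumes "\<xi> \<in> S" "\<eta> \<in> S" "\<And>i j. i \<in> Ix \<Longrightarrow> j \<in> Ix \<Longrightarrow> \<xi> (\<chi> i j) = \<eta> (\<chi> i j)"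
  shows "\<xi> = \<eta>"
proof
  fix f
  show "\<xi> f = \<eta> f"
  proof (cases "f \<in> A")
    case True
    then show ?thesis using lin_on_A_ext[OF S_lin[OF assms(1)] S_lin[OF assms(2)]] assms(3) by blast
  next
    case False
    then show ?thesis using assms(1,2) by (simp add: schur_def)
  qed
qed

lemma S_equivariant:
  assumes "\<xi> \<in> S"
  shows "equivariant (\<lambda>i j. \<xi> (\<chi> i j))"
  unfolding equivariant_def
proof (intro ballI)
  fix i j \<pi> assume ij: "i \<in> Ix" "j \<in> Ix" and p: "\<pi> \<in> perms r"
  have "\<chi> (i \<circ> \<pi>) (j \<circ> \<pi>) = fscale (eps i \<pi> * eps j \<pi>) (\<chi> i j)" by (auto simp: fun_eq_iff chi_comp[OF p])
  then show "\<xi> (\<chi> (i \<circ> \<pi>) (j \<circ> \<pi>)) = eps i \<pi> * eps j \<pi> * \<xi> (\<chi> i j)"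
    using S_lin[OF assms] chi_in_A[OF ij] unfolding lin_on_def by simp
qed

lemma S_chi_comp:
  "\<xi> \<in> S \<Longrightarrow> i \<in> Ix \<Longrightarrow> j \<in> Ix \<Longrightarrow> \<pi> \<in> perms r \<Longrightarrow> \<xi> (\<chi> (i \<circ> \<pi>) (j \<circ> \<pi>)) = eps i \<pi> * eps j \<pi> * \<xi> (\<chi> i j)"
  using S_equivariant unfolding equivariant_def by blast

text \<open>Reindexing the middle index by \<open>\<pi>\<close> makes its sign appear twice.\<close>

lemma equivariant_mult:
  assumes F: "equivariant F" and G: "equivariant G"
  shows "equivariant (\<lambda>i j. \<Sum>s\<in>Ix. F i s * G s j)"
  unfolding equivariant_def
proof (intro ballI)
  fix i j \<pi> assume ij: "i \<in> Ix" "j \<in> Ix" and p: "\<pi> \<in> perms r"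
  have "(\<Sum>s\<in>Ix. F (i \<circ> \<pi>) s * G s (j \<circ> \<pi>)) = (\<Sum>s\<in>Ix. F (i \<circ> \<pi>) (s \<circ> \<pi>) * G (s \<circ> \<pi>) (j \<circ> \<pi>))"
    by (rule sum_multiindices_perm[OF p, symmetric])
  also have "\<dots> = (\<Sum>s\<in>Ix. eps i \<pi> * eps j \<pi> * (F i s * G s j))"
  proof (intro sum.cong refl)
    fix s assume s: "s \<in> Ix"
    have "F (i \<circ> \<pi>) (s \<circ> \<pi>) = eps i \<pi> * eps s \<pi> * F i s" "G (s \<circ> \<pi>) (j \<circ> \<pi>) = eps s \<pi> * eps j \<pi> * G s j"
      using F G ij s p unfolding equivariant_def by blast+
    then have "F (i \<circ> \<pi>) (s \<circ> \<pi>) * G (s \<circ> \<pi>) (j \<circ> \<pi>) = (eps s \<pi> * eps s \<pi>) * (eps i \<pi> * eps j \<pi> * (F i s * G s j))"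
      by (simp only: mult_ac)
    then show "F (i \<circ> \<pi>) (s \<circ> \<pi>) * G (s \<circ> \<pi>) (j \<circ> \<pi>) = eps i \<pi> * eps j \<pi> * (F i s * G s j)"
      using eps_mult_self[OF s p] by simp
  qed
  finally show "(\<Sum>s\<in>Ix. F (i \<circ> \<pi>) s * G s (j \<circ> \<pi>)) = eps i \<pi> * eps j \<pi> * (\<Sum>s\<in>Ix. F i s * G s j)"
    by (simp add: sum_distrib_left)
qed

lemma mult_spec:
  assumes "\<xi> \<in> S" "\<eta> \<in> S"
  shows "mult \<xi> \<eta> \<in> S \<and> (\<forall>p\<in>Ix. \<forall>q\<in>Ix. mult \<xi> \<eta> (\<chi> p q) = (\<Sum>s\<in>Ix. \<xi> (\<chi> p s) * \<eta> (\<chi> s q)))"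
proof -
  let ?F = "\<lambda>p q. \<Sum>s\<in>Ix. \<xi> (\<chi> p s) * \<eta> (\<chi> s q)"
  have e: "equivariant ?F" by (rule equivariant_mult[OF S_equivariant[OF assms(1)] S_equivariant[OF assms(2)]])
  have "mult \<xi> \<eta> = to_S ?F"
    unfolding schur_mult_def using e by (intro the_equality S_ext) auto
  then show ?thesis using e by simp
qed

lemma mult_in [simp]: "\<xi> \<in> S \<Longrightarrow> \<eta> \<in> S \<Longrightarrow> mult \<xi> \<eta> \<in> S"
  using mult_spec by blast

lemma mult_chi:
  "\<xi> \<in> S \<Longrightarrow> \<eta> \<in> S \<Longrightarrow> p \<in> Ix \<Longrightarrow> q \<in> Ix \<Longrightarrow> mult \<xi> \<eta> (\<chi> p q) = (\<Sum>s\<in>Ix. \<xi> (\<chi> p s) * \<eta> (\<chi> s q))"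
  using mult_spec by blast

lemma equivariant_id: "equivariant (\<lambda>i j. if i = j \<and> Q i then 1 else 0)"
  if "\<And>i \<pi>. i \<in> Ix \<Longrightarrow> \<pi> \<in> perms r \<Longrightarrow> Q (i \<circ> \<pi>) \<longleftrightarrow> Q i"
  unfolding equivariant_def
proof (intro ballI)
  fix i j \<pi> assume ij: "i \<in> Ix" "j \<in> Ix" and p: "\<pi> \<in> perms r"
  have "i \<circ> \<pi> = j \<circ> \<pi> \<longleftrightarrow> i = j" using perms_inv_comp_assoc(3)[OF p] by metis
  then show "(if i \<circ> \<pi> = j \<circ> \<pi> \<and> Q (i \<circ> \<pi>) then 1 else 0) = eps i \<pi> * eps j \<pi> * (if i = j \<and> Q i then 1 else 0)"
    using that[OF ij(1) p] eps_mult_self[OF ij(1) p] by auto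
qed

abbreviation one :: "'k functional" where "one \<equiv> schur_one m n r"

lemma one_spec: "one \<in> S \<and> (\<forall>i\<in>Ix. \<forall>j\<in>Ix. one (\<chi> i j) = (if i = j then 1 else 0))"
proof -
  define e where "e = to_S (\<lambda>i j. if i = j \<and> True then 1 else 0)"
  have e: "e \<in> S" "\<And>i j. i \<in> Ix \<Longrightarrow> j \<in> Ix \<Longrightarrow> e (\<chi> i j) = (if i = j then 1 else 0)"
    unfolding e_def using equivariant_id[of "\<lambda>_. True"] by simp_all
  have unit: "mult e \<xi> = \<xi> \<and> mult \<xi> e = \<xi>" if x: "\<xi> \<in> S" for \<xi>
  proof
    show "mult e \<xi> = \<xi>" using x e
      by (intro S_ext) (simp_all add: mult_chi if_distrib[of "\<lambda>x. x * _"] sum.delta' cong: if_cong)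
    show "mult \<xi> e = \<xi>" using x e
      by (intro S_ext) (simp_all add: mult_chi if_distrib[of "\<lambda>x. _ * x"] sum.delta cong: if_cong)
  qed
  have "one = e" unfolding schur_one_def
  proof (rule the_equality)
    show "e \<in> S \<and> (\<forall>\<xi>\<in>S. mult e \<xi> = \<xi> \<and> mult \<xi> e = \<xi>)" using e unit by blast
  next
    fix e' assume "e' \<in> S \<and> (\<forall>\<xi>\<in>S. mult e' \<xi> = \<xi> \<and> mult \<xi> e' = \<xi>)"
    then show "e' = e" using e unit by metis
  qed
  then show ?thesis using e by simp
qed

lemma one_in [simp]: "one \<in> S" using one_spec by blast

lemma one_chi: "i \<in> Ix \<Longrightarrow> j \<in> Ix \<Longrightarrow> one (\<chi> i j) = (if i = j then 1 else 0)"
  using one_spec by blast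

definition lift_A :: "((nat \<Rightarrow> nat) \<Rightarrow> (nat \<Rightarrow> nat) \<Rightarrow> 'x \<Rightarrow> 'k) \<Rightarrow> 'k superpoly \<Rightarrow> 'x \<Rightarrow> 'k" where
  "lift_A G f = (if f \<in> A then \<Sum>x\<in>Ix \<times> Ix. fscale (coord f x) (G (fst x) (snd x)) else 0)"

lemma lift_A_lin: "lin_on fscale fscale A (lift_A G)"
  unfolding lin_on_def lift_A_def
  by (auto simp: A_add A_scale coord_add coord_scale fun_eq_iff sum_fun_apply sum.distrib ring_distribs
      sum_distrib_left mult.assoc)

lemma lift_A_chi:
  assumes "\<And>M. equivariant (\<lambda>i j. G i j M)" "i \<in> Ix" "j \<in> Ix"
  shows "lift_A G (\<chi> i j) = G i j"
  unfolding lift_A_def using lift_chi[OF assms(1) assms(2,3)] assms(2,3)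
  by (auto simp: fun_eq_iff sum_fun_apply)

lemma lact_spec:
  assumes x: "\<xi> \<in> S"
  shows "lin_on fscale fscale A (lact \<xi>) \<and> (\<forall>f. f \<notin> A \<longrightarrow> lact \<xi> f = 0) \<and>
    (\<forall>i\<in>Ix. \<forall>j\<in>Ix. lact \<xi> (\<chi> i j) = (\<Sum>a\<in>Ix. fscale (\<xi> (\<chi> a j)) (\<chi> i a)))"
proof -
  let ?G = "\<lambda>i j. \<Sum>a\<in>Ix. fscale (\<xi> (\<chi> a j)) (\<chi> i a)"
  have "equivariant (\<lambda>i j. ?G i j M)" for M
    using equivariant_mult[OF chi_equivariant S_equivariant[OF x], of M] by (simp add: sum_fun_apply mult.commute)
  then have *: "lin_on fscale fscale A (lift_A ?G) \<and> (\<forall>f. f \<notin> A \<longrightarrow> lift_A ?G f = 0) \<and>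
    (\<forall>i\<in>Ix. \<forall>j\<in>Ix. lift_A ?G (\<chi> i j) = ?G i j)"
    using lift_A_lin[of ?G] lift_A_chi[of ?G] by (auto simp: lift_A_def)
  have "lact \<xi> = lift_A ?G"
    unfolding A_lact_def
  proof (rule the_equality)
    fix F assume F: "lin_on fscale fscale A F \<and> (\<forall>f. f \<notin> A \<longrightarrow> F f = 0) \<and> (\<forall>i\<in>Ix. \<forall>j\<in>Ix. F (\<chi> i j) = ?G i j)"
    show "F = lift_A ?G"
    proof
      fix f
      show "F f = lift_A ?G f"
        using lin_on_A_ext[of fscale F "lift_A ?G" f] F * by (cases "f \<in> A") auto
    qed
  qed (rule *)
  then show ?thesis using * by simp
qed

lemma ract_spec:
  assumes x: "\<xi> \<in> S"
  shows "lin_on fscale fscale A (ract \<xi>) \<and> (\<forall>f. f \<notin> A \<longrightarrow> ract \<xi> f = 0) \<and>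
    (\<forall>i\<in>Ix. \<forall>j\<in>Ix. ract \<xi> (\<chi> i j) = (\<Sum>b\<in>Ix. fscale (\<xi> (\<chi> i b)) (\<chi> b j)))"
proof -
  let ?G = "\<lambda>i j. \<Sum>b\<in>Ix. fscale (\<xi> (\<chi> i b)) (\<chi> b j)"
  have "equivariant (\<lambda>i j. ?G i j M)" for M
    using equivariant_mult[OF S_equivariant[OF x] chi_equivariant, of M] by (simp add: sum_fun_apply)
  then have *: "lin_on fscale fscale A (lift_A ?G) \<and> (\<forall>f. f \<notin> A \<longrightarrow> lift_A ?G f = 0) \<and>
    (\<forall>i\<in>Ix. \<forall>j\<in>Ix. lift_A ?G (\<chi> i j) = ?G i j)"
    using lift_A_lin[of ?G] lift_A_chi[of ?G] by (auto simp: lift_A_def)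
  have "ract \<xi> = lift_A ?G"
    unfolding A_ract_def
  proof (rule the_equality)
    fix F assume F: "lin_on fscale fscale A F \<and> (\<forall>f. f \<notin> A \<longrightarrow> F f = 0) \<and> (\<forall>i\<in>Ix. \<forall>j\<in>Ix. F (\<chi> i j) = ?G i j)"
    show "F = lift_A ?G"
    proof
      fix f
      show "F f = lift_A ?G f"
        using lin_on_A_ext[of fscale F "lift_A ?G" f] F * by (cases "f \<in> A") auto
    qed
  qed (rule *)
  then show ?thesis using * by simp
qed

section \<open>Contents, weights and the weight idempotents\<close>

lemma content_iff_perm:
  assumes i: "i \<in> Ix" "has_content m n r i \<mu>" and k: "k \<in> Ix"
  shows "(\<exists>\<pi>. \<pi> permutes {1..r} \<and> k = i \<circ> \<pi>) \<longleftrightarrow> has_content m n r k \<mu>"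
proof
  have cnt: "count (image_mset i (mset_set {1..r})) a = card {t\<in>{1..r}. i t = a}" for i a
    by (simp add: count_image_mset_eq_card_vimage)
  {
    assume "\<exists>\<pi>. \<pi> permutes {1..r} \<and> k = i \<circ> \<pi>"
    then obtain \<pi> where p: "\<pi> permutes {1..r}" "k = i \<circ> \<pi>" by blast
    then have "image_mset k (mset_set {1..r}) = image_mset i (mset_set {1..r})"
      using permutes_image_mset[OF p(1)] by (metis multiset.map_comp)
    then have "card {t\<in>{1..r}. k t = a} = card {t\<in>{1..r}. i t = a}" for a unfolding cnt[symmetric] by simp
    then show "has_content m n r k \<mu>" using i(2) by (simp add: has_content_def)
  }
  assume h: "has_content m n r k \<mu>"
  have "image_mset k (mset_set {1..r}) = image_mset i (mset_set {1..r})"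
  proof (rule multiset_eqI)
    fix a
    show "count (image_mset k (mset_set {1..r})) a = count (image_mset i (mset_set {1..r})) a"
    proof (cases "a \<in> {1..m + n}")
      case True
      then show ?thesis using h i(2) unfolding cnt has_content_def by simp
    next
      case False
      then have "{t\<in>{1..r}. k t = a} = {}" "{t\<in>{1..r}. i t = a} = {}"
        using i k by (auto simp: multiindices_def PiE_def Pi_def)
      then show ?thesis unfolding cnt by (simp only: card.empty)
    qed
  qed
  then obtain \<pi> where p: "\<pi> permutes {1..r}" "\<forall>t\<in>{1..r}. k t = i (\<pi> t)"
    using image_mset_eq_implies_permutes[of "{1..r}" k i] by auto
  then have "i \<circ> \<pi> \<in> Ix" using i by (simp add: perms_def)
  then have "k = i \<circ> \<pi>" using k p(2) unfolding multiindices_def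
    by (intro extensionalityI[of _ "{1..r}"]) (auto simp: PiE_def)
  then show "\<exists>\<pi>. \<pi> permutes {1..r} \<and> k = i \<circ> \<pi>" using p(1) by blast
qed

abbreviation widem :: "(nat \<Rightarrow> nat) \<Rightarrow> 'k functional" where "widem \<equiv> weight_idem m n r"

text \<open>A multiindex of content \<open>\<mu>\<close> must exist: otherwise the defining
  condition of \<open>weight_idem\<close> is vacuous and \<open>THE\<close> determines
  nothing.\<close>

lemma widem_spec:
  assumes i: "i \<in> Ix" "has_content m n r i \<mu>"
  shows "widem \<mu> \<in> S \<and> (\<forall>k\<in>Ix. \<forall>l\<in>Ix. widem \<mu> (\<chi> k l) = (if k = l \<and> has_content m n r k \<mu> then 1 else 0))"
proof -
  let ?F = "\<lambda>k l. if k = l \<and> has_content m n r k \<mu> then 1 else (0 :: 'k)"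
  have Q: "has_content m n r (k \<circ> \<pi>) \<mu> \<longleftrightarrow> has_content m n r k \<mu>" if "k \<in> Ix" "\<pi> \<in> perms r" for k \<pi>
  proof -
    have "has_content m n r (k \<circ> \<pi>) \<mu>" if "has_content m n r k \<mu>" "k \<in> Ix" "\<pi> \<in> perms r" for k \<pi>
      using content_iff_perm[OF that(2,1), of "k \<circ> \<pi>"] that by (auto simp: perms_def)
    from this[of k \<pi>] this[of "k \<circ> \<pi>" "inv \<pi>"] show ?thesis
      using that perms_inv_comp_assoc(3)[OF that(2), of k] by auto
  qed
  have e: "equivariant ?F" using equivariant_id[of "\<lambda>k. has_content m n r k \<mu>"] Q by blast
  have iff: "(if k = l \<and> (\<exists>\<pi>. \<pi> permutes {1..r} \<and> k = j \<circ> \<pi>) then 1 else 0) = ?F k l"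
    if "j \<in> Ix" "has_content m n r j \<mu>" "k \<in> Ix" for j k l
    using content_iff_perm[OF that] by simp
  have "widem \<mu> = to_S ?F"
    unfolding weight_idem_def
  proof (rule the_equality)
    show "to_S ?F \<in> S \<and> (\<forall>i\<in>Ix. has_content m n r i \<mu> \<longrightarrow> (\<forall>k\<in>Ix. \<forall>l\<in>Ix. to_S ?F (\<chi> k l) =
        (if k = l \<and> (\<exists>\<pi>. \<pi> permutes {1..r} \<and> k = i \<circ> \<pi>) then 1 else 0)))"
      using e iff by simp
    fix \<xi> assume "\<xi> \<in> S \<and> (\<forall>i\<in>Ix. has_content m n r i \<mu> \<longrightarrow> (\<forall>k\<in>Ix. \<forall>l\<in>Ix. \<xi> (\<chi> k l) =
        (if k = l \<and> (\<exists>\<pi>. \<pi> permutes {1..r} \<and> k = i \<circ> \<pi>) then 1 else 0)))"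
    then have "\<xi> \<in> S" "\<And>k l. k \<in> Ix \<Longrightarrow> l \<in> Ix \<Longrightarrow> \<xi> (\<chi> k l) = ?F k l"
      using i iff[OF i] by auto
    then show "\<xi> = to_S ?F" using e by (intro S_ext) simp_all
  qed
  then show ?thesis using e by simp
qed

definition content :: "(nat \<Rightarrow> nat) \<Rightarrow> nat \<Rightarrow> nat" where
  "content i a = (if a \<in> {1..m + n} then card {t\<in>{1..r}. i t = a} else 0)"

lemma has_content_content: "has_content m n r i (content i)"
  by (simp add: has_content_def content_def)

lemma has_content_iff: "\<mu> \<in> weights m n r \<Longrightarrow> has_content m n r i \<mu> \<longleftrightarrow> content i = \<mu>"
  by (auto simp: has_content_def content_def weights_def fun_eq_iff)

lemma content_weights:
  assumes "i \<in> Ix"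
  shows "content i \<in> weights m n r"
proof -
  have "(\<Sum>a = 1..m + n. content i a) = (\<Sum>a\<in>{1..m + n}. card {t\<in>{1..r}. i t = a})"
    by (intro sum.cong) (auto simp: content_def)
  also have "\<dots> = card (\<Union>a\<in>{1..m + n}. {t\<in>{1..r}. i t = a})"
    by (intro card_UN_disjoint[symmetric]) auto
  also have "(\<Union>a\<in>{1..m + n}. {t\<in>{1..r}. i t = a}) = {1..r}"
    using assms by (fastforce simp: multiindices_def PiE_def Pi_def)
  finally show ?thesis by (simp add: weights_def content_def)
qed

lemma content_exists:
  assumes "\<mu> \<in> weights m n r"
  shows "\<exists>i\<in>Ix. content i = \<mu>"
proof -
  define M where "M = (\<Sum>a\<in>{1..m + n}. replicate_mset (\<mu> a) a)"
  have cM: "count M a = (if a \<in> {1..m + n} then \<mu> a else 0)" for a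
    unfolding M_def count_sum by (simp add: count_replicate_mset sum.delta)
  have "size (\<Sum>a\<in>B. replicate_mset (\<mu> a) a) = (\<Sum>a\<in>B. \<mu> a)" if "finite B" for B
    using that by (induction B) auto
  then have "size M = r" using assms by (simp add: M_def weights_def)
  obtain xs where xs: "mset xs = M" using ex_mset by blast
  then have len: "length xs = r" using \<open>size M = r\<close> by (metis size_mset)
  define i where "i = (\<lambda>t\<in>{1..r}. xs ! (t - 1))"
  have "xs ! (t - 1) \<in> {1..m + n}" if "t \<in> {1..r}" for t
  proof -
    have "t - 1 < length xs" using that len by auto
    then have "xs ! (t - 1) \<in># M" unfolding xs[symmetric] by (simp add: nth_mem_mset)
    then have "count M (xs ! (t - 1)) \<noteq> 0" by simp
    then show ?thesis unfolding cM by (auto split: if_splits)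
  qed
  then have iI: "i \<in> Ix" unfolding i_def multiindices_def by auto
  have "image_mset i (mset_set {1..r}) = image_mset (\<lambda>t. xs ! (t - 1)) (mset_set {1..r})"
    by (intro image_mset_cong) (auto simp: i_def)
  also have "\<dots> = M" using image_mset_nth[of xs] xs len by simp
  finally have im: "image_mset i (mset_set {1..r}) = M" .
  have "card {t\<in>{1..r}. i t = a} = count M a" for a
    unfolding im[symmetric] by (simp add: count_image_mset_eq_card_vimage)
  then have "content i = \<mu>" using assms by (auto simp: content_def cM weights_def fun_eq_iff)
  then show ?thesis using iI by blast
qed

lemma widem_in: "\<mu> \<in> weights m n r \<Longrightarrow> widem \<mu> \<in> S"
  using content_exists widem_spec has_content_content by blast

lemma widem_chi:
  assumes "\<mu> \<in> weights m n r" "k \<in> Ix" "l \<in> Ix"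
  shows "widem \<mu> (\<chi> k l) = (if k = l \<and> content k = \<mu> then 1 else 0)"
  using content_exists[OF assms(1)] widem_spec[of _ \<mu>] has_content_content assms has_content_iff[OF assms(1)]
  by metis

end

section \<open>\<open>A(m|n,r)\<close> as a superbimodule\<close>

lemma bit_add_self [simp]: "(p :: bit) + p = 0" "(p :: bit) + (p + q) = q"
  by (cases p; cases q; simp)+

lemma bit_neq_iff: "(p :: bit) \<noteq> q \<longleftrightarrow> p = q + 1"
  by (cases p; cases q; simp)

context schur_setting
begin

abbreviation Ac :: "bit \<Rightarrow> 'k superpoly set" where "Ac \<equiv> A_comp m n r"
abbreviation Sc :: "bit \<Rightarrow> 'k functional set" where "Sc \<equiv> schur_comp m n r"

text \<open>Parity of a single multiindex, valued in \<open>bit\<close> so that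
  \<open>\<chi> i j\<close> has parity \<open>tp i + tp j\<close>.\<close>

definition tp :: "(nat \<Rightarrow> nat) \<Rightarrow> bit" where
  "tp i = of_nat (\<Sum>t = 1..r. par m (i t))"

lemma monom_par_pos: "of_nat (monom_par m (pos_monom r i j)) = tp i + tp j"
proof -
  have "monom_par m (pos_monom r i j) = (\<Sum>t = 1..r. par m (i t)) + (\<Sum>t = 1..r. par m (j t))"
    by (simp add: monom_par_def pos_monom_def gen_par_def multiset.map_comp comp_def sum_unfold_sum_mset sum_mset.distrib)
  then show ?thesis by (simp only: of_nat_add tp_def)
qed

lemma Ac_subset: "f \<in> Ac p \<Longrightarrow> f \<in> A" by (simp add: A_comp_def)

lemma Ac_subspace: "fs.subspace (Ac p)"
proof (rule fs.subspaceI)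
  show "0 \<in> Ac p" by (simp add: A_comp_def A_zero)
  show "f + g \<in> Ac p" if "f \<in> Ac p" "g \<in> Ac p" for f g
  proof -
    have "(f + g) M \<noteq> 0 \<Longrightarrow> f M \<noteq> 0 \<or> g M \<noteq> 0" for M by auto
    then show ?thesis using that A_add unfolding A_comp_def by blast
  qed
  show "fscale c f \<in> Ac p" if "f \<in> Ac p" for c f
    using that by (auto simp: A_comp_def A_scale)
qed

lemma Ac_disjoint:
  assumes "f \<in> Ac p" "f \<in> Ac q" "p \<noteq> q"
  shows "f = 0"
proof
  fix M show "f M = 0 M" using assms unfolding A_comp_def by (cases "f M = 0") auto
qed

lemma chi_Ac: "i \<in> Ix \<Longrightarrow> j \<in> Ix \<Longrightarrow> \<chi> i j \<in> Ac (tp i + tp j)"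
  by (auto simp: A_comp_def chi_eq monom_par_pos)

lemma Sc_chi:
  assumes "\<xi> \<in> Sc p" "i \<in> Ix" "j \<in> Ix" "\<xi> (\<chi> i j) \<noteq> 0"
  shows "tp i + tp j = p"
proof (rule ccontr)
  assume "tp i + tp j \<noteq> p"
  then have "tp i + tp j = p + 1" by (simp only: bit_neq_iff)
  then have "\<chi> i j \<in> Ac (p + 1)" using chi_Ac[OF assms(2,3)] by (simp only:)
  then show False using assms unfolding schur_comp_def by blast
qed

lemma coord_Ac:
  assumes "f \<in> Ac q" "coord f x \<noteq> 0"
  shows "tp (fst x) + tp (snd x) = q"
proof -
  have "f (pos_monom r (fst x) (snd x)) \<noteq> 0" using assms(2) unfolding coord_def by auto
  then show ?thesis using assms(1) unfolding A_comp_def monom_par_pos[symmetric] by blast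
qed

lemma lact_lin: "\<xi> \<in> S \<Longrightarrow> lin_on fscale fscale A (lact \<xi>)" using lact_spec by blast
lemma ract_lin: "\<xi> \<in> S \<Longrightarrow> lin_on fscale fscale A (ract \<xi>)" using ract_spec by blast

lemma lact_chi:
  "\<xi> \<in> S \<Longrightarrow> i \<in> Ix \<Longrightarrow> j \<in> Ix \<Longrightarrow> lact \<xi> (\<chi> i j) = (\<Sum>a\<in>Ix. fscale (\<xi> (\<chi> a j)) (\<chi> i a))"
  using lact_spec by blast

lemma ract_chi:
  "\<xi> \<in> S \<Longrightarrow> i \<in> Ix \<Longrightarrow> j \<in> Ix \<Longrightarrow> ract \<xi> (\<chi> i j) = (\<Sum>b\<in>Ix. fscale (\<xi> (\<chi> i b)) (\<chi> b j))"
  using ract_spec by blast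

lemma lact_expand:
  "\<xi> \<in> S \<Longrightarrow> f \<in> A \<Longrightarrow> lact \<xi> f = (\<Sum>x\<in>Ix \<times> Ix. fscale (coord f x) (\<Sum>a\<in>Ix. fscale (\<xi> (\<chi> a (snd x))) (\<chi> (fst x) a)))"
  using lin_on_A_expand[OF lact_lin] by (simp add: lact_chi mem_Times_iff)

lemma ract_expand:
  "\<xi> \<in> S \<Longrightarrow> f \<in> A \<Longrightarrow> ract \<xi> f = (\<Sum>x\<in>Ix \<times> Ix. fscale (coord f x) (\<Sum>b\<in>Ix. fscale (\<xi> (\<chi> (fst x) b)) (\<chi> b (snd x))))"
  using lin_on_A_expand[OF ract_lin] by (simp add: ract_chi mem_Times_iff)

lemma lact_in [simp]: "\<xi> \<in> S \<Longrightarrow> f \<in> A \<Longrightarrow> lact \<xi> f \<in> A"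
  by (simp add: lact_expand) (intro A_sum A_scale chi_in_A, auto)

lemma ract_in [simp]: "\<xi> \<in> S \<Longrightarrow> f \<in> A \<Longrightarrow> ract \<xi> f \<in> A"
  by (simp add: ract_expand) (intro A_sum A_scale chi_in_A, auto)

lemma lin_on_A_sum:
  assumes "lin_on fscale s' A f" "\<And>x. x \<in> X \<Longrightarrow> v x \<in> A"
  shows "f (\<Sum>x\<in>X. fscale (c x) (v x)) = (\<Sum>x\<in>X. s' (c x) (f (v x)))"
  by (rule lin_on_sum[OF assms(1) A_zero A_add A_scale assms(2)])

lemma lin_on_A_comp:
  assumes "lin_on fscale fscale A f" "lin_on fscale fscale A g" "\<And>v. v \<in> A \<Longrightarrow> g v \<in> A"
  shows "lin_on fscale fscale A (\<lambda>v. f (g v))"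
  using assms unfolding lin_on_def by simp

lemma lact_mult:
  assumes x: "\<xi> \<in> S" and y: "\<eta> \<in> S" and f: "f \<in> A"
  shows "lact (mult \<xi> \<eta>) f = lact \<xi> (lact \<eta> f)"
proof (rule lin_on_A_ext[OF lact_lin lin_on_A_comp[OF lact_lin lact_lin] _ f])
  fix i j assume ij: "i \<in> Ix" "j \<in> Ix"
  have "lact \<xi> (lact \<eta> (\<chi> i j)) = (\<Sum>a\<in>Ix. fscale (\<eta> (\<chi> a j)) (lact \<xi> (\<chi> i a)))"
    unfolding lact_chi[OF y ij] by (rule lin_on_A_sum[OF lact_lin[OF x]]) (use ij in auto)
  also have "\<dots> = lact (mult \<xi> \<eta>) (\<chi> i j)"
    using ij x y by (simp add: lact_chi mult_chi fun_eq_iff sum_fun_apply sum_distrib_left sum_distrib_right)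
      (subst sum.swap, simp add: mult_ac)
  finally show "lact (mult \<xi> \<eta>) (\<chi> i j) = lact \<xi> (lact \<eta> (\<chi> i j))" ..
qed (use x y in auto)

lemma ract_mult:
  assumes x: "\<xi> \<in> S" and y: "\<eta> \<in> S" and f: "f \<in> A"
  shows "ract (mult \<xi> \<eta>) f = ract \<eta> (ract \<xi> f)"
proof (rule lin_on_A_ext[OF ract_lin lin_on_A_comp[OF ract_lin ract_lin] _ f])
  fix i j assume ij: "i \<in> Ix" "j \<in> Ix"
  have "ract \<eta> (ract \<xi> (\<chi> i j)) = (\<Sum>a\<in>Ix. fscale (\<xi> (\<chi> i a)) (ract \<eta> (\<chi> a j)))"
    unfolding ract_chi[OF x ij] by (rule lin_on_A_sum[OF ract_lin[OF y]]) (use ij in auto)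
  also have "\<dots> = ract (mult \<xi> \<eta>) (\<chi> i j)"
    using ij x y by (simp add: ract_chi mult_chi fun_eq_iff sum_fun_apply sum_distrib_left sum_distrib_right)
      (subst sum.swap, simp add: mult_ac)
  finally show "ract (mult \<xi> \<eta>) (\<chi> i j) = ract \<eta> (ract \<xi> (\<chi> i j))" ..
qed (use x y in auto)

lemma lact_ract:
  assumes x: "\<xi> \<in> S" and y: "\<eta> \<in> S" and f: "f \<in> A"
  shows "ract \<eta> (lact \<xi> f) = lact \<xi> (ract \<eta> f)"
proof (rule lin_on_A_ext[OF lin_on_A_comp[OF ract_lin lact_lin] lin_on_A_comp[OF lact_lin ract_lin] _ f])
  fix i j assume ij: "i \<in> Ix" "j \<in> Ix"
  have "ract \<eta> (lact \<xi> (\<chi> i j)) = (\<Sum>a\<in>Ix. fscale (\<xi> (\<chi> a j)) (ract \<eta> (\<chi> i a)))"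
    unfolding lact_chi[OF x ij] by (rule lin_on_A_sum[OF ract_lin[OF y]]) (use ij in auto)
  moreover have "lact \<xi> (ract \<eta> (\<chi> i j)) = (\<Sum>b\<in>Ix. fscale (\<eta> (\<chi> i b)) (lact \<xi> (\<chi> b j)))"
    unfolding ract_chi[OF y ij] by (rule lin_on_A_sum[OF lact_lin[OF x]]) (use ij in auto)
  ultimately show "ract \<eta> (lact \<xi> (\<chi> i j)) = lact \<xi> (ract \<eta> (\<chi> i j))"
    using ij x y by (simp add: ract_chi lact_chi fun_eq_iff sum_fun_apply sum_distrib_left)
      (subst sum.swap, simp add: mult_ac)
qed (use x y in auto)

lemma lin_on_id: "lin_on s s V (\<lambda>v. v)" by (simp add: lin_on_def)

lemma lact_one: "f \<in> A \<Longrightarrow> lact one f = f"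
proof (rule lin_on_A_ext[OF lact_lin lin_on_id])
  show "lact one (\<chi> i j) = \<chi> i j" if "i \<in> Ix" "j \<in> Ix" for i j
  proof -
    have "fscale (one (\<chi> a j)) (\<chi> i a) = (if a = j then \<chi> i a else 0)" if "a \<in> Ix" for a
      using that \<open>j \<in> Ix\<close> by (simp add: one_chi fscale_def zero_fun_def)
    then show ?thesis using that by (simp add: lact_chi sum.delta cong: sum.cong)
  qed
qed auto

lemma ract_one: "f \<in> A \<Longrightarrow> ract one f = f"
proof (rule lin_on_A_ext[OF ract_lin lin_on_id])
  show "ract one (\<chi> i j) = \<chi> i j" if "i \<in> Ix" "j \<in> Ix" for i j
  proof -
    have "fscale (one (\<chi> i b)) (\<chi> b j) = (if i = b then \<chi> b j else 0)" if "b \<in> Ix" for b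
      using that \<open>i \<in> Ix\<close> by (simp add: one_chi fscale_def zero_fun_def)
    then show ?thesis using that by (simp add: ract_chi sum.delta' cong: sum.cong)
  qed
qed auto

lemma Sc_S: "\<xi> \<in> Sc p \<Longrightarrow> \<xi> \<in> S" by (simp add: schur_comp_def)

lemma lact_Ac:
  assumes x: "\<xi> \<in> Sc p" and f: "f \<in> Ac q"
  shows "lact \<xi> f \<in> Ac (p + q)"
  unfolding lact_expand[OF Sc_S[OF x] Ac_subset[OF f]] fs.scale_sum_right
proof (intro fs.subspace_sum[OF Ac_subspace])
  fix y a assume y: "y \<in> Ix \<times> Ix" and a: "a \<in> Ix"
  show "fscale (coord f y) (fscale (\<xi> (\<chi> a (snd y))) (\<chi> (fst y) a)) \<in> Ac (p + q)"
  proof (cases "coord f y = 0 \<or> \<xi> (\<chi> a (snd y)) = 0")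
    case True
    then show ?thesis using fs.subspace_0[OF Ac_subspace] by (auto simp: fscale_def zero_fun_def)
  next
    case False
    have "tp (fst y) + tp (snd y) = q" by (rule coord_Ac[OF f]) (use False in blast)
    moreover have "tp a + tp (snd y) = p" by (rule Sc_chi[OF x a]) (use False y in auto)
    ultimately have "p + q = tp (fst y) + tp a" by (metis add.commute add.left_commute bit_add_self(2))
    then show ?thesis using chi_Ac[of "fst y" a] y a by (intro fs.subspace_scale[OF Ac_subspace]) (simp only: mem_Times_iff)
  qed
qed

lemma ract_Ac:
  assumes x: "\<xi> \<in> Sc p" and f: "f \<in> Ac q"
  shows "ract \<xi> f \<in> Ac (p + q)"
  unfolding ract_expand[OF Sc_S[OF x] Ac_subset[OF f]] fs.scale_sum_right
proof (intro fs.subspace_sum[OF Ac_subspace])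
  fix y a assume y: "y \<in> Ix \<times> Ix" and a: "a \<in> Ix"
  show "fscale (coord f y) (fscale (\<xi> (\<chi> (fst y) a)) (\<chi> a (snd y))) \<in> Ac (p + q)"
  proof (cases "coord f y = 0 \<or> \<xi> (\<chi> (fst y) a) = 0")
    case True
    then show ?thesis using fs.subspace_0[OF Ac_subspace] by (auto simp: fscale_def zero_fun_def)
  next
    case False
    have "tp (fst y) + tp (snd y) = q" by (rule coord_Ac[OF f]) (use False in blast)
    moreover have "tp (fst y) + tp a = p" by (rule Sc_chi[OF x _ a]) (use False y in auto)
    ultimately have "p + q = tp a + tp (snd y)" by (metis add.commute add.left_commute bit_add_self(2))
    then show ?thesis using chi_Ac[of a "snd y"] y a by (intro fs.subspace_scale[OF Ac_subspace]) (simp only: mem_Times_iff)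
  qed
qed

lemma S_add: "\<xi> \<in> S \<Longrightarrow> \<eta> \<in> S \<Longrightarrow> \<xi> + \<eta> \<in> S"
  by (auto simp: schur_def lin_on_def ring_distribs)

lemma S_scale: "\<xi> \<in> S \<Longrightarrow> fscale c \<xi> \<in> S"
  by (auto simp: schur_def lin_on_def ring_distribs)

lemma S_zero: "0 \<in> S" by (simp add: schur_def lin_on_def)

lemma lact_lin_S: "f \<in> A \<Longrightarrow> lin_on fscale fscale S (\<lambda>\<xi>. lact \<xi> f)"
  unfolding lin_on_def
  by (auto simp: lact_expand S_add S_scale fun_eq_iff sum_fun_apply sum.distrib ring_distribs
      sum_distrib_left mult_ac)

lemma ract_lin_S: "f \<in> A \<Longrightarrow> lin_on fscale fscale S (\<lambda>\<xi>. ract \<xi> f)"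
  unfolding lin_on_def
  by (auto simp: ract_expand S_add S_scale fun_eq_iff sum_fun_apply sum.distrib ring_distribs
      sum_distrib_left mult_ac)

definition sub_space :: "'k superpoly set \<Rightarrow> ('k, 'k superpoly) gspace" where
  "sub_space W = \<lparr>scal = fscale, carr = W, hcomp = (\<lambda>p. W \<inter> Ac p)\<rparr>"

lemma sub_space_simps [simp]:
  "scal (sub_space W) = fscale" "carr (sub_space W) = W" "hcomp (sub_space W) p = W \<inter> Ac p"
  by (simp_all add: sub_space_def)

lemma homogeneous_span_decomp:
  assumes B: "\<And>b. b \<in> B \<Longrightarrow> \<exists>p. b \<in> Ac p" and f: "f \<in> fs.span B"
  shows "\<exists>v\<in>fs.span B \<inter> Ac 0. \<exists>w\<in>fs.span B \<inter> Ac 1. f = v + w"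
  using f
proof (induction rule: fs.span_induct_alt)
  case base
  show ?case
    by (intro bexI[of _ 0] IntI fs.subspace_0[OF Ac_subspace] fs.span_zero) simp
next
  case (step c b f)
  then obtain v w where vw: "v \<in> fs.span B \<inter> Ac 0" "w \<in> fs.span B \<inter> Ac 1" "f = v + w" by blast
  obtain p where p: "b \<in> Ac p" using B step by blast
  have cb: "fscale c b \<in> fs.span B" "fscale c b \<in> Ac p"
    using step p by (auto intro: fs.span_scale fs.span_base fs.subspace_scale[OF Ac_subspace])
  show ?case
  proof (cases "p = 0")
    case True
    have "fscale c b + v \<in> fs.span B \<inter> Ac 0"
      using vw cb True by (blast intro: fs.span_add fs.subspace_add[OF Ac_subspace])
    moreover have "fscale c b + f = (fscale c b + v) + w" unfolding vw(3) by (rule add.assoc[symmetric])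
    ultimately show ?thesis using vw(2) by blast
  next
    case False
    then have "p = 1" by (cases p) auto
    then have "fscale c b + w \<in> fs.span B \<inter> Ac 1"
      using vw cb by (blast intro: fs.span_add fs.subspace_add[OF Ac_subspace])
    moreover have "fscale c b + f = v + (fscale c b + w)" unfolding vw(3) by (rule add.left_commute)
    ultimately show ?thesis using vw(1) by blast
  qed
qed

lemma graded_sub_space:
  assumes "\<And>b. b \<in> B \<Longrightarrow> \<exists>p. b \<in> Ac p"
  shows "graded_space (sub_space (fs.span B))"
  unfolding graded_space_def sub_space_simps
proof (intro conjI allI)
  show "fs.span B = {v + w |v w. v \<in> fs.span B \<inter> Ac 0 \<and> w \<in> fs.span B \<inter> Ac 1}"
  proof -
    have "\<exists>v\<in>fs.span B \<inter> Ac 0. \<exists>w\<in>fs.span B \<inter> Ac 1. f = v + w" if "f \<in> fs.span B" for f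
      using assms that by (rule homogeneous_span_decomp)
    then show ?thesis by (fastforce intro: fs.span_add)
  qed
  show "fs.span B \<inter> Ac 0 \<inter> (fs.span B \<inter> Ac 1) = {0}"
    using Ac_disjoint[of _ 0 1] fs.subspace_0[OF Ac_subspace] fs.span_zero by auto
qed (auto intro: fs.vector_space_axioms fs.subspace_inter Ac_subspace)

lemma lin_on_subset: "lin_on s s' V f \<Longrightarrow> W \<subseteq> V \<Longrightarrow> lin_on s s' W f"
  unfolding lin_on_def by blast

lemma left_supermodule_sub_space:
  assumes g: "graded_space (sub_space W)" and W: "W \<subseteq> A" and stab: "\<And>\<xi> f. \<xi> \<in> S \<Longrightarrow> f \<in> W \<Longrightarrow> lact \<xi> f \<in> W"
  shows "left_supermodule m n r (sub_space W) lact"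
  unfolding left_supermodule_def graded_action_def sub_space_simps
proof (intro conjI ballI allI)
  fix \<xi> assume x: "\<xi> \<in> S"
  show "lin_on fscale fscale W (lact \<xi>)" by (rule lin_on_subset[OF lact_lin[OF x] W])
  show "lact \<xi> ` W \<subseteq> W" using stab x by blast
next
  fix p q \<xi> v assume "\<xi> \<in> Sc p" "v \<in> W \<inter> Ac q"
  then show "lact \<xi> v \<in> W \<inter> Ac (p + q)" using stab[OF Sc_S, of \<xi> p v] lact_Ac[of \<xi> p v q] by auto
qed (use g W lact_lin_S lact_one lact_mult in auto)

lemma right_supermodule_sub_space:
  assumes g: "graded_space (sub_space W)" and W: "W \<subseteq> A" and stab: "\<And>\<xi> f. \<xi> \<in> S \<Longrightarrow> f \<in> W \<Longrightarrow> ract \<xi> f \<in> W"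
  shows "right_supermodule m n r (sub_space W) ract"
  unfolding right_supermodule_def graded_action_def sub_space_simps
proof (intro conjI ballI allI)
  fix \<xi> assume x: "\<xi> \<in> S"
  show "lin_on fscale fscale W (ract \<xi>)" by (rule lin_on_subset[OF ract_lin[OF x] W])
  show "ract \<xi> ` W \<subseteq> W" using stab x by blast
next
  fix p q \<xi> v assume "\<xi> \<in> Sc p" "v \<in> W \<inter> Ac q"
  then show "ract \<xi> v \<in> W \<inter> Ac (p + q)" using stab[OF Sc_S, of \<xi> p v] ract_Ac[of \<xi> p v q] by auto
qed (use g W ract_lin_S ract_one ract_mult in auto)

end

section \<open>Symmetrizers\<close>

lemma fscale_span_induct_lin:
  fixes F :: "('x \<Rightarrow> 'k::field) \<Rightarrow> ('y \<Rightarrow> 'k)"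
  assumes lin: "lin_on fscale fscale V F" and V: "fs.subspace V" and B: "B \<subseteq> V"
    and gen: "\<And>b. b \<in> B \<Longrightarrow> F b \<in> W" and W: "fs.subspace W" and f: "f \<in> fs.span B"
  shows "F f \<in> W"
proof -
  have "f \<in> V \<and> F f \<in> W" using f
  proof (induction rule: fs.span_induct_alt)
    case base
    show ?case unfolding lin_on_0[OF lin fs.subspace_0[OF V]]
      using fs.subspace_0[OF V] fs.subspace_0[OF W] by blast
  next
    case (step c b f)
    then have b: "b \<in> V" "fscale c b \<in> V" "F b \<in> W" using B gen fs.subspace_scale[OF V] by blast+
    then have "F (fscale c b + f) = fscale c (F b) + F f" using lin step unfolding lin_on_def by simp
    moreover have "fscale c b + f \<in> V" "fscale c (F b) + F f \<in> W"
      using step b fs.subspace_add[OF V] fs.subspace_add[OF W] fs.subspace_scale[OF W] by blast+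
    ultimately show ?case by (simp only:)
  qed
  then show ?thesis ..
qed

locale tableau_setting = schur_setting m n r K + young_shape r row col
  for m n r and K :: "'k::field_char_0 itself" and row col
begin

sublocale signed_young m n r "\<lambda>a. m < a" "act_sgn m r :: _ \<Rightarrow> _ \<Rightarrow> 'k" row col
  by (intro signed_young.intro signed_action_axioms young_shape_axioms)

definition hc :: 'k where "hc = of_int hook_const"

lemma hc_nonzero [simp]: "hc \<noteq> 0"
  using hook_const_nonzero by (simp add: hc_def)

abbreviation RS :: "(nat \<Rightarrow> nat) \<Rightarrow> 'k" where "RS \<equiv> rowsum r row"
abbreviation CS :: "(nat \<Rightarrow> nat) \<Rightarrow> 'k" where "CS \<equiv> colsum r col"

lemma act_young_idem: "j \<in> Ix \<Longrightarrow> act Y (act Y H) j = hc * act Y H j"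
proof -
  assume j: "j \<in> Ix"
  have "conv r Y Y = (\<lambda>\<pi>. hc * Y \<pi>)" by (rule ext) (simp add: young_idem hc_def)
  then show ?thesis using j by (simp add: grp_act_conv grp_act_scale)
qed

text \<open>On an eigenfunction, \<open>h\<close> may be replaced by \<open>Y h\<close> at the cost
  of \<open>hc\<close>; then \<open>young_sandwich\<close> applies and \<open>hc\<close> is
  cancelled.\<close>

lemma act_young_sandwich:
  assumes h: "\<And>i. i \<in> Ix \<Longrightarrow> act Y h i = hc * h i" and j: "j \<in> Ix" and p: "\<pi> \<in> perms r"
  shows "act Y (act (delta \<pi>) h) j = hc * Y (inv \<pi>) * h j"
proof -
  have "hc * act Y (act (delta \<pi>) h) j = act Y (act (delta \<pi>) (\<lambda>i. hc * h i)) j"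
    by (simp add: grp_act_const[abs_def] grp_act_const)
  also have "\<dots> = act Y (act (delta \<pi>) (act Y h)) j"
    using j h by (intro grp_act_cong) auto
  also have "\<dots> = act (conv r Y (conv r (delta \<pi>) Y)) h j"
  proof -
    have "act Y (act (delta \<pi>) (act Y h)) j = act Y (act (conv r (delta \<pi>) Y) h) j"
      using j by (intro grp_act_cong grp_act_conv)
    then show ?thesis by (simp add: grp_act_conv j)
  qed
  also have "\<dots> = hc * Y (inv \<pi>) * act Y h j"
    unfolding young_sandwich[OF p] hc_def by (simp add: grp_act_scale)
  also have "\<dots> = hc * (hc * Y (inv \<pi>) * h j)" by (simp add: h j)
  finally show ?thesis by simp
qed

lemma young_inv:
  assumes "\<pi> \<in> perms r"
  shows "Y (inv \<pi>) = conv r RS CS \<pi>"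
  unfolding young_def conv_inv[OF assms] using assms by (intro conv_cong) (auto simp: rowsum_inv colsum_inv)

lemma act_young_inv: "j \<in> Ix \<Longrightarrow> act (\<lambda>\<sigma>. Y (inv \<sigma>)) H j = act RS (act CS H) j"
  unfolding grp_act_conv by (simp add: grp_act_def young_inv)

text \<open>Inverting \<open>Y Y = hc Y\<close> gives the same relation for rows times
  columns.\<close>

lemma act_RCRC:
  assumes j: "j \<in> Ix"
  shows "act RS (act Y (act CS H)) j = hc * act RS (act CS H) j"
proof -
  have "act RS (act Y (act CS H)) j = act RS (act CS (act RS (act CS H))) j"
    using j by (intro grp_act_cong act_young)
  also have "\<dots> = act RS (act CS (act (conv r RS CS) H)) j"
    using j by (intro grp_act_cong grp_act_conv)
  also have "\<dots> = act (conv r (conv r RS CS) (conv r RS CS)) H j"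
    using j by (simp add: grp_act_conv)
  also have "\<dots> = act (\<lambda>\<sigma>. hc * conv r RS CS \<sigma>) H j"
    unfolding grp_act_def
  proof (intro sum.cong refl)
    fix \<pi> assume p: "\<pi> \<in> perms r"
    have "conv r (conv r RS CS) (conv r RS CS) \<pi> = conv r Y Y (inv \<pi>)"
      unfolding conv_inv[OF p] using p by (intro conv_cong) (auto simp: young_inv)
    also have "\<dots> = hc * conv r RS CS \<pi>" by (simp add: young_idem hc_def young_inv p)
    finally show "conv r (conv r RS CS) (conv r RS CS) \<pi> * eps j \<pi> * H (j \<circ> \<pi>) =
      hc * conv r RS CS \<pi> * eps j \<pi> * H (j \<circ> \<pi>)" by simp
  qed
  finally show ?thesis by (simp add: grp_act_scale grp_act_conv j)
qed

text \<open>Equivariance trades a permutation of the first index for its inverse on the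
  second.\<close>

lemma act_move:
  assumes G: "equivariant G" and i: "i \<in> Ix" and j: "j \<in> Ix"
  shows "act g (\<lambda>i. G i j) i = act (\<lambda>\<sigma>. g (inv \<sigma>)) (G i) j"
proof -
  have "act g (\<lambda>i. G i j) i = (\<Sum>\<pi>\<in>perms r. g \<pi> * eps j (inv \<pi>) * G i (j \<circ> inv \<pi>))"
    unfolding grp_act_def
  proof (intro sum.cong refl)
    fix \<pi> assume p: "\<pi> \<in> perms r"
    have jp: "j \<circ> inv \<pi> \<in> Ix" using j p by simp
    have "G (i \<circ> \<pi>) (j \<circ> inv \<pi> \<circ> \<pi>) = eps i \<pi> * eps (j \<circ> inv \<pi>) \<pi> * G i (j \<circ> inv \<pi>)"
      using G i jp p unfolding equivariant_def by blast
    moreover have "eps (j \<circ> inv \<pi>) \<pi> = eps j (inv \<pi>)" using sg_inv[OF j perms_inv[OF p]] p by simp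
    ultimately show "g \<pi> * eps i \<pi> * G (i \<circ> \<pi>) j = g \<pi> * eps j (inv \<pi>) * G i (j \<circ> inv \<pi>)"
      using sg_square_left[OF i p, of "eps j (inv \<pi>) * G i (j \<circ> inv \<pi>)"]
      by (simp add: perms_inv_comp_assoc(4)[OF p] mult.assoc)
  qed
  also have "\<dots> = act (\<lambda>\<sigma>. g (inv \<sigma>)) (G i) j"
    unfolding grp_act_def by (subst sum_perms_inv[symmetric]) (intro sum.cong refl, simp)
  finally show ?thesis .
qed

text \<open>The row sum acts on the first index and the column sum on the second. Moved across,
  where inversion leaves it unchanged, the row sum joins the column sum to form \<open>Y\<close> on
  the second index alone.\<close>

lemma row_col_young:
  assumes G: "equivariant G" and ij: "i \<in> Ix" "j \<in> Ix"
  shows "(\<Sum>\<rho>\<in>R. \<Sum>\<kappa>\<in>C. of_int (sign \<kappa>) * eps i \<rho> * eps j \<kappa> * G (i \<circ> \<rho>) (j \<circ> \<kappa>)) = act Y (G i) j"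
proof -
  have "(\<Sum>\<rho>\<in>R. \<Sum>\<kappa>\<in>C. of_int (sign \<kappa>) * eps i \<rho> * eps j \<kappa> * G (i \<circ> \<rho>) (j \<circ> \<kappa>)) =
      (\<Sum>\<kappa>\<in>C. of_int (sign \<kappa>) * eps j \<kappa> * (\<Sum>\<rho>\<in>R. eps i \<rho> * G (i \<circ> \<rho>) (j \<circ> \<kappa>)))"
    by (subst sum.swap) (simp add: sum_distrib_left mult_ac)
  also have "\<dots> = act CS (\<lambda>j. act RS (\<lambda>i. G i j) i) j" by (simp add: grp_act_colsum grp_act_rowsum)
  also have "\<dots> = act CS (act RS (G i)) j"
  proof (rule grp_act_cong[OF ij(2)])
    fix l assume l: "l \<in> Ix"
    show "act RS (\<lambda>i. G i l) i = act RS (G i) l"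
      unfolding act_move[OF G ij(1) l] by (simp add: grp_act_def rowsum_inv)
  qed
  finally show ?thesis by (simp add: act_young ij)
qed

lemma equivariant_average:
  "equivariant (\<lambda>i j. \<Sum>\<pi>\<in>perms r. eps i \<pi> * eps j \<pi> * F (i \<circ> \<pi>) (j \<circ> \<pi>))"
  unfolding equivariant_def
proof (intro ballI)
  fix i j \<sigma> assume ij: "i \<in> Ix" "j \<in> Ix" and s: "\<sigma> \<in> perms r"
  have "(\<Sum>\<pi>\<in>perms r. eps (i \<circ> \<sigma>) \<pi> * eps (j \<circ> \<sigma>) \<pi> * F (i \<circ> \<sigma> \<circ> \<pi>) (j \<circ> \<sigma> \<circ> \<pi>)) =
     (\<Sum>\<pi>\<in>perms r. eps i \<sigma> * eps j \<sigma> * (eps i (\<sigma> \<circ> \<pi>) * eps j (\<sigma> \<circ> \<pi>) * F (i \<circ> (\<sigma> \<circ> \<pi>)) (j \<circ> (\<sigma> \<circ> \<pi>))))"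
  proof (intro sum.cong refl)
    fix \<pi> assume p: "\<pi> \<in> perms r"
    have e: "eps i \<sigma> * eps i (\<sigma> \<circ> \<pi>) = eps (i \<circ> \<sigma>) \<pi>" "eps j \<sigma> * eps j (\<sigma> \<circ> \<pi>) = eps (j \<circ> \<sigma>) \<pi>"
      using sg_comp[OF ij(1) s p] sg_comp[OF ij(2) s p] sg_square_left ij s by simp_all
    show "eps (i \<circ> \<sigma>) \<pi> * eps (j \<circ> \<sigma>) \<pi> * F (i \<circ> \<sigma> \<circ> \<pi>) (j \<circ> \<sigma> \<circ> \<pi>) =
      eps i \<sigma> * eps j \<sigma> * (eps i (\<sigma> \<circ> \<pi>) * eps j (\<sigma> \<circ> \<pi>) * F (i \<circ> (\<sigma> \<circ> \<pi>)) (j \<circ> (\<sigma> \<circ> \<pi>)))"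
      unfolding e[symmetric] o_assoc by (simp only: mult_ac)
  qed
  also have "\<dots> = eps i \<sigma> * eps j \<sigma> * (\<Sum>\<pi>\<in>perms r. eps i \<pi> * eps j \<pi> * F (i \<circ> \<pi>) (j \<circ> \<pi>))"
    unfolding sum_distrib_left[symmetric]
    by (rule arg_cong[where f = "\<lambda>x. eps i \<sigma> * eps j \<sigma> * x"],
        rule sum_perms_left[OF s, of "\<lambda>\<pi>. eps i \<pi> * eps j \<pi> * F (i \<circ> \<pi>) (j \<circ> \<pi>)"])
  finally show "(\<Sum>\<pi>\<in>perms r. eps (i \<circ> \<sigma>) \<pi> * eps (j \<circ> \<sigma>) \<pi> * F (i \<circ> \<sigma> \<circ> \<pi>) (j \<circ> \<sigma> \<circ> \<pi>)) =
      eps i \<sigma> * eps j \<sigma> * (\<Sum>\<pi>\<in>perms r. eps i \<pi> * eps j \<pi> * F (i \<circ> \<pi>) (j \<circ> \<pi>))" .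
qed

definition sym :: "(nat \<Rightarrow> nat) \<Rightarrow> (nat \<Rightarrow> nat) \<Rightarrow> 'k superpoly" where
  "sym i j = (\<Sum>\<rho>\<in>R. \<Sum>\<kappa>\<in>C. fscale (of_int (sign \<kappa>) * eps i \<rho> * eps j \<kappa>) (\<chi> (i \<circ> \<rho>) (j \<circ> \<kappa>)))"

lemma sym_young: "i \<in> Ix \<Longrightarrow> j \<in> Ix \<Longrightarrow> sym i j M = act Y (\<lambda>l. \<chi> i l M) j"
  using row_col_young[OF chi_equivariant, of i j M] by (simp add: sym_def sum_fun_apply)

lemma sym_sum:
  assumes "i \<in> Ix" "j \<in> Ix"
  shows "sym i j = (\<Sum>\<pi>\<in>perms r. fscale (Y \<pi> * eps j \<pi>) (\<chi> i (j \<circ> \<pi>)))"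
  by (auto simp: fun_eq_iff sum_fun_apply sym_young[OF assms] grp_act_def)

lemma sym_in [simp]: "i \<in> Ix \<Longrightarrow> j \<in> Ix \<Longrightarrow> sym i j \<in> A"
  unfolding sym_sum by (intro A_sum A_scale chi_in_A) auto

lemma tp_comp:
  assumes "\<pi> \<in> perms r"
  shows "tp (j \<circ> \<pi>) = tp j"
proof -
  have "bij_betw \<pi> {1..r} {1..r}" using assms by (auto simp: perms_def permutes_imp_bij)
  from sum.reindex_bij_betw[OF this, of "\<lambda>t. par m (j t)"] show ?thesis by (simp add: tp_def)
qed

lemma sym_Ac: "i \<in> Ix \<Longrightarrow> j \<in> Ix \<Longrightarrow> sym i j \<in> Ac (tp i + tp j)"
proof -
  assume ij: "i \<in> Ix" "j \<in> Ix"
  have "\<chi> i (j \<circ> \<pi>) \<in> Ac (tp i + tp j)" if "\<pi> \<in> perms r" for \<pi>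
    using chi_Ac[OF ij(1) multiindices_comp[OF ij(2) that]] unfolding tp_comp[OF that] .
  then show ?thesis unfolding sym_sum[OF ij]
    by (intro fs.subspace_sum[OF Ac_subspace] fs.subspace_scale[OF Ac_subspace])
qed

text \<open>The left action touches only the second index and commutes with the signed action there,
  hence passes through \<open>Y\<close>.\<close>

lemma lact_sym:
  assumes x: "\<xi> \<in> S" and ij: "i \<in> Ix" "j \<in> Ix"
  shows "lact \<xi> (sym i j) = (\<Sum>a\<in>Ix. fscale (\<xi> (\<chi> a j)) (sym i a))"
proof
  fix M
  have "lact \<xi> (sym i j) = (\<Sum>\<pi>\<in>perms r. fscale (Y \<pi> * eps j \<pi>) (lact \<xi> (\<chi> i (j \<circ> \<pi>))))"
    unfolding sym_sum[OF ij] by (rule lin_on_A_sum[OF lact_lin[OF x]]) (use ij in auto)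
  then have "lact \<xi> (sym i j) M = (\<Sum>\<pi>\<in>perms r. Y \<pi> * eps j \<pi> * (\<Sum>a\<in>Ix. \<xi> (\<chi> a (j \<circ> \<pi>)) * \<chi> i a M))"
    using ij by (simp add: lact_chi[OF x] sum_fun_apply)
  also have "\<dots> = (\<Sum>\<pi>\<in>perms r. \<Sum>a\<in>Ix. \<xi> (\<chi> a j) * (Y \<pi> * eps a \<pi> * \<chi> i (a \<circ> \<pi>) M))"
  proof (intro sum.cong refl)
    fix \<pi> assume p: "\<pi> \<in> perms r"
    have "(\<Sum>a\<in>Ix. \<xi> (\<chi> a (j \<circ> \<pi>)) * \<chi> i a M) = (\<Sum>a\<in>Ix. \<xi> (\<chi> (a \<circ> \<pi>) (j \<circ> \<pi>)) * \<chi> i (a \<circ> \<pi>) M)"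
      by (rule sum_multiindices_perm[OF p, symmetric])
    also have "\<dots> = (\<Sum>a\<in>Ix. eps j \<pi> * (\<xi> (\<chi> a j) * (eps a \<pi> * \<chi> i (a \<circ> \<pi>) M)))"
      by (intro sum.cong refl) (simp add: S_chi_comp[OF x _ ij(2) p])
    also have "\<dots> = eps j \<pi> * (\<Sum>a\<in>Ix. \<xi> (\<chi> a j) * (eps a \<pi> * \<chi> i (a \<circ> \<pi>) M))"
      by (rule sum_distrib_left[symmetric])
    finally have E: "(\<Sum>a\<in>Ix. \<xi> (\<chi> a (j \<circ> \<pi>)) * \<chi> i a M) = \<dots>" .
    have cancel: "Y \<pi> * eps j \<pi> * (eps j \<pi> * X) = Y \<pi> * X" for X
      by (simp only: mult.assoc sg_square_left[OF ij(2) p])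
    show "Y \<pi> * eps j \<pi> * (\<Sum>a\<in>Ix. \<xi> (\<chi> a (j \<circ> \<pi>)) * \<chi> i a M) =
        (\<Sum>a\<in>Ix. \<xi> (\<chi> a j) * (Y \<pi> * eps a \<pi> * \<chi> i (a \<circ> \<pi>) M))"
      unfolding E cancel by (simp add: sum_distrib_left mult_ac)
  qed
  also have "\<dots> = (\<Sum>a\<in>Ix. fscale (\<xi> (\<chi> a j)) (sym i a)) M"
    by (subst sum.swap) (simp add: sum_fun_apply sym_young ij grp_act_def sum_distrib_left)
  finally show "lact \<xi> (sym i j) M = (\<Sum>a\<in>Ix. fscale (\<xi> (\<chi> a j)) (sym i a)) M" .
qed

lemma ract_sym:
  assumes x: "\<xi> \<in> S" and ij: "i \<in> Ix" "j \<in> Ix"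
  shows "ract \<xi> (sym i j) = (\<Sum>b\<in>Ix. fscale (\<xi> (\<chi> i b)) (sym b j))"
proof
  fix M
  have "ract \<xi> (sym i j) = (\<Sum>\<pi>\<in>perms r. fscale (Y \<pi> * eps j \<pi>) (ract \<xi> (\<chi> i (j \<circ> \<pi>))))"
    unfolding sym_sum[OF ij] by (rule lin_on_A_sum[OF ract_lin[OF x]]) (use ij in auto)
  then have "ract \<xi> (sym i j) M = (\<Sum>\<pi>\<in>perms r. \<Sum>b\<in>Ix. \<xi> (\<chi> i b) * (Y \<pi> * eps j \<pi> * \<chi> b (j \<circ> \<pi>) M))"
    using ij by (simp add: ract_chi[OF x] sum_fun_apply sum_distrib_left mult_ac)
  also have "\<dots> = (\<Sum>b\<in>Ix. fscale (\<xi> (\<chi> i b)) (sym b j)) M"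
    by (subst sum.swap) (simp add: sum_fun_apply sym_young ij grp_act_def sum_distrib_left)
  finally show "ract \<xi> (sym i j) M = (\<Sum>b\<in>Ix. fscale (\<xi> (\<chi> i b)) (sym b j)) M" .
qed

text \<open>\<open>straightening\<close> is applied to
  \<open>act RS (\<lambda>l. \<chi> i l M)\<close> for every \<open>i\<close> and every monomial
  \<open>M\<close> at once, which is possible because its coefficients do not depend on the
  function.\<close>

lemma sym_straighten_right:
  assumes "j \<in> Ix"
  shows "\<exists>c. \<forall>i\<in>Ix. sym i j = (\<Sum>l\<in>SS. fscale (c l) (sym i l))"
proof -
  obtain c where c: "\<And>F. row_equiv F \<Longrightarrow> act CS F j = (\<Sum>l\<in>SS. c l * act CS F l)"
    using straightening[OF assms] by blast
  have "sym i j M = (\<Sum>l\<in>SS. c l * sym i l M)" if i: "i \<in> Ix" for i M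
  proof -
    have "row_equiv (act RS (\<lambda>l. \<chi> i l M))" unfolding row_equiv_def using rowsum_perm by blast
    from c[OF this] show ?thesis using assms i SS_Ix by (simp add: sym_young act_young)
  qed
  then show ?thesis by (intro exI[of _ c]) (auto simp: fun_eq_iff sum_fun_apply)
qed

lemma sym_row:
  assumes ij: "i \<in> Ix" "j \<in> Ix"
  shows "sym i j M = act RS (\<lambda>i. act CS (\<lambda>l. \<chi> i l M) j) i"
  by (simp add: sym_def sum_fun_apply grp_act_colsum grp_act_rowsum sum_distrib_left mult_ac)

text \<open>In its first index the symmetrizer is a row sum of a function that the column group
  multiplies by twisted signs. In the twisted locale on the transposed shape this is a column sum of
  a row-equivariant function.\<close>

lemma sym_straighten_left:
  assumes i: "i \<in> Ix"
  shows "\<exists>c. \<forall>j\<in>Ix. sym i j = (\<Sum>l\<in>SS. fscale (c l) (sym l j))"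
proof -
  interpret tw: signed_young m n r "\<lambda>a. \<not> m < a" "\<lambda>i \<pi>. of_int (sign \<pi>) * eps i \<pi>" col row
    by (rule twisted_young)
  obtain c where c: "\<And>F. tw.row_equiv F \<Longrightarrow> act RS F i = (\<Sum>l\<in>SS. c l * act RS F l)"
    using tw.straightening[OF i] unfolding twisted_colsum twisted_SS by blast
  have "sym i j M = (\<Sum>l\<in>SS. c l * sym l j M)" if j: "j \<in> Ix" for j M
  proof -
    have "tw.row_equiv (\<lambda>i. act CS (\<lambda>l. \<chi> i l M) j)"
      unfolding tw.row_equiv_def
    proof (intro ballI)
      fix i \<kappa> assume i: "i \<in> Ix" and k: "\<kappa> \<in> C"
      have kp: "\<kappa> \<in> perms r" using k by (rule level_permsD)
      have mv: "act CS (\<lambda>l. \<chi> i l M) j = act CS (\<lambda>i. \<chi> i j M) i" if "i \<in> Ix" for i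
        unfolding act_move[OF chi_equivariant that j] by (simp add: grp_act_def colsum_inv)
      have "act CS (\<lambda>i. \<chi> i j M) i = of_int (sign \<kappa>) * eps i \<kappa> * act CS (\<lambda>i. \<chi> i j M) (i \<circ> \<kappa>)"
        by (rule colsum_perm[OF i k])
      then have "of_int (sign \<kappa>) * eps i \<kappa> * act CS (\<lambda>i. \<chi> i j M) i =
        (of_int (sign \<kappa>) * of_int (sign \<kappa>)) * (eps i \<kappa> * (eps i \<kappa> * act CS (\<lambda>i. \<chi> i j M) (i \<circ> \<kappa>)))"
        by (simp only: mult_ac)
      also have "\<dots> = act CS (\<lambda>i. \<chi> i j M) (i \<circ> \<kappa>)"
        using sg_square_left[OF i kp] by (simp flip: of_int_mult)
      finally show "act CS (\<lambda>l. \<chi> (i \<circ> \<kappa>) l M) j = of_int (sign \<kappa>) * eps i \<kappa> * act CS (\<lambda>l. \<chi> i l M) j"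
        using mv[OF i] mv[of "i \<circ> \<kappa>"] i kp by simp
    qed
    from c[OF this] show ?thesis using i j SS_Ix by (simp add: sym_row)
  qed
  then show ?thesis by (intro exI[of _ c]) (auto simp: fun_eq_iff sum_fun_apply)
qed

text \<open>Test functionals on \<open>A\<close>: \<open>H\<close> is row-symmetrized in its first
  index and then averaged over the symmetric group to become equivariant. They serve both for
  independence and for the map to the tensor product.\<close>

definition theta :: "((nat \<Rightarrow> nat) \<Rightarrow> (nat \<Rightarrow> nat) \<Rightarrow> 'k) \<Rightarrow> 'k functional" where
  "theta H = to_S (\<lambda>i j. \<Sum>\<pi>\<in>perms r. eps i \<pi> * eps j \<pi> * act RS (\<lambda>i. H i (j \<circ> \<pi>)) (i \<circ> \<pi>))"

lemma theta_in [simp]: "theta H \<in> S" by (simp add: theta_def)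

lemma theta_chi:
  "i \<in> Ix \<Longrightarrow> j \<in> Ix \<Longrightarrow>
    theta H (\<chi> i j) = (\<Sum>\<pi>\<in>perms r. eps i \<pi> * eps j \<pi> * act RS (\<lambda>i. H i (j \<circ> \<pi>)) (i \<circ> \<pi>))"
  unfolding theta_def using equivariant_average[of "\<lambda>i j. act RS (\<lambda>i. H i j) i"] by simp

text \<open>Under \<open>Y\<close> in the second index, \<open>act_young_sandwich\<close> turns the
  summand of \<open>\<pi>\<close> into a multiple by \<open>hc * Y (inv \<pi>)\<close>, so the
  average becomes \<open>R C\<close> on the first index. With the row sum already there this is
  \<open>R C R = R Y\<close>, and \<open>Y\<close> yields the second factor
  \<open>hc\<close>.\<close>

lemma theta_sym:
  assumes H1: "\<And>i j. i \<in> Ix \<Longrightarrow> j \<in> Ix \<Longrightarrow> act Y (H i) j = hc * H i j"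
    and H2: "\<And>i j. i \<in> Ix \<Longrightarrow> j \<in> Ix \<Longrightarrow> act Y (\<lambda>i. H i j) i = hc * H i j"
    and ij: "i \<in> Ix" "j \<in> Ix"
  shows "theta H (sym i j) = hc * hc * act RS (\<lambda>i. H i j) i"
proof -
  define RH where "RH i j = act RS (\<lambda>i. H i j) i" for i j
  have RH1: "act Y (RH i) j = hc * RH i j" if "i \<in> Ix" "j \<in> Ix" for i j
  proof -
    have "act Y (RH i) j = act RS (\<lambda>i. act Y (H i) j) i"
      unfolding RH_def grp_act_def[of r eps RS] grp_act_def[of r eps Y] sum_distrib_left
      by (subst sum.swap) (simp add: mult_ac)
    also have "\<dots> = act RS (\<lambda>i. hc * H i j) i" using H1 that by (intro grp_act_cong) auto
    finally show ?thesis by (simp add: grp_act_const RH_def)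
  qed
  have "theta H (sym i j) = (\<Sum>\<pi>\<in>perms r. Y \<pi> * eps j \<pi> * theta H (\<chi> i (j \<circ> \<pi>)))"
    unfolding sym_sum[OF ij]
    by (rule lin_on_A_sum[OF S_lin[OF theta_in]]) (rule chi_in_A[OF ij(1) multiindices_comp[OF ij(2)]])
  also have "\<dots> = act Y (\<lambda>l. \<Sum>\<pi>\<in>perms r. eps i \<pi> * act (delta \<pi>) (RH (i \<circ> \<pi>)) l) j"
    unfolding grp_act_def[of r eps Y] using ij
    by (intro sum.cong refl) (simp add: theta_chi RH_def grp_act_delta mult_ac)
  also have "\<dots> = (\<Sum>\<pi>\<in>perms r. eps i \<pi> * act Y (act (delta \<pi>) (RH (i \<circ> \<pi>))) j)"
    by (simp add: grp_act_sum grp_act_const)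
  also have "\<dots> = (\<Sum>\<pi>\<in>perms r. hc * (Y (inv \<pi>) * eps i \<pi> * RH (i \<circ> \<pi>) j))"
  proof (intro sum.cong refl)
    fix \<pi> assume p: "\<pi> \<in> perms r"
    have "act Y (act (delta \<pi>) (RH (i \<circ> \<pi>))) j = hc * Y (inv \<pi>) * RH (i \<circ> \<pi>) j"
      using ij p by (intro act_young_sandwich RH1) auto
    then show "eps i \<pi> * act Y (act (delta \<pi>) (RH (i \<circ> \<pi>))) j = hc * (Y (inv \<pi>) * eps i \<pi> * RH (i \<circ> \<pi>) j)"
      by simp
  qed
  also have "\<dots> = hc * act (\<lambda>\<sigma>. Y (inv \<sigma>)) (\<lambda>i. RH i j) i"
    by (simp add: grp_act_def sum_distrib_left)
  also have "act (\<lambda>\<sigma>. Y (inv \<sigma>)) (\<lambda>i. RH i j) i = act RS (act CS (act RS (\<lambda>i. H i j))) i"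
    by (simp add: act_young_inv ij RH_def[abs_def])
  also have "\<dots> = act RS (act Y (\<lambda>i. H i j)) i" using ij by (intro grp_act_cong) (auto simp: act_young)
  also have "\<dots> = act RS (\<lambda>i. hc * H i j) i" using ij H2 by (intro grp_act_cong) auto
  finally show ?thesis by (simp add: grp_act_const mult.assoc)
qed

text \<open>As functions of \<open>j\<close> these span the image of \<open>Y\<close>; they are the
  coordinates in which linear relations among symmetrized vectors are tested.\<close>

definition bc :: "(nat \<Rightarrow> nat) \<Rightarrow> (nat \<Rightarrow> nat) \<Rightarrow> 'k" where
  "bc l j = act Y (delta l) j"

lemma bc_young: "j \<in> Ix \<Longrightarrow> act Y (bc l) j = hc * bc l j"
  unfolding bc_def[abs_def] by (rule act_young_idem)

lemma bc_triangular:
  assumes "\<And>l. l \<in> SS \<Longrightarrow> (\<Sum>j\<in>SS. y j * bc l j) = 0" "j \<in> SS"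
  shows "y j = 0"
  using triangular[of y j] assms unfolding bc_def by blast

text \<open>The triangularity for the opposite order of row and column sums comes from the transposed
  shape with the sign-twisted action.\<close>

lemma row_bc_triangular:
  assumes y: "\<And>l. l \<in> Ix \<Longrightarrow> (\<Sum>i\<in>SS. y i * act RS (bc l) i) = 0" and i: "i \<in> SS"
  shows "y i = 0"
proof -
  interpret tw: signed_young m n r "\<lambda>a. \<not> m < a" "\<lambda>i \<pi>. of_int (sign \<pi>) * eps i \<pi>" col row
    by (rule twisted_young)
  have tw_act: "tw.act tw.Y (delta k) i = act RS (act CS (delta k)) i" if "i \<in> Ix" for i k
    using tw.act_young[OF that] unfolding twisted_colsum twisted_rowsum by blast
  show ?thesis
  proof (rule tw.triangular[unfolded twisted_SS, of y])
    fix k assume k: "k \<in> SS"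
    \<comment> \<open>Expanding the column sum of \<open>delta k\<close> into point masses brings in
      the functions \<open>act RS (bc l)\<close>. On the other hand \<open>R Y C = hc R C\<close>,
      and \<open>R C\<close> is the Young symmetrizer of the twisted locale.\<close>
    have exp: "act RS (act Y (act CS (delta k))) i = (\<Sum>l\<in>Ix. act CS (delta k) l * act RS (bc l) i)" if i: "i \<in> Ix" for i
    proof -
      have "act CS (delta k) j = (\<Sum>l\<in>Ix. act CS (delta k) l * delta l j)" if "j \<in> Ix" for j
        using that by (simp add: delta_def if_distrib[of "\<lambda>x. _ * x"] sum.delta cong: if_cong)
      then have "act Y (act CS (delta k)) j = act Y (\<lambda>j. \<Sum>l\<in>Ix. act CS (delta k) l * delta l j) j" if "j \<in> Ix" for j
        using that by (intro grp_act_cong)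
      then have "act Y (act CS (delta k)) j = (\<Sum>l\<in>Ix. act CS (delta k) l * bc l j)" if "j \<in> Ix" for j
        using that by (simp add: grp_act_sum grp_act_const bc_def)
      then have "act RS (act Y (act CS (delta k))) i = act RS (\<lambda>j. \<Sum>l\<in>Ix. act CS (delta k) l * bc l j) i"
        using i by (intro grp_act_cong)
      then show ?thesis by (simp add: grp_act_sum grp_act_const)
    qed
    have "hc * (\<Sum>i\<in>SS. y i * tw.act tw.Y (delta k) i) = (\<Sum>i\<in>SS. y i * act RS (act Y (act CS (delta k))) i)"
      using SS_Ix by (simp add: tw_act act_RCRC sum_distrib_left mult_ac)
    also have "\<dots> = (\<Sum>l\<in>Ix. act CS (delta k) l * (\<Sum>i\<in>SS. y i * act RS (bc l) i))"
      using SS_Ix by (simp add: exp sum_distrib_left) (subst sum.swap, simp add: mult_ac)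
    also have "\<dots> = 0" using y by simp
    finally show "(\<Sum>i\<in>SS. y i * tw.act tw.Y (delta k) i) = 0" by simp
  qed (rule i)
qed

text \<open>Separation of variables: for fixed \<open>k\<close>, triangularity in \<open>j\<close>
  leaves a relation in \<open>i\<close> alone.\<close>

lemma bc_bc_independent:
  assumes x: "\<And>k l. k \<in> Ix \<Longrightarrow> l \<in> Ix \<Longrightarrow> (\<Sum>i\<in>SS. \<Sum>j\<in>SS. x i j * (act RS (bc k) i * bc l j)) = 0"
    and ij: "i \<in> SS" "j \<in> SS"
  shows "x i j = 0"
proof (rule row_bc_triangular[of "\<lambda>i. x i j", OF _ ij(1)])
  fix k assume k: "k \<in> Ix"
  show "(\<Sum>i\<in>SS. x i j * act RS (bc k) i) = 0"
  proof (rule bc_triangular[of "\<lambda>j. \<Sum>i\<in>SS. x i j * act RS (bc k) i", OF _ ij(2)])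
    fix l assume "l \<in> SS"
    then have "(\<Sum>i\<in>SS. \<Sum>j\<in>SS. x i j * (act RS (bc k) i * bc l j)) = 0" using x[OF k SS_Ix] by blast
    then show "(\<Sum>j\<in>SS. (\<Sum>i\<in>SS. x i j * act RS (bc k) i) * bc l j) = 0"
      by (subst (asm) sum.swap) (simp add: sum_distrib_right mult.assoc)
  qed
qed

text \<open>Apply \<open>theta\<close> for the products \<open>bc k i * bc l j\<close>, which are
  eigenfunctions of \<open>Y\<close> in both indices.\<close>

lemma sym_independent:
  assumes z: "(\<Sum>i\<in>SS. \<Sum>j\<in>SS. fscale (x i j) (sym i j)) = 0" and ij: "i \<in> SS" "j \<in> SS"
  shows "x i j = 0"
proof (rule bc_bc_independent[OF _ ij])
  fix k l assume kl: "k \<in> Ix" "l \<in> Ix"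
  define H where "H i j = bc k i * bc l j" for i j
  have th: "theta H (sym i j) = hc * hc * (act RS (bc k) i * bc l j)" if "i \<in> Ix" "j \<in> Ix" for i j
  proof -
    have "theta H (sym i j) = hc * hc * act RS (\<lambda>i. H i j) i"
    proof (rule theta_sym[OF _ _ that])
      fix i j assume "i \<in> Ix" "j \<in> Ix"
      then show "act Y (H i) j = hc * H i j" "act Y (\<lambda>i. H i j) i = hc * H i j"
        unfolding H_def[abs_def] using bc_young grp_act_const[of r eps Y "bc k i" "bc l" j]
          grp_act_const[of r eps Y "bc l j" "bc k" i] by (simp_all add: mult_ac)
    qed
    then show ?thesis unfolding H_def using grp_act_const[of r eps RS "bc l j" "bc k" i] by (simp add: mult_ac)
  qed
  have "0 = theta H (\<Sum>i\<in>SS. \<Sum>j\<in>SS. fscale (x i j) (sym i j))"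
    unfolding z using lin_on_0[OF S_lin[OF theta_in] A_zero] by simp
  also have "(\<Sum>i\<in>SS. \<Sum>j\<in>SS. fscale (x i j) (sym i j)) = (\<Sum>y\<in>SS \<times> SS. fscale (x (fst y) (snd y)) (sym (fst y) (snd y)))"
    by (simp add: sum.cartesian_product case_prod_beta)
  also have "theta H \<dots> = (\<Sum>y\<in>SS \<times> SS. x (fst y) (snd y) * theta H (sym (fst y) (snd y)))"
    by (rule lin_on_A_sum[OF S_lin[OF theta_in]]) (use SS_Ix in auto)
  also have "\<dots> = (\<Sum>y\<in>SS \<times> SS. hc * hc * (x (fst y) (snd y) * (act RS (bc k) (fst y) * bc l (snd y))))"
    using SS_Ix by (intro sum.cong refl) (simp add: th mem_Times_iff)
  also have "\<dots> = hc * hc * (\<Sum>i\<in>SS. \<Sum>j\<in>SS. x i j * (act RS (bc k) i * bc l j))"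
    by (simp add: sum.cartesian_product case_prod_beta sum_distrib_left)
  finally show "(\<Sum>i\<in>SS. \<Sum>j\<in>SS. x i j * (act RS (bc k) i * bc l j)) = 0" by simp
qed

section \<open>The bimodule spanned by the symmetrizers and its basis\<close>

definition Alam :: "'k superpoly set" where
  "Alam = fs.span {sym i j | i j. i \<in> Ix \<and> j \<in> Ix}"

lemma Alam_SS: "Alam = fs.span {sym i j | i j. i \<in> SS \<and> j \<in> SS}"
proof
  show "fs.span {sym i j | i j. i \<in> SS \<and> j \<in> SS} \<subseteq> Alam"
    unfolding Alam_def by (rule fs.span_mono) (use SS_Ix in blast)
  show "Alam \<subseteq> fs.span {sym i j | i j. i \<in> SS \<and> j \<in> SS}"
    unfolding Alam_def
  proof (rule fs.span_minimal[OF _ fs.subspace_span])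
    have "sym i j \<in> fs.span {sym i j | i j. i \<in> SS \<and> j \<in> SS}" if i: "i \<in> Ix" and j: "j \<in> Ix" for i j
    proof -
      obtain c where c: "\<And>i. i \<in> Ix \<Longrightarrow> sym i j = (\<Sum>l\<in>SS. fscale (c l) (sym i l))"
        using sym_straighten_right[OF j] by blast
      obtain d where d: "\<And>j. j \<in> Ix \<Longrightarrow> sym i j = (\<Sum>k\<in>SS. fscale (d k) (sym k j))"
        using sym_straighten_left[OF i] by blast
      have "sym i j = (\<Sum>l\<in>SS. fscale (c l) (\<Sum>k\<in>SS. fscale (d k) (sym k l)))"
        unfolding c[OF i] using d SS_Ix by (intro sum.cong refl) simp
      then show ?thesis by (simp only:) (intro fs.span_sum fs.span_scale fs.span_base, blast)
    qed
    then show "{sym i j | i j. i \<in> Ix \<and> j \<in> Ix} \<subseteq> fs.span {sym i j | i j. i \<in> SS \<and> j \<in> SS}" by blast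
  qed
qed

lemma Alam_sub: "Alam \<subseteq> A"
  unfolding Alam_def by (rule fs.span_minimal[OF _ A_subspace]) auto

lemma sym_Alam: "i \<in> Ix \<Longrightarrow> j \<in> Ix \<Longrightarrow> sym i j \<in> Alam"
  unfolding Alam_def by (rule fs.span_base) blast

lemma Alam_subspace: "fs.subspace Alam"
  unfolding Alam_def by (rule fs.subspace_span)

lemma lact_Alam: "\<xi> \<in> S \<Longrightarrow> f \<in> Alam \<Longrightarrow> lact \<xi> f \<in> Alam"
  unfolding Alam_def
  by (rule fscale_span_induct_lin[OF lact_lin A_subspace _ _ fs.subspace_span])
    (auto simp: lact_sym sym_Alam[unfolded Alam_def] intro!: fs.span_sum fs.span_scale)

lemma ract_Alam: "\<xi> \<in> S \<Longrightarrow> f \<in> Alam \<Longrightarrow> ract \<xi> f \<in> Alam"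
  unfolding Alam_def
  by (rule fscale_span_induct_lin[OF ract_lin A_subspace _ _ fs.subspace_span])
    (auto simp: ract_sym sym_Alam[unfolded Alam_def] intro!: fs.span_sum fs.span_scale)

lemma graded_Alam: "graded_space (sub_space Alam)"
  unfolding Alam_def by (rule graded_sub_space) (use sym_Ac in blast)

theorem superbimodule_Alam: "superbimodule m n r (sub_space Alam) lact ract"
  unfolding superbimodule_def
  using left_supermodule_sub_space[OF graded_Alam Alam_sub] right_supermodule_sub_space[OF graded_Alam Alam_sub]
    lact_Alam ract_Alam lact_ract Alam_sub by auto

theorem basis_Alam:
  shows "inj_on (\<lambda>(i, j). sym i j) (SS \<times> SS)"
    and "\<not> fs.dependent ((\<lambda>(i, j). sym i j) ` (SS \<times> SS))"
    and "fs.span ((\<lambda>(i, j). sym i j) ` (SS \<times> SS)) = Alam"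
proof -
  let ?s = "\<lambda>(i, j). sym i j"
  have indep: "c y = 0" if "(\<Sum>y\<in>SS \<times> SS. fscale (c y) (?s y)) = 0" "y \<in> SS \<times> SS" for c y
  proof -
    have "(\<Sum>i\<in>SS. \<Sum>j\<in>SS. fscale (c (i, j)) (sym i j)) = (\<Sum>y\<in>SS \<times> SS. fscale (c y) (?s y))"
      by (simp add: sum.cartesian_product case_prod_beta)
    then have "(\<Sum>i\<in>SS. \<Sum>j\<in>SS. fscale (c (i, j)) (sym i j)) = 0" using that(1) by simp
    from sym_independent[OF this, of "fst y" "snd y"] show ?thesis using that(2) by auto
  qed
  show inj: "inj_on ?s (SS \<times> SS)"
  proof (rule inj_onI, rule ccontr)
    fix y z assume yz: "y \<in> SS \<times> SS" "z \<in> SS \<times> SS" "?s y = ?s z" "y \<noteq> z"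
    \<comment> \<open>Equal symmetrizers at distinct pairs would be a relation with coefficients 1
      and -1.\<close>
    let ?c = "\<lambda>u. if u = y then 1 else if u = z then -1 else (0 :: 'k)"
    have "(\<Sum>u\<in>SS \<times> SS. fscale (?c u) (?s u)) = (\<Sum>u\<in>{y, z}. fscale (?c u) (?s u))"
      using yz by (intro sum.mono_neutral_right) (auto simp: fun_eq_iff)
    also have "\<dots> = 0" using yz by (auto simp: fun_eq_iff)
    finally show False using indep[of ?c y] yz(1) by simp
  qed
  show "\<not> fs.dependent (?s ` (SS \<times> SS))"
  proof (subst fs.independent_explicit_finite_subsets, intro allI impI ballI)
    fix B u b assume B: "B \<subseteq> ?s ` (SS \<times> SS)" "finite B" and z: "(\<Sum>v\<in>B. fscale (u v) v) = 0" and b: "b \<in> B"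
    let ?c = "\<lambda>y. if ?s y \<in> B then u (?s y) else 0"
    have "(\<Sum>y\<in>SS \<times> SS. fscale (?c y) (?s y)) = (\<Sum>v\<in>?s ` (SS \<times> SS). fscale (if v \<in> B then u v else 0) v)"
      by (subst sum.reindex[OF inj]) simp
    also have "\<dots> = (\<Sum>v\<in>B. fscale (u v) v)"
      using B by (intro sum.mono_neutral_cong_right) (auto simp: fun_eq_iff)
    finally have "(\<Sum>y\<in>SS \<times> SS. fscale (?c y) (?s y)) = 0" using z by simp
    moreover obtain y where "y \<in> SS \<times> SS" "b = ?s y" using b B by blast
    ultimately show "u b = 0" using indep[of ?c y] b by simp
  qed
  have "?s ` (SS \<times> SS) = {sym i j | i j. i \<in> SS \<and> j \<in> SS}" by auto
  then show "fs.span (?s ` (SS \<times> SS)) = Alam" by (simp only: Alam_SS)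
qed

end

section \<open>Matrix units and Young symmetrizers in the Schur superalgebra\<close>

context tableau_setting
begin

text \<open>The matrix unit at \<open>(k, l)\<close> made equivariant by a signed sum over
  permutations: a multiple of the usual basis element of the Schur superalgebra, possibly
  zero.\<close>

definition unit_mat :: "(nat \<Rightarrow> nat) \<Rightarrow> (nat \<Rightarrow> nat) \<Rightarrow> (nat \<Rightarrow> nat) \<Rightarrow> (nat \<Rightarrow> nat) \<Rightarrow> 'k" where
  "unit_mat k l a b = (\<Sum>\<pi>\<in>perms r. eps a \<pi> * eps b \<pi> * (delta k (a \<circ> \<pi>) * delta l (b \<circ> \<pi>)))"

definition eta_mat :: "(nat \<Rightarrow> nat) \<Rightarrow> (nat \<Rightarrow> nat) \<Rightarrow> (nat \<Rightarrow> nat) \<Rightarrow> (nat \<Rightarrow> nat) \<Rightarrow> 'k" where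
  "eta_mat k l a b = act Y (\<lambda>k. unit_mat k l a b) k"

definition unit_S :: "(nat \<Rightarrow> nat) \<Rightarrow> (nat \<Rightarrow> nat) \<Rightarrow> 'k functional" where
  "unit_S k l = to_S (unit_mat k l)"

definition eta :: "(nat \<Rightarrow> nat) \<Rightarrow> (nat \<Rightarrow> nat) \<Rightarrow> 'k functional" where
  "eta k l = to_S (eta_mat k l)"

lemma unit_mat_equivariant: "equivariant (unit_mat k l)"
  unfolding unit_mat_def using equivariant_average[of "\<lambda>a b. delta k a * delta l b"] by simp

lemma eta_mat_equivariant: "equivariant (eta_mat k l)"
  unfolding equivariant_def
proof (intro ballI)
  fix i j \<pi> assume "i \<in> Ix" "j \<in> Ix" "\<pi> \<in> perms r"
  then have "unit_mat k l (i \<circ> \<pi>) (j \<circ> \<pi>) = eps i \<pi> * eps j \<pi> * unit_mat k l i j" for k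
    using unit_mat_equivariant unfolding equivariant_def by blast
  then show "eta_mat k l (i \<circ> \<pi>) (j \<circ> \<pi>) = eps i \<pi> * eps j \<pi> * eta_mat k l i j"
    unfolding eta_mat_def by (simp add: grp_act_const)
qed

lemma unit_S_in [simp]: "unit_S k l \<in> S" by (simp add: unit_S_def)
lemma eta_in [simp]: "eta k l \<in> S" by (simp add: eta_def)

lemma unit_S_chi: "i \<in> Ix \<Longrightarrow> j \<in> Ix \<Longrightarrow> unit_S k l (\<chi> i j) = unit_mat k l i j"
  by (simp add: unit_S_def unit_mat_equivariant)

lemma eta_chi: "i \<in> Ix \<Longrightarrow> j \<in> Ix \<Longrightarrow> eta k l (\<chi> i j) = eta_mat k l i j"
  by (simp add: eta_def eta_mat_equivariant)

lemma comp_eq_iff: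
  assumes "\<pi> \<in> perms r"
  shows "a \<circ> \<pi> = k \<longleftrightarrow> a = k \<circ> inv \<pi>"
  using perms_inv_comp_assoc(3,4)[OF assms] by metis

lemma sum_delta_comp:
  assumes p: "\<pi> \<in> perms r" and k: "k \<in> Ix"
  shows "(\<Sum>a\<in>Ix. eps a \<pi> * delta k (a \<circ> \<pi>) * h a) = eps k (inv \<pi>) * h (k \<circ> inv \<pi>)"
proof -
  have "(\<Sum>a\<in>Ix. eps a \<pi> * delta k (a \<circ> \<pi>) * h a) = (\<Sum>a\<in>Ix. if a = k \<circ> inv \<pi> then eps a \<pi> * h a else 0)"
    by (intro sum.cong refl) (simp add: delta_def comp_eq_iff[OF p])
  also have "\<dots> = eps (k \<circ> inv \<pi>) \<pi> * h (k \<circ> inv \<pi>)" using k p by (simp add: sum.delta)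
  also have "eps (k \<circ> inv \<pi>) \<pi> = eps k (inv \<pi>)" using sg_inv[OF k perms_inv[OF p]] p by simp
  finally show ?thesis .
qed

lemma unit_mat_apply:
  assumes k: "k \<in> Ix" and j: "j \<in> Ix"
  shows "(\<Sum>a\<in>Ix. unit_mat k l a j * h a) = (\<Sum>\<pi>\<in>perms r. eps j \<pi> * delta l (j \<circ> \<pi>) * act (delta (inv \<pi>)) h k)"
proof -
  have "(\<Sum>a\<in>Ix. unit_mat k l a j * h a) =
      (\<Sum>\<pi>\<in>perms r. eps j \<pi> * delta l (j \<circ> \<pi>) * (\<Sum>a\<in>Ix. eps a \<pi> * delta k (a \<circ> \<pi>) * h a))"
    unfolding unit_mat_def sum_distrib_right sum_distrib_left by (subst sum.swap) (simp add: mult_ac)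
  then show ?thesis by (simp add: sum_delta_comp k grp_act_delta)
qed

text \<open>On eigenfunctions of \<open>Y\<close> the matrix \<open>eta_mat k l\<close> has rank
  one: it reads off the value at \<open>k\<close> and multiplies it by \<open>bc l\<close>. The
  orbit sum supplies the permutation between two copies of \<open>Y\<close>, and the sandwich
  identity collapses them.\<close>

lemma eta_mat_apply:
  assumes h: "\<And>i. i \<in> Ix \<Longrightarrow> act Y h i = hc * h i" and k: "k \<in> Ix" and j: "j \<in> Ix"
  shows "(\<Sum>a\<in>Ix. eta_mat k l a j * h a) = hc * bc l j * h k"
proof -
  have "(\<Sum>a\<in>Ix. eta_mat k l a j * h a) = act Y (\<lambda>k. \<Sum>a\<in>Ix. unit_mat k l a j * h a) k"
    unfolding eta_mat_def grp_act_sum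
    by (intro sum.cong refl) (simp add: grp_act_def sum_distrib_right mult.assoc)
  also have "\<dots> = act Y (\<lambda>k. \<Sum>\<pi>\<in>perms r. eps j \<pi> * delta l (j \<circ> \<pi>) * act (delta (inv \<pi>)) h k) k"
    using k j by (intro grp_act_cong unit_mat_apply)
  also have "\<dots> = (\<Sum>\<pi>\<in>perms r. eps j \<pi> * delta l (j \<circ> \<pi>) * act Y (act (delta (inv \<pi>)) h) k)"
    by (simp add: grp_act_sum grp_act_const)
  also have "\<dots> = (\<Sum>\<pi>\<in>perms r. hc * h k * (Y \<pi> * eps j \<pi> * delta l (j \<circ> \<pi>)))"
    by (intro sum.cong refl) (simp add: act_young_sandwich[OF h k])
  also have "\<dots> = hc * h k * bc l j" by (simp add: bc_def grp_act_def sum_distrib_left)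
  finally show ?thesis by (simp add: mult_ac)
qed

text \<open>Equivariant matrices commute with the signed action: reindexing by \<open>\<pi>\<close>
  moves it from \<open>j\<close> to the summation index.\<close>

lemma equivariant_act_commute:
  assumes X: "equivariant X" and j: "j \<in> Ix"
  shows "act g (\<lambda>j. \<Sum>s\<in>Ix. X s j * h s) j = (\<Sum>s\<in>Ix. X s j * act g h s)"
proof -
  have "act g (\<lambda>j. \<Sum>s\<in>Ix. X s j * h s) j = (\<Sum>\<pi>\<in>perms r. \<Sum>s\<in>Ix. X s j * (g \<pi> * eps s \<pi> * h (s \<circ> \<pi>)))"
    unfolding grp_act_def
  proof (intro sum.cong refl)
    fix \<pi> assume p: "\<pi> \<in> perms r"
    have "(\<Sum>s\<in>Ix. X s (j \<circ> \<pi>) * h s) = (\<Sum>s\<in>Ix. X (s \<circ> \<pi>) (j \<circ> \<pi>) * h (s \<circ> \<pi>))"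
      by (rule sum_multiindices_perm[OF p, symmetric])
    also have "\<dots> = (\<Sum>s\<in>Ix. eps j \<pi> * (X s j * (eps s \<pi> * h (s \<circ> \<pi>))))"
    proof (intro sum.cong refl)
      fix s assume "s \<in> Ix"
      then have "X (s \<circ> \<pi>) (j \<circ> \<pi>) = eps s \<pi> * eps j \<pi> * X s j" using X j p unfolding equivariant_def by blast
      then show "X (s \<circ> \<pi>) (j \<circ> \<pi>) * h (s \<circ> \<pi>) = eps j \<pi> * (X s j * (eps s \<pi> * h (s \<circ> \<pi>)))" by simp
    qed
    also have "\<dots> = eps j \<pi> * (\<Sum>s\<in>Ix. X s j * (eps s \<pi> * h (s \<circ> \<pi>)))"
      by (rule sum_distrib_left[symmetric])
    finally have E: "(\<Sum>s\<in>Ix. X s (j \<circ> \<pi>) * h s) = \<dots>" .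
    have cancel: "g \<pi> * eps j \<pi> * (eps j \<pi> * x) = g \<pi> * x" for x
      by (simp only: mult.assoc sg_square_left[OF j p])
    show "g \<pi> * eps j \<pi> * (\<Sum>s\<in>Ix. X s (j \<circ> \<pi>) * h s) = (\<Sum>s\<in>Ix. X s j * (g \<pi> * eps s \<pi> * h (s \<circ> \<pi>)))"
      unfolding E cancel by (simp add: sum_distrib_left mult_ac)
  qed
  then show ?thesis by (subst (asm) sum.swap) (simp add: grp_act_def sum_distrib_left)
qed

lemma mult_unit_mat:
  assumes x: "\<xi> \<in> S" and a: "a \<in> Ix" and j: "j \<in> Ix"
  shows "(\<Sum>s\<in>Ix. \<xi> (\<chi> a s) * unit_mat j i s b) = (\<Sum>s\<in>Ix. \<xi> (\<chi> s j) * unit_mat s i a b)"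
proof -
  have "(\<Sum>s\<in>Ix. \<xi> (\<chi> a s) * unit_mat j i s b) =
      (\<Sum>\<pi>\<in>perms r. eps b \<pi> * delta i (b \<circ> \<pi>) * (\<Sum>s\<in>Ix. eps s \<pi> * delta j (s \<circ> \<pi>) * \<xi> (\<chi> a s)))"
    unfolding unit_mat_def sum_distrib_left by (subst sum.swap) (simp add: mult_ac)
  also have "\<dots> = (\<Sum>\<pi>\<in>perms r. eps b \<pi> * delta i (b \<circ> \<pi>) * (eps a \<pi> * \<xi> (\<chi> (a \<circ> \<pi>) j)))"
  proof (intro sum.cong refl)
    fix \<pi> assume p: "\<pi> \<in> perms r"
    have ap: "a \<circ> \<pi> \<in> Ix" using a p by simp
    have "\<xi> (\<chi> (a \<circ> \<pi> \<circ> inv \<pi>) (j \<circ> inv \<pi>)) = eps (a \<circ> \<pi>) (inv \<pi>) * eps j (inv \<pi>) * \<xi> (\<chi> (a \<circ> \<pi>) j)"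
      by (rule S_chi_comp[OF x ap j perms_inv[OF p]])
    then have "\<xi> (\<chi> a (j \<circ> inv \<pi>)) = eps a \<pi> * eps j (inv \<pi>) * \<xi> (\<chi> (a \<circ> \<pi>) j)"
      by (simp only: perms_inv_comp_assoc(3)[OF p] sg_inv[OF a p])
    then have "eps j (inv \<pi>) * \<xi> (\<chi> a (j \<circ> inv \<pi>)) = eps j (inv \<pi>) * (eps j (inv \<pi>) * (eps a \<pi> * \<xi> (\<chi> (a \<circ> \<pi>) j)))"
      by (simp only: mult_ac)
    then have "eps j (inv \<pi>) * \<xi> (\<chi> a (j \<circ> inv \<pi>)) = eps a \<pi> * \<xi> (\<chi> (a \<circ> \<pi>) j)"
      by (simp only: sg_square_left[OF j perms_inv[OF p]])
    then show "eps b \<pi> * delta i (b \<circ> \<pi>) * (\<Sum>s\<in>Ix. eps s \<pi> * delta j (s \<circ> \<pi>) * \<xi> (\<chi> a s)) =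
        eps b \<pi> * delta i (b \<circ> \<pi>) * (eps a \<pi> * \<xi> (\<chi> (a \<circ> \<pi>) j))"
      unfolding sum_delta_comp[OF p j] by (simp only:)
  qed
  also have "\<dots> = (\<Sum>\<pi>\<in>perms r. \<Sum>s\<in>Ix. \<xi> (\<chi> s j) * (eps a \<pi> * eps b \<pi> * (delta s (a \<circ> \<pi>) * delta i (b \<circ> \<pi>))))"
  proof (intro sum.cong refl)
    fix \<pi> assume "\<pi> \<in> perms r"
    then have "a \<circ> \<pi> \<in> Ix" using a by simp
    then show "eps b \<pi> * delta i (b \<circ> \<pi>) * (eps a \<pi> * \<xi> (\<chi> (a \<circ> \<pi>) j)) =
       (\<Sum>s\<in>Ix. \<xi> (\<chi> s j) * (eps a \<pi> * eps b \<pi> * (delta s (a \<circ> \<pi>) * delta i (b \<circ> \<pi>))))"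
      by (simp add: delta_def[of _ "a \<circ> \<pi>"] if_distrib[of "\<lambda>x. x * _"] if_distrib[of "\<lambda>x. _ * x"] sum.delta mult_ac cong: if_cong)
  qed
  also have "\<dots> = (\<Sum>s\<in>Ix. \<xi> (\<chi> s j) * unit_mat s i a b)"
    by (subst sum.swap) (simp add: unit_mat_def sum_distrib_left)
  finally show ?thesis .
qed

lemma mult_unit_S:
  assumes x: "\<xi> \<in> S" and j: "j \<in> Ix"
  shows "mult \<xi> (unit_S j i) = (\<Sum>s\<in>Ix. fscale (\<xi> (\<chi> s j)) (unit_S s i))"
proof (rule S_ext)
  show "(\<Sum>s\<in>Ix. fscale (\<xi> (\<chi> s j)) (unit_S s i)) \<in> S"
    by (rule fs.subspace_sum[OF fs.subspaceI[OF S_zero S_add S_scale]]) (auto intro: S_scale)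
  show "mult \<xi> (unit_S j i) (\<chi> a b) = (\<Sum>s\<in>Ix. fscale (\<xi> (\<chi> s j)) (unit_S s i)) (\<chi> a b)"
    if "a \<in> Ix" "b \<in> Ix" for a b
    using mult_unit_mat[OF x that(1) j] that x by (simp add: mult_chi unit_S_chi sum_fun_apply)
qed (use x in auto)

text \<open>For a fixed second label, the \<open>eta s i\<close> transform under left multiplication
  like the basis vectors of tensor space.\<close>

lemma mult_eta:
  assumes x: "\<xi> \<in> S" and j: "j \<in> Ix"
  shows "mult \<xi> (eta j i) = (\<Sum>s\<in>Ix. fscale (\<xi> (\<chi> s j)) (eta s i))"
proof (rule S_ext)
  show "(\<Sum>s\<in>Ix. fscale (\<xi> (\<chi> s j)) (eta s i)) \<in> S"
    by (rule fs.subspace_sum[OF fs.subspaceI[OF S_zero S_add S_scale]]) (auto intro: S_scale)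
  fix a b assume ab: "a \<in> Ix" "b \<in> Ix"
  have "mult \<xi> (eta j i) (\<chi> a b) = act Y (\<lambda>j. \<Sum>s\<in>Ix. \<xi> (\<chi> a s) * unit_mat j i s b) j"
    using ab x by (simp add: mult_chi eta_chi eta_mat_def grp_act_sum grp_act_const)
  also have "\<dots> = act Y (\<lambda>j. \<Sum>s\<in>Ix. \<xi> (\<chi> s j) * unit_mat s i a b) j"
    using j ab by (intro grp_act_cong mult_unit_mat x)
  also have "\<dots> = (\<Sum>s\<in>Ix. \<xi> (\<chi> s j) * eta_mat s i a b)"
    unfolding eta_mat_def by (rule equivariant_act_commute[OF S_equivariant[OF x] j])
  finally show "mult \<xi> (eta j i) (\<chi> a b) = (\<Sum>s\<in>Ix. fscale (\<xi> (\<chi> s j)) (eta s i)) (\<chi> a b)"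
    using ab by (simp add: sum_fun_apply eta_chi)
qed (use x in auto)

lemma eta_eq_sum: "eta j i f = act Y (\<lambda>k. unit_S k i f) j"
  unfolding eta_def unit_S_def to_S_def eta_mat_def
  by (cases "f \<in> A") (simp_all add: grp_act_sum grp_act_const, simp add: grp_act_def)

lemma eta_young: "j \<in> Ix \<Longrightarrow> act Y (\<lambda>j. eta j i f) j = hc * eta j i f"
  unfolding eta_eq_sum[abs_def] by (rule act_young_idem)

text \<open>So the \<open>eta k l\<close> multiply like rank one operators, with \<open>bc\<close>
  as the form that contracts the inner labels.\<close>

lemma eta_mult:
  assumes "k \<in> Ix" "j \<in> Ix"
  shows "mult (eta k l) (eta j i) = fscale (hc * bc l j) (eta k i)"
proof
  fix f
  have "mult (eta k l) (eta j i) f = (\<Sum>s\<in>Ix. eta_mat k l s j * eta s i f)"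
    unfolding mult_eta[OF eta_in assms(2)] using assms(2) by (simp add: sum_fun_apply eta_chi)
  also have "\<dots> = hc * bc l j * eta k i f" by (rule eta_mat_apply[OF eta_young assms])
  finally show "mult (eta k l) (eta j i) f = fscale (hc * bc l j) (eta k i) f" by simp
qed

lemma sym_young_eigen: "i \<in> Ix \<Longrightarrow> j \<in> Ix \<Longrightarrow> act Y (\<lambda>j. sym i j M) j = hc * sym i j M"
  using act_young_idem[of j "\<lambda>l. \<chi> i l M"] grp_act_cong[of j "\<lambda>j. sym i j M" "act Y (\<lambda>l. \<chi> i l M)" Y]
  by (simp add: sym_young)

lemma lact_eta_sym:
  assumes "k \<in> Ix" "i \<in> Ix" "j \<in> Ix"
  shows "lact (eta k l) (sym i j) = fscale (hc * bc l j) (sym i k)"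
proof
  fix M
  have "lact (eta k l) (sym i j) M = (\<Sum>s\<in>Ix. eta_mat k l s j * sym i s M)"
    using assms by (simp add: lact_sym sum_fun_apply eta_chi)
  also have "\<dots> = hc * bc l j * sym i k M"
    by (rule eta_mat_apply[OF sym_young_eigen[OF assms(2)] assms(1,3)])
  finally show "lact (eta k l) (sym i j) M = fscale (hc * bc l j) (sym i k) M" by simp
qed

lemma unit_mat_tp: "unit_mat k l a b \<noteq> 0 \<Longrightarrow> tp a + tp b = tp k + tp l"
proof -
  assume "unit_mat k l a b \<noteq> 0"
  then obtain \<pi> where "\<pi> \<in> perms r" "delta k (a \<circ> \<pi>) * delta l (b \<circ> \<pi>) \<noteq> (0 :: 'k)"
    unfolding unit_mat_def by (metis (no_types, lifting) mult_zero_right sum.neutral)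
  then have "\<pi> \<in> perms r" "a \<circ> \<pi> = k" "b \<circ> \<pi> = l" by (auto simp: delta_def split: if_splits)
  then show ?thesis using tp_comp by metis
qed

lemma eta_mat_tp: "eta_mat k l a b \<noteq> 0 \<Longrightarrow> tp a + tp b = tp k + tp l"
proof -
  assume "eta_mat k l a b \<noteq> 0"
  then obtain \<pi> where p: "\<pi> \<in> perms r" "unit_mat (k \<circ> \<pi>) l a b \<noteq> 0"
    unfolding eta_mat_def grp_act_def by (metis (no_types, lifting) mult_zero_right sum.neutral)
  show ?thesis using unit_mat_tp[OF p(2)] tp_comp[OF p(1)] by (simp only:)
qed

lemma to_S_Sc:
  assumes "\<And>a b. a \<in> Ix \<Longrightarrow> b \<in> Ix \<Longrightarrow> F a b \<noteq> 0 \<Longrightarrow> tp a + tp b = q"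
  shows "to_S F \<in> Sc q"
  unfolding schur_comp_def
proof (intro CollectI conjI ballI to_S_in)
  fix f assume f: "f \<in> Ac (q + 1)"
  have "coord f x * F (fst x) (snd x) = 0" if "x \<in> Ix \<times> Ix" for x
  proof (rule ccontr)
    assume "coord f x * F (fst x) (snd x) \<noteq> 0"
    then have 0: "coord f x \<noteq> 0" "F (fst x) (snd x) \<noteq> 0" by auto
    then have "tp (fst x) + tp (snd x) = q" using that assms[of "fst x" "snd x"] by (simp only: mem_Times_iff simp_thms)
    moreover have "tp (fst x) + tp (snd x) = q + 1" by (rule coord_Ac[OF f 0(1)])
    ultimately have "q = q + 1" by (simp only:)
    then show False using bit_neq_iff[of q q] by blast
  qed
  then show "to_S F f = 0" unfolding to_S_def by (simp add: sum.neutral)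
qed

lemma eta_Sc: "eta k l \<in> Sc (tp k + tp l)"
  unfolding eta_def by (rule to_S_Sc) (rule eta_mat_tp)

end

section \<open>Reduction modulo weights that are not dominated\<close>

context tableau_setting
begin

lemma content_comp:
  assumes "i \<in> Ix" "\<pi> \<in> perms r"
  shows "content (i \<circ> \<pi>) = content i"
proof -
  have "has_content m n r (i \<circ> \<pi>) (content i)"
    using content_iff_perm[OF assms(1) has_content_content, of "i \<circ> \<pi>"] assms by (auto simp: perms_def)
  then show ?thesis using has_content_iff[OF content_weights[OF assms(1)]] by simp
qed

lemma content_eq_perm:
  assumes "i \<in> Ix" "k \<in> Ix" "content k = content i"
  shows "\<exists>\<pi>\<in>perms r. k = i \<circ> \<pi>"
proof -
  have "has_content m n r k (content i)" using has_content_content[of k] assms(3) by simp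
  then show ?thesis using content_iff_perm[OF assms(1) has_content_content assms(2)] by (auto simp: perms_def)
qed

lemma content_sum:
  assumes "i \<in> Ix" "a \<le> m + n"
  shows "(\<Sum>b = 1..a. content i b) = card {t\<in>{1..r}. i t \<le> a}"
proof -
  have "(\<Sum>b = 1..a. content i b) = (\<Sum>b\<in>{1..a}. card {t\<in>{1..r}. i t = b})"
    using assms by (intro sum.cong) (auto simp: content_def)
  also have "\<dots> = card (\<Union>b\<in>{1..a}. {t\<in>{1..r}. i t = b})"
    by (intro card_UN_disjoint[symmetric]) auto
  also have "(\<Union>b\<in>{1..a}. {t\<in>{1..r}. i t = b}) = {t\<in>{1..r}. i t \<le> a}"
    using assms by (fastforce simp: multiindices_def PiE_def Pi_def)
  finally show ?thesis .
qed

lemma unit_mat_comp: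
  assumes i: "i \<in> Ix" and a: "a \<in> Ix" and b: "b \<in> Ix" and s: "\<sigma> \<in> perms r"
  shows "unit_mat (i \<circ> \<sigma>) (k \<circ> \<sigma>) a b = eps i \<sigma> * eps k \<sigma> * unit_mat i k a b"
proof -
  have inj: "x \<circ> \<sigma> = y \<circ> \<sigma> \<longleftrightarrow> x = y" for x y :: "nat \<Rightarrow> nat"
    using perms_inv_comp_assoc(3)[OF s] by metis
  have "unit_mat (i \<circ> \<sigma>) (k \<circ> \<sigma>) a b =
     (\<Sum>\<pi>\<in>perms r. eps a (\<pi> \<circ> \<sigma>) * eps b (\<pi> \<circ> \<sigma>) * (delta (i \<circ> \<sigma>) (a \<circ> (\<pi> \<circ> \<sigma>)) * delta (k \<circ> \<sigma>) (b \<circ> (\<pi> \<circ> \<sigma>))))"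
    unfolding unit_mat_def by (rule sum_perms_right[OF s, symmetric])
  also have "\<dots> = (\<Sum>\<pi>\<in>perms r. eps i \<sigma> * eps k \<sigma> * (eps a \<pi> * eps b \<pi> * (delta i (a \<circ> \<pi>) * delta k (b \<circ> \<pi>))))"
  proof (intro sum.cong refl)
    fix \<pi> assume p: "\<pi> \<in> perms r"
    show "eps a (\<pi> \<circ> \<sigma>) * eps b (\<pi> \<circ> \<sigma>) * (delta (i \<circ> \<sigma>) (a \<circ> (\<pi> \<circ> \<sigma>)) * delta (k \<circ> \<sigma>) (b \<circ> (\<pi> \<circ> \<sigma>))) =
       eps i \<sigma> * eps k \<sigma> * (eps a \<pi> * eps b \<pi> * (delta i (a \<circ> \<pi>) * delta k (b \<circ> \<pi>)))"
      unfolding delta_def o_assoc inj sg_comp[OF a p s] sg_comp[OF b p s] by auto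
  qed
  finally show ?thesis by (simp add: unit_mat_def sum_distrib_left)
qed

lemma unit_S_comp:
  assumes "i \<in> Ix" "\<sigma> \<in> perms r"
  shows "unit_S (i \<circ> \<sigma>) (k \<circ> \<sigma>) = fscale (eps i \<sigma> * eps k \<sigma>) (unit_S i k)"
  by (rule S_ext) (use assms in \<open>simp_all add: unit_S_chi unit_mat_comp S_scale\<close>)

text \<open>The factor is the order of the stabilizer of \<open>l\<close>; on the diagonal the two
  signs of each term are equal and cancel.\<close>

lemma unit_S_diag:
  assumes l: "l \<in> Ix"
  shows "\<exists>N. N \<noteq> 0 \<and> unit_S l l = fscale N (widem (content l))"
proof -
  define N where "N = (\<Sum>\<pi>\<in>perms r. if l \<circ> \<pi> = l then 1 else 0 :: 'k)"
  have "N = of_nat (card {\<pi>\<in>perms r. l \<circ> \<pi> = l})" by (simp add: N_def sum.If_cases Int_def)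
  moreover have "card {\<pi>\<in>perms r. l \<circ> \<pi> = l} \<noteq> 0" by (rule card_nonzeroI[of _ id]) auto
  ultimately have N0: "N \<noteq> 0" by simp
  have "unit_S l l = fscale N (widem (content l))"
  proof (rule S_ext)
    fix a b assume ab: "a \<in> Ix" "b \<in> Ix"
    show "unit_S l l (\<chi> a b) = fscale N (widem (content l)) (\<chi> a b)"
    proof (cases "a = b")
      case False
      have "unit_mat l l a b = 0" unfolding unit_mat_def
      proof (intro sum.neutral ballI)
        fix \<pi> assume p: "\<pi> \<in> perms r"
        have "\<not> (a \<circ> \<pi> = l \<and> b \<circ> \<pi> = l)" using False unfolding comp_eq_iff[OF p] by blast
        then show "eps a \<pi> * eps b \<pi> * (delta l (a \<circ> \<pi>) * delta l (b \<circ> \<pi>)) = 0" by (auto simp: delta_def)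
      qed
      then show ?thesis using False ab by (simp add: unit_S_chi widem_chi content_weights l)
    next
      case True
      have e: "unit_mat l l a a = (\<Sum>\<pi>\<in>perms r. if a \<circ> \<pi> = l then 1 else 0)"
        unfolding unit_mat_def using ab by (intro sum.cong refl) (simp add: delta_def)
      show ?thesis
      proof (cases "content a = content l")
        case c: True
        then obtain \<sigma> where s: "\<sigma> \<in> perms r" "a = l \<circ> \<sigma>" using content_eq_perm[OF l ab(1)] by blast
        have "(\<Sum>\<pi>\<in>perms r. if l \<circ> (\<sigma> \<circ> \<pi>) = l then 1 else 0 :: 'k) = N"
          unfolding N_def by (rule sum_perms_left[OF s(1), of "\<lambda>\<pi>. if l \<circ> \<pi> = l then 1 else 0"])
        then have "unit_mat l l a a = N" unfolding e unfolding s(2) o_assoc .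
        then show ?thesis using True c ab by (simp add: unit_S_chi widem_chi content_weights l)
      next
        case c: False
        then have "a \<circ> \<pi> \<noteq> l" if "\<pi> \<in> perms r" for \<pi> using content_comp[OF ab(1) that] by auto
        then have "unit_mat l l a a = 0" unfolding e by simp
        then show ?thesis using True c ab by (simp add: unit_S_chi widem_chi content_weights l)
      qed
    qed
  qed (auto intro: S_scale widem_in content_weights l)
  then show ?thesis using N0 by blast
qed

text \<open>These elements factor through weights not dominated by that of \<open>l\<close>, so they
  act as zero wherever such weight spaces vanish.\<close>

definition low_ideal :: "(nat \<Rightarrow> nat) \<Rightarrow> 'k functional set" where
  "low_ideal l = fs.span {mult x (unit_S k l) | x k. x \<in> S \<and> k \<in> Ix \<and> \<not> dominated m n (content k) (content l)}"

lemma low_ideal_subspace: "fs.subspace (low_ideal l)"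
  unfolding low_ideal_def by (rule fs.subspace_span)

definition scalar_mod :: "(nat \<Rightarrow> nat) \<Rightarrow> 'k functional \<Rightarrow> bool" where
  "scalar_mod l x \<longleftrightarrow> (\<exists>\<theta>. x - fscale \<theta> (unit_S l l) \<in> low_ideal l)"

lemma scalar_mod_scale: "scalar_mod l x \<Longrightarrow> scalar_mod l (fscale c x)"
proof -
  assume "scalar_mod l x"
  then obtain \<theta> where "x - fscale \<theta> (unit_S l l) \<in> low_ideal l" unfolding scalar_mod_def by blast
  then have "fscale c (x - fscale \<theta> (unit_S l l)) \<in> low_ideal l" by (rule fs.subspace_scale[OF low_ideal_subspace])
  also have "fscale c (x - fscale \<theta> (unit_S l l)) = fscale c x - fscale (c * \<theta>) (unit_S l l)"
    by (simp add: fs.scale_right_diff_distrib fs.scale_scale)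
  finally show ?thesis unfolding scalar_mod_def by blast
qed

lemma scalar_mod_add: "scalar_mod l x \<Longrightarrow> scalar_mod l y \<Longrightarrow> scalar_mod l (x + y)"
proof -
  assume "scalar_mod l x" "scalar_mod l y"
  then obtain \<theta> \<theta>' where "x - fscale \<theta> (unit_S l l) \<in> low_ideal l" "y - fscale \<theta>' (unit_S l l) \<in> low_ideal l"
    unfolding scalar_mod_def by blast
  then have "(x - fscale \<theta> (unit_S l l)) + (y - fscale \<theta>' (unit_S l l)) \<in> low_ideal l"
    by (rule fs.subspace_add[OF low_ideal_subspace])
  also have "(x - fscale \<theta> (unit_S l l)) + (y - fscale \<theta>' (unit_S l l)) = x + y - fscale (\<theta> + \<theta>') (unit_S l l)"
    by (simp add: fs.scale_left_distrib)
  finally show ?thesis unfolding scalar_mod_def by blast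
qed

lemma scalar_mod_low: "x \<in> low_ideal l \<Longrightarrow> scalar_mod l x"
  unfolding scalar_mod_def by (rule exI[of _ 0]) (simp only: fs.scale_zero_left diff_zero)

lemma scalar_mod_sum: "(\<And>x. x \<in> X \<Longrightarrow> scalar_mod l (F x)) \<Longrightarrow> scalar_mod l (\<Sum>x\<in>X. F x)"
proof (induction X rule: infinite_finite_induct)
  case (insert x X)
  then show ?case using scalar_mod_add[of l "F x" "\<Sum>x\<in>X. F x"] by (simp only: sum.insert insertI1 insertI2 simp_thms)
qed (simp_all only: sum.infinite sum.empty scalar_mod_low fs.subspace_0[OF low_ideal_subspace] not_False_eq_True)

text \<open>Measures progress inside the block \<open>l = a\<close>.\<close>

definition agree :: "(nat \<Rightarrow> nat) \<Rightarrow> nat \<Rightarrow> (nat \<Rightarrow> nat) \<Rightarrow> nat" where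
  "agree l a i = card {t\<in>{1..r}. l t = a \<and> i t = a}"

text \<open>The entry \<open>i t\<^sub>0\<close> is lowered to \<open>a = l t\<^sub>0\<close>, which raises the weight, and then one entry \<open>a\<close> is
  raised back in all possible ways. The terms where this happens inside the block \<open>l = a\<close> give back a
  positive multiple of the original element; the others agree with \<open>l\<close> in one more place.\<close>

lemma scalar_mod_step:
  assumes l: "l \<in> Ix" and i: "i \<in> Ix" and ci: "content i = content l"
    and t0: "t0 \<in> {1..r}" "l t0 = a" "a < i t0"
    and below: "\<And>t. t \<in> {1..r} \<Longrightarrow> l t < a \<Longrightarrow> i t = l t"
    and IH: "\<And>i'. i' \<in> Ix \<Longrightarrow> content i' = content l \<Longrightarrow> (\<And>t. t \<in> {1..r} \<Longrightarrow> l t < a \<Longrightarrow> i' t = l t) \<Longrightarrow>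
       agree l a i' = Suc (agree l a i) \<Longrightarrow> scalar_mod l (unit_S i' l)"
  shows "scalar_mod l (unit_S i l)"
proof -
  define k where "k = i(t0 := a)"
  have a: "a \<in> {1..m + n}" using l t0 by (auto simp: multiindices_def PiE_def Pi_def)
  have kI: "k \<in> Ix" using i a t0(1) unfolding k_def multiindices_def
    by (auto simp: PiE_def Pi_def extensional_def)
  have i_k: "i t = (if t = t0 then i t0 else k t)" for t by (simp add: k_def)
  \<comment> \<open>Lowering one entry to \<open>a\<close> makes the partial sum up to
    \<open>a\<close> exceed that of \<open>l\<close>, so any product through \<open>k\<close> lies
    in \<open>low_ideal l\<close>.\<close>
  have "\<not> dominated m n (content k) (content l)"
  proof -
    have "{t\<in>{1..r}. k t \<le> a} = insert t0 {t\<in>{1..r}. i t \<le> a}" using t0 by (auto simp: k_def)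
    moreover have "t0 \<notin> {t\<in>{1..r}. i t \<le> a}" using t0 by simp
    ultimately have "card {t\<in>{1..r}. k t \<le> a} = Suc (card {t\<in>{1..r}. i t \<le> a})" by simp
    then have "(\<Sum>b = 1..a. content k b) = Suc (\<Sum>b = 1..a. content l b)"
      using content_sum[OF kI, of a] content_sum[OF i, of a] a ci by simp
    then have "\<not> (\<Sum>b = 1..a. content k b) \<le> (\<Sum>b = 1..a. content l b)" by simp
    then show ?thesis using a unfolding dominated_def by blast
  qed
  then have low: "mult (unit_S i k) (unit_S k l) \<in> low_ideal l"
    unfolding low_ideal_def using kI unit_S_in by (intro fs.span_base) blast
  define St where "St = {\<tau>\<in>perms r. k \<circ> \<tau> = k}"
  have exp: "mult (unit_S i k) (unit_S k l) = (\<Sum>\<tau>\<in>St. fscale (eps k \<tau> * eps i \<tau>) (unit_S (i \<circ> \<tau>) l))"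
  proof
    fix f
    have "mult (unit_S i k) (unit_S k l) f = (\<Sum>s\<in>Ix. unit_mat i k s k * unit_S s l f)"
      unfolding mult_unit_S[OF unit_S_in kI] using kI by (simp add: sum_fun_apply unit_S_chi)
    also have "\<dots> = (\<Sum>\<pi>\<in>perms r. eps k \<pi> * delta k (k \<circ> \<pi>) * act (delta (inv \<pi>)) (\<lambda>s. unit_S s l f) i)"
      by (rule unit_mat_apply[OF i kI])
    also have "\<dots> = (\<Sum>\<pi>\<in>perms r. eps k (inv \<pi>) * delta k (k \<circ> inv \<pi>) * act (delta (inv (inv \<pi>))) (\<lambda>s. unit_S s l f) i)"
      by (rule sum_perms_inv[symmetric])
    also have "\<dots> = (\<Sum>\<pi>\<in>perms r. if k \<circ> \<pi> = k then eps k \<pi> * eps i \<pi> * unit_S (i \<circ> \<pi>) l f else 0)"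
    proof (intro sum.cong refl)
      fix \<pi> assume p: "\<pi> \<in> perms r"
      have "k \<circ> inv \<pi> = k \<longleftrightarrow> k \<circ> \<pi> = k" using comp_eq_iff[OF p, of k k] by auto
      moreover have "eps k (inv \<pi>) = eps k \<pi>" if "k \<circ> \<pi> = k" using sg_inv[OF kI p] that by simp
      ultimately show "eps k (inv \<pi>) * delta k (k \<circ> inv \<pi>) * act (delta (inv (inv \<pi>))) (\<lambda>s. unit_S s l f) i =
          (if k \<circ> \<pi> = k then eps k \<pi> * eps i \<pi> * unit_S (i \<circ> \<pi>) l f else 0)"
        by (simp add: delta_def[of k] grp_act_delta p perms_inv_comp(3)[OF p])
    qed
    also have "\<dots> = (\<Sum>\<tau>\<in>St. eps k \<tau> * eps i \<tau> * unit_S (i \<circ> \<tau>) l f)"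
      unfolding St_def by (rule sum.inter_filter[symmetric]) simp
    finally show "mult (unit_S i k) (unit_S k l) f = (\<Sum>\<tau>\<in>St. fscale (eps k \<tau> * eps i \<tau>) (unit_S (i \<circ> \<tau>) l)) f"
      by (simp add: sum_fun_apply)
  qed
  define S1 where "S1 = {\<tau>\<in>St. l (inv \<tau> t0) = a}"
  have fin: "finite St" by (simp add: St_def)
  have idS1: "id \<in> S1" using t0 by (simp add: S1_def St_def)
  \<comment> \<open>For \<open>\<tau>\<close> fixing \<open>k\<close>, the multiindex
    \<open>i \<circ> \<tau>\<close> is \<open>k\<close> with the original entry \<open>i t0\<close>
    put back at \<open>s = inv \<tau> t0\<close> instead of at \<open>t0\<close>.\<close>
  have pos: "s \<in> {1..r} \<and> k s = a \<and> (i \<circ> \<tau>) t = (if t = s then i t0 else k t)"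
    if tau: "\<tau> \<in> St" and s: "s = inv \<tau> t0" for \<tau> s t
  proof -
    have p: "\<tau> \<in> perms r" and kt: "k \<circ> \<tau> = k" using tau by (auto simp: St_def)
    have ts: "\<tau> s = t0" using s p by simp
    have "s \<in> {1..r}" using perms_in[OF p, of s] ts t0 by simp
    moreover have "k (\<tau> x) = k x" for x using kt by (metis comp_apply)
    moreover from this[of s] have "k s = a" using ts by (simp add: k_def)
    moreover have "\<tau> t = t0 \<longleftrightarrow> t = s" using ts perms_inj[OF p, of t s] by auto
    ultimately show ?thesis using i_k[of "\<tau> t"] by simp
  qed
  \<comment> \<open>Write \<open>\<tau> = \<tau>' \<circ> w\<close> with \<open>w\<close> swapping
    \<open>s\<close> and \<open>t0\<close>. Then \<open>\<tau>'\<close> fixes \<open>i\<close> and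
    \<open>k\<close>, which differ only at its fixed point \<open>t0\<close>, so its two signs
    agree; \<open>w\<close> fixes \<open>k\<close> and \<open>l\<close>, and its signs agree there
    because both carry \<open>a\<close> at the two positions. All signs cancel.\<close>
  have in1: "fscale (eps k \<tau> * eps i \<tau>) (unit_S (i \<circ> \<tau>) l) = unit_S i l" if tau: "\<tau> \<in> S1" for \<tau>
  proof -
    define s where "s = inv \<tau> t0"
    define w where "w = transpose s t0"
    define \<tau>' where "\<tau>' = \<tau> \<circ> w"
    have tSt: "\<tau> \<in> St" and ls: "l s = a" using tau by (auto simp: S1_def s_def)
    have p: "\<tau> \<in> perms r" and kt: "k \<circ> \<tau> = k" using tSt by (auto simp: St_def)
    have s: "s \<in> {1..r}" "k s = a" using pos[OF tSt s_def] by auto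
    have kt0: "k t0 = a" by (simp add: k_def)
    have w: "w \<in> perms r" unfolding w_def using s t0 by simp
    have ww: "\<tau>' \<circ> w = \<tau>" by (simp add: \<tau>'_def w_def o_assoc[symmetric])
    have kw: "k \<circ> w = k" "l \<circ> w = l" using s kt0 ls t0 by (auto simp: w_def fun_eq_iff transpose_def)
    have p': "\<tau>' \<in> perms r" using p w by (simp add: \<tau>'_def)
    have kt': "k \<circ> \<tau>' = k" unfolding \<tau>'_def o_assoc kt kw ..
    have t't0: "\<tau>' t0 = t0" using p by (simp add: \<tau>'_def w_def s_def)
    have it': "i \<circ> \<tau>' = i"
    proof
      fix x
      show "(i \<circ> \<tau>') x = i x"
      proof (cases "x = t0")
        case False
        then have "\<tau>' x \<noteq> t0" using t't0 perms_inj[OF p', of x t0] by auto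
        then have "i (\<tau>' x) = k (\<tau>' x)" by (simp add: k_def)
        also have "\<dots> = k x" using kt' by (metis comp_apply)
        finally show ?thesis using False by (simp add: k_def)
      qed (simp add: t't0)
    qed
    have e: "eps i \<tau>' = eps k \<tau>'"
    proof (rule sg_common_stabilizer[OF p' it' i kI])
      show "k x = i x" if "\<tau>' x \<noteq> x" for x using that t't0 by (auto simp: k_def)
    qed
    have "eps i \<tau> = eps i \<tau>' * eps i w" "eps k \<tau> = eps k \<tau>' * eps k w"
      using sg_comp[OF i p' w] sg_comp[OF kI p' w] it' kt' ww by simp_all
    then have "eps k \<tau> * eps i \<tau> = (eps k \<tau>' * eps k \<tau>') * (eps k w * eps i w)" using e by (simp add: mult_ac)
    then have "eps k \<tau> * eps i \<tau> = eps k w * eps i w" using sg_square[OF kI p'] by simp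
    moreover have "unit_S (i \<circ> \<tau>) l = fscale (eps i w * eps l w) (unit_S i l)"
    proof -
      have "i \<circ> \<tau> = i \<circ> w" using it' ww by (metis o_assoc)
      then show ?thesis using unit_S_comp[OF i w, of l] kw by simp
    qed
    moreover have "eps l w = eps k w"
    proof (cases "s = t0")
      case True
      then show ?thesis using sg_id[OF l] sg_id[OF kI] by (simp add: w_def)
    next
      case False
      then show ?thesis using sg_transpose[OF l s(1) t0(1)] sg_transpose[OF kI s(1) t0(1)] s ls t0 kt0 by (simp add: w_def)
    qed
    moreover have "eps k w * eps i w * (eps i w * eps k w) = 1"
      by (simp only: mult.assoc sg_square_left[OF i w] sg_square[OF kI w])
    ultimately show ?thesis by (simp only: fs.scale_scale fs.scale_one)
  qed
  \<comment> \<open>Here \<open>t0\<close> has become correct, and the entry put back sits at a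
    position outside the block, so no other agreement inside it is lost.\<close>
  have in2: "scalar_mod l (fscale (eps k \<tau> * eps i \<tau>) (unit_S (i \<circ> \<tau>) l))" if tau: "\<tau> \<in> St - S1" for \<tau>
  proof (rule scalar_mod_scale, rule IH)
    define s where "s = inv \<tau> t0"
    have tSt: "\<tau> \<in> St" and ls: "l s \<noteq> a" using tau by (auto simp: S1_def s_def)
    have p: "\<tau> \<in> perms r" using tSt by (auto simp: St_def)
    show "i \<circ> \<tau> \<in> Ix" using i p by simp
    show "content (i \<circ> \<tau>) = content l" using content_comp[OF i p] ci by simp
    have s: "s \<in> {1..r}" "k s = a" and val: "\<And>t. (i \<circ> \<tau>) t = (if t = s then i t0 else k t)"
      using pos[OF tSt s_def] by auto
    have st0: "s \<noteq> t0" using ls t0 by auto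
    then have isa: "i s = a" using s by (simp add: k_def)
    show "(i \<circ> \<tau>) t = l t" if t: "t \<in> {1..r}" "l t < a" for t
    proof -
      have "t \<noteq> s" using below[of s] isa s t by auto
      moreover have "t \<noteq> t0" using t t0 by auto
      ultimately show ?thesis using below[OF t] by (simp only: val k_def fun_upd_apply if_False)
    qed
    have "{t\<in>{1..r}. l t = a \<and> (i \<circ> \<tau>) t = a} = insert t0 {t\<in>{1..r}. l t = a \<and> i t = a}"
      using t0 ls st0 unfolding val k_def by auto
    moreover have "t0 \<notin> {t\<in>{1..r}. l t = a \<and> i t = a}" using t0 by simp
    ultimately show "agree l a (i \<circ> \<tau>) = Suc (agree l a i)" unfolding agree_def by simp
  qed
  define N where "N = (of_nat (card S1) :: 'k)"
  have N: "N \<noteq> 0" unfolding N_def of_nat_eq_0_iff by (rule card_nonzeroI[OF _ idS1]) (simp add: S1_def St_def)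
  have "mult (unit_S i k) (unit_S k l) = (\<Sum>\<tau>\<in>St - S1. fscale (eps k \<tau> * eps i \<tau>) (unit_S (i \<circ> \<tau>) l)) +
      (\<Sum>\<tau>\<in>S1. fscale (eps k \<tau> * eps i \<tau>) (unit_S (i \<circ> \<tau>) l))"
    unfolding exp by (rule sum.subset_diff) (auto simp: S1_def fin)
  also have "(\<Sum>\<tau>\<in>S1. fscale (eps k \<tau> * eps i \<tau>) (unit_S (i \<circ> \<tau>) l)) = (\<Sum>\<tau>\<in>S1. unit_S i l)"
    using in1 by (rule sum.cong[OF refl])
  also have "\<dots> = fscale N (unit_S i l)" by (rule ext) (simp add: sum_fun_apply N_def)
  finally have split: "mult (unit_S i k) (unit_S k l) =
      (\<Sum>\<tau>\<in>St - S1. fscale (eps k \<tau> * eps i \<tau>) (unit_S (i \<circ> \<tau>) l)) + fscale N (unit_S i l)" .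
  have move: "y = z + fscale (-1) x" if "z = x + y" for x y z :: "'k functional"
    using that by (simp add: fun_eq_iff)
  have eq: "fscale N (unit_S i l) = mult (unit_S i k) (unit_S k l) +
      fscale (-1) (\<Sum>\<tau>\<in>St - S1. fscale (eps k \<tau> * eps i \<tau>) (unit_S (i \<circ> \<tau>) l))"
    by (rule move[OF split])
  have "scalar_mod l (fscale N (unit_S i l))"
    unfolding eq by (intro scalar_mod_add scalar_mod_low[OF low] scalar_mod_scale scalar_mod_sum in2)
  then have "scalar_mod l (fscale (1 / N) (fscale N (unit_S i l)))" by (rule scalar_mod_scale)
  then show ?thesis using N by (simp only: fs.scale_scale) (simp only: nonzero_eq_divide_eq[symmetric] fs.scale_one divide_self_if times_divide_eq_left mult_1 if_False)
qed

text \<open>Double induction: the blocks \<open>l = a\<close> are corrected in increasing order of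
  \<open>a\<close>, and inside a block \<open>scalar_mod_step\<close> corrects one entry at a
  time.\<close>

lemma scalar_mod_unit:
  assumes l: "l \<in> Ix" and i: "i \<in> Ix" and ci: "content i = content l"
  shows "scalar_mod l (unit_S i l)"
proof -
  have main: "scalar_mod l (unit_S i l)"
    if "a \<le> Suc (m + n)" "i \<in> Ix" "content i = content l" "\<And>t. t \<in> {1..r} \<Longrightarrow> l t < a \<Longrightarrow> i t = l t" for a i
    using that
  proof (induction arbitrary: i rule: inc_induct)
    case base
    have "l t < Suc (m + n)" if "t \<in> {1..r}" for t using l that by (auto simp: multiindices_def PiE_def Pi_def less_Suc_eq_le)
    then have "i = l" using base l unfolding multiindices_def
      by (intro extensionalityI[of _ "{1..r}"]) (auto simp: PiE_def)
    moreover have "unit_S l l - fscale 1 (unit_S l l) \<in> low_ideal l"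
      by (simp only: fs.scale_one diff_self fs.subspace_0[OF low_ideal_subspace])
    ultimately show ?case unfolding scalar_mod_def by blast
  next
    case (step a)
    note outer = step.IH
    show ?case using step.prems
    proof (induction "r - agree l a i" arbitrary: i rule: less_induct)
      case less
      show ?case
      proof (cases "\<forall>t\<in>{1..r}. l t = a \<longrightarrow> i t = a")
        case True
        then show ?thesis using less.prems by (intro outer) (auto simp: less_Suc_eq)
      next
        case False
        then obtain t0 where t0: "t0 \<in> {1..r}" "l t0 = a" "i t0 \<noteq> a" by blast
        \<comment> \<open>The symbols below \<open>a\<close> already fill their blocks of
          \<open>l\<close>, and equality of contents leaves none over.\<close>
        have "\<not> i t0 < a"
        proof
          assume lt: "i t0 < a"
          define c where "c = i t0"
          have c: "c \<in> {1..m + n}" using less.prems(1) t0 by (auto simp: c_def multiindices_def PiE_def Pi_def)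
          have "{t\<in>{1..r}. l t = c} \<subseteq> {t\<in>{1..r}. i t = c}" using less.prems(3) lt c_def by auto
          moreover have "card {t\<in>{1..r}. l t = c} = card {t\<in>{1..r}. i t = c}"
            using fun_cong[OF less.prems(2), of c] c by (simp add: content_def)
          ultimately have "{t\<in>{1..r}. l t = c} = {t\<in>{1..r}. i t = c}" by (intro card_subset_eq) auto
          then have "l t0 = c" using t0 c_def by blast
          then show False using lt t0 c_def by simp
        qed
        then have lt: "a < i t0" using t0 by simp
        have ag: "agree l a i' \<le> r" for i'
          unfolding agree_def by (rule order_trans[OF card_mono[of "{1..r}"]]) auto
        show ?thesis
        proof (rule scalar_mod_step[OF l less.prems(1,2) t0(1,2) lt less.prems(3)])
          fix i' assume h: "i' \<in> Ix" "content i' = content l" "\<And>t. t \<in> {1..r} \<Longrightarrow> l t < a \<Longrightarrow> i' t = l t"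
            "agree l a i' = Suc (agree l a i)"
          have "r - agree l a i' < r - agree l a i" using h(4) ag[of i'] by simp
          from less.hyps[OF this h(1,2,3)] show "scalar_mod l (unit_S i' l)" by blast
        qed
      qed
    qed
  qed
  show ?thesis by (rule main[of 0]) (use i ci in auto)
qed

text \<open>Expanding \<open>Y\<close>, only labels \<open>l \<circ> \<pi>\<close> occur, and they
  all have the content of \<open>l\<close>.\<close>

lemma scalar_mod_eta:
  assumes l: "l \<in> Ix"
  shows "\<exists>\<theta>. eta l l - fscale \<theta> (widem (content l)) \<in> low_ideal l"
proof -
  have "eta l l = (\<Sum>\<pi>\<in>perms r. fscale (Y \<pi> * eps l \<pi>) (unit_S (l \<circ> \<pi>) l))"
    by (auto simp: fun_eq_iff sum_fun_apply eta_eq_sum grp_act_def)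
  moreover have "scalar_mod l (unit_S (l \<circ> \<pi>) l)" if "\<pi> \<in> perms r" for \<pi>
    using that l content_comp by (intro scalar_mod_unit) auto
  ultimately have "scalar_mod l (eta l l)" by (simp only:) (intro scalar_mod_sum scalar_mod_scale)
  then obtain \<theta> where th: "eta l l - fscale \<theta> (unit_S l l) \<in> low_ideal l" unfolding scalar_mod_def by blast
  obtain N where "unit_S l l = fscale N (widem (content l))" using unit_S_diag[OF l] by blast
  then show ?thesis using th by (metis fs.scale_scale)
qed

end

section \<open>Supermodules of highest weight\<close>

lemma span_image_sum:
  assumes vs: "vector_space s" and I: "finite I" and w: "w \<in> module.span s (g ` I)"
  shows "\<exists>x. w = (\<Sum>i\<in>I. s (x i) (g i))"
proof -
  interpret vs: vector_space s by (rule vs)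
  show ?thesis using w
  proof (induction rule: vs.span_induct_alt)
    case base
    show ?case by (rule exI[of _ "\<lambda>_. 0"]) simp
  next
    case (step c b w)
    then obtain x i where x: "w = (\<Sum>i\<in>I. s (x i) (g i))" and i: "i \<in> I" "b = g i" by blast
    have "(\<Sum>k\<in>I. s (if k = i then c else 0) (g k)) = (\<Sum>k\<in>I. if k = i then s c (g k) else 0)"
      by (intro sum.cong refl) simp
    then have "(\<Sum>k\<in>I. s ((if k = i then c else 0) + x k) (g k)) = s c b + w"
      using i I by (simp add: vs.scale_left_distrib sum.distrib x)
    then show ?case by metis
  qed
qed

locale left_mod = tableau_setting m n r K row col
  for m n r and K :: "'k::field_char_0 itself" and row col +
  fixes V :: "('k, 'v::ab_group_add) gspace" and L :: "('k, 'v) action"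
  assumes lm: "left_supermodule m n r V L"
begin

lemma gsp: "graded_space V" and gact: "graded_action m n r V L"
  using lm by (auto simp: left_supermodule_def)

sublocale vs: vector_space "scal V"
  using gsp by (simp add: graded_space_def)

lemma hcomp_subspace: "vs.subspace (hcomp V p)"
  using gsp by (simp add: graded_space_def)

lemma carr_decomp: "carr V = {v + w | v w. v \<in> hcomp V 0 \<and> w \<in> hcomp V 1}"
  using gsp unfolding graded_space_def by blast

lemma carr_subspace: "vs.subspace (carr V)"
  unfolding carr_decomp by (rule vs.subspace_sums[OF hcomp_subspace hcomp_subspace])

lemma hcomp_carr: "v \<in> hcomp V p \<Longrightarrow> v \<in> carr V"
proof -
  assume v: "v \<in> hcomp V p"
  have z: "0 \<in> hcomp V q" for q by (rule vs.subspace_0[OF hcomp_subspace])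
  have "v + 0 \<in> carr V \<or> 0 + v \<in> carr V"
  proof (cases "p = 0")
    case True
    then show ?thesis using v z unfolding carr_decomp by blast
  next
    case False
    then have "p = 1" by (cases p) auto
    then show ?thesis using v z unfolding carr_decomp by blast
  qed
  then show ?thesis by simp
qed

lemma L_lin: "\<xi> \<in> S \<Longrightarrow> lin_on (scal V) (scal V) (carr V) (L \<xi>)"
  using gact unfolding graded_action_def by blast

lemma L_carr: "\<xi> \<in> S \<Longrightarrow> v \<in> carr V \<Longrightarrow> L \<xi> v \<in> carr V"
  using gact unfolding graded_action_def by blast

lemma L_lin_S: "v \<in> carr V \<Longrightarrow> lin_on fscale (scal V) S (\<lambda>\<xi>. L \<xi> v)"
  using gact unfolding graded_action_def by blast

lemma L_hcomp: "\<xi> \<in> Sc p \<Longrightarrow> v \<in> hcomp V q \<Longrightarrow> L \<xi> v \<in> hcomp V (p + q)"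
  using gact unfolding graded_action_def by blast

lemma L_mult: "\<xi> \<in> S \<Longrightarrow> \<eta> \<in> S \<Longrightarrow> v \<in> carr V \<Longrightarrow> L (mult \<xi> \<eta>) v = L \<xi> (L \<eta> v)"
  using lm unfolding left_supermodule_def by blast

lemma lin_on_carr_sum:
  assumes "lin_on (scal V) s' (carr V) f" "\<And>x. x \<in> X \<Longrightarrow> v x \<in> carr V"
  shows "f (\<Sum>x\<in>X. scal V (c x) (v x)) = (\<Sum>x\<in>X. s' (c x) (f (v x)))"
  by (rule lin_on_sum[OF assms(1) vs.subspace_0[OF carr_subspace] vs.subspace_add[OF carr_subspace]
        vs.subspace_scale[OF carr_subspace] assms(2)])

lemma L_S_sum:
  assumes "v \<in> carr V" "\<And>x. x \<in> X \<Longrightarrow> \<eta> x \<in> S"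
  shows "L (\<Sum>x\<in>X. fscale (c x) (\<eta> x)) v = (\<Sum>x\<in>X. scal V (c x) (L (\<eta> x) v))"
  by (rule lin_on_sum[OF L_lin_S[OF assms(1)] S_zero S_add S_scale assms(2)])

lemma L_zero: "\<xi> \<in> S \<Longrightarrow> L \<xi> 0 = 0"
  using lin_on_0[OF L_lin] vs.subspace_0[OF carr_subspace] by blast

lemma L_eta:
  assumes "\<xi> \<in> S" "j \<in> Ix" "v \<in> carr V"
  shows "L \<xi> (L (eta j i) v) = (\<Sum>s\<in>Ix. scal V (\<xi> (\<chi> s j)) (L (eta s i) v))"
proof -
  have "L \<xi> (L (eta j i) v) = L (mult \<xi> (eta j i)) v" by (rule L_mult[OF assms(1) eta_in assms(3), symmetric])
  also have "\<dots> = (\<Sum>s\<in>Ix. scal V (\<xi> (\<chi> s j)) (L (eta s i) v))"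
    unfolding mult_eta[OF assms(1,2)] by (rule L_S_sum[OF assms(3) eta_in])
  finally show ?thesis .
qed

lemma widem_unit:
  assumes k: "k \<in> Ix" and l: "l \<in> Ix"
  shows "mult (widem (content k)) (unit_S k l) = unit_S k l"
proof (rule S_ext)
  fix a b assume ab: "a \<in> Ix" "b \<in> Ix"
  have "unit_mat k l a b = 0" if "content a \<noteq> content k"
    unfolding unit_mat_def
  proof (intro sum.neutral ballI)
    fix \<pi> assume p: "\<pi> \<in> perms r"
    then have "a \<circ> \<pi> \<noteq> k" using content_comp[OF ab(1) p] that by auto
    then show "eps a \<pi> * eps b \<pi> * (delta k (a \<circ> \<pi>) * delta l (b \<circ> \<pi>)) = 0" by (simp add: delta_def)
  qed
  moreover have "mult (widem (content k)) (unit_S k l) (\<chi> a b) =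
      (\<Sum>s\<in>Ix. if s = a then (if content a = content k then unit_mat k l s b else 0) else 0)"
    unfolding mult_chi[OF widem_in[OF content_weights[OF k]] unit_S_in ab]
    by (intro sum.cong refl) (use ab k in \<open>auto simp: widem_chi content_weights unit_S_chi\<close>)
  ultimately show "mult (widem (content k)) (unit_S k l) (\<chi> a b) = unit_S k l (\<chi> a b)"
    using ab by (simp add: sum.delta unit_S_chi)
qed (use k in \<open>auto intro!: mult_in widem_in content_weights\<close>)

text \<open>A generator passes through the weight space of \<open>content k\<close>, which is zero
  by assumption.\<close>

lemma low_ideal_kills:
  assumes w: "\<And>\<mu> u. \<mu> \<in> weights m n r \<Longrightarrow> \<not> dominated m n \<mu> (content l) \<Longrightarrow> u \<in> carr V \<Longrightarrow> L (widem \<mu>) u = 0"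
    and l: "l \<in> Ix" and v: "v \<in> carr V" and z: "z \<in> low_ideal l"
  shows "z \<in> S \<and> L z v = 0"
  using z unfolding low_ideal_def
proof (induction rule: fs.span_induct_alt)
  case base
  show ?case using S_zero lin_on_0[OF L_lin_S[OF v] S_zero] by blast
next
  case (step c b z)
  then obtain x k where b: "b = mult x (unit_S k l)" and x: "x \<in> S" and k: "k \<in> Ix"
    and nd: "\<not> dominated m n (content k) (content l)" by blast
  have u: "L (unit_S k l) v \<in> carr V" by (rule L_carr[OF unit_S_in v])
  have wS: "widem (content k) \<in> S" by (rule widem_in[OF content_weights[OF k]])
  have "L (unit_S k l) v = L (widem (content k)) (L (unit_S k l) v)"
    using L_mult[OF wS unit_S_in v, of k l] widem_unit[OF k l] by simp
  also have "\<dots> = 0" by (rule w[OF content_weights[OF k] nd u])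
  finally have "L b v = 0" unfolding b L_mult[OF x unit_S_in v] using L_zero[OF x] by simp
  moreover have bS: "b \<in> S" unfolding b by (rule mult_in[OF x unit_S_in])
  ultimately have "L (fscale c b + z) v = 0"
    using L_lin_S[OF v] step S_scale[OF bS] unfolding lin_on_def by simp
  moreover have "fscale c b + z \<in> S" using S_add[OF S_scale[OF bS]] step by blast
  ultimately show ?case by blast
qed

end

locale hw_setting = tableau_setting m n r K row col
  for m n r and K :: "'k::field_char_0 itself" and row col +
  fixes el
  assumes el_SS: "el \<in> SS" and el_dom: "\<And>j. j \<in> SS \<Longrightarrow> dominated m n (content j) (content el)"
begin

abbreviation wl where "wl \<equiv> content el"

lemma el_Ix [simp]: "el \<in> Ix" using el_SS by (rule SS_Ix)

lemma wl_weights [simp]: "wl \<in> weights m n r" by (rule content_weights) simp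

lemma bc_el: "bc el el \<noteq> 0"
  unfolding bc_def by (rule act_young_delta_diag[OF el_SS])

text \<open>A model of the irreducible left module inside \<open>A\<close>: the first index is
  frozen at \<open>el\<close>. It gives existence and also fixes the constant in
  \<open>eta_low\<close>.\<close>

definition V0 :: "'k superpoly set" where "V0 = fs.span (sym el ` Ix)"

lemma V0_SS: "V0 = fs.span (sym el ` SS)"
proof
  show "fs.span (sym el ` SS) \<subseteq> V0" unfolding V0_def by (rule fs.span_mono) (use SS_Ix in blast)
  have "sym el j \<in> fs.span (sym el ` SS)" if j: "j \<in> Ix" for j
  proof -
    obtain c where "sym el j = (\<Sum>l\<in>SS. fscale (c l) (sym el l))"
      using sym_straighten_right[OF j] el_Ix by blast
    then show ?thesis by (simp only:) (intro fs.span_sum fs.span_scale fs.span_base imageI)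
  qed
  then show "V0 \<subseteq> fs.span (sym el ` SS)" unfolding V0_def by (intro fs.span_minimal[OF _ fs.subspace_span]) blast
qed

lemma V0_expand: "w \<in> V0 \<Longrightarrow> \<exists>x. w = (\<Sum>j\<in>SS. fscale (x j) (sym el j))"
  unfolding V0_SS by (rule span_image_sum[OF vector_space_fscale finite_SS])

lemma V0_A: "V0 \<subseteq> A"
  unfolding V0_def by (rule fs.span_minimal[OF _ A_subspace]) auto

lemma sym_V0: "j \<in> Ix \<Longrightarrow> sym el j \<in> V0"
  unfolding V0_def by (rule fs.span_base) blast

lemma V0_subspace: "fs.subspace V0" unfolding V0_def by (rule fs.subspace_span)

lemma lact_V0: "\<xi> \<in> S \<Longrightarrow> f \<in> V0 \<Longrightarrow> lact \<xi> f \<in> V0"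
  unfolding V0_def
  by (rule fscale_span_induct_lin[OF lact_lin A_subspace _ _ fs.subspace_span])
    (auto simp: lact_sym sym_V0[unfolded V0_def] intro!: fs.span_sum fs.span_scale)

lemma left_V0: "left_supermodule m n r (sub_space V0) lact"
proof (rule left_supermodule_sub_space[OF _ V0_A lact_V0])
  show "graded_space (sub_space V0)" unfolding V0_def
    by (rule graded_sub_space) (use sym_Ac[OF el_Ix] in blast)
qed

lemma sym_el_nonzero: "sym el el \<noteq> 0"
proof
  assume z: "sym el el = 0"
  have "(\<Sum>i\<in>SS. \<Sum>j\<in>SS. fscale (if i = el \<and> j = el then 1 else 0) (sym i j)) = 0"
  proof (intro sum.neutral ballI)
    fix i j show "fscale (if i = el \<and> j = el then 1 else 0) (sym i j) = 0"
    proof (cases "i = el \<and> j = el")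
      case True
      then show ?thesis using z fs.scale_zero_right by (simp only:)
    qed (auto simp: fun_eq_iff)
  qed
  from sym_independent[OF this el_SS el_SS] show False by simp
qed

lemma lact_widem_sym:
  assumes "\<mu> \<in> weights m n r" "j \<in> Ix"
  shows "lact (widem \<mu>) (sym el j) = (if content j = \<mu> then sym el j else 0)"
proof -
  have "lact (widem \<mu>) (sym el j) = (\<Sum>a\<in>Ix. if a = j then (if content j = \<mu> then sym el a else 0) else 0)"
    unfolding lact_sym[OF widem_in[OF assms(1)] el_Ix assms(2)]
  proof (intro sum.cong refl)
    fix a assume "a \<in> Ix"
    then show "fscale (widem \<mu> (\<chi> a j)) (sym el a) = (if a = j then (if content j = \<mu> then sym el a else 0) else 0)"
      using assms by (cases "a = j") (simp_all add: widem_chi fscale_def zero_fun_def)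
  qed
  then show ?thesis using assms by (simp add: sum.delta)
qed

lemma V0_weights:
  assumes mu: "\<mu> \<in> weights m n r" and u: "u \<in> V0" "lact (widem \<mu>) u \<noteq> 0"
  shows "dominated m n \<mu> wl"
proof -
  obtain x where x: "u = (\<Sum>j\<in>SS. fscale (x j) (sym el j))" using V0_expand[OF u(1)] by blast
  have "lact (widem \<mu>) u = (\<Sum>j\<in>SS. fscale (x j) (lact (widem \<mu>) (sym el j)))"
    unfolding x by (rule lin_on_A_sum[OF lact_lin[OF widem_in[OF mu]]]) (use SS_Ix in auto)
  then obtain j where "j \<in> SS" "fscale (x j) (lact (widem \<mu>) (sym el j)) \<noteq> 0"
    using u(2) by (metis (no_types, lifting) sum.neutral)
  then have "j \<in> SS" "content j = \<mu>"
    using lact_widem_sym[OF mu SS_Ix] fs.scale_zero_right by (metis, metis)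
  then show ?thesis using el_dom by blast
qed

text \<open>The scalar left open by \<open>scalar_mod_eta\<close> is found in the model
  \<open>V0\<close>: there the low ideal kills \<open>sym el el\<close>, \<open>widem wl\<close>
  fixes it, and \<open>eta el el\<close> multiplies it by \<open>hc * bc el el\<close>. Being a
  congruence in \<open>S\<close>, the result can then be used in every module of this highest
  weight.\<close>

lemma eta_low: "eta el el - fscale (hc * bc el el) (widem wl) \<in> low_ideal el"
proof -
  interpret M: left_mod m n r K row col "sub_space V0" lact
    by unfold_locales (rule left_V0)
  obtain \<theta> where th: "eta el el - fscale \<theta> (widem wl) \<in> low_ideal el" using scalar_mod_eta[OF el_Ix] by blast
  let ?z = "eta el el - fscale \<theta> (widem wl)"
  have v: "sym el el \<in> V0" by (rule sym_V0) simp
  have z: "?z \<in> S" "lact ?z (sym el el) = 0"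
    using M.low_ideal_kills[OF _ el_Ix _ th] V0_weights v by auto
  have "eta el el = ?z + fscale \<theta> (widem wl)" by simp
  then have "lact (eta el el) (sym el el) = lact ?z (sym el el) + lact (fscale \<theta> (widem wl)) (sym el el)"
    using lact_lin_S[of "sym el el"] z(1) S_scale[OF widem_in[OF wl_weights]] unfolding lin_on_def by (metis sym_in el_Ix)
  also have "lact (fscale \<theta> (widem wl)) (sym el el) = fscale \<theta> (lact (widem wl) (sym el el))"
    using lact_lin_S[of "sym el el"] widem_in[OF wl_weights] unfolding lin_on_def by (metis sym_in el_Ix)
  finally have "fscale (hc * bc el el) (sym el el) = fscale \<theta> (sym el el)"
    unfolding z(2) lact_eta_sym[OF el_Ix el_Ix el_Ix] lact_widem_sym[OF wl_weights el_Ix]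
    by (simp only: if_True add_0_left simp_thms)
  then have "\<theta> = hc * bc el el" using fs.scale_right_imp_eq[OF sym_el_nonzero] by metis
  then show ?thesis using th by simp
qed

text \<open>By triangularity the coefficients of a nonzero vector pair nontrivially with some
  \<open>bc l\<close>; then \<open>eta k l\<close> sends the vector to a nonzero multiple of
  \<open>sym el k\<close>, for every \<open>k\<close>.\<close>

lemma irreducible_V0: "irreducible_action m n r (sub_space V0) lact"
  unfolding irreducible_action_def sub_space_simps
proof (intro conjI allI impI)
  show "V0 \<noteq> {0}" using sym_V0[OF el_Ix] sym_el_nonzero by blast
  fix W assume W: "graded_subspace (sub_space V0) W \<and> (\<forall>\<xi>\<in>S. lact \<xi> ` W \<subseteq> W)"
  then have sub: "W \<subseteq> V0" "fs.subspace W" by (auto simp: graded_subspace_def)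
  show "W = {0} \<or> W = V0"
  proof (cases "W \<subseteq> {0}")
    case True
    then show ?thesis using fs.subspace_0[OF sub(2)] by blast
  next
    case False
    then obtain w where w: "w \<in> W" "w \<noteq> 0" by blast
    obtain x where x: "w = (\<Sum>j\<in>SS. fscale (x j) (sym el j))" using V0_expand w sub by blast
    have "\<exists>j\<in>SS. x j \<noteq> 0"
    proof (rule ccontr)
      assume "\<not> (\<exists>j\<in>SS. x j \<noteq> 0)"
      then have "w = 0" unfolding x by (intro sum.neutral) (auto simp: fun_eq_iff)
      then show False using w by blast
    qed
    then obtain l where l: "l \<in> SS" "(\<Sum>j\<in>SS. x j * bc l j) \<noteq> 0" using bc_triangular[of x] by blast
    have "sym el k \<in> W" if k: "k \<in> Ix" for k
    proof -
      have "lact (eta k l) w = (\<Sum>j\<in>SS. fscale (x j) (lact (eta k l) (sym el j)))"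
        unfolding x by (rule lin_on_A_sum[OF lact_lin[OF eta_in]]) (use SS_Ix in auto)
      also have "\<dots> = (\<Sum>j\<in>SS. fscale (x j) (fscale (hc * bc l j) (sym el k)))"
        by (intro sum.cong refl arg_cong2[where f = fscale] lact_eta_sym k el_Ix SS_Ix)
      also have "\<dots> = fscale (hc * (\<Sum>j\<in>SS. x j * bc l j)) (sym el k)"
        by (simp add: fun_eq_iff sum_fun_apply sum_distrib_left sum_distrib_right mult_ac)
      finally have "fscale (hc * (\<Sum>j\<in>SS. x j * bc l j)) (sym el k) \<in> W"
        using W w(1) eta_in by (metis image_subset_iff)
      then have "fscale (1 / (hc * (\<Sum>j\<in>SS. x j * bc l j))) (fscale (hc * (\<Sum>j\<in>SS. x j * bc l j)) (sym el k)) \<in> W"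
        by (rule fs.subspace_scale[OF sub(2)])
      moreover have "1 / (hc * (\<Sum>j\<in>SS. x j * bc l j)) * (hc * (\<Sum>j\<in>SS. x j * bc l j)) = 1" using l(2) by simp
      ultimately show ?thesis by (simp only: fs.scale_scale fs.scale_one)
    qed
    then have "V0 \<subseteq> W" unfolding V0_def by (intro fs.span_minimal sub(2)) blast
    then show ?thesis using sub by blast
  qed
qed

lemma highest_weight_V0: "highest_weight m n r (sub_space V0) lact wl"
  unfolding highest_weight_def weight_space_def sub_space_simps
proof (intro conjI ballI impI wl_weights)
  have "lact (widem wl) (sym el el) = sym el el" using lact_widem_sym[OF wl_weights el_Ix] by simp
  then have "sym el el \<in> lact (widem wl) ` V0" using sym_V0[OF el_Ix] by (metis imageI)
  then show "lact (widem wl) ` V0 \<noteq> {0}" using sym_el_nonzero by blast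
  fix \<mu> assume mu: "\<mu> \<in> weights m n r" and ne: "lact (widem \<mu>) ` V0 \<noteq> {0}"
  have "0 \<in> lact (widem \<mu>) ` V0"
    using lin_on_0[OF lact_lin[OF widem_in[OF mu]] A_zero] fs.subspace_0[OF V0_subspace] by (metis imageI)
  then obtain u where "u \<in> V0" "lact (widem \<mu>) u \<noteq> 0" using ne by blast
  then show "dominated m n \<mu> wl" using V0_weights[OF mu] by blast
qed

end

locale hw_mod = hw_setting m n r K row col el + left_mod m n r K row col V L
  for m n r and K :: "'k::field_char_0 itself" and row col el
    and V :: "('k, 'v::ab_group_add) gspace" and L :: "('k, 'v) action" +
  assumes irr: "irreducible_action m n r V L" and hw: "highest_weight m n r V L (content el)"
begin

lemma weight_kills:
  assumes "\<mu> \<in> weights m n r" "\<not> dominated m n \<mu> wl" "u \<in> carr V"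
  shows "L (widem \<mu>) u = 0"
proof -
  have "weight_space m n r V L \<mu> = {0}" using hw assms unfolding highest_weight_def by blast
  then show ?thesis using assms(3) unfolding weight_space_def by blast
qed

lemma widem_Sc: "\<mu> \<in> weights m n r \<Longrightarrow> widem \<mu> \<in> Sc 0"
proof -
  assume mu: "\<mu> \<in> weights m n r"
  let ?F = "\<lambda>i j. widem \<mu> (\<chi> i j)"
  have "to_S ?F \<in> Sc 0"
    by (rule to_S_Sc) (auto simp: widem_chi[OF mu] split: if_splits)
  moreover have "to_S ?F = widem \<mu>"
    using S_equivariant[OF widem_in[OF mu]] widem_in[OF mu] by (intro S_ext) simp_all
  ultimately show ?thesis by simp
qed

lemma widem_idem:
  assumes "\<mu> \<in> weights m n r"
  shows "mult (widem \<mu>) (widem \<mu>) = widem \<mu>"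
proof (rule S_ext)
  fix i j assume ij: "i \<in> Ix" "j \<in> Ix"
  have "mult (widem \<mu>) (widem \<mu>) (\<chi> i j) = (\<Sum>s\<in>Ix. if s = i then widem \<mu> (\<chi> s j) else 0)"
    unfolding mult_chi[OF widem_in[OF assms] widem_in[OF assms] ij]
    by (intro sum.cong refl) (use ij assms in \<open>auto simp: widem_chi\<close>)
  then show "mult (widem \<mu>) (widem \<mu>) (\<chi> i j) = widem \<mu> (\<chi> i j)" using ij by (simp add: sum.delta)
qed (use assms widem_in in auto)

text \<open>The idempotent is even, so it preserves parity, and at least one homogeneous component
  of a vector it does not kill survives.\<close>

lemma highest_vector:
  obtains v q where "v \<in> hcomp V q" "v \<noteq> 0" "L (widem wl) v = v"
proof -
  have wS: "widem wl \<in> S" by (rule widem_in[OF wl_weights])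
  have "L (widem wl) ` carr V \<noteq> {0}" using hw unfolding highest_weight_def weight_space_def by blast
  moreover have "0 \<in> L (widem wl) ` carr V" using L_zero[OF wS] vs.subspace_0[OF carr_subspace] by (metis imageI)
  ultimately obtain u where u: "u \<in> carr V" "L (widem wl) u \<noteq> 0" by blast
  then obtain a b where ab: "u = a + b" "a \<in> hcomp V 0" "b \<in> hcomp V 1" unfolding carr_decomp by blast
  have "L (widem wl) u = L (widem wl) a + L (widem wl) b"
    using L_lin[OF wS] ab hcomp_carr unfolding lin_on_def by blast
  then have "L (widem wl) a \<noteq> 0 \<or> L (widem wl) b \<noteq> 0" using u(2) by auto
  then obtain c q where c: "c \<in> hcomp V q" "L (widem wl) c \<noteq> 0" using ab by blast
  have "L (widem wl) c \<in> hcomp V q" using L_hcomp[OF widem_Sc[OF wl_weights] c(1)] by (simp only: add_0_left)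
  moreover have "L (widem wl) (L (widem wl) c) = L (widem wl) c"
    using L_mult[OF wS wS hcomp_carr[OF c(1)]] widem_idem[OF wl_weights] by simp
  ultimately show ?thesis using c(2) that by blast
qed

text \<open>The last two clauses express the linear relations of the family dually: every functional
  on it is an eigenfunction of \<open>Y\<close>, and every \<open>bc l\<close> occurs as a
  functional. In this form they can be fed into \<open>theta\<close>.\<close>

theorem irreducible_structure:
  obtains f q where "\<And>j. j \<in> Ix \<Longrightarrow> f j \<in> hcomp V (tp j + q)"
    "\<And>\<xi> j. \<xi> \<in> S \<Longrightarrow> j \<in> Ix \<Longrightarrow> L \<xi> (f j) = (\<Sum>s\<in>Ix. scal V (\<xi> (\<chi> s j)) (f s))"
    "carr V = vs.span (f ` Ix)"
    "\<And>\<beta> j. lin_on (scal V) (*) (carr V) \<beta> \<Longrightarrow> j \<in> Ix \<Longrightarrow> act Y (\<lambda>j. \<beta> (f j)) j = hc * \<beta> (f j)"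
    "\<And>l. l \<in> Ix \<Longrightarrow> \<exists>\<beta>. lin_on (scal V) (*) (carr V) \<beta> \<and> (\<forall>j\<in>Ix. \<beta> (f j) = bc l j)"
proof -
  obtain v q where v: "v \<in> hcomp V q" "v \<noteq> 0" "L (widem wl) v = v" using highest_vector by blast
  have vc: "v \<in> carr V" by (rule hcomp_carr[OF v(1)])
  define f where "f j = L (eta j el) v" for j
  have f_carr: "f j \<in> carr V" for j unfolding f_def by (rule L_carr[OF eta_in vc])
  have f_hcomp: "f j \<in> hcomp V (tp j + (tp el + q))" for j
    unfolding f_def add.assoc[symmetric] by (rule L_hcomp[OF eta_Sc v(1)])
  have f_act: "L \<xi> (f j) = (\<Sum>s\<in>Ix. scal V (\<xi> (\<chi> s j)) (f s))" if "\<xi> \<in> S" "j \<in> Ix" for \<xi> j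
    unfolding f_def by (rule L_eta[OF that vc])
  \<comment> \<open>By \<open>eta_low\<close>, \<open>eta el el\<close> acts on the highest weight
    vector as a nonzero scalar, so the family is not zero and irreducibility can be applied to its
    span.\<close>
  have f_el: "f el = scal V (hc * bc el el) v"
  proof -
    let ?z = "eta el el - fscale (hc * bc el el) (widem wl)"
    have z: "?z \<in> S" "L ?z v = 0" using low_ideal_kills[OF weight_kills el_Ix vc eta_low] by auto
    have wS: "widem wl \<in> S" by (rule widem_in[OF wl_weights])
    have "eta el el = ?z + fscale (hc * bc el el) (widem wl)" by simp
    then have "f el = L ?z v + L (fscale (hc * bc el el) (widem wl)) v"
      unfolding f_def using L_lin_S[OF vc] z(1) S_scale[OF wS] unfolding lin_on_def by metis
    also have "L (fscale (hc * bc el el) (widem wl)) v = scal V (hc * bc el el) (L (widem wl) v)"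
      using L_lin_S[OF vc] wS unfolding lin_on_def by blast
    finally show ?thesis unfolding z(2) v(3) by (simp only: add_0_left)
  qed
  then have f_el0: "f el \<noteq> 0" using v(2) bc_el by simp
  have span_sub: "vs.span (f ` Ix) \<subseteq> carr V" by (rule vs.span_minimal[OF _ carr_subspace]) (use f_carr in blast)
  have exp: "\<exists>x. w = (\<Sum>j\<in>Ix. scal V (x j) (f j))" if "w \<in> vs.span (f ` Ix)" for w
    by (rule span_image_sum[OF vs.vector_space_axioms finite_multiindices that])
  have f_span: "f j \<in> vs.span (f ` Ix)" if "j \<in> Ix" for j using that by (intro vs.span_base imageI)
  have stable: "L \<xi> w \<in> vs.span (f ` Ix)" if x: "\<xi> \<in> S" and w: "w \<in> vs.span (f ` Ix)" for \<xi> w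
  proof -
    obtain y where y: "w = (\<Sum>j\<in>Ix. scal V (y j) (f j))" using exp[OF w] by blast
    have "L \<xi> w = (\<Sum>j\<in>Ix. scal V (y j) (L \<xi> (f j)))"
      unfolding y by (rule lin_on_carr_sum[OF L_lin[OF x] f_carr])
    also have "\<dots> = (\<Sum>j\<in>Ix. scal V (y j) (\<Sum>s\<in>Ix. scal V (\<xi> (\<chi> s j)) (f s)))"
      by (intro sum.cong refl arg_cong[where f = "scal V _"] f_act[OF x])
    also have "\<dots> \<in> vs.span (f ` Ix)" by (intro vs.span_sum vs.span_scale f_span)
    finally show ?thesis .
  qed
  have graded: "graded_subspace V (vs.span (f ` Ix))"
    unfolding graded_subspace_def
  proof (intro conjI span_sub vs.subspace_span set_eqI iffI)
    fix w assume "w \<in> vs.span (f ` Ix)"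
    then obtain x where x: "w = (\<Sum>j\<in>Ix. scal V (x j) (f j))" using exp by blast
    define I where "I p = {j\<in>Ix. tp j + (tp el + q) = p}" for p
    define c where "c p = (\<Sum>j\<in>I p. scal V (x j) (f j))" for p
    have "c p \<in> vs.span (f ` Ix) \<inter> hcomp V p" for p
    proof
      show "c p \<in> vs.span (f ` Ix)" unfolding c_def I_def by (intro vs.span_sum vs.span_scale f_span) simp
      have "f j \<in> hcomp V p" if "j \<in> I p" for j using f_hcomp[of j] that unfolding I_def by auto
      then show "c p \<in> hcomp V p" unfolding c_def
        by (intro vs.subspace_sum[OF hcomp_subspace] vs.subspace_scale[OF hcomp_subspace])
    qed
    moreover have "w = c 0 + c 1"
    proof -
      have "Ix = I 0 \<union> I 1"
      proof -
        have "p = 0 \<or> p = 1" for p :: bit by (cases p) auto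
        then show ?thesis unfolding I_def by blast
      qed
      moreover have "I 0 \<inter> I 1 = {}" by (auto simp only: I_def zero_neq_one mem_Collect_eq)
      moreover have "finite (I p)" for p by (simp add: I_def)
      ultimately show ?thesis unfolding x c_def using sum.union_disjoint[of "I 0" "I 1"] by metis
    qed
    ultimately show "w \<in> {a + b | a b. a \<in> vs.span (f ` Ix) \<inter> hcomp V 0 \<and> b \<in> vs.span (f ` Ix) \<inter> hcomp V 1}" by blast
  next
    fix w assume "w \<in> {a + b | a b. a \<in> vs.span (f ` Ix) \<inter> hcomp V 0 \<and> b \<in> vs.span (f ` Ix) \<inter> hcomp V 1}"
    then show "w \<in> vs.span (f ` Ix)" by (auto intro: vs.span_add)
  qed
  have carr: "carr V = vs.span (f ` Ix)"
  proof -
    have "vs.span (f ` Ix) \<noteq> {0}" using f_span[OF el_Ix] f_el0 by blast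
    then show ?thesis using irr graded stable unfolding irreducible_action_def by blast
  qed
  have young: "act Y (\<lambda>j. \<beta> (f j)) j = hc * \<beta> (f j)" if b: "lin_on (scal V) (*) (carr V) \<beta>" and j: "j \<in> Ix" for \<beta> j
  proof -
    have eq: "(\<Sum>\<pi>\<in>perms r. fscale (Y \<pi> * eps j \<pi>) (eta (j \<circ> \<pi>) el)) = fscale hc (eta j el)"
      by (rule ext) (use eta_young[OF j] in \<open>simp add: sum_fun_apply grp_act_def\<close>)
    have "(\<Sum>\<pi>\<in>perms r. scal V (Y \<pi> * eps j \<pi>) (f (j \<circ> \<pi>))) = L (\<Sum>\<pi>\<in>perms r. fscale (Y \<pi> * eps j \<pi>) (eta (j \<circ> \<pi>) el)) v"
      unfolding f_def by (rule L_S_sum[OF vc eta_in, symmetric])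
    also have "\<dots> = scal V hc (f j)"
      unfolding eq f_def using L_lin_S[OF vc] eta_in unfolding lin_on_def by blast
    finally have "\<beta> (\<Sum>\<pi>\<in>perms r. scal V (Y \<pi> * eps j \<pi>) (f (j \<circ> \<pi>))) = \<beta> (scal V hc (f j))" by simp
    then show ?thesis
      unfolding lin_on_carr_sum[OF b f_carr] using b f_carr[of j] unfolding lin_on_def grp_act_def by simp
  qed
  \<comment> \<open>Applying \<open>eta el l\<close> collapses every combination to a multiple of
    the single nonzero vector \<open>f el\<close>.\<close>
  have faithful: "(\<Sum>j\<in>Ix. x j * bc l j) = 0" if z: "(\<Sum>j\<in>Ix. scal V (x j) (f j)) = 0" and l: "l \<in> Ix" for x l
  proof -
    have ef: "L (eta el l) (f j) = scal V (hc * bc l j) (f el)" if "j \<in> Ix" for j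
    proof -
      have "L (eta el l) (f j) = L (mult (eta el l) (eta j el)) v"
        unfolding f_def by (rule L_mult[OF eta_in eta_in vc, symmetric])
      also have "\<dots> = scal V (hc * bc l j) (f el)"
        unfolding eta_mult[OF el_Ix that] f_def using L_lin_S[OF vc] eta_in unfolding lin_on_def by blast
      finally show ?thesis .
    qed
    have "0 = L (eta el l) (\<Sum>j\<in>Ix. scal V (x j) (f j))" unfolding z using L_zero[OF eta_in] by simp
    also have "\<dots> = (\<Sum>j\<in>Ix. scal V (x j) (L (eta el l) (f j)))"
      by (rule lin_on_carr_sum[OF L_lin[OF eta_in] f_carr])
    also have "\<dots> = (\<Sum>j\<in>Ix. scal V (x j * (hc * bc l j)) (f el))"
      by (intro sum.cong refl) (simp add: ef)
    also have "\<dots> = scal V (hc * (\<Sum>j\<in>Ix. x j * bc l j)) (f el)"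
      by (simp add: vs.scale_sum_left[symmetric] sum_distrib_left mult_ac)
    finally show ?thesis using f_el0 by simp
  qed
  have functional: "\<exists>\<beta>. lin_on (scal V) (*) (carr V) \<beta> \<and> (\<forall>j\<in>Ix. \<beta> (f j) = bc l j)" if l: "l \<in> Ix" for l
  proof -
    \<comment> \<open>Coordinates are picked arbitrarily; \<open>faithful\<close> makes the value of
      \<open>\<beta>\<close> independent of the choice.\<close>
    define X where "X w = (SOME x. w = (\<Sum>j\<in>Ix. scal V (x j) (f j)))" for w
    define \<beta> where "\<beta> w = (\<Sum>j\<in>Ix. X w j * bc l j)" for w
    have \<beta>: "\<beta> (\<Sum>j\<in>Ix. scal V (x j) (f j)) = (\<Sum>j\<in>Ix. x j * bc l j)" for x
    proof -
      let ?w = "\<Sum>j\<in>Ix. scal V (x j) (f j)"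
      have "?w = (\<Sum>j\<in>Ix. scal V (X ?w j) (f j))"
        unfolding X_def by (rule someI[of "\<lambda>y. ?w = (\<Sum>j\<in>Ix. scal V (y j) (f j))"]) (rule refl)
      then have "(\<Sum>j\<in>Ix. scal V (X ?w j - x j) (f j)) = 0"
        by (simp add: vs.scale_left_diff_distrib sum_subtractf)
      then have "(\<Sum>j\<in>Ix. (X ?w j - x j) * bc l j) = 0" by (rule faithful[OF _ l])
      then show ?thesis by (simp add: \<beta>_def left_diff_distrib sum_subtractf)
    qed
    have "lin_on (scal V) (*) (carr V) \<beta>"
      unfolding lin_on_def
    proof (intro conjI ballI allI)
      fix a b assume "a \<in> carr V" "b \<in> carr V"
      then obtain x y where "a = (\<Sum>j\<in>Ix. scal V (x j) (f j))" "b = (\<Sum>j\<in>Ix. scal V (y j) (f j))"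
        using exp unfolding carr by blast
      moreover from this have "a + b = (\<Sum>j\<in>Ix. scal V (x j + y j) (f j))"
        by (simp add: vs.scale_left_distrib sum.distrib)
      ultimately show "\<beta> (a + b) = \<beta> a + \<beta> b" using \<beta> by (simp add: distrib_right sum.distrib)
    next
      fix c a assume "a \<in> carr V"
      then obtain x where "a = (\<Sum>j\<in>Ix. scal V (x j) (f j))" using exp unfolding carr by blast
      moreover from this have "scal V c a = (\<Sum>j\<in>Ix. scal V (c * x j) (f j))"
        by (simp add: vs.scale_sum_right)
      ultimately show "\<beta> (scal V c a) = c * \<beta> a" using \<beta> by (simp add: sum_distrib_left mult.assoc)
    qed
    moreover have "\<beta> (f j) = bc l j" if j: "j \<in> Ix" for j
    proof -
      have "f j = (\<Sum>k\<in>Ix. if k = j then f k else 0)" using j by (simp add: sum.delta)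
      also have "\<dots> = (\<Sum>k\<in>Ix. scal V (if k = j then 1 else 0) (f k))" by (intro sum.cong refl) simp
      finally have "\<beta> (f j) = (\<Sum>k\<in>Ix. (if k = j then 1 else 0) * bc l k)" using \<beta> by metis
      then show ?thesis using j by (simp add: if_distrib[of "\<lambda>x. x * _"] sum.delta cong: if_cong)
    qed
    ultimately show ?thesis by blast
  qed
  show ?thesis using that[of f "tp el + q"] f_hcomp f_act carr young functional by blast
qed

end

section \<open>Transposition exchanges left and right supermodules\<close>

context tableau_setting
begin

text \<open>Plain matrix transposition. It respects equivariance because the sign is symmetric in
  the two indices, it reverses products because matrix entries are scalars, and it preserves parity;
  so it exchanges left and right supermodules.\<close>

definition tr :: "'k functional \<Rightarrow> 'k functional" where
  "tr \<xi> = to_S (\<lambda>i j. \<xi> (\<chi> j i))"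

lemma tr_in [simp]: "tr \<xi> \<in> S" by (simp add: tr_def)

lemma tr_chi [simp]:
  assumes "\<xi> \<in> S" "i \<in> Ix" "j \<in> Ix"
  shows "tr \<xi> (\<chi> i j) = \<xi> (\<chi> j i)"
proof -
  have "equivariant (\<lambda>i j. \<xi> (\<chi> j i))"
    using S_equivariant[OF assms(1)] unfolding equivariant_def by (simp add: mult.commute)
  then show ?thesis unfolding tr_def using assms by simp
qed

lemma tr_tr: "\<xi> \<in> S \<Longrightarrow> tr (tr \<xi>) = \<xi>"
  by (rule S_ext) auto

lemma tr_add: "\<xi> \<in> S \<Longrightarrow> \<eta> \<in> S \<Longrightarrow> tr (\<xi> + \<eta>) = tr \<xi> + tr \<eta>"
  by (rule S_ext) (auto simp: S_add)

lemma tr_scale: "\<xi> \<in> S \<Longrightarrow> tr (fscale c \<xi>) = fscale c (tr \<xi>)"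
  by (rule S_ext) (auto simp: S_scale)

lemma tr_mult: "\<xi> \<in> S \<Longrightarrow> \<eta> \<in> S \<Longrightarrow> tr (mult \<xi> \<eta>) = mult (tr \<eta>) (tr \<xi>)"
  by (rule S_ext) (auto simp: mult_chi mult.commute)

lemma tr_one: "tr one = one"
  by (rule S_ext) (auto simp: one_chi)

lemma tr_widem: "\<mu> \<in> weights m n r \<Longrightarrow> tr (widem \<mu>) = widem \<mu>"
  by (rule S_ext) (auto simp: widem_in widem_chi)

lemma tr_Sc:
  assumes x: "\<xi> \<in> Sc p"
  shows "tr \<xi> \<in> Sc p"
  unfolding tr_def
proof (rule to_S_Sc)
  fix a b assume "a \<in> Ix" "b \<in> Ix" "\<xi> (\<chi> b a) \<noteq> 0"
  then have "tp b + tp a = p" by (intro Sc_chi[OF x])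
  then show "tp a + tp b = p" by (simp only: add.commute)
qed

lemma graded_action_tr:
  assumes g: "graded_action m n r V X"
  shows "graded_action m n r V (\<lambda>\<xi>. X (tr \<xi>))"
  unfolding graded_action_def
proof (intro conjI ballI allI)
  fix v assume v: "v \<in> carr V"
  have "lin_on fscale (scal V) S (\<lambda>\<xi>. X \<xi> v)" using g v unfolding graded_action_def by blast
  then show "lin_on fscale (scal V) S (\<lambda>\<xi>. X (tr \<xi>) v)"
    unfolding lin_on_def by (simp add: tr_add tr_scale)
  show "X (tr one) v = v" unfolding tr_one using g v unfolding graded_action_def by blast
next
  fix p q \<xi> v assume "\<xi> \<in> Sc p" "v \<in> hcomp V q"
  then show "X (tr \<xi>) v \<in> hcomp V (p + q)" using g tr_Sc unfolding graded_action_def by blast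
qed (use g tr_in in \<open>unfold graded_action_def, blast+\<close>)

lemma left_to_right:
  assumes "left_supermodule m n r V L"
  shows "right_supermodule m n r V (\<lambda>\<xi>. L (tr \<xi>))"
proof -
  have "L (tr (mult \<xi> \<eta>)) v = L (tr \<eta>) (L (tr \<xi>) v)" if "\<xi> \<in> S" "\<eta> \<in> S" "v \<in> carr V" for \<xi> \<eta> v
    unfolding tr_mult[OF that(1,2)] using assms that tr_in unfolding left_supermodule_def by blast
  then show ?thesis
    using assms graded_action_tr unfolding left_supermodule_def right_supermodule_def by blast
qed

lemma right_to_left:
  assumes "right_supermodule m n r V X"
  shows "left_supermodule m n r V (\<lambda>\<xi>. X (tr \<xi>))"
proof -
  have "X (tr (mult \<xi> \<eta>)) v = X (tr \<xi>) (X (tr \<eta>) v)" if "\<xi> \<in> S" "\<eta> \<in> S" "v \<in> carr V" for \<xi> \<eta> v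
    unfolding tr_mult[OF that(1,2)] using assms that tr_in unfolding right_supermodule_def by blast
  then show ?thesis
    using assms graded_action_tr unfolding left_supermodule_def right_supermodule_def by blast
qed

lemma irreducible_tr:
  assumes "irreducible_action m n r V X"
  shows "irreducible_action m n r V (\<lambda>\<xi>. X (tr \<xi>))"
proof -
  have "\<forall>\<xi>\<in>S. X \<xi> ` W \<subseteq> W" if "\<forall>\<xi>\<in>S. X (tr \<xi>) ` W \<subseteq> W" for W
    using that tr_tr tr_in by metis
  then show ?thesis using assms unfolding irreducible_action_def by blast
qed

lemma highest_weight_tr:
  assumes "highest_weight m n r V X \<nu>"
  shows "highest_weight m n r V (\<lambda>\<xi>. X (tr \<xi>)) \<nu>"
proof -
  have "weight_space m n r V (\<lambda>\<xi>. X (tr \<xi>)) \<mu> = weight_space m n r V X \<mu>" if "\<mu> \<in> weights m n r" for \<mu>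
    unfolding weight_space_def tr_widem[OF that] ..
  then show ?thesis using assms unfolding highest_weight_def by auto
qed

end

section \<open>The isomorphism with the tensor product\<close>

lemma lin_on_span_eq:
  assumes f: "lin_on fscale s V f" and g: "lin_on fscale s V g" and V: "fs.subspace V" and B: "B \<subseteq> V"
    and eq: "\<And>b. b \<in> B \<Longrightarrow> f b = g b" and x: "x \<in> fs.span B"
  shows "f x = g x"
proof -
  have "x \<in> V \<and> f x = g x" using x
  proof (induction rule: fs.span_induct_alt)
    case base
    show ?case using lin_on_0[OF f fs.subspace_0[OF V]] lin_on_0[OF g fs.subspace_0[OF V]] fs.subspace_0[OF V] by metis
  next
    case (step c b x)
    then have b: "b \<in> V" "fscale c b \<in> V" using B fs.subspace_scale[OF V] by blast+
    then have "f (fscale c b + x) = s c (f b) + f x" "g (fscale c b + x) = s c (g b) + g x"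
      using f g step unfolding lin_on_def by simp_all
    moreover have "fscale c b + x \<in> V" using b step fs.subspace_add[OF V] by blast
    ultimately show ?case using eq step by metis
  qed
  then show ?thesis ..
qed

lemma subspace_image_lin:
  assumes f: "lin_on fscale fscale V f" and W: "fs.subspace W" "W \<subseteq> V"
  shows "fs.subspace (f ` W)"
proof (rule fs.subspaceI)
  have 0: "0 \<in> W" by (rule fs.subspace_0[OF W(1)])
  then show "0 \<in> f ` W" using lin_on_0[OF f] W(2) by (metis imageI subsetD)
  fix x y assume "x \<in> f ` W" "y \<in> f ` W"
  then obtain a b where "a \<in> W" "b \<in> W" "x = f a" "y = f b" by blast
  moreover from this have "f (a + b) = f a + f b" using f W(2) unfolding lin_on_def by blast
  ultimately show "x + y \<in> f ` W" using fs.subspace_add[OF W(1)] by (metis imageI)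
next
  fix c x assume "x \<in> f ` W"
  then obtain a where "a \<in> W" "x = f a" by blast
  moreover from this have "f (fscale c a) = fscale c (f a)" using f W(2) unfolding lin_on_def by blast
  ultimately show "fscale c x \<in> f ` W" using fs.subspace_scale[OF W(1)] by (metis imageI)
qed

context left_mod
begin

text \<open>Split the spanning family by parity: the contribution of the wrong parity lies in both
  components, hence vanishes.\<close>

lemma hcomp_span:
  assumes f: "\<And>j. j \<in> Ix \<Longrightarrow> f j \<in> hcomp V (tp j + q)" and carr: "carr V = vs.span (f ` Ix)"
    and v: "v \<in> hcomp V p"
  shows "v \<in> vs.span (f ` {j\<in>Ix. tp j + q = p})"
proof -
  define I where "I p = {j\<in>Ix. tp j + q = p}" for p
  have mem: "w \<in> hcomp V p'" if "w \<in> vs.span (f ` I p')" for w p'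
  proof -
    have "f j \<in> hcomp V p'" if "j \<in> I p'" for j
    proof -
      have "j \<in> Ix" "tp j + q = p'" using that unfolding I_def by blast+
      then show ?thesis using f[of j] by (simp only:)
    qed
    then have "vs.span (f ` I p') \<subseteq> hcomp V p'" by (intro vs.span_minimal[OF _ hcomp_subspace]) blast
    then show ?thesis using that by blast
  qed
  have "tp j + q = p \<or> tp j + q = p + 1" for j using bit_neq_iff[of "tp j + q" p] by blast
  then have "Ix = I p \<union> I (p + 1)" unfolding I_def by blast
  then have "v \<in> vs.span (f ` I p \<union> f ` I (p + 1))"
    using hcomp_carr[OF v] unfolding carr by (simp only: image_Un)
  then obtain a b where ab: "a \<in> vs.span (f ` I p)" "b \<in> vs.span (f ` I (p + 1))" "v = a + b"
    unfolding vs.span_Un by blast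
  have "b = v - a" using ab by simp
  then have "b \<in> hcomp V p" using vs.subspace_diff[OF hcomp_subspace v mem[OF ab(1)]] by (simp only:)
  moreover have "b \<in> hcomp V (p + 1)" by (rule mem[OF ab(2)])
  moreover have "hcomp V p \<inter> hcomp V (p + 1) = {0}"
  proof -
    have "hcomp V 0 \<inter> hcomp V 1 = {0}" using gsp unfolding graded_space_def by blast
    then show ?thesis by (cases p) (auto simp: Int_commute)
  qed
  ultimately have "b = 0" by blast
  then show ?thesis using ab unfolding I_def by (simp only: add_0_right)
qed

end

lemma bilinear_formsD:
  assumes "B \<in> bilinear_forms V W"
  shows "v \<in> carr V \<Longrightarrow> lin_on (scal W) (*) (carr W) (B v)"
    "w \<in> carr W \<Longrightarrow> lin_on (scal V) (*) (carr V) (\<lambda>v. B v w)"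
  using assms by (auto simp: bilinear_forms_def)

text \<open>Two families with the properties supplied by \<open>irreducible_structure\<close>. The
  second module is meant to be a right module viewed from the left through
  \<open>tr\<close>.\<close>

locale two_mods = hw_setting m n r K row col el + V: left_mod m n r K row col V L + W: left_mod m n r K row col W L'
  for m n r and K :: "'k::field_char_0 itself" and row col el
    and V :: "('k, 'v::ab_group_add) gspace" and L :: "('k, 'v) action"
    and W :: "('k, 'w::ab_group_add) gspace" and L' :: "('k, 'w) action" +
  fixes f q g q'
  assumes f: "\<And>j. j \<in> Ix \<Longrightarrow> f j \<in> hcomp V (tp j + q)"
    "\<And>\<xi> j. \<xi> \<in> S \<Longrightarrow> j \<in> Ix \<Longrightarrow> L \<xi> (f j) = (\<Sum>s\<in>Ix. scal V (\<xi> (\<chi> s j)) (f s))"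
    "carr V = module.span (scal V) (f ` Ix)"
    "\<And>\<beta> j. lin_on (scal V) (*) (carr V) \<beta> \<Longrightarrow> j \<in> Ix \<Longrightarrow> act Y (\<lambda>j. \<beta> (f j)) j = hc * \<beta> (f j)"
    "\<And>l. l \<in> Ix \<Longrightarrow> \<exists>\<beta>. lin_on (scal V) (*) (carr V) \<beta> \<and> (\<forall>j\<in>Ix. \<beta> (f j) = bc l j)"
  assumes g: "\<And>j. j \<in> Ix \<Longrightarrow> g j \<in> hcomp W (tp j + q')"
    "\<And>\<xi> j. \<xi> \<in> S \<Longrightarrow> j \<in> Ix \<Longrightarrow> L' \<xi> (g j) = (\<Sum>s\<in>Ix. scal W (\<xi> (\<chi> s j)) (g s))"
    "carr W = module.span (scal W) (g ` Ix)"
    "\<And>\<beta> j. lin_on (scal W) (*) (carr W) \<beta> \<Longrightarrow> j \<in> Ix \<Longrightarrow> act Y (\<lambda>j. \<beta> (g j)) j = hc * \<beta> (g j)"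
    "\<And>l. l \<in> Ix \<Longrightarrow> \<exists>\<beta>. lin_on (scal W) (*) (carr W) \<beta> \<and> (\<forall>j\<in>Ix. \<beta> (g j) = bc l j)"
begin

abbreviation BF where "BF \<equiv> bilinear_forms V W"

lemma f_carr: "j \<in> Ix \<Longrightarrow> f j \<in> carr V" using f(1) V.hcomp_carr by blast
lemma g_carr: "j \<in> Ix \<Longrightarrow> g j \<in> carr W" using g(1) W.hcomp_carr by blast

definition gR :: "(nat \<Rightarrow> nat) \<Rightarrow> 'w" where
  "gR i = (\<Sum>\<rho>\<in>perms r. scal W (RS \<rho> * eps i \<rho>) (g (i \<circ> \<rho>)))"

lemma gR_hcomp:
  assumes "i \<in> Ix"
  shows "gR i \<in> hcomp W (tp i + q')"
proof -
  have "g (i \<circ> \<rho>) \<in> hcomp W (tp i + q')" if "\<rho> \<in> perms r" for \<rho>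
    using g(1)[OF multiindices_comp[OF assms that]] unfolding tp_comp[OF that] .
  then show ?thesis unfolding gR_def
    by (intro W.vs.subspace_sum[OF W.hcomp_subspace] W.vs.subspace_scale[OF W.hcomp_subspace])
qed

lemma gR_carr: "i \<in> Ix \<Longrightarrow> gR i \<in> carr W" using gR_hcomp W.hcomp_carr by blast

lemma beta_gR:
  assumes "lin_on (scal W) (*) (carr W) \<beta>" "i \<in> Ix"
  shows "\<beta> (gR i) = act RS (\<lambda>i. \<beta> (g i)) i"
proof -
  have "\<beta> (gR i) = (\<Sum>\<rho>\<in>perms r. RS \<rho> * eps i \<rho> * \<beta> (g (i \<circ> \<rho>)))"
    unfolding gR_def by (rule W.lin_on_carr_sum[OF assms(1)]) (rule g_carr[OF multiindices_comp[OF assms(2)]])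
  then show ?thesis by (simp only: grp_act_def)
qed

text \<open>Tensors are modelled by their values on bilinear forms, so the map can be given on all
  of \<open>A\<close> by one functional per form; linearity and well-definedness are then
  automatic.\<close>

definition \<Theta> :: "'k superpoly \<Rightarrow> ('v \<Rightarrow> 'w \<Rightarrow> 'k) \<Rightarrow> 'k" where
  "\<Theta> a = (\<lambda>B. if B \<in> BF then theta (\<lambda>i j. B (f j) (g i)) a else 0)"

lemma Theta_lin: "lin_on fscale fscale A \<Theta>"
  using S_lin[OF theta_in] unfolding lin_on_def \<Theta>_def by (auto simp: fun_eq_iff)

lemma theta_B_sym:
  assumes B: "B \<in> BF" and ij: "i \<in> Ix" "j \<in> Ix"
  shows "theta (\<lambda>i j. B (f j) (g i)) (sym i j) = hc * hc * B (f j) (gR i)"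
proof -
  have "theta (\<lambda>i j. B (f j) (g i)) (sym i j) = hc * hc * act RS (\<lambda>i. B (f j) (g i)) i"
  proof (rule theta_sym[OF _ _ ij])
    fix i j assume ij: "i \<in> Ix" "j \<in> Ix"
    show "act Y (\<lambda>j. B (f j) (g i)) j = hc * B (f j) (g i)"
      by (rule f(4)[OF bilinear_formsD(2)[OF B g_carr[OF ij(1)]] ij(2)])
    show "act Y (\<lambda>i. B (f j) (g i)) i = hc * B (f j) (g i)"
      by (rule g(4)[OF bilinear_formsD(1)[OF B f_carr[OF ij(2)]] ij(1)])
  qed
  then show ?thesis using beta_gR[OF bilinear_formsD(1)[OF B f_carr[OF ij(2)]] ij(1)] by (simp only:)
qed

lemma Theta_sym:
  assumes "i \<in> Ix" "j \<in> Ix"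
  shows "\<Theta> (sym i j) = fscale (hc * hc) (tensor V W (f j) (gR i))"
  by (rule ext) (use assms in \<open>simp add: \<Theta>_def tensor_def theta_B_sym\<close>)

text \<open>Inverts \<open>Theta_sym\<close>: the column sum recovers \<open>g\<close> from its row
  symmetrization, since \<open>C R = Y\<close> multiplies functionals of \<open>g\<close> by
  \<open>hc\<close>. This accounts for one factor \<open>hc\<close> in the denominator,
  \<open>Theta_sym\<close> for the other two.\<close>

lemma tensor_f_g:
  assumes ij: "i \<in> Ix" "j \<in> Ix"
  shows "tensor V W (f j) (g i) =
    (\<Sum>\<kappa>\<in>perms r. fscale (CS \<kappa> * eps i \<kappa> / (hc * hc * hc)) (\<Theta> (sym (i \<circ> \<kappa>) j)))"
proof
  fix B
  show "tensor V W (f j) (g i) B = (\<Sum>\<kappa>\<in>perms r. fscale (CS \<kappa> * eps i \<kappa> / (hc * hc * hc)) (\<Theta> (sym (i \<circ> \<kappa>) j))) B"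
  proof (cases "B \<in> BF")
    case True
    let ?h = "\<lambda>i. B (f j) (g i)"
    have lin: "lin_on (scal W) (*) (carr W) (B (f j))" by (rule bilinear_formsD(1)[OF True f_carr[OF ij(2)]])
    have "hc * ?h i = act Y ?h i" using g(4)[OF lin ij(1)] by simp
    also have "\<dots> = act CS (act RS ?h) i" by (rule act_young[OF ij(1)])
    also have "\<dots> = (\<Sum>\<kappa>\<in>perms r. CS \<kappa> * eps i \<kappa> * B (f j) (gR (i \<circ> \<kappa>)))"
      unfolding grp_act_def[of r eps CS] using ij by (intro sum.cong refl) (simp add: beta_gR[OF lin])
    finally have "?h i = (\<Sum>\<kappa>\<in>perms r. CS \<kappa> * eps i \<kappa> * B (f j) (gR (i \<circ> \<kappa>))) / hc" by (simp add: field_simps)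
    also have "\<dots> = (\<Sum>\<kappa>\<in>perms r. CS \<kappa> * eps i \<kappa> / (hc * hc * hc) * (hc * hc * B (f j) (gR (i \<circ> \<kappa>))))"
      unfolding sum_divide_distrib by (intro sum.cong refl) (simp add: field_simps)
    finally show ?thesis
      using True ij by (simp add: tensor_def sum_fun_apply \<Theta>_def theta_B_sym)
  qed (simp add: tensor_def sum_fun_apply \<Theta>_def)
qed

lemma tensor_in_subspace:
  assumes T: "fs.subspace T" and I: "I \<subseteq> Ix" "J \<subseteq> Ix"
    and gen: "\<And>i j. i \<in> J \<Longrightarrow> j \<in> I \<Longrightarrow> tensor V W (f j) (g i) \<in> T"
    and v: "v \<in> V.vs.span (f ` I)" and w: "w \<in> W.vs.span (g ` J)"
  shows "tensor V W v w \<in> T"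
proof -
  have fin: "finite I" "finite J" using I finite_multiindices finite_subset by blast+
  obtain x where x: "v = (\<Sum>j\<in>I. scal V (x j) (f j))"
    using span_image_sum[OF V.vs.vector_space_axioms fin(1) v] by blast
  obtain y where y: "w = (\<Sum>i\<in>J. scal W (y i) (g i))"
    using span_image_sum[OF W.vs.vector_space_axioms fin(2) w] by blast
  have wc: "w \<in> carr W"
    unfolding y by (intro W.vs.subspace_sum[OF W.carr_subspace] W.vs.subspace_scale[OF W.carr_subspace] g_carr)
      (use I in blast)
  have "tensor V W v w = (\<Sum>j\<in>I. \<Sum>i\<in>J. fscale (x j * y i) (tensor V W (f j) (g i)))"
  proof
    fix B
    show "tensor V W v w B = (\<Sum>j\<in>I. \<Sum>i\<in>J. fscale (x j * y i) (tensor V W (f j) (g i))) B"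
    proof (cases "B \<in> BF")
      case True
      have "B v w = (\<Sum>j\<in>I. x j * B (f j) w)"
        unfolding x by (rule V.lin_on_carr_sum[OF bilinear_formsD(2)[OF True wc]]) (use f_carr I in blast)
      also have "\<dots> = (\<Sum>j\<in>I. x j * (\<Sum>i\<in>J. y i * B (f j) (g i)))"
      proof (intro sum.cong refl arg_cong2[where f = "(*)"])
        fix j assume "j \<in> I"
        then have "f j \<in> carr V" using f_carr I by blast
        then show "B (f j) w = (\<Sum>i\<in>J. y i * B (f j) (g i))"
          unfolding y by (intro W.lin_on_carr_sum[OF bilinear_formsD(1)[OF True]]) (use g_carr I in blast)+
      qed
      finally show ?thesis using True by (simp add: tensor_def sum_fun_apply sum_distrib_left mult.assoc)
    qed (simp add: tensor_def sum_fun_apply)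
  qed
  then show ?thesis by (simp only:) (intro fs.subspace_sum[OF T] fs.subspace_scale[OF T] gen)
qed

lemma Theta_image_carr: "\<Theta> ` Alam = carr (tensor_space V W)"
proof
  let ?T = "fs.span {tensor V W v w | v w. v \<in> carr V \<and> w \<in> carr W}"
  have c: "carr (tensor_space V W) = ?T" by (simp add: tensor_space_def)
  show "\<Theta> ` Alam \<subseteq> carr (tensor_space V W)"
    unfolding c
  proof
    fix t assume "t \<in> \<Theta> ` Alam"
    then obtain a where a: "a \<in> Alam" "t = \<Theta> a" by blast
    show "t \<in> ?T" unfolding a(2)
    proof (rule fscale_span_induct_lin[OF Theta_lin A_subspace _ _ fs.subspace_span a(1)[unfolded Alam_def]])
      fix b assume "b \<in> {sym i j | i j. i \<in> Ix \<and> j \<in> Ix}"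
      then obtain i j where "i \<in> Ix" "j \<in> Ix" "b = sym i j" by blast
      then show "\<Theta> b \<in> ?T" using f_carr gR_carr
        by (simp only: Theta_sym) (intro fs.span_scale fs.span_base, blast)
    qed auto
  qed
  show "carr (tensor_space V W) \<subseteq> \<Theta> ` Alam"
    unfolding c
  proof (rule fs.span_minimal)
    show sub: "fs.subspace (\<Theta> ` Alam)" by (rule subspace_image_lin[OF Theta_lin Alam_subspace Alam_sub])
    have "tensor V W v w \<in> \<Theta> ` Alam" if "v \<in> carr V" "w \<in> carr W" for v w
    proof (rule tensor_in_subspace[OF sub subset_refl subset_refl])
      show "v \<in> V.vs.span (f ` Ix)" "w \<in> W.vs.span (g ` Ix)" using that f(3) g(3) by blast+
      fix i j assume "i \<in> Ix" "j \<in> Ix"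
      then show "tensor V W (f j) (g i) \<in> \<Theta> ` Alam"
        by (simp only: tensor_f_g)
          (intro fs.subspace_sum[OF sub] fs.subspace_scale[OF sub] imageI sym_Alam multiindices_comp)
    qed
    then show "{tensor V W v w | v w. v \<in> carr V \<and> w \<in> carr W} \<subseteq> \<Theta> ` Alam" by blast
  qed
qed

text \<open>Test with forms \<open>\<beta> v * \<gamma> w\<close> whose factors realize
  \<open>bc l\<close> on \<open>f\<close> and \<open>bc k\<close> on \<open>g\<close>; this leads
  back to the independence of the products of these functions.\<close>

lemma Theta_inj: "inj_on \<Theta> Alam"
proof (rule inj_onI)
  fix a b assume ab: "a \<in> Alam" "b \<in> Alam" "\<Theta> a = \<Theta> b"
  let ?c = "a + fscale (-1) b"
  have cA: "?c \<in> Alam" using ab fs.subspace_add[OF Alam_subspace] fs.subspace_scale[OF Alam_subspace] by blast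
  have b': "fscale (-1) b \<in> A" using ab Alam_sub A_scale by blast
  have "\<Theta> ?c = \<Theta> a + fscale (-1) (\<Theta> b)"
    using Theta_lin ab(1,2) Alam_sub b' unfolding lin_on_def by (metis subsetD)
  then have c0: "\<Theta> ?c B = 0" for B using ab(3) by (simp add: fun_eq_iff)
  have "{sym i j | i j. i \<in> SS \<and> j \<in> SS} = (\<lambda>y. sym (fst y) (snd y)) ` (SS \<times> SS)" by force
  then have cS: "?c \<in> fs.span ((\<lambda>y. sym (fst y) (snd y)) ` (SS \<times> SS))" using cA unfolding Alam_SS by (simp only:)
  obtain x where x: "?c = (\<Sum>y\<in>SS \<times> SS. fscale (x y) (sym (fst y) (snd y)))"
    using span_image_sum[OF vector_space_fscale finite_cartesian_product[OF finite_SS finite_SS] cS] by (elim exE)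
  have "x (i, j) = 0" if ij: "i \<in> SS" "j \<in> SS" for i j
  proof (rule bc_bc_independent[of "\<lambda>i j. x (i, j)", OF _ ij])
    fix k l assume kl: "k \<in> Ix" "l \<in> Ix"
    obtain \<beta> where \<beta>: "lin_on (scal V) (*) (carr V) \<beta>" "\<And>j. j \<in> Ix \<Longrightarrow> \<beta> (f j) = bc l j" using f(5)[OF kl(2)] by blast
    obtain \<gamma> where \<gamma>: "lin_on (scal W) (*) (carr W) \<gamma>" "\<And>j. j \<in> Ix \<Longrightarrow> \<gamma> (g j) = bc k j" using g(5)[OF kl(1)] by blast
    let ?B = "\<lambda>v w. \<beta> v * \<gamma> w"
    have B: "?B \<in> BF" using \<beta>(1) \<gamma>(1) by (auto simp: bilinear_forms_def lin_on_def ring_distribs)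
    have \<gamma>X: "\<gamma> (gR i) = act RS (bc k) i" if "i \<in> Ix" for i
      unfolding beta_gR[OF \<gamma>(1) that] using that \<gamma>(2) by (intro grp_act_cong)
    have "0 = theta (\<lambda>i j. ?B (f j) (g i)) ?c" using c0[of ?B] B by (simp add: \<Theta>_def)
    also have "\<dots> = (\<Sum>y\<in>SS \<times> SS. x y * theta (\<lambda>i j. ?B (f j) (g i)) (sym (fst y) (snd y)))"
      unfolding x by (rule lin_on_A_sum[OF S_lin[OF theta_in]]) (use SS_Ix in auto)
    also have "\<dots> = (\<Sum>y\<in>SS \<times> SS. hc * hc * (x (fst y, snd y) * (act RS (bc k) (fst y) * bc l (snd y))))"
      using SS_Ix by (intro sum.cong refl) (auto simp: theta_B_sym[OF B] \<beta>(2) \<gamma>X mult_ac)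
    also have "\<dots> = hc * hc * (\<Sum>i\<in>SS. \<Sum>j\<in>SS. x (i, j) * (act RS (bc k) i * bc l j))"
      by (simp add: sum.cartesian_product case_prod_beta sum_distrib_left)
    finally show "(\<Sum>i\<in>SS. \<Sum>j\<in>SS. x (i, j) * (act RS (bc k) i * bc l j)) = 0" by simp
  qed
  then have "?c = 0" unfolding x by (intro sum.neutral) (auto simp: fun_eq_iff)
  then have "a M + - b M = 0" for M by (metis fscale_apply mult_minus1 plus_fun_apply zero_fun_apply)
  then show "a = b" by (auto simp: fun_eq_iff)
qed

lemma Theta_lact:
  assumes x: "\<xi> \<in> S" and a: "a \<in> Alam"
  shows "\<Theta> (lact \<xi> a) = tensor_lact V W L \<xi> (\<Theta> a)"
proof
  fix B
  show "\<Theta> (lact \<xi> a) B = tensor_lact V W L \<xi> (\<Theta> a) B"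
  proof (cases "B \<in> BF")
    case True
    let ?B = "\<lambda>v w. B (L \<xi> v) w"
    have B': "?B \<in> BF"
      using True V.L_lin[OF x] V.L_carr[OF x] unfolding bilinear_forms_def lin_on_def by auto
    have "theta (\<lambda>i j. B (f j) (g i)) (lact \<xi> a) = theta (\<lambda>i j. ?B (f j) (g i)) a"
    proof (rule lin_on_span_eq[OF _ S_lin[OF theta_in] A_subspace _ _ a[unfolded Alam_def]])
      show "lin_on fscale (*) A (\<lambda>a. theta (\<lambda>i j. B (f j) (g i)) (lact \<xi> a))"
        using S_lin[OF theta_in] lact_lin[OF x] lact_in[OF x] unfolding lin_on_def by simp
      fix b assume "b \<in> {sym i j | i j. i \<in> Ix \<and> j \<in> Ix}"
      then obtain i j where ij: "i \<in> Ix" "j \<in> Ix" and b: "b = sym i j" by blast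
      have "theta (\<lambda>i j. B (f j) (g i)) (lact \<xi> b) = (\<Sum>s\<in>Ix. \<xi> (\<chi> s j) * theta (\<lambda>i j. B (f j) (g i)) (sym i s))"
        unfolding b lact_sym[OF x ij] by (rule lin_on_A_sum[OF S_lin[OF theta_in]]) (use ij in auto)
      also have "\<dots> = hc * hc * (\<Sum>s\<in>Ix. \<xi> (\<chi> s j) * B (f s) (gR i))"
        by (simp add: theta_B_sym[OF True ij(1)] sum_distrib_left mult_ac)
      also have "(\<Sum>s\<in>Ix. \<xi> (\<chi> s j) * B (f s) (gR i)) = B (L \<xi> (f j)) (gR i)"
        unfolding f(2)[OF x ij(2)]
        by (rule V.lin_on_carr_sum[OF bilinear_formsD(2)[OF True gR_carr[OF ij(1)]] f_carr, symmetric])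
      finally show "theta (\<lambda>i j. B (f j) (g i)) (lact \<xi> b) = theta (\<lambda>i j. ?B (f j) (g i)) b"
        unfolding b theta_B_sym[OF B' ij] .
    qed auto
    then show ?thesis using True B' by (simp add: \<Theta>_def tensor_lact_def)
  qed (simp add: \<Theta>_def tensor_lact_def)
qed

lemma Theta_ract:
  assumes X: "\<And>\<xi>. \<xi> \<in> S \<Longrightarrow> X \<xi> = L' (tr \<xi>)" and x: "\<xi> \<in> S" and a: "a \<in> Alam"
  shows "\<Theta> (ract \<xi> a) = tensor_ract V W X \<xi> (\<Theta> a)"
proof
  fix B
  note xt = tr_in[of \<xi>]
  show "\<Theta> (ract \<xi> a) B = tensor_ract V W X \<xi> (\<Theta> a) B"
  proof (cases "B \<in> BF")
    case True
    let ?B = "\<lambda>v w. B v (X \<xi> w)"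
    have B': "?B \<in> BF"
      using True W.L_lin[OF xt] W.L_carr[OF xt] unfolding bilinear_forms_def lin_on_def X[OF x] by auto
    have Rg: "X \<xi> (g i) = (\<Sum>s\<in>Ix. scal W (\<xi> (\<chi> i s)) (g s))" if "i \<in> Ix" for i
      unfolding X[OF x] g(2)[OF xt that] by (intro sum.cong refl) (simp add: x that)
    have "theta (\<lambda>i j. B (f j) (g i)) (ract \<xi> a) = theta (\<lambda>i j. ?B (f j) (g i)) a"
    proof (rule lin_on_span_eq[OF _ S_lin[OF theta_in] A_subspace _ _ a[unfolded Alam_def]])
      show "lin_on fscale (*) A (\<lambda>a. theta (\<lambda>i j. B (f j) (g i)) (ract \<xi> a))"
        using S_lin[OF theta_in] ract_lin[OF x] ract_in[OF x] unfolding lin_on_def by simp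
      fix b assume "b \<in> {sym i j | i j. i \<in> Ix \<and> j \<in> Ix}"
      then obtain i j where ij: "i \<in> Ix" "j \<in> Ix" and b: "b = sym i j" by blast
      have lin: "lin_on (scal W) (*) (carr W) (B (f j))" by (rule bilinear_formsD(1)[OF True f_carr[OF ij(2)]])
      have lin': "lin_on (scal W) (*) (carr W) (?B (f j))" by (rule bilinear_formsD(1)[OF B' f_carr[OF ij(2)]])
      have "theta (\<lambda>i j. B (f j) (g i)) (ract \<xi> b) = (\<Sum>s\<in>Ix. \<xi> (\<chi> i s) * theta (\<lambda>i j. B (f j) (g i)) (sym s j))"
        unfolding b ract_sym[OF x ij] by (rule lin_on_A_sum[OF S_lin[OF theta_in]]) (use ij in auto)
      also have "\<dots> = hc * hc * (\<Sum>s\<in>Ix. \<xi> (\<chi> i s) * B (f j) (gR s))"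
        by (simp add: theta_B_sym[OF True _ ij(2)] sum_distrib_left mult_ac)
      also have "(\<Sum>s\<in>Ix. \<xi> (\<chi> i s) * B (f j) (gR s)) = (\<Sum>s\<in>Ix. tr \<xi> (\<chi> s i) * act RS (\<lambda>s. B (f j) (g s)) s)"
        by (intro sum.cong refl) (simp add: beta_gR[OF lin] x ij)
      \<comment> \<open>The right action is an equivariant matrix acting on the index of
        \<open>g\<close>, so it commutes with the row sum contained in \<open>gR\<close>.\<close>
      also have "\<dots> = act RS (\<lambda>i. \<Sum>s\<in>Ix. tr \<xi> (\<chi> s i) * B (f j) (g s)) i"
        by (rule equivariant_act_commute[OF S_equivariant[OF xt] ij(1), symmetric])
      also have "\<dots> = act RS (\<lambda>i. ?B (f j) (g i)) i"
      proof (rule grp_act_cong[OF ij(1)])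
        fix i assume i: "i \<in> Ix"
        have "B (f j) (X \<xi> (g i)) = (\<Sum>s\<in>Ix. \<xi> (\<chi> i s) * B (f j) (g s))"
          unfolding Rg[OF i] by (rule W.lin_on_carr_sum[OF lin g_carr])
        then show "(\<Sum>s\<in>Ix. tr \<xi> (\<chi> s i) * B (f j) (g s)) = B (f j) (X \<xi> (g i))" using x i by simp
      qed
      also have "\<dots> = ?B (f j) (gR i)" by (rule beta_gR[OF lin' ij(1), symmetric])
      finally show "theta (\<lambda>i j. B (f j) (g i)) (ract \<xi> b) = theta (\<lambda>i j. ?B (f j) (g i)) b"
        unfolding b theta_B_sym[OF B' ij] .
    qed auto
    then show ?thesis using True B' by (simp add: \<Theta>_def tensor_ract_def)
  qed (simp add: \<Theta>_def tensor_ract_def)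
qed

lemma Alam_Ac_span:
  assumes a: "a \<in> Alam" "a \<in> Ac p"
  shows "a \<in> fs.span {sym i j | i j. i \<in> Ix \<and> j \<in> Ix \<and> tp i + tp j = p}"
proof -
  define B where "B p = {sym i j | i j. i \<in> Ix \<and> j \<in> Ix \<and> tp i + tp j = p}" for p
  have mem: "fs.span (B p') \<subseteq> Ac p'" for p'
    by (rule fs.span_minimal[OF _ Ac_subspace]) (use sym_Ac in \<open>unfold B_def, blast\<close>)
  have "tp i + tp j = p \<or> tp i + tp j = p + 1" for i j using bit_neq_iff[of "tp i + tp j" p] by blast
  then have "{sym i j | i j. i \<in> Ix \<and> j \<in> Ix} = B p \<union> B (p + 1)" unfolding B_def by blast
  then have "a \<in> fs.span (B p \<union> B (p + 1))" using a(1) unfolding Alam_def by (simp only:)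
  then obtain b c where bc: "b \<in> fs.span (B p)" "c \<in> fs.span (B (p + 1))" "a = b + c"
    unfolding fs.span_Un by blast
  have "c = a - b" using bc by simp
  then have "c \<in> Ac p" using fs.subspace_diff[OF Ac_subspace a(2)] mem bc(1) by blast
  moreover have "c \<in> Ac (p + 1)" using mem bc(2) by blast
  moreover have "p \<noteq> p + 1" by (cases p) simp_all
  ultimately have "c = 0" using Ac_disjoint by blast
  then show ?thesis using bc unfolding B_def by (simp only: add_0_right)
qed

text \<open>The tensor of \<open>f j\<close> with \<open>gR i\<close> has parity
  \<open>tp i + tp j\<close> shifted by both \<open>q\<close> and \<open>q'\<close>, so the parity
  shift of the map is \<open>q + q'\<close>.\<close>

lemma Theta_hcomp: "\<Theta> ` (Alam \<inter> Ac p) = hcomp (tensor_space V W) (p + (q + q'))"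
proof
  let ?T = "fs.span {tensor V W v w | v w. \<exists>p'. v \<in> hcomp V p' \<and> w \<in> hcomp W (p + (q + q') + p')}"
  have c: "hcomp (tensor_space V W) (p + (q + q')) = ?T" by (simp add: tensor_space_def)
  show "\<Theta> ` (Alam \<inter> Ac p) \<subseteq> hcomp (tensor_space V W) (p + (q + q'))"
    unfolding c
  proof
    fix t assume "t \<in> \<Theta> ` (Alam \<inter> Ac p)"
    then obtain a where a: "a \<in> Alam" "a \<in> Ac p" "t = \<Theta> a" by blast
    show "t \<in> ?T" unfolding a(3)
    proof (rule fscale_span_induct_lin[OF Theta_lin A_subspace _ _ fs.subspace_span Alam_Ac_span[OF a(1,2)]])
      fix b assume "b \<in> {sym i j | i j. i \<in> Ix \<and> j \<in> Ix \<and> tp i + tp j = p}"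
      then obtain i j where ij: "i \<in> Ix" "j \<in> Ix" "b = sym i j" "tp i + tp j = p" by blast
      have e: "p + (q + q') + (tp j + q) = tp i + q'"
      proof -
        have "p + (q + q') + (tp j + q) = tp i + ((tp j + tp j) + ((q + q) + q'))"
          unfolding ij(4)[symmetric] by (simp only: ac_simps)
        then show ?thesis by (simp only: bit_add_self add_0_left)
      qed
      have "gR i \<in> hcomp W (p + (q + q') + (tp j + q))" unfolding e by (rule gR_hcomp[OF ij(1)])
      then have "tensor V W (f j) (gR i) \<in> ?T" using f(1)[OF ij(2)] by (intro fs.span_base) blast
      then show "\<Theta> b \<in> ?T" unfolding ij(3) Theta_sym[OF ij(1,2)] by (rule fs.span_scale)
    qed (auto intro: sym_in)
  qed
  show "hcomp (tensor_space V W) (p + (q + q')) \<subseteq> \<Theta> ` (Alam \<inter> Ac p)"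
    unfolding c
  proof (rule fs.span_minimal)
    have "fs.subspace (Alam \<inter> Ac p)" by (rule fs.subspace_inter[OF Alam_subspace Ac_subspace])
    then show sub: "fs.subspace (\<Theta> ` (Alam \<inter> Ac p))"
      by (rule subspace_image_lin[OF Theta_lin]) (use Alam_sub in blast)
    have "tensor V W v w \<in> \<Theta> ` (Alam \<inter> Ac p)"
      if v: "v \<in> hcomp V p'" and w: "w \<in> hcomp W (p + (q + q') + p')" for v w p'
    proof (rule tensor_in_subspace[OF sub _ _ _ V.hcomp_span[OF f(1,3) v] W.hcomp_span[OF g(1,3) w]])
      fix i j assume i: "i \<in> {j\<in>Ix. tp j + q' = p + (q + q') + p'}" and j: "j \<in> {j\<in>Ix. tp j + q = p'}"
      then have ij: "i \<in> Ix" "j \<in> Ix" and e: "tp i + q' = p + (q + q') + p'" "tp j + q = p'" by blast+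
      have "tp i + tp j = p"
      proof -
        have "tp i + tp j = (tp i + q') + q' + tp j" by (simp only: ac_simps bit_add_self)
        also have "\<dots> = p + (q + q') + (tp j + q) + q' + tp j" unfolding e(1) e(2)[symmetric] ..
        also have "\<dots> = p + ((q + q) + ((q' + q') + (tp j + tp j)))" by (simp only: ac_simps)
        finally show ?thesis by (simp only: bit_add_self add_0_right)
      qed
      then have "sym (i \<circ> \<kappa>) j \<in> Alam \<inter> Ac p" if "\<kappa> \<in> perms r" for \<kappa>
        using sym_Alam[of "i \<circ> \<kappa>" j] sym_Ac[of "i \<circ> \<kappa>" j] multiindices_comp[OF ij(1) that] ij(2) tp_comp[OF that, of i]
        by (simp only: Int_iff simp_thms)
      then show "tensor V W (f j) (g i) \<in> \<Theta> ` (Alam \<inter> Ac p)"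
        unfolding tensor_f_g[OF ij] by (intro fs.subspace_sum[OF sub] fs.subspace_scale[OF sub] imageI)
    qed auto
    then show "{tensor V W v w | v w. \<exists>p'. v \<in> hcomp V p' \<and> w \<in> hcomp W (p + (q + q') + p')} \<subseteq> \<Theta> ` (Alam \<inter> Ac p)"
      by blast
  qed
qed

theorem Theta_iso:
  assumes "\<And>\<xi>. \<xi> \<in> S \<Longrightarrow> X \<xi> = L' (tr \<xi>)"
  shows "superbimodule_iso m n r (sub_space Alam) lact ract
    (tensor_space V W) (tensor_lact V W L) (tensor_ract V W X)"
proof -
  have "lin_on fscale (scal (tensor_space V W)) Alam \<Theta>"
    using lin_on_subset[OF Theta_lin Alam_sub] by (simp add: tensor_space_def)
  moreover have "bij_betw \<Theta> Alam (carr (tensor_space V W))"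
    using Theta_inj Theta_image_carr unfolding bij_betw_def by blast
  ultimately show ?thesis
    unfolding superbimodule_iso_def sub_space_simps
    using Theta_lact Theta_ract[OF assms] Theta_hcomp by blast
qed

end

section \<open>Tableaux of hook shape\<close>

text \<open>Connects the pointwise description with the blockwise one: an injection of a finite
  level into itself is onto.\<close>

lemma level_perms_blocks:
  "level_perms r f = {\<pi>. \<pi> permutes {1..r} \<and>
     (\<forall>a. \<pi> ` {t\<in>{1..r}. f t = a} = {t\<in>{1..r}. f t = a})}" (is "_ = ?G")
proof (intro set_eqI iffI)
  fix \<pi> assume \<pi>: "\<pi> \<in> level_perms r f"
  have p: "\<pi> permutes {1..r}" using level_permsD(1)[OF \<pi>] unfolding perms_def by (rule CollectD)
  have "\<pi> ` {t\<in>{1..r}. f t = a} = {t\<in>{1..r}. f t = a}" for a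
  proof (rule endo_inj_surj)
    show "\<pi> ` {t\<in>{1..r}. f t = a} \<subseteq> {t\<in>{1..r}. f t = a}"
      using level_permsD(2)[OF \<pi>] permutes_in_image[OF p] by auto
    show "inj_on \<pi> {t\<in>{1..r}. f t = a}"
      by (rule inj_on_subset[OF permutes_inj[OF p] subset_UNIV])
  qed simp
  then show "\<pi> \<in> ?G" using p by blast
next
  fix \<pi> assume \<pi>: "\<pi> \<in> ?G"
  have "f (\<pi> t) = f t" if "t \<in> {1..r}" for t
  proof -
    have "\<pi> t \<in> \<pi> ` {s\<in>{1..r}. f s = f t}" using that by blast
    then have "\<pi> t \<in> {s\<in>{1..r}. f s = f t}" using \<pi> by blast
    then show ?thesis by blast
  qed
  then show "\<pi> \<in> level_perms r f" using \<pi> by (simp add: level_perms_def perms_def)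
qed

locale hook_tableau =
  fixes m n r :: nat and K :: "'k::field_char_0 itself" and lam :: "nat \<Rightarrow> nat" and T :: "nat \<times> nat \<Rightarrow> nat"
  assumes hook: "hook_partition m n r lam" and bij: "bij_betw T (diagram lam) {1..r}"
begin

definition row :: "nat \<Rightarrow> nat" where "row t = fst (inv_into (diagram lam) T t)"
definition col :: "nat \<Rightarrow> nat" where "col t = snd (inv_into (diagram lam) T t)"

lemma box:
  assumes "t \<in> {1..r}"
  shows "(row t, col t) \<in> diagram lam" "T (row t, col t) = t"
proof -
  have t: "t \<in> T ` diagram lam" using assms bij by (simp add: bij_betw_def)
  show "(row t, col t) \<in> diagram lam" using inv_into_into[OF t] by (simp add: row_def col_def)
  show "T (row t, col t) = t" using f_inv_into_f[OF t] by (simp add: row_def col_def)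
qed

lemma row_col_T:
  assumes "bx \<in> diagram lam"
  shows "T bx \<in> {1..r}" "row (T bx) = fst bx" "col (T bx) = snd bx"
proof -
  show "T bx \<in> {1..r}" using assms bij bij_betwE by blast
  have "inv_into (diagram lam) T (T bx) = bx" using assms bij by (simp add: bij_betw_def inv_into_f_f)
  then show "row (T bx) = fst bx" "col (T bx) = snd bx" by (simp_all add: row_def col_def)
qed

lemma lam_mono: "1 \<le> a \<Longrightarrow> a \<le> b \<Longrightarrow> lam b \<le> lam a"
  using hook by (simp add: hook_partition_def partition_of_def)

lemma shape: "t \<in> {1..r} \<Longrightarrow> 1 \<le> row t \<and> 1 \<le> col t \<and> col t \<le> lam (row t)"
  using box(1)[of t] by (simp add: diagram_def)

sublocale tableau_setting m n r K row col
proof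
  show "1 \<le> row t \<and> 1 \<le> col t" if "t \<in> {1..r}" for t using shape[OF that] by blast
  show "s = t" if "s \<in> {1..r}" "t \<in> {1..r}" "row s = row t" "col s = col t" for s t
    using box(2)[OF that(1)] box(2)[OF that(2)] that(3,4) by metis
  show "\<exists>s\<in>{1..r}. row s = a \<and> col s = b"
    if t: "t \<in> {1..r}" and ab: "1 \<le> a" "a \<le> row t" "1 \<le> b" "b \<le> col t" for t a b
  proof -
    have "b \<le> lam a" using shape[OF t] lam_mono[OF ab(1,2)] ab(4) by linarith
    then have "(a, b) \<in> diagram lam" using ab by (simp add: diagram_def)
    from row_col_T[OF this] show ?thesis by auto
  qed
qed

lemma image_T: "T ` {bx \<in> diagram lam. P bx} = {t\<in>{1..r}. P (row t, col t)}"
proof (intro set_eqI iffI)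
  fix t assume "t \<in> T ` {bx \<in> diagram lam. P bx}"
  then obtain bx where "bx \<in> diagram lam" "P bx" "t = T bx" by blast
  then show "t \<in> {t\<in>{1..r}. P (row t, col t)}" using row_col_T[of bx] by simp
next
  fix t assume t: "t \<in> {t\<in>{1..r}. P (row t, col t)}"
  then have "t = T (row t, col t)" "(row t, col t) \<in> {bx \<in> diagram lam. P bx}" using box[of t] by simp_all
  then show "t \<in> T ` {bx \<in> diagram lam. P bx}" by (rule image_eqI)
qed

lemma row_group_eq: "row_group r lam T = R"
  unfolding row_group_def level_perms_blocks image_T by simp

lemma col_group_eq: "col_group r lam T = C"
  unfolding col_group_def level_perms_blocks image_T by simp

lemma symmetrizer_eq: "symmetrizer m r lam T i j = sym i j"
  by (simp add: symmetrizer_def sym_def row_group_eq col_group_eq)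

lemma semistandard_iff: "semistandard m lam T i \<longleftrightarrow> semistd i"
proof
  assume i: "semistandard m lam T i"
  show "semistd i"
    unfolding semistd_def
  proof (intro ballI)
    fix s t assume st: "s \<in> {1..r}" "t \<in> {1..r}"
    note b = box[OF st(1)] box[OF st(2)]
    show "(row s = row t \<and> col s < col t \<longrightarrow> i s \<le> i t \<and> (i s = i t \<longrightarrow> \<not> m < i s)) \<and>
      (col s = col t \<and> row s < row t \<longrightarrow> i s \<le> i t \<and> (i s = i t \<longrightarrow> m < i s))"
    proof (intro conjI impI; elim conjE)
      assume rc: "row s = row t" "col s < col t"
      have "i (T (row s, col s)) \<le> i (T (row s, col t)) \<and>
        (i (T (row s, col s)) = i (T (row s, col t)) \<longrightarrow> i (T (row s, col s)) \<le> m)"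
        using i b(1,3) rc unfolding semistandard_def by metis
      then have "i s \<le> i t \<and> (i s = i t \<longrightarrow> i s \<le> m)" using b(2,4) rc by simp
      then show "i s \<le> i t" "i s = i t \<Longrightarrow> \<not> m < i s" by auto
    next
      assume rc: "col s = col t" "row s < row t"
      have "i (T (row s, col s)) \<le> i (T (row t, col s)) \<and>
        (i (T (row s, col s)) = i (T (row t, col s)) \<longrightarrow> m < i (T (row s, col s)))"
        using i b(1,3) rc unfolding semistandard_def by metis
      then have "i s \<le> i t \<and> (i s = i t \<longrightarrow> m < i s)" using b(2,4) rc by simp
      then show "i s \<le> i t" "i s = i t \<Longrightarrow> m < i s" by auto
    qed
  qed
next
  assume i: "semistd i"
  show "semistandard m lam T i"
    unfolding semistandard_def
  proof (intro conjI allI impI; elim conjE)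
    fix a b b' assume ab: "(a, b) \<in> diagram lam" "(a, b') \<in> diagram lam" "b < b'"
    show "i (T (a, b)) \<le> i (T (a, b'))" "i (T (a, b)) = i (T (a, b')) \<Longrightarrow> i (T (a, b)) \<le> m"
      using i row_col_T[OF ab(1)] row_col_T[OF ab(2)] ab(3) unfolding semistd_def by (fastforce simp: not_less)+
  next
    fix a a' b assume ab: "(a, b) \<in> diagram lam" "(a', b) \<in> diagram lam" "a < a'"
    show "i (T (a, b)) \<le> i (T (a', b))" "i (T (a, b)) = i (T (a', b)) \<Longrightarrow> m < i (T (a, b))"
      using i row_col_T[OF ab(1)] row_col_T[OF ab(2)] ab(3) unfolding semistd_def by fastforce+
  qed
qed

lemma ss_indices_eq: "ss_indices m n r lam T = SS"
  by (simp add: ss_indices_def SS_def semistandard_iff)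

lemma A_lam_eq: "A_lam m n r lam T = Alam"
  by (simp add: A_lam_def Alam_def symmetrizer_eq)

lemma A_lam_space_eq: "A_lam_space m n r lam T = sub_space Alam"
  by (simp add: A_lam_space_def sub_space_def A_lam_eq)

text \<open>The filling \<open>T_ell\<close> as a multiindex; \<open>restrict\<close> gives it the
  extensional form that \<open>multiindices\<close> demands.\<close>

definition el :: "nat \<Rightarrow> nat" where "el = restrict (\<lambda>t. T_ell m (row t, col t)) {1..r}"

lemma el_apply: "t \<in> {1..r} \<Longrightarrow> el t = (if row t \<le> m then row t else m + col t)"
  by (simp add: el_def T_ell_def)

lemma el_in: "el \<in> Ix"
proof -
  have "el t \<in> {1..m + n}" if t: "t \<in> {1..r}" for t
  proof (cases "row t \<le> m")
    case False
    \<comment> \<open>The hook condition bounds the columns below row \<open>m\<close> by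
      \<open>n\<close>, so the symbols used there exist.\<close>
    have "lam (row t) \<le> lam (m + 1)" using False by (intro lam_mono) auto
    then have "col t \<le> n" using shape[OF t] hook unfolding hook_partition_def by linarith
    then show ?thesis using False shape[OF t] t by (simp add: el_apply)
  qed (use shape[OF t] t in \<open>simp add: el_apply\<close>)
  then show ?thesis unfolding multiindices_def by (auto simp: el_def)
qed

lemma el_SS: "el \<in> SS"
proof -
  have "semistd el" unfolding semistd_def
  proof (intro ballI)
    fix s t assume st: "s \<in> {1..r}" "t \<in> {1..r}"
    show "(row s = row t \<and> col s < col t \<longrightarrow> el s \<le> el t \<and> (el s = el t \<longrightarrow> \<not> m < el s)) \<and>
      (col s = col t \<and> row s < row t \<longrightarrow> el s \<le> el t \<and> (el s = el t \<longrightarrow> m < el s))"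
      using shape[OF st(1)] shape[OF st(2)] unfolding el_apply[OF st(1)] el_apply[OF st(2)] by auto
  qed
  then show ?thesis using el_in by (simp add: SS_def)
qed

text \<open>Even symbols increase strictly down a column, so an even entry is at least its row
  number; the cap \<open>m + 1\<close> accounts for entries that have become odd.\<close>

lemma semistd_row_bound:
  assumes j: "j \<in> SS" and t: "t \<in> {1..r}"
  shows "min (row t) (m + 1) \<le> j t"
  using t
proof (induction "row t" arbitrary: t)
  case 0
  then show ?case by simp
next
  case (Suc a)
  have jt: "1 \<le> j t" using SS_Ix[OF j] Suc.prems unfolding multiindices_def by fastforce
  show ?case
  proof (cases "a = 0")
    case True
    then show ?thesis using jt Suc.hyps(2) by simp
  next
    case False
    then obtain s where s: "s \<in> {1..r}" "row s = a" "col s = col t"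
      using down[OF Suc.prems, of a "col t"] Suc.hyps(2) shape[OF Suc.prems] by auto
    have "min a (m + 1) \<le> j s" using Suc.hyps(1)[OF s(2)[symmetric] s(1)] s(2) by simp
    moreover have "j s \<le> j t \<and> (j s = j t \<longrightarrow> m < j s)"
      using j s Suc.prems Suc.hyps(2) unfolding SS_def semistd_def by simp
    ultimately show ?thesis using Suc.hyps(2)[symmetric] by linarith
  qed
qed

text \<open>Below row \<open>m\<close> all entries are odd by the row bound, and odd symbols
  increase strictly along rows.\<close>

lemma semistd_col_bound:
  assumes j: "j \<in> SS" and t: "t \<in> {1..r}" "m < row t"
  shows "m + col t \<le> j t"
  using t
proof (induction "col t" arbitrary: t)
  case 0
  then show ?case using shape by fastforce
next
  case (Suc b)
  have jt: "m + 1 \<le> j t" using semistd_row_bound[OF j Suc.prems(1)] Suc.prems(2) by simp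
  show ?case
  proof (cases "b = 0")
    case True
    then show ?thesis using jt Suc.hyps(2) by simp
  next
    case False
    then obtain s where s: "s \<in> {1..r}" "row s = row t" "col s = b"
      using down[OF Suc.prems(1), of "row t" b] Suc.hyps(2) shape[OF Suc.prems(1)] by auto
    have "m + b \<le> j s" using Suc.hyps(1)[OF s(3)[symmetric] s(1)] s(2,3) Suc.prems(2) by simp
    moreover have "j s \<le> j t \<and> (j s = j t \<longrightarrow> \<not> m < j s)"
      using j s Suc.prems Suc.hyps(2) unfolding SS_def semistd_def by simp
    ultimately show ?thesis using Suc.hyps(2)[symmetric] False by linarith
  qed
qed

lemma el_le:
  assumes "j \<in> SS" "t \<in> {1..r}"
  shows "el t \<le> j t"
  using semistd_row_bound[OF assms] semistd_col_bound[OF assms] by (auto simp: el_apply[OF assms(2)])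

text \<open>Entrywise minimality gives \<open>el\<close> the most entries up to any bound
  \<open>a\<close>, which is dominance of its content.\<close>

sublocale hw_setting m n r K row col el
proof
  show "el \<in> SS" by (rule el_SS)
  fix j assume j: "j \<in> SS"
  show "dominated m n (content j) (content el)"
    unfolding dominated_def
  proof
    fix a assume "a \<in> {1..m + n}"
    then have a: "a \<le> m + n" by simp
    have "{t\<in>{1..r}. j t \<le> a} \<subseteq> {t\<in>{1..r}. el t \<le> a}" using el_le[OF j] le_trans by blast
    then show "(\<Sum>b = 1..a. content j b) \<le> (\<Sum>b = 1..a. content el b)"
      unfolding content_sum[OF SS_Ix[OF j] a] content_sum[OF el_in a] by (intro card_mono) simp_all
  qed
qed

lemma hook_weight_eq: "hook_weight m lam = content el"
proof
  fix a
  have "inj_on T {bx \<in> diagram lam. T_ell m bx = a}"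
    using bij unfolding bij_betw_def by (rule inj_on_subset[OF conjunct1]) blast
  then have "hook_weight m lam a = card (T ` {bx \<in> diagram lam. T_ell m bx = a})"
    unfolding hook_weight_def by (rule card_image[symmetric])
  also have "T ` {bx \<in> diagram lam. T_ell m bx = a} = {t\<in>{1..r}. el t = a}"
    unfolding image_T by (auto simp: el_def)
  also have "card \<dots> = content el a"
  proof (cases "a \<in> {1..m + n}")
    case False
    then have "{t\<in>{1..r}. el t = a} = {}" using el_in unfolding multiindices_def by blast
    then show ?thesis using False by (simp add: content_def)
  qed (simp add: content_def)
  finally show "hook_weight m lam a = content el a" .
qed

lemma is_D_V0: "is_D m n r lam (sub_space V0) lact"
  unfolding is_D_def hook_weight_eq using left_V0 irreducible_V0 highest_weight_V0 by blast

lemma is_D_op_V0: "is_D_op m n r lam (sub_space V0) (\<lambda>\<xi>. lact (tr \<xi>))"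
  unfolding is_D_op_def hook_weight_eq
  using left_to_right[OF left_V0] irreducible_tr[OF irreducible_V0] highest_weight_tr[OF highest_weight_V0] by blast

lemma Alam_iso:
  fixes V :: "('k, 'v::ab_group_add) gspace" and W :: "('k, 'w::ab_group_add) gspace"
  assumes V: "is_D m n r lam V L" and W: "is_D_op m n r lam W X"
  shows "superbimodule_iso m n r (sub_space Alam) lact ract
    (tensor_space V W) (tensor_lact V W L) (tensor_ract V W X)"
proof -
  interpret V: hw_mod m n r K row col el V L
    by unfold_locales (use V in \<open>simp_all add: is_D_def hook_weight_eq\<close>)
  interpret W: hw_mod m n r K row col el W "\<lambda>\<xi>. X (tr \<xi>)"
    by unfold_locales
      (use W right_to_left irreducible_tr highest_weight_tr in \<open>unfold is_D_op_def hook_weight_eq, blast+\<close>)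
  obtain f q where f: "\<And>j. j \<in> Ix \<Longrightarrow> f j \<in> hcomp V (tp j + q)"
    "\<And>\<xi> j. \<xi> \<in> S \<Longrightarrow> j \<in> Ix \<Longrightarrow> L \<xi> (f j) = (\<Sum>s\<in>Ix. scal V (\<xi> (\<chi> s j)) (f s))"
    "carr V = module.span (scal V) (f ` Ix)"
    "\<And>\<beta> j. lin_on (scal V) (*) (carr V) \<beta> \<Longrightarrow> j \<in> Ix \<Longrightarrow> act Y (\<lambda>j. \<beta> (f j)) j = hc * \<beta> (f j)"
    "\<And>l. l \<in> Ix \<Longrightarrow> \<exists>\<beta>. lin_on (scal V) (*) (carr V) \<beta> \<and> (\<forall>j\<in>Ix. \<beta> (f j) = bc l j)"
    by (rule V.irreducible_structure) (rule that)
  obtain g q' where g: "\<And>j. j \<in> Ix \<Longrightarrow> g j \<in> hcomp W (tp j + q')"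
    "\<And>\<xi> j. \<xi> \<in> S \<Longrightarrow> j \<in> Ix \<Longrightarrow> X (tr \<xi>) (g j) = (\<Sum>s\<in>Ix. scal W (\<xi> (\<chi> s j)) (g s))"
    "carr W = module.span (scal W) (g ` Ix)"
    "\<And>\<beta> j. lin_on (scal W) (*) (carr W) \<beta> \<Longrightarrow> j \<in> Ix \<Longrightarrow> act Y (\<lambda>j. \<beta> (g j)) j = hc * \<beta> (g j)"
    "\<And>l. l \<in> Ix \<Longrightarrow> \<exists>\<beta>. lin_on (scal W) (*) (carr W) \<beta> \<and> (\<forall>j\<in>Ix. \<beta> (g j) = bc l j)"
    by (rule W.irreducible_structure) (rule that)
  interpret two_mods m n r K row col el V L W "\<lambda>\<xi>. X (tr \<xi>)" f q g q'
    by unfold_locales (fact f g)+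
  show ?thesis by (rule Theta_iso) (simp add: tr_tr)
qed

end

text \<open>The irreducible modules are given by their defining properties rather than as fixed
  objects, so the isomorphism is stated for every such pair, in arbitrary carrier types; the two
  existence clauses show that it is not vacuous.\<close>

theorem theorem4p1:
  fixes m n r :: nat and lam :: "nat \<Rightarrow> nat" and T :: "nat \<times> nat \<Rightarrow> nat"
  assumes "hook_partition m n r lam"
    and "bij_betw T (diagram lam) {1..r}"
  shows
    "superbimodule m n r
       (A_lam_space m n r lam T :: ('k::field_char_0, 'k superpoly) gspace)
       (A_lact m n r) (A_ract m n r) \<and>
     (let SS = ss_indices m n r lam T;
          sym = (\<lambda>(i, j). symmetrizer m r lam T i j :: 'k superpoly)
      in inj_on sym (SS \<times> SS) \<and>
         \<not> module.dependent fscale (sym ` (SS \<times> SS)) \<and>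
         module.span fscale (sym ` (SS \<times> SS)) = A_lam m n r lam T) \<and>
     (\<exists>(V :: ('k, 'k superpoly) gspace) L. is_D m n r lam V L) \<and>
     (\<exists>(W :: ('k, 'k superpoly) gspace) R. is_D_op m n r lam W R) \<and>
     (\<forall>(V :: ('k, 'v::ab_group_add) gspace) L (W :: ('k, 'w::ab_group_add) gspace) R.
        is_D m n r lam V L \<and> is_D_op m n r lam W R \<longrightarrow>
        superbimodule_iso m n r (A_lam_space m n r lam T) (A_lact m n r) (A_ract m n r)
          (tensor_space V W) (tensor_lact V W L) (tensor_ract V W R))"
proof -
  interpret hook_tableau m n r "TYPE('k)" lam T by unfold_locales (fact assms)+
  show ?thesis
    unfolding Let_def ss_indices_eq symmetrizer_eq A_lam_eq A_lam_space_eq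
    using superbimodule_Alam basis_Alam is_D_V0 is_D_op_V0 Alam_iso by blast
qed

end
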